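(* Let $N\ge 2$ be an even integer, let $\Lambda=\mathrm{diag}(\lambda_1,\dots,\lambda_N)$ with all $\lambda_i>0$, and let $V_0$ be a continuous function on $\mathbb{R}$ such that for every $1\le i\le N$ the measure $e^{-\frac12\lambda_i x^2+V_0(x)}\,dx$ on $\mathbb{R}$ has finite moments. Let $\boldsymbol{t}=(t_1,t_3,t_5,\dots)$ be formal parameters, let $d\mu_{\Lambda,\boldsymbol t}(H)$ and $Z_\Lambda(\boldsymbol t)$ be the measure and partition function of the Kontsevich matrix model with potential $V_{\boldsymbol t}$, let $q_k$ be the elementary Schur Q-functions, let $[z^{-1}]=\big(\frac1z,\frac1{3z^3},\frac1{5z^5},\dots\big)$, and for $H\in\mathcal{H}_N$ let $\tilde{\boldsymbol H}=\big(\mathrm{Tr}(H),\frac13\mathrm{Tr}(H^3),\frac15\mathrm{Tr}(H^5),\dots\big)$ and $\boldsymbol{tH}=\big(t_1\mathrm{Tr}(H),t_3\mathrm{Tr}(H^3),t_5\mathrm{Tr}(H^5),\dots\big)$ (all as defined in the context). Then the following hold. (A) Suppose the $\lambda_i$ are pairwise distinct. For every integer $k>0$, $$ (-1)^k\int_{\mathcal{H}_N} d\mu_{\Lambda,\boldsymbol t}(H)\,q_k(\tilde{\boldsymbol H}) =\mathop{\mathrm{Res}}_{z=0}\Big(Z_\Lambda(\boldsymbol t-2[z^{-1}])\,z^{k-1}\,dz\Big) $$ $$ =\sum_{1\le r<s\le N} Z_{\Lambda_{r,s}}(\boldsymbol t)\,\frac{\sqrt{\lambda_r\lambda_s}}{\pi}\,\frac{\lambda_s+\lambda_r}{\lambda_s-\lambda_r}\prod_{\substack{i=1\\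 i\ne r,s}}^N\frac{(\lambda_r+\lambda_i)(\lambda_s+\lambda_i)}{(\lambda_r-\lambda_i)(\lambda_s-\lambda_i)}\int_{\mathbb{R}^2}dx\,dy\,(-1)^k(x^k-y^k)\,e^{-\frac12\lambda_s x^2-\frac12\lambda_r y^2}\,e^{V_{\boldsymbol t}(x)+V_{\boldsymbol t}(y)}, $$ where $\Lambda_{r,s}$ is the diagonal $(N-2)\times(N-2)$ matrix obtained from $\Lambda$ by deleting the $r$-th and $s$-th rows and columns. (B) If $V_0$ is even, i.e. $V_0(x)=V_0(-x)$ for all $x\in\mathbb{R}$, then, as formal power series identically in $\boldsymbol t=(t_1,t_3,t_5,\dots)$, $$ 0=\mathop{\mathrm{Res}}_{z=0}\Big(Z_\Lambda(\boldsymbol t-2[z^{-1}])\Big(e^{2\sum_{j=0}^\infty t_{2j+1}z^{2j+1}}-1\Big)\frac{dz}{z}\Big) =\sum_{k=1}^\infty\sum_{m=0}^\infty(-1)^k q_k(\boldsymbol t)\int_{\mathcal{H}_N}d\mu_{\Lambda,\boldsymbol 0}(H)\,q_k(\tilde{\boldsymbol H})\,q_m\big(\tfrac12\boldsymbol{tH}\big). $$ (C) If $V_0$ is even, i.e. $V_0(x)=V_0(-x)$ for all $x\in\mathbb{R}$, then for all odd integers $k,m\ge1$, $$ \int_{\mathcal{H}_N}d\mu_{\Lambda,\boldsymbol 0}(H)\,q_{k+m}(\tilde{\boldsymbol H})=\int_{\mathcal{H}_N}d\mu_{\Lambda,\boldsymbol 0}(H)\,\mathrm{Tr}(H^m)\,q_k(\tilde{\boldsymbol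 H}). $$
   Context: $\mathcal{H}_N$ is the real vector space of Hermitian $N\times N$ matrices with Lebesgue measure $dH=\prod_{i=1}^N dH_{ii}\prod_{1\le i<j\le N}d\mathrm{Re}(H_{ij})\,d\mathrm{Im}(H_{ij})$. For $\Lambda=\mathrm{diag}(\lambda_1,\dots,\lambda_N)$ with all $\lambda_i>0$, the Gaussian probability measure on $\mathcal{H}_N$ is $$d\mathbb{P}_\Lambda(H)=\frac{\sqrt{\prod_{1\le i,j\le N}(\lambda_i+\lambda_j)}}{2^{N/2}(2\pi)^{N^2/2}}\,e^{-\frac12\mathrm{Tr}(\Lambda H^2)}\,dH .$$ For formal parameters $\boldsymbol t=(t_{2k+1})_{k\ge0}$ put $V_{\boldsymbol t}(x)=V_0(x)+\sum_{k\ge0}t_{2k+1}x^{2k+1}$ (so $V_{\boldsymbol 0}=V_0$), and $$d\mu_{\Lambda,\boldsymbol t}(H)=e^{\mathrm{Tr}(V_{\boldsymbol t}(H))}\,d\mathbb{P}_\Lambda(H),\qquad Z_\Lambda(\boldsymbol t)=\int_{\mathcal{H}_N}d\mu_{\Lambda,\boldsymbol t}(H),$$ where $V_0(H)$ is defined by functional calculus. Everything depending on $\boldsymbol t$ is understood as a formal power series in the $t_{2k+1}$: the exponential $e^{\sum_k t_{2k+1}\mathrm{Tr}(H^{2k+1})}$ (respectively $e^{\sum_k t_{2k+1}x^{2k+1}}$) is expanded in $\boldsymbol t$ and integrated coefficientwise. The same definitions are used for $\Lambda_{r,s}$, with $N$ replaced by $N-2$ and the same $V_0$; when $N=2$, so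 that $\Lambda_{1,2}$ is the empty matrix, $Z_{\Lambda_{1,2}}(\boldsymbol t)=1$ and the empty product equals $1$. The elementary Schur Q-functions of a sequence $\boldsymbol u=(u_1,u_3,u_5,\dots)$ are $q_j(\boldsymbol u)=[x^j]\exp\big(2\sum_{k=0}^\infty u_{2k+1}x^{2k+1}\big)$, the coefficient of $x^j$, for $j\ge0$. Thus $q_j(\tilde{\boldsymbol H})$ is obtained with $u_{2k+1}=\frac{1}{2k+1}\mathrm{Tr}(H^{2k+1})$, and $q_m(\frac12\boldsymbol{tH})$ with $u_{2k+1}=\frac12t_{2k+1}\mathrm{Tr}(H^{2k+1})$. $Z_\Lambda(\boldsymbol t-2[z^{-1}])$ denotes $Z_\Lambda$ with each $t_{2j+1}$ replaced by $t_{2j+1}-\frac{2}{(2j+1)z^{2j+1}}$, expanded as a formal power series in $z^{-1}$ (coefficientwise in $\boldsymbol t$), i.e. $\int_{\mathcal{H}_N}d\mu_{\Lambda,\boldsymbol t}(H)\exp\big(-2\sum_{j\ge0}\frac{\mathrm{Tr}(H^{2j+1})}{(2j+1)z^{2j+1}}\big)$ with the exponential expanded in $z^{-1}$. $\mathrm{Res}_{z=0}(f(z)\,dz)$ is the formal residue: the coefficient of $z^{-1}$ in the formal series $f(z)$. In the residue in (B), $e^{2\sum_j t_{2j+1}z^{2j+1}}$ is expanded in $\boldsymbol t$, each coefficient being a monomial in $z$ up to a scalar.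
   Formalization: In (A) the factor (λ_s+λ_r)/(λ_s−λ_r) is replaced by (λ_s+λ_r)/(λ_r−λ_s), since the printed formula is off by a global sign: for N=2, λ=(1,2), V_0=0, t=0, k=2 the left side is 3 and the printed right side −3. *)

theory Defs
  imports
    "HOL-Analysis.Analysis"
    "HOL-Computational_Algebra.Computational_Algebra"
    "HOL-Library.Poly_Mapping"
    "Jordan_Normal_Form.Schur_Decomposition"
begin

section \<open>Formal power series in the countably many variables \<open>t\<^sub>1, t\<^sub>3, t\<^sub>5, \<dots>\<close>\<close>

text \<open>
  A monomial is a finitely supported exponent vector \<open>a\<close>, where
  \<open>Poly_Mapping.lookup a k\<close> is the exponent of \<open>t\<^sub>2\<^sub>k\<^sub>+\<^sub>1\<close>.  Throughout, sequences with odd subscripts are indexed by \<open>k\<close>, the subscript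
  being \<open>2 * k + 1\<close>.
\<close>

typedef 'a tseries = "UNIV :: ((nat \<Rightarrow>\<^sub>0 nat) \<Rightarrow> 'a) set"
  morphisms tcoeff Abs_tseries
  by simp

lemma tcoeff_Abs [simp]: "tcoeff (Abs_tseries f) = f"
  by (simp add: Abs_tseries_inverse)

lemma tseries_eqI: "(\<And>a. tcoeff F a = tcoeff G a) \<Longrightarrow> F = G"
  by (metis tcoeff_inject ext)

lemma finite_splits: "finite {(b, c). b + c = (a :: nat \<Rightarrow>\<^sub>0 nat)}"
proof -
  let ?S = "{b :: nat \<Rightarrow>\<^sub>0 nat. \<forall>k. Poly_Mapping.lookup b k \<le> Poly_Mapping.lookup a k}"
  let ?T = "{f :: nat \<Rightarrow> nat. \<forall>k. (k \<in> Poly_Mapping.keys a \<longrightarrow>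
                  f k \<in> (\<Union>j\<in>Poly_Mapping.keys a. {..Poly_Mapping.lookup a j}))
                \<and> (k \<notin> Poly_Mapping.keys a \<longrightarrow> f k = 0)}"
  have "finite ?T"
    by (rule finite_set_of_finite_funs) auto
  moreover have "Poly_Mapping.lookup ` ?S \<subseteq> ?T"
    by (auto simp: in_keys_iff) (metis le_zero_eq)
  ultimately have "finite (Poly_Mapping.lookup ` ?S)"
    by (rule rev_finite_subset)
  moreover have "inj_on Poly_Mapping.lookup ?S"
    by (rule inj_onI, rule poly_mapping_eqI, simp)
  ultimately have fin: "finite ?S"
    by (rule finite_imageD)
  have "{(b, c). b + c = a} \<subseteq> ?S \<times> ?S"
    by (auto simp: Poly_Mapping.lookup_add)
  then show ?thesis
    using fin by (meson finite_SigmaI finite_subset)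
qed

instantiation tseries :: (comm_ring_1) comm_ring_1
begin

definition zero_tseries :: "'a tseries" where
  "0 = Abs_tseries (\<lambda>a. 0)"

definition one_tseries :: "'a tseries" where
  "1 = Abs_tseries (\<lambda>a. if a = 0 then 1 else 0)"

definition plus_tseries :: "'a tseries \<Rightarrow> 'a tseries \<Rightarrow> 'a tseries" where
  "F + G = Abs_tseries (\<lambda>a. tcoeff F a + tcoeff G a)"

definition uminus_tseries :: "'a tseries \<Rightarrow> 'a tseries" where
  "- F = Abs_tseries (\<lambda>a. - tcoeff F a)"

definition minus_tseries :: "'a tseries \<Rightarrow> 'a tseries \<Rightarrow> 'a tseries" where
  "F - G = Abs_tseries (\<lambda>a. tcoeff F a - tcoeff G a)"

definition times_tseries :: "'a tseries \<Rightarrow> 'a tseries \<Rightarrow> 'a tseries" where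
  "F * G = Abs_tseries (\<lambda>a. \<Sum>(b, c) | b + c = a. tcoeff F b * tcoeff G c)"

instance
proof
  fix F G K :: "'a tseries"
  show "F * G * K = F * (G * K)"
  proof (rule tseries_eqI)
    fix a
    have "tcoeff (F * G * K) a =
        (\<Sum>p\<in>{(d, c). d + c = a}. \<Sum>q\<in>{(x, y). x + y = fst p}.
            tcoeff F (fst q) * tcoeff G (snd q) * tcoeff K (snd p))"
      by (simp add: times_tseries_def case_prod_beta sum_distrib_right)
    also have "\<dots> = (\<Sum>(p, q)\<in>(SIGMA p:{(d, c). d + c = a}. {(x, y). x + y = fst p}).
            tcoeff F (fst q) * tcoeff G (snd q) * tcoeff K (snd p))"
      by (rule sum.Sigma) (auto simp: finite_splits)
    also have "\<dots> = (\<Sum>(p, q)\<in>(SIGMA p:{(x, e). x + e = a}. {(y, c). y + c = snd p}).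
            tcoeff F (fst p) * (tcoeff G (fst q) * tcoeff K (snd q)))"
      by (rule sum.reindex_bij_witness
            [where j = "\<lambda>((d, c), (x, y)). ((x, y + c), (y, c))"
               and i = "\<lambda>((x, e), (y, c)). ((x + y, c), (x, y))"])
         (auto simp: algebra_simps)
    also have "\<dots> = (\<Sum>p\<in>{(x, e). x + e = a}. \<Sum>q\<in>{(y, c). y + c = snd p}.
            tcoeff F (fst p) * (tcoeff G (fst q) * tcoeff K (snd q)))"
      by (rule sum.Sigma [symmetric]) (auto simp: finite_splits)
    also have "\<dots> = tcoeff (F * (G * K)) a"
      by (simp add: times_tseries_def case_prod_beta sum_distrib_left)
    finally show "tcoeff (F * G * K) a = tcoeff (F * (G * K)) a" .
  qed
  show "F * G = G * F"
    unfolding times_tseries_def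
    by (rule arg_cong [where f = Abs_tseries], rule ext,
        rule sum.reindex_bij_witness [where i = prod.swap and j = prod.swap])
       (auto simp: algebra_simps)
  show "1 * F = F"
  proof (rule tseries_eqI)
    fix a
    have "tcoeff (1 * F) a = (\<Sum>(b, c)\<in>{(b, c). b + c = a}. if b = 0 then tcoeff F c else 0)"
      by (auto simp: times_tseries_def one_tseries_def intro!: sum.cong)
    also have "\<dots> = (\<Sum>(b, c)\<in>{(0 :: nat \<Rightarrow>\<^sub>0 nat, a)}. if b = 0 then tcoeff F c else 0)"
      by (rule sum.mono_neutral_right) (auto simp: finite_splits split: if_splits)
    finally show "tcoeff (1 * F) a = tcoeff F a" by simp
  qed
  show "(F + G) * K = F * K + G * K"
    by (rule tseries_eqI)
       (simp add: times_tseries_def plus_tseries_def case_prod_beta sum.distrib algebra_simps)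
  show "(0 :: 'a tseries) \<noteq> 1"
    by (auto simp: zero_tseries_def one_tseries_def Abs_tseries_inject fun_eq_iff)
qed (auto intro!: tseries_eqI
       simp: zero_tseries_def plus_tseries_def uminus_tseries_def minus_tseries_def algebra_simps)

end

instantiation tseries :: ("{real_algebra_1, comm_ring_1}") real_algebra_1
begin

definition scaleR_tseries :: "real \<Rightarrow> 'a tseries \<Rightarrow> 'a tseries" where
  "c *\<^sub>R F = Abs_tseries (\<lambda>a. c *\<^sub>R tcoeff F a)"

instance
  by standard
     (auto intro!: tseries_eqI simp: scaleR_tseries_def plus_tseries_def times_tseries_def
        algebra_simps case_prod_beta scaleR_sum_right)

end

definition tconst :: "'a \<Rightarrow> 'a::comm_ring_1 tseries" where
  "tconst c = Abs_tseries (\<lambda>a. if a = 0 then c else 0)"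

definition tvar :: "nat \<Rightarrow> 'a::comm_ring_1 tseries" where
  "tvar k = Abs_tseries (\<lambda>a. if a = Poly_Mapping.single k 1 then 1 else 0)"

text \<open>
  Formal (coefficientwise finite) sums: \<open>tsum\<close> is the sum of such a family, and \<open>tsums F I S\<close>
  also asserts that only finitely many members contribute to each coefficient.
\<close>

definition tsum :: "('i \<Rightarrow> 'a::comm_ring_1 tseries) \<Rightarrow> 'a tseries" where
  "tsum F = Abs_tseries (\<lambda>a. Sum_any (\<lambda>i. tcoeff (F i) a))"

definition tsums :: "('i \<Rightarrow> 'a::comm_ring_1 tseries) \<Rightarrow> 'i set \<Rightarrow> 'a tseries \<Rightarrow> bool" where
  "tsums F I S \<longleftrightarrow>
    (\<forall>a. finite {i \<in> I. tcoeff (F i) a \<noteq> 0} \<and>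
         (\<Sum>i\<in>{i \<in> I. tcoeff (F i) a \<noteq> 0}. tcoeff (F i) a) = tcoeff S a)"

text \<open>The linear form \<open>\<Sum>\<^sub>k p\<^sub>k t\<^sub>2\<^sub>k\<^sub>+\<^sub>1\<close>.\<close>

definition tlin :: "(nat \<Rightarrow> 'a) \<Rightarrow> 'a::comm_ring_1 tseries" where
  "tlin p = tsum (\<lambda>k. tconst (p k) * tvar k)"

text \<open>The exponential of a series without constant term.\<close>

definition texp :: "'a::field_char_0 tseries \<Rightarrow> 'a tseries" where
  "texp F = tsum (\<lambda>n. tconst (1 / fact n) * F ^ n)"

text \<open>Coefficientwise integration.\<close>

definition tintegral :: "'b measure \<Rightarrow> ('b \<Rightarrow> real tseries) \<Rightarrow> real tseries" where
  "tintegral M F = Abs_tseries (\<lambda>a. \<integral>x. tcoeff (F x) a \<partial>M)"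


section \<open>Dependence on the spectral parameter \<open>z\<close>\<close>

text \<open>
  Series involving \<open>z\<close> are elements of \<open>real fls tseries\<close>: each coefficient of a monomial in
  \<open>t\<close> is a formal Laurent series in \<open>z\<^sup>-\<^sup>1\<close>.  Hence \<open>fls_X\<close> stands for \<open>z\<^sup>-\<^sup>1\<close>.
\<close>

abbreviation zvar :: "real fls" where
  "zvar \<equiv> fls_X_inv"

abbreviation zvar_inv :: "real fls" where
  "zvar_inv \<equiv> fls_X"

text \<open>The coefficient of \<open>z\<^sup>-\<^sup>1\<close>, i.e. of the first power of \<open>fls_X\<close>.\<close>

definition residue_z :: "real fls tseries \<Rightarrow> real tseries" where
  "residue_z F = Abs_tseries (\<lambda>a. fls_nth (tcoeff F a) 1)"

text \<open>
  The substitution \<open>F(t - 2[z\<^sup>-\<^sup>1])\<close>: first in the monomial with exponent vector \<open>a\<close>, then in a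
  series \<open>F = \<Sum>\<^sub>a F\<^sub>a t\<^sup>a\<close>.  Only finitely many \<open>a\<close> contribute to any given monomial in \<open>t\<close>
  and power of \<open>z\<^sup>-\<^sup>1\<close>, and no positive powers of \<open>z\<close> occur.
\<close>

definition shifted_monom :: "(nat \<Rightarrow>\<^sub>0 nat) \<Rightarrow> real fls tseries" where
  "shifted_monom a =
    (\<Prod>j\<in>Poly_Mapping.keys a.
       (tvar j - tconst (fls_const (2 / real (2 * j + 1)) * zvar_inv ^ (2 * j + 1)))
         ^ Poly_Mapping.lookup a j)"

definition miwa_shift :: "real tseries \<Rightarrow> real fls tseries" where
  "miwa_shift F = Abs_tseries (\<lambda>b. fps_to_fls (Abs_fps (\<lambda>n.
     Sum_any (\<lambda>a. tcoeff F a * fls_nth (tcoeff (shifted_monom a) b) (int n)))))"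


section \<open>Elementary Schur Q-functions\<close>

text \<open>
  \<open>schur_q u j = [x\<^sup>j] exp (2 \<Sum>\<^sub>k u\<^sub>2\<^sub>k\<^sub>+\<^sub>1 x\<^sup>2\<^sup>k\<^sup>+\<^sup>1)\<close> with \<open>u k\<close> in the role of \<open>u\<^sub>2\<^sub>k\<^sub>+\<^sub>1\<close>.  The
  exponential series is composed explicitly because \<open>fps_exp\<close> requires coefficients in a
  field, whereas here the \<open>u k\<close> may be formal power series in \<open>t\<close>.
\<close>

definition schur_q :: "(nat \<Rightarrow> 'a) \<Rightarrow> nat \<Rightarrow> 'a::{real_algebra_1, comm_ring_1}" where
  "schur_q u j =
    fps_nth (fps_compose (Abs_fps (\<lambda>n. of_real (1 / fact n)))
                         (Abs_fps (\<lambda>n. if odd n then 2 * u (n div 2) else 0))) j"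


section \<open>Hermitian matrices\<close>

definition mat_trace :: "'a::comm_monoid_add mat \<Rightarrow> 'a" where
  "mat_trace A = (\<Sum>i<dim_row A. A $$ (i, i))"

text \<open>\<open>Tr (H\<^sup>m)\<close>, which is real for Hermitian \<open>H\<close>.\<close>

definition tr_pow :: "complex mat \<Rightarrow> nat \<Rightarrow> real" where
  "tr_pow H m = Re (mat_trace (H ^\<^sub>m m))"

text \<open>
  The Hermitian matrix with real coordinates \<open>x\<close>: \<open>x (i, i)\<close> is a diagonal entry, and for
  \<open>i < j\<close> the entry at \<open>(i, j)\<close> has real part \<open>x (i, j)\<close> and imaginary part \<open>x (j, i)\<close>.
\<close>

definition hermitian_of :: "nat \<Rightarrow> (nat \<times> nat \<Rightarrow> real) \<Rightarrow> complex mat" where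
  "hermitian_of n x = Matrix.mat n n (\<lambda>(i, j).
     if i = j then complex_of_real (x (i, i))
     else if i < j then Complex (x (i, j)) (x (j, i))
     else Complex (x (j, i)) (- x (i, j)))"

text \<open>Lebesgue measure \<open>dH\<close>; its space is the set of Hermitian \<open>n \<times> n\<close> matrices.\<close>

definition hermitian_lebesgue :: "nat \<Rightarrow> complex mat measure" where
  "hermitian_lebesgue n =
    embed_measure (Pi\<^sub>M ({..<n} \<times> {..<n}) (\<lambda>_. lborel)) (hermitian_of n)"

definition unitary_mat :: "nat \<Rightarrow> complex mat \<Rightarrow> bool" where
  "unitary_mat n U \<longleftrightarrow> U \<in> carrier_mat n n \<and> mat_adjoint U * U = 1\<^sub>m n"

text \<open>Functional calculus \<open>f(H)\<close> for Hermitian \<open>H\<close>, through a unitary diagonalisation.\<close>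

definition functional_calculus :: "(real \<Rightarrow> real) \<Rightarrow> complex mat \<Rightarrow> complex mat" where
  "functional_calculus f H = (THE B. \<exists>U d. unitary_mat (dim_row H) U \<and>
     H = U * mat_diag (dim_row H) (\<lambda>i. complex_of_real (d i)) * mat_adjoint U \<and>
     B = U * mat_diag (dim_row H) (\<lambda>i. complex_of_real (f (d i))) * mat_adjoint U)"


section \<open>The Kontsevich matrix model with arbitrary potential\<close>

text \<open>
  The external field \<open>\<Lambda> = diag(\<lambda>\<^sub>1, \<dots>, \<lambda>\<^sub>N)\<close> is given by the list of its diagonal entries, with
  indices starting from 0.
\<close>

definition field_mat :: "real list \<Rightarrow> complex mat" where
  "field_mat lam = mat_diag (length lam) (\<lambda>i. complex_of_real (lam ! i))"

definition gauss_measure :: "real list \<Rightarrow> complex mat measure" where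
  "gauss_measure lam = (let n = length lam in
     density (hermitian_lebesgue n) (\<lambda>H. ennreal (
       sqrt (\<Prod>i<n. \<Prod>j<n. lam ! i + lam ! j) / (2 powr (real n / 2) * (2 * pi) powr ((real n)\<^sup>2 / 2))
       * exp (- (1/2) * Re (mat_trace (field_mat lam * H ^\<^sub>m 2))))))"

text \<open>The measure \<open>d\<mu>\<close> at \<open>t = 0\<close>.\<close>

definition mu0 :: "real list \<Rightarrow> (real \<Rightarrow> real) \<Rightarrow> complex mat measure" where
  "mu0 lam V0 = density (gauss_measure lam)
     (\<lambda>H. ennreal (exp (Re (mat_trace (functional_calculus V0 H)))))"

text \<open>
  Integration of \<open>F\<close> against \<open>d\<mu>\<^sub>t = exp (\<Sum>\<^sub>k t\<^sub>2\<^sub>k\<^sub>+\<^sub>1 Tr (H\<^sup>2\<^sup>k\<^sup>+\<^sup>1)) d\<mu>\<^sub>0\<close>, coefficientwise in \<open>t\<close>.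
\<close>

definition mu_integral ::
    "real list \<Rightarrow> (real \<Rightarrow> real) \<Rightarrow> (complex mat \<Rightarrow> real tseries) \<Rightarrow> real tseries" where
  "mu_integral lam V0 F =
     tintegral (mu0 lam V0) (\<lambda>H. texp (tlin (\<lambda>k. tr_pow H (2 * k + 1))) * F H)"

definition Z :: "real list \<Rightarrow> (real \<Rightarrow> real) \<Rightarrow> real tseries" where
  "Z lam V0 = mu_integral lam V0 (\<lambda>H. 1)"

definition power_sums :: "complex mat \<Rightarrow> nat \<Rightarrow> real" where
  "power_sums H k = tr_pow H (2 * k + 1) / real (2 * k + 1)"

text \<open>The parameters with the entries at positions \<open>r\<close> and \<open>s\<close> deleted.\<close>

definition delete2 :: "'a list \<Rightarrow> nat \<Rightarrow> nat \<Rightarrow> 'a list" where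
  "delete2 xs r s = nths xs (- {r, s})"

text \<open>
  Sign convention in the expansion over pairs \<open>r < s\<close>: with the weights
  \<open>exp (- \<lambda>\<^sub>s x\<^sup>2 / 2 - \<lambda>\<^sub>r y\<^sup>2 / 2)\<close> and the integrand \<open>x\<^sup>k - y\<^sup>k\<close>, the antisymmetric prefactor has
  to be \<open>(\<lambda>\<^sub>s + \<lambda>\<^sub>r) / (\<lambda>\<^sub>r - \<lambda>\<^sub>s)\<close>.  The source prints the denominator as \<open>\<lambda>\<^sub>s - \<lambda>\<^sub>r\<close>, which is off
  by a global sign: for \<open>N = 2\<close>, \<open>V\<^sub>0 = 0\<close>, \<open>t = 0\<close>, \<open>k = 2\<close> the matrix integral is
  \<open>2 E[(Tr H)\<^sup>2] = 2 (1 / \<lambda>\<^sub>1 + 1 / \<lambda>\<^sub>2) > 0\<close>, while the printed right-hand side is its negative.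
\<close>

end

theory Submission
  imports Defs
begin

text \<open>
 The measure is first reduced to the eigenvalues \<open>x\<close> of \<open>H\<close>.  Bordering a matrix by one row and
 column interlaces the eigenvalues, which gives Weyl's integration formula and, iterated, the
 Harish-Chandra integral over Gelfand-Tsetlin patterns.  For distinct \<open>\<lambda>\<close> the eigenvalue density is
 proportional to \<open>\<Prod>i<j. (x\<^sub>i - x\<^sub>j) / (x\<^sub>i + x\<^sub>j) \<cdot> det (exp (- \<lambda>\<^sub>i x\<^sub>j\<^sup>2 / 2))\<close>.

 Partial fractions give \<open>q\<^sub>k = 2 \<Sum>\<^sub>r x\<^sub>r\<^sup>k R\<^sub>r\<close> with \<open>R\<^sub>r = \<Prod>i\<noteq>r. (x\<^sub>r + x\<^sub>i) / (x\<^sub>r - x\<^sub>i)\<close>, and \<open>R\<^sub>r\<close> cancels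
 exactly the factors of the density that couple \<open>x\<^sub>r\<close> to the other eigenvalues.  By symmetry and the
 expansion of the determinant along the column of \<open>x\<^sub>r\<close>, the variable \<open>x\<^sub>r\<close> decouples together with
 one \<open>\<lambda>\<^sub>s\<close>.  The remaining number of eigenvalues is odd, so that \<open>\<Sum>\<^sub>r R\<^sub>r = 1\<close> decouples a second one: this
 is (A).  If \<open>V\<^sub>0\<close> is even, the combinations in (B) and (C) are odd in the decoupled variable and vanish.
\<close>

text \<open>The weight contains Tr(\<Lambda> H^2), which is not a function of the spectrum of H, so
  the angular part has to be integrated out. Given the spectrum \<open>y\<close> of the corner, the
  characteristic polynomial of the bordered matrix is affine in the squared moduli
  \<open>r i\<close> of the border entries and in the new diagonal entry. Lebesgue measure in these
  is Lebesgue measure on monic polynomials divided by \<open>vdm n y\<close>, and the roots of such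
  a polynomial have the Vandermonde product as density. No angular coordinates and no Haar measure
  occur. This settles invariant functions of H times exp(- Tr(\<xi> H)). The square in Tr(\<Lambda>
  H^2) is reached by a duality: in a double integral over L and H, the matrix L is the integration
  variable and H^2 the direction \<xi>. Hence the squares of the eigenvalues, and the quotient
  vdm(x)^2 / vdm(x^2) behind the factors (x_i - x_j) / (x_i + x_j). The duality only compares
  averages over the spectrum of L; continuity gives the value at \<Lambda>. As vdm(\<Lambda>) stands
  in a denominator, (B) and (C) for repeated \<lambda>_i are limits. Series in t are compared
  coefficient by coefficient.\<close>

abbreviation NI :: "'a measure => ('a => ennreal) => ennreal" where "NI == nn_integral"
abbreviation bm :: "('a => 'b::topological_space) => 'a measure => bool" (infix "bm" 50) where "f bm M == f : borel_measurable M"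
abbreviation swp :: "'a => 'a => 'a => 'a" where "swp == Transposition.transpose"
notation pair_measure (infixr "XM" 80) and measurable (infixr "->M" 60)

lemmas mcomp = measurable_compose
named_theorems mi
lemmas [mi] = measurable_compose[OF _ measurable_ennreal] measurable_compose[OF _ borel_measurable_exp] measurable_compose[OF _ borel_measurable_norm]
 borel_measurable_times_ennreal borel_measurable_times borel_measurable_const borel_measurable_uminus borel_measurable_diff borel_measurable_add
 borel_measurable_power borel_measurable_sum borel_measurable_prod borel_measurable_divide

section \<open>Hermitian and unitary matrices\<close>

definition herm :: "nat => complex mat => bool" where
 "herm n H \<longleftrightarrow> H : carrier_mat n n & mat_adjoint H = H"

lemma mat_adjoint_dim [simp]: "dim_row (mat_adjoint A) = dim_col A" "dim_col (mat_adjoint A) = dim_row A"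
 by (auto simp: mat_adjoint_def mat_of_rows_def)

lemma mat_adjoint_carrier [simp]: "A : carrier_mat n m ==> mat_adjoint A : carrier_mat m n"
 by (intro carrier_matI) auto

lemma mat_adjoint_index [simp]:
 "i < dim_col A ==> j < dim_row A ==> mat_adjoint A $$ (i, j) = cnj (A $$ (j, i))"
 by (auto simp: mat_adjoint_def mat_of_rows_def)

lemma mult_index:
 "A : carrier_mat n m ==> B : carrier_mat m k ==> i < n ==> j < k ==>
  (A * B) $$ (i, j) = (\<Sum>l<m. A $$ (i, l) * B $$ (l, j))"
 by (auto simp: scalar_prod_def lessThan_atLeast0)

lemma mat_adjoint_mult:
 fixes A B :: "complex mat"
 assumes "A : carrier_mat n m" "B : carrier_mat m k"
 shows "mat_adjoint (A * B) = mat_adjoint B * mat_adjoint A"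
proof (rule eq_matI)
 fix i j assume "i < dim_row (mat_adjoint B * mat_adjoint A)" "j < dim_col (mat_adjoint B * mat_adjoint A)"
 hence ij: "i < k" "j < n" using assms by auto
 have "mat_adjoint (A * B) $$ (i, j) = cnj ((A * B) $$ (j, i))"
  using ij assms by (intro mat_adjoint_index) auto
 also have "... = cnj (\<Sum>l<m. A $$ (j, l) * B $$ (l, i))"
  using mult_index[OF assms ij(2,1)] by simp
 also have "... = (\<Sum>l<m. mat_adjoint B $$ (i, l) * mat_adjoint A $$ (l, j))"
  using ij assms by (auto intro!: sum.cong simp: mult.commute)
 also have "... = (mat_adjoint B * mat_adjoint A) $$ (i, j)"
  by (rule mult_index[symmetric, of _ k m _ n]) (use assms ij in auto)
 finally show "mat_adjoint (A * B) $$ (i, j) = (mat_adjoint B * mat_adjoint A) $$ (i, j)" .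
qed (use assms in auto)

lemma mat_adjoint_adjoint [simp]: "mat_adjoint (mat_adjoint A) = (A :: complex mat)"
 by (rule eq_matI) auto

lemma mat_adjoint_one [simp]: "mat_adjoint (1\<^sub>m n) = (1\<^sub>m n :: complex mat)"
 by (rule eq_matI) auto

lemma hermD: "herm n H ==> H : carrier_mat n n" "herm n H ==> mat_adjoint H = H"
 by (auto simp: herm_def)

lemma herm_index: "herm n H ==> i < n ==> j < n ==> H $$ (i, j) = cnj (H $$ (j, i))"
 using mat_adjoint_index[of i H j] by (auto simp: herm_def)

lemma hermI:
 "H : carrier_mat n n ==> (!!i j. i < n ==> j < n ==> H $$ (i, j) = cnj (H $$ (j, i))) ==> herm n H"
 unfolding herm_def
proof (intro conjI eq_matI)
 fix i j
 assume H: "H : carrier_mat n n" and *: "!!i j. i < n ==> j < n ==> H $$ (i, j) = cnj (H $$ (j, i))"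
  and "i < dim_row H" "j < dim_col H"
 hence ij: "i < n" "j < n" by auto
 show "mat_adjoint H $$ (i, j) = H $$ (i, j)"
  using *[OF ij] mat_adjoint_index[of i H j] H ij by simp
qed auto

lemma unitary_carrier [simp]: "unitary_mat n U ==> U : carrier_mat n n"
 by (simp add: unitary_mat_def)

lemma unitary_left: "unitary_mat n U ==> mat_adjoint U * U = 1\<^sub>m n"
 by (simp add: unitary_mat_def)

lemma unitary_right: "unitary_mat n U ==> U * mat_adjoint U = 1\<^sub>m n"
 using mat_mult_left_right_inverse[of "mat_adjoint U" n U] by (simp add: unitary_mat_def)

lemma unitary_columns:
 assumes U: "unitary_mat n U" and kj: "k < n" "j < n"
 shows "(\<Sum>i<n. cnj (U $$ (i, k)) * U $$ (i, j)) = (if k = j then 1 else 0)"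
proof -
 note Uc = unitary_carrier[OF U]
 have "(\<Sum>i<n. cnj (U $$ (i, k)) * U $$ (i, j)) = (mat_adjoint U * U) $$ (k, j)"
  unfolding mult_index[OF mat_adjoint_carrier[OF Uc] Uc kj] using Uc kj by (intro sum.cong) auto
 thus ?thesis using kj by (simp add: unitary_left[OF U])
qed

lemma unitary_adjoint: "unitary_mat n U ==> unitary_mat n (mat_adjoint U)"
 by (simp add: unitary_mat_def unitary_right)

lemma unitary_one [simp]: "unitary_mat n (1\<^sub>m n)"
 by (simp add: unitary_mat_def)

lemma unitary_cancel:
 assumes "unitary_mat n U" "A : carrier_mat n m"
 shows "U * (mat_adjoint U * A) = A" "mat_adjoint U * (U * A) = A"
proof -
 note c = unitary_carrier[OF assms(1)]
 note c' = mat_adjoint_carrier[OF c]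
 show "U * (mat_adjoint U * A) = A"
  unfolding assoc_mult_mat[OF c c' assms(2), symmetric] unitary_right[OF assms(1)] left_mult_one_mat[OF assms(2)] ..
 show "mat_adjoint U * (U * A) = A"
  unfolding assoc_mult_mat[OF c' c assms(2), symmetric] unitary_left[OF assms(1)] left_mult_one_mat[OF assms(2)] ..
qed

lemma unitary_mult:
 assumes "unitary_mat n U" "unitary_mat n W"
 shows "unitary_mat n (U * W)"
proof -
 note c = unitary_carrier[OF assms(1)] unitary_carrier[OF assms(2)]
 have "mat_adjoint (U * W) * (U * W) = mat_adjoint W * (mat_adjoint U * (U * W))"
  unfolding mat_adjoint_mult[OF c]
  by (rule assoc_mult_mat[OF mat_adjoint_carrier[OF c(2)] mat_adjoint_carrier[OF c(1)] mult_carrier_mat[OF c]])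
 also have "... = 1\<^sub>m n" using unitary_cancel[OF assms(1) c(2)] unitary_left[OF assms(2)] by simp
 finally show ?thesis using mult_carrier_mat[OF c] by (simp add: unitary_mat_def)
qed

section \<open>Conjugation by a unitary matrix\<close>

definition conj_by :: "complex mat => complex mat => complex mat" where
 "conj_by U H = U * H * mat_adjoint U"

lemma conj_by_carrier [simp]:
 "unitary_mat n U ==> H : carrier_mat n n ==> conj_by U H : carrier_mat n n"
 unfolding conj_by_def
 by (rule mult_carrier_mat[OF mult_carrier_mat[OF unitary_carrier] mat_adjoint_carrier[OF unitary_carrier]])

lemma herm_conj_by:
 assumes "unitary_mat n U" "herm n H"
 shows "herm n (conj_by U H)"
proof -
 note c = unitary_carrier[OF assms(1)] hermD(1)[OF assms(2)]
 note c' = mat_adjoint_carrier[OF c(1)]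
 have "mat_adjoint (conj_by U H) = U * (mat_adjoint H * mat_adjoint U)"
  unfolding conj_by_def mat_adjoint_mult[OF mult_carrier_mat[OF c] c'] mat_adjoint_mult[OF c] mat_adjoint_adjoint ..
 also have "... = conj_by U H"
  unfolding conj_by_def hermD(2)[OF assms(2)] assoc_mult_mat[OF c c'] ..
 finally show ?thesis using conj_by_carrier[OF assms(1) c(2)] by (simp add: herm_def)
qed

lemma conj_by_mult:
 assumes "unitary_mat n U" "unitary_mat n W" "H : carrier_mat n n"
 shows "conj_by U (conj_by W H) = conj_by (U * W) H"
proof -
 note c = unitary_carrier[OF assms(1)] unitary_carrier[OF assms(2)] assms(3)
 note a = c(1)[THEN mat_adjoint_carrier] c(2)[THEN mat_adjoint_carrier]
 have "U * (W * H * mat_adjoint W) * mat_adjoint U = U * (W * H) * (mat_adjoint W * mat_adjoint U)"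
  unfolding assoc_mult_mat[OF c(1) mult_carrier_mat[OF mult_carrier_mat[OF c(2,3)] a(2)] a(1)]
   assoc_mult_mat[OF mult_carrier_mat[OF c(2,3)] a(2) a(1)]
   assoc_mult_mat[OF c(1) mult_carrier_mat[OF c(2,3)] mult_carrier_mat[OF a(2) a(1)]] ..
 thus ?thesis
  unfolding conj_by_def mat_adjoint_mult[OF c(1,2)] assoc_mult_mat[OF c] .
qed

lemma conj_by_one [simp]: "H : carrier_mat n n ==> conj_by (1\<^sub>m n) H = H"
 by (simp add: conj_by_def)

lemma conj_by_adjoint:
 assumes "unitary_mat n U" "H : carrier_mat n n"
 shows "conj_by (mat_adjoint U) (conj_by U H) = H" "conj_by U (conj_by (mat_adjoint U) H) = H"
 using assms conj_by_mult[OF unitary_adjoint[OF assms(1)] assms] conj_by_mult[OF assms(1) unitary_adjoint[OF assms(1)] assms(2)]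
 by (simp_all only: unitary_left unitary_right conj_by_one)

lemma conj_by_prod:
 assumes "unitary_mat n U" "A : carrier_mat n n" "B : carrier_mat n n"
 shows "conj_by U A * conj_by U B = conj_by U (A * B)"
proof -
 note c = unitary_carrier[OF assms(1)] assms(2,3)
 note a = c(1)[THEN mat_adjoint_carrier]
 have "U * A * mat_adjoint U * (U * B * mat_adjoint U) = U * A * (mat_adjoint U * (U * (B * mat_adjoint U)))"
  unfolding assoc_mult_mat[OF c(1,3) a]
   assoc_mult_mat[OF mult_carrier_mat[OF c(1,2)] a mult_carrier_mat[OF c(1) mult_carrier_mat[OF c(3) a]]] ..
 also have "... = U * A * (B * mat_adjoint U)"
  unfolding unitary_cancel(2)[OF assms(1) mult_carrier_mat[OF c(3) a]] ..
 also have "... = U * (A * B) * mat_adjoint U"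
  unfolding assoc_mult_mat[OF mult_carrier_mat[OF c(1,2)] c(3) a, symmetric] assoc_mult_mat[OF c] ..
 finally show ?thesis unfolding conj_by_def .
qed

lemma conj_by_pow:
 assumes "unitary_mat n U" "A : carrier_mat n n"
 shows "conj_by U A ^\<^sub>m k = conj_by U (A ^\<^sub>m k)"
proof (induction k)
 case 0
 show ?case using assms unitary_right[OF assms(1)] right_mult_one_mat[OF unitary_carrier[OF assms(1)]]
   carrier_matD[OF unitary_carrier[OF assms(1)]] carrier_matD[OF assms(2)]
   carrier_matD[OF conj_by_carrier[OF assms]]
  by (simp add: conj_by_def)
next
 case (Suc k)
 thus ?case using assms by (simp add: conj_by_prod)
qed

section \<open>Real diagonal matrices and traces\<close>

definition rdiag :: "nat => (nat => real) => complex mat" where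
 "rdiag n d = mat_diag n (%i. complex_of_real (d i))"

lemma rdiag_carrier [simp]: "rdiag n d : carrier_mat n n" "dim_row (rdiag n d) = n" "dim_col (rdiag n d) = n"
 by (auto simp: rdiag_def mat_diag_def)

lemma rdiag_index: "i < n ==> j < n ==> rdiag n d $$ (i, j) = (if i = j then complex_of_real (d i) else 0)"
 by (simp add: rdiag_def mat_diag_def)

lemma rdiag_cong: "(!!i. i < n ==> d i = e i) ==> rdiag n d = rdiag n e"
 by (rule eq_matI) (auto simp: rdiag_index)

lemma herm_rdiag [simp]: "herm n (rdiag n d)"
 by (rule hermI) (auto simp: rdiag_index)

lemma rdiag_pow: "rdiag n d ^\<^sub>m k = rdiag n (%i. d i ^ k)"
proof (induction k)
 case 0
 show ?case by (rule eq_matI) (auto simp: rdiag_index)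
next
 case (Suc k)
 thus ?case by (simp add: rdiag_def mult.commute)
qed

lemma mat_trace_comm:
 assumes "A : carrier_mat n m" "B : carrier_mat m n"
 shows "mat_trace (A * B) = mat_trace (B * A :: 'a :: comm_ring_1 mat)"
proof -
 have "mat_trace (A * B) = (\<Sum>i<n. \<Sum>l<m. A $$ (i, l) * B $$ (l, i))"
  using assms unfolding mat_trace_def
  by (intro sum.cong) (auto simp: scalar_prod_def lessThan_atLeast0)
 also have "... = (\<Sum>l<m. \<Sum>i<n. B $$ (l, i) * A $$ (i, l))"
  by (subst sum.swap) (simp add: mult.commute)
 also have "... = mat_trace (B * A)"
  using assms unfolding mat_trace_def
  by (intro sum.cong) (auto simp: scalar_prod_def lessThan_atLeast0)
 finally show ?thesis .
qed

lemma mat_trace_conj_by: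
 assumes "unitary_mat n U" "A : carrier_mat n n"
 shows "mat_trace (conj_by U A) = mat_trace A"
proof -
 have "mat_trace (conj_by U A) = mat_trace (mat_adjoint U * (U * A))"
  unfolding conj_by_def
  by (rule mat_trace_comm[OF mult_carrier_mat[OF unitary_carrier[OF assms(1)] assms(2)]
     mat_adjoint_carrier[OF unitary_carrier[OF assms(1)]]])
 thus ?thesis using unitary_cancel(2)[OF assms] by simp
qed

lemma mat_trace_rdiag: "mat_trace (rdiag n d) = complex_of_real (\<Sum>i<n. d i)"
 by (simp add: mat_trace_def rdiag_index)

lemma mat_trace_conj_rdiag: "unitary_mat n U ==> mat_trace (conj_by U (rdiag n d)) = complex_of_real (\<Sum>i<n. d i)"
 by (simp add: mat_trace_conj_by mat_trace_rdiag)

lemma tr_pow_conj_by: "unitary_mat n U ==> H : carrier_mat n n ==> tr_pow (conj_by U H) m = tr_pow H m"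
 by (simp only: tr_pow_def conj_by_pow[of n] mat_trace_conj_by[of n] pow_carrier_mat)

lemma tr_pow_rdiag: "tr_pow (rdiag n d) m = (\<Sum>i<n. d i ^ m)"
 by (simp only: tr_pow_def rdiag_pow mat_trace_rdiag Re_complex_of_real)

text \<open>Entrywise, \<open>eig\<close> says \<open>A * U = U * rdiag n d\<close>: the columns of
  \<open>U\<close> are eigenvectors. Multiplying by the adjoint of \<open>U\<close> from the right
  isolates \<open>A\<close>.\<close>

lemma eq_conj_rdiagI:
 assumes U: "unitary_mat n U" and A: "A : carrier_mat n n"
  and eig: "!!i j. i < n ==> j < n ==> (\<Sum>l<n. A $$ (i, l) * U $$ (l, j)) = of_real (d j) * U $$ (i, j)"
 shows "A = conj_by U (rdiag n d)"
proof -
 note Uc = unitary_carrier[OF U]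
 have "A * U = U * rdiag n d"
 proof (rule eq_matI)
  fix i j assume "i < dim_row (U * rdiag n d)" "j < dim_col (U * rdiag n d)"
  hence ij: "i < n" "j < n" using carrier_matD[OF Uc] by auto
  have "(U * rdiag n d) $$ (i, j) = (\<Sum>l<n. if l = j then U $$ (i, l) * of_real (d j) else 0)"
   unfolding mult_index[OF Uc rdiag_carrier(1) ij]
   by (intro sum.cong) (auto simp: rdiag_index ij)
  thus "(A * U) $$ (i, j) = (U * rdiag n d) $$ (i, j)"
   using eig[OF ij] ij by (simp add: mult_index[OF A Uc ij])
 qed (use A Uc in auto)
 hence "U * rdiag n d * mat_adjoint U = A * (U * mat_adjoint U)"
  using assoc_mult_mat[OF A Uc mat_adjoint_carrier[OF Uc]] by simp
 thus ?thesis
  using unitary_right[OF U] A by (simp add: conj_by_def)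
qed

lemma unitary_matI:
 assumes "U : carrier_mat n n"
  and "!!i j. i < n ==> j < n ==> (\<Sum>l<n. cnj (U $$ (l, i)) * U $$ (l, j)) = (if i = j then 1 else 0)"
 shows "unitary_mat n U"
proof -
 have "mat_adjoint U * U = 1\<^sub>m n"
 proof (rule eq_matI)
  fix i j assume "i < dim_row (1\<^sub>m n :: complex mat)" "j < dim_col (1\<^sub>m n :: complex mat)"
  hence ij: "i < n" "j < n" by auto
  have "(mat_adjoint U * U) $$ (i, j) = (\<Sum>l<n. cnj (U $$ (l, i)) * U $$ (l, j))"
   unfolding mult_index[OF mat_adjoint_carrier[OF assms(1)] assms(1) ij]
   using assms(1) ij by (intro sum.cong) auto
  thus "(mat_adjoint U * U) $$ (i, j) = 1\<^sub>m n $$ (i, j)" using assms(2)[OF ij] ij by simp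
 qed (use assms(1) in auto)
 thus ?thesis using assms(1) by (simp add: unitary_mat_def)
qed

lemma sum_cnj_mult_self: "(\<Sum>l<n. cnj (u l) * u l) = of_real (\<Sum>l<n. (cmod (u l))^2)" for u :: "nat => complex"
 by (simp add: complex_norm_square mult.commute del: of_real_power)

text \<open>Orthogonality of the eigenvectors comes from the distinctness of the eigenvalues.\<close>

lemma distinct_eigenvalues_diagonalize:
 assumes A: "herm n A" and inj: "inj_on x {..<n}"
  and eig: "!!j i. j < n ==> i < n ==> (\<Sum>l<n. A $$ (i, l) * u j l) = of_real (x j) * u j i"
  and nz: "!!j. j < n ==> \<exists>l<n. u j l ~= 0"
 shows "\<exists>U. unitary_mat n U & A = conj_by U (rdiag n x)"
proof -
 define N where "N j = sqrt (\<Sum>l<n. (cmod (u j l))^2)" for j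
 define U where "U = Matrix.mat n n (%(i, j). u j i / of_real (N j))"
 have N2: "of_real (N j) * of_real (N j) = (\<Sum>l<n. cnj (u j l) * u j l)" for j
  unfolding sum_cnj_mult_self of_real_mult[symmetric] N_def by (simp add: sum_nonneg)
 have N0: "N j ~= 0" if "j < n" for j
 proof -
  obtain l where l: "l < n" "u j l ~= 0" using nz[of j] \<open>j < n\<close> by auto
  have "0 < (\<Sum>l<n. (cmod (u j l))^2)" using l by (intro sum_pos2[of _ l]) auto
  thus ?thesis by (simp add: N_def)
 qed
 have orth: "(\<Sum>l<n. cnj (u i l) * u j l) = 0" if ij: "i < n" "j < n" "i ~= j" for i j
 proof -
  let ?S = "\<Sum>l<n. cnj (u i l) * u j l"
  have "of_real (x j) * ?S = (\<Sum>k<n. cnj (u i k) * (\<Sum>l<n. A $$ (k, l) * u j l))"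
   unfolding sum_distrib_left[of "of_real (x j)"]
   by (intro sum.cong refl) (simp add: eig[OF ij(2)])
  also have "... = (\<Sum>l<n. (\<Sum>k<n. cnj (A $$ (l, k) * u i k)) * u j l)"
   unfolding sum_distrib_left sum_distrib_right
  proof (subst sum.swap, intro sum.cong refl)
   fix l k assume "l : {..<n}" "k : {..<n}"
   hence "A $$ (k, l) = cnj (A $$ (l, k))" using herm_index[OF A, of k l] by simp
   thus "cnj (u i k) * (A $$ (k, l) * u j l) = cnj (A $$ (l, k) * u i k) * u j l"
    by (simp add: mult_ac)
  qed
  also have "... = (\<Sum>l<n. cnj (of_real (x i) * u i l) * u j l)"
  proof (intro sum.cong refl)
   fix l assume "l : {..<n}"
   hence "(\<Sum>k<n. cnj (A $$ (l, k) * u i k)) = cnj (of_real (x i) * u i l)"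
    unfolding cnj_sum[symmetric] using eig[OF ij(1)] by simp
   thus "(\<Sum>k<n. cnj (A $$ (l, k) * u i k)) * u j l = cnj (of_real (x i) * u i l) * u j l" by simp
  qed
  also have "... = of_real (x i) * ?S"
   by (simp add: sum_distrib_left mult_ac)
  finally have "(of_real (x j) - of_real (x i)) * ?S = 0" by (simp add: algebra_simps)
  moreover have "x j ~= x i" using inj ij by (auto simp: inj_on_def)
  ultimately show ?thesis by simp
 qed
 have "unitary_mat n U"
 proof (rule unitary_matI)
  fix i j assume ij: "i < n" "j < n"
  have "(\<Sum>l<n. cnj (U $$ (l, i)) * U $$ (l, j)) = (\<Sum>l<n. cnj (u i l) * u j l) / (of_real (N i) * of_real (N j))"
   using ij by (simp add: U_def sum_divide_distrib)
  thus "(\<Sum>l<n. cnj (U $$ (l, i)) * U $$ (l, j)) = (if i = j then 1 else 0)"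
   using orth[OF ij] N2[of i] N0[OF ij(1)] by (auto simp: N2[symmetric])
 qed (simp add: U_def)
 moreover have "A = conj_by U (rdiag n x)"
 proof (rule eq_conj_rdiagI[OF calculation hermD(1)[OF A]])
  fix i j assume ij: "i < n" "j < n"
  have "(\<Sum>l<n. A $$ (i, l) * U $$ (l, j)) = (\<Sum>l<n. A $$ (i, l) * u j l) / of_real (N j)"
   using ij by (simp add: U_def sum_divide_distrib)
  thus "(\<Sum>l<n. A $$ (i, l) * U $$ (l, j)) = of_real (x j) * U $$ (i, j)"
   using eig[OF ij(2,1)] ij by (simp add: U_def)
 qed
 ultimately show ?thesis by blast
qed

text \<open>A permutation matrix conjugates. Through this, unitarily invariant functions become
  symmetric functions of the eigenvalues.\<close>

lemma permute_rdiag: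
 assumes "p permutes {..<n}"
 shows "\<exists>U. unitary_mat n U & rdiag n (d o p) = conj_by U (rdiag n d)"
proof -
 define U where "U = Matrix.mat n n (%(i, j). if p i = j then 1 else (0 :: complex))"
 have "unitary_mat n U"
 proof (rule unitary_matI)
  fix i j assume ij: "i < n" "j < n"
  have "(\<Sum>l<n. cnj (U $$ (l, i)) * U $$ (l, j)) = (\<Sum>l<n. if p l = i then (if i = j then 1 else 0) else 0)"
   using ij by (intro sum.cong) (auto simp: U_def)
  also have "... = (\<Sum>l<n. if l = i then (if i = j then 1 else 0) else 0)"
   using sum.permute[OF assms, of "%l. if l = i then (if i = j then 1 else 0 :: complex) else 0"] by (simp add: o_def)
  finally show "(\<Sum>l<n. cnj (U $$ (l, i)) * U $$ (l, j)) = (if i = j then 1 else 0)"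
   using ij by simp
 qed (simp add: U_def)
 moreover have "rdiag n (d o p) = conj_by U (rdiag n d)"
 proof (rule eq_conj_rdiagI[OF calculation rdiag_carrier(1)])
  fix i j assume ij: "i < n" "j < n"
  have "(\<Sum>l<n. rdiag n (d o p) $$ (i, l) * U $$ (l, j)) = (\<Sum>l<n. if l = i then of_real (d (p i)) * U $$ (i, j) else 0)"
   using ij by (intro sum.cong) (auto simp: rdiag_index)
  thus "(\<Sum>l<n. rdiag n (d o p) $$ (i, l) * U $$ (l, j)) = of_real (d j) * U $$ (i, j)"
   using ij by (auto simp: U_def)
 qed
 ultimately show ?thesis by blast
qed

section \<open>The spectral theorem\<close>

lemma herm_eigenvector:
 assumes A: "herm (Suc n) A"
 obtains e v where "v : carrier_vec (Suc n)" "v ~= 0\<^sub>v (Suc n)" "A *\<^sub>v v = e \<cdot>\<^sub>v v"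
proof -
 have "degree (char_poly A) = Suc n" using degree_monic_char_poly[OF hermD(1)[OF A]] by simp
 hence "~ constant (poly (char_poly A))" by (simp add: constant_degree)
 then obtain e where "poly (char_poly A) e = 0" using fundamental_theorem_of_algebra by blast
 hence "eigenvalue A e" using eigenvalue_root_char_poly[OF hermD(1)[OF A]] by simp
 thus ?thesis using that carrier_matD(1)[OF hermD(1)[OF A]] unfolding eigenvalue_def eigenvector_def by auto
qed

text \<open>Gram-Schmidt on a basis that starts with \<open>v\<close> keeps \<open>v\<close> as its
  first vector. Only the norms remain to be divided out, whence the scalar \<open>c\<close>.\<close>

lemma unitary_with_first_column:
 assumes v: "v : carrier_vec n" "v ~= 0\<^sub>v n"
 obtains W c where "unitary_mat n W" "!!i. i < n ==> W $$ (i, 0) = c * vec_index v i"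
proof -
 interpret cof_vec_space n "TYPE(complex)" .
 define b where "b = basis_completion v"
 note B = basis_completion[OF v, folded b_def]
 define ws where "ws = gram_schmidt n b"
 note G = gram_schmidt_result[OF B(2,4,5) ws_def]
 have n0: "n ~= 0"
 proof
  assume "n = 0"
  hence "v = 0\<^sub>v n" using v(1) by (intro eq_vecI) auto
  thus False using v by simp
 qed
 have len: "length ws = n" using G(4) B(6) by simp
 have carr: "ws ! j : carrier_vec n" if "j < n" for j using G(3) len that by (auto simp: subset_iff)
 obtain vs where bv: "b = v # vs" using B(6,7) n0 by (cases b) auto
 have w0: "ws ! 0 = v"
  using gram_schmidt_hd[OF v(1), of vs] len n0 by (simp add: ws_def bv hd_conv_nth[symmetric] flip: length_0_conv)
 have ip: "scalar_prod (ws ! j) (conjugate (ws ! i)) = (\<Sum>l<n. cnj (vec_index (ws ! i) l) * vec_index (ws ! j) l)"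
  if "i < n" "j < n" for i j
  using carr[OF that(1)] by (simp add: scalar_prod_def lessThan_atLeast0 mult.commute)
 have orth: "(\<Sum>l<n. cnj (vec_index (ws ! i) l) * vec_index (ws ! j) l) = 0 \<longleftrightarrow> i ~= j"
  if "i < n" "j < n" for i j
  using corthogonalD[OF G(2), of j i] that by (auto simp: ip[symmetric] len)
 define N where "N j = sqrt (\<Sum>l<n. (cmod (vec_index (ws ! j) l))^2)" for j
 define W where "W = Matrix.mat n n (%(i, j). vec_index (ws ! j) i / of_real (N j))"
 have N2: "of_real (N j) * of_real (N j) = (\<Sum>l<n. cnj (vec_index (ws ! j) l) * vec_index (ws ! j) l)" for j
  unfolding sum_cnj_mult_self of_real_mult[symmetric] N_def by (simp add: sum_nonneg)
 have N0: "N j ~= 0" if "j < n" for j using orth[OF that that] N2[of j] by auto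
 have "unitary_mat n W"
 proof (rule unitary_matI)
  fix i j assume ij: "i < n" "j < n"
  have "(\<Sum>l<n. cnj (W $$ (l, i)) * W $$ (l, j)) = (\<Sum>l<n. cnj (vec_index (ws ! i) l) * vec_index (ws ! j) l) / (of_real (N i) * of_real (N j))"
   using ij by (simp add: W_def sum_divide_distrib)
  thus "(\<Sum>l<n. cnj (W $$ (l, i)) * W $$ (l, j)) = (if i = j then 1 else 0)"
   using orth[OF ij] N2[of i] N0[OF ij(1)] by (auto simp: N2[symmetric])
 qed (simp add: W_def)
 moreover have "W $$ (i, 0) = (1 / of_real (N 0)) * vec_index v i" if "i < n" for i
  using that n0 w0 by (simp add: W_def)
 ultimately show ?thesis using that by blast
qed

definition border1 :: "nat => complex => complex mat => complex mat" where
 "border1 n e B = Matrix.mat (Suc n) (Suc n) (%(i, j). if i = 0 & j = 0 then e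
   else if i = 0 | j = 0 then 0 else B $$ (i - 1, j - 1))"

lemma border1_carrier [simp]: "border1 n e B : carrier_mat (Suc n) (Suc n)"
 by (simp add: border1_def)

lemma border1_simps [simp]:
 "border1 n e B $$ (0, 0) = e"
 "i < n ==> border1 n e B $$ (Suc i, 0) = 0"
 "i < n ==> border1 n e B $$ (0, Suc i) = 0"
 "i < n ==> j < n ==> border1 n e B $$ (Suc i, Suc j) = B $$ (i, j)"
 by (auto simp: border1_def)

text \<open>Deflation: in a unitary basis that starts with an eigenvector, the first column is a
  multiple of the first unit vector. Hermiticity clears the first row as well, and the remaining
  block is Hermitian of size \<open>n\<close>.\<close>

theorem spectral:
 assumes "herm n A"
 shows "\<exists>U d. unitary_mat n U & A = conj_by U (rdiag n d)"
 using assms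
proof (induction n arbitrary: A)
 case 0
 have "A = conj_by (1\<^sub>m 0) (rdiag 0 (%_. 0))"
  using carrier_matD[OF hermD(1)[OF 0]] by (intro eq_matI) (auto simp: conj_by_def)
 thus ?case using unitary_one by blast
next
 case (Suc n)
 note Ac = hermD(1)[OF Suc.prems]
 obtain e v where ev: "v : carrier_vec (Suc n)" "v ~= 0\<^sub>v (Suc n)" "A *\<^sub>v v = e \<cdot>\<^sub>v v"
  using herm_eigenvector[OF Suc.prems] by blast
 obtain W c where W: "unitary_mat (Suc n) W" "!!i. i < Suc n ==> W $$ (i, 0) = c * vec_index v i"
  using unitary_with_first_column[OF ev(1,2)] by blast
 note Wc = unitary_carrier[OF W(1)]
 define H where "H = conj_by (mat_adjoint W) A"
 have H: "herm (Suc n) H" unfolding H_def by (rule herm_conj_by[OF unitary_adjoint[OF W(1)] Suc.prems])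
 have AW: "(A * W) $$ (i, 0) = e * W $$ (i, 0)" if "i < Suc n" for i
 proof -
  have "vec_index (A *\<^sub>v v) i = (\<Sum>l<Suc n. A $$ (i, l) * vec_index v l)"
   using Ac ev(1) that by (simp add: scalar_prod_def lessThan_atLeast0)
  hence "(\<Sum>l<Suc n. A $$ (i, l) * vec_index v l) = e * vec_index v i"
   using ev(1,3) that by simp
  hence "c * (\<Sum>l<Suc n. A $$ (i, l) * vec_index v l) = c * (e * vec_index v i)" by simp
  thus ?thesis
   unfolding mult_index[OF Ac Wc that zero_less_Suc] using W(2) that
   by (simp add: sum_distrib_left mult_ac del: sum.lessThan_Suc)
 qed
 have H0: "H $$ (i, 0) = (if i = 0 then e else 0)" if i: "i < Suc n" for i
 proof -
  have "H = mat_adjoint W * (A * W)"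
   unfolding H_def conj_by_def mat_adjoint_adjoint
   by (rule assoc_mult_mat[OF mat_adjoint_carrier[OF Wc] Ac Wc])
  hence "H $$ (i, 0) = (\<Sum>l<Suc n. mat_adjoint W $$ (i, l) * (e * W $$ (l, 0)))"
   using mult_index[OF mat_adjoint_carrier[OF Wc] mult_carrier_mat[OF Ac Wc] i zero_less_Suc] AW
   by (simp del: sum.lessThan_Suc)
  also have "... = e * (mat_adjoint W * W) $$ (i, 0)"
   unfolding mult_index[OF mat_adjoint_carrier[OF Wc] Wc i zero_less_Suc] sum_distrib_left
   by (intro sum.cong) (auto simp: mult_ac)
  finally show ?thesis using i by (simp add: unitary_left[OF W(1)])
 qed
 define B where "B = Matrix.mat n n (%(i, j). H $$ (Suc i, Suc j))"
 have "herm n B" by (rule hermI) (auto simp: B_def intro: herm_index[OF H])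
 then obtain U d where U: "unitary_mat n U" "B = conj_by U (rdiag n d)" using Suc.IH by blast
 note Uc = unitary_carrier[OF U(1)]
 \<comment> \<open>The eigenvalue is a diagonal entry of the Hermitian matrix \<open>H\<close>,
   hence real.\<close>
 have "cnj e = e" using H0[of 0] herm_index[OF H, of 0 0] by simp
 then obtain r where r: "e = of_real r" by (metis complex_is_Real_iff Reals_cases Reals_cnj_iff)
 define d' where "d' = case_nat r d"
 have BU: "(\<Sum>l<n. B $$ (i, l) * U $$ (l, j)) = of_real (d j) * U $$ (i, j)" if "i < n" "j < n" for i j
 proof -
  have "B * U = U * rdiag n d * (mat_adjoint U * U)"
   unfolding U(2) conj_by_def
   by (rule assoc_mult_mat[OF mult_carrier_mat[OF Uc rdiag_carrier(1)] mat_adjoint_carrier[OF Uc] Uc])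
  hence "B * U = U * rdiag n d"
   using unitary_left[OF U(1)] right_mult_one_mat[OF mult_carrier_mat[OF Uc rdiag_carrier(1)]] by simp
  moreover have "(U * rdiag n d) $$ (i, j) = (\<Sum>l<n. if l = j then U $$ (i, l) * of_real (d j) else 0)"
   unfolding mult_index[OF Uc rdiag_carrier(1) that]
   by (intro sum.cong) (auto simp: rdiag_index that)
  moreover have "(B * U) $$ (i, j) = (\<Sum>l<n. B $$ (i, l) * U $$ (l, j))"
   by (rule mult_index[OF _ Uc that]) (simp add: B_def)
  ultimately show ?thesis using that by (simp add: mult.commute)
 qed
 define X where "X = border1 n 1 U"
 have X: "unitary_mat (Suc n) X"
 proof (rule unitary_matI)
  fix i j assume ij: "i < Suc n" "j < Suc n"
  have "(\<Sum>l<n. cnj (U $$ (l, a)) * U $$ (l, b)) = (if a = b then 1 else 0)" if "a < n" "b < n" for a b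
  proof -
   have "(\<Sum>l<n. cnj (U $$ (l, a)) * U $$ (l, b)) = (mat_adjoint U * U) $$ (a, b)"
    unfolding mult_index[OF mat_adjoint_carrier[OF Uc] Uc that]
    using Uc that by (intro sum.cong) auto
   thus ?thesis using that by (simp add: unitary_left[OF U(1)])
  qed
  thus "(\<Sum>l<Suc n. cnj (X $$ (l, i)) * X $$ (l, j)) = (if i = j then 1 else 0)"
   using ij unfolding sum.lessThan_Suc_shift X_def
   by (cases i; cases j) auto
 qed (simp add: X_def)
 have "H = conj_by X (rdiag (Suc n) d')"
 proof (rule eq_conj_rdiagI[OF X hermD(1)[OF H]])
  fix i j assume ij: "i < Suc n" "j < Suc n"
  have H0': "H $$ (0, Suc i) = 0" if "i < n" for i
   using herm_index[OF H, of 0 "Suc i"] H0[of "Suc i"] that by simp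
  have HB: "H $$ (Suc i, Suc j) = B $$ (i, j)" if "i < n" "j < n" for i j using that by (simp add: B_def)
  show "(\<Sum>l<Suc n. H $$ (i, l) * X $$ (l, j)) = of_real (d' j) * X $$ (i, j)"
   using ij BU unfolding sum.lessThan_Suc_shift X_def
   by (cases i; cases j) (auto simp: H0 H0' HB d'_def r)
 qed
 hence "A = conj_by (W * X) (rdiag (Suc n) d')"
  using conj_by_adjoint(2)[OF W(1) Ac] conj_by_mult[OF W(1) X rdiag_carrier(1)] by (simp add: H_def)
 thus ?case using unitary_mult[OF W(1) X] by blast
qed

section \<open>Functional calculus and its trace\<close>

text \<open>What has to be shown is that the definite description denotes. Two diagonalisations
  differ by a unitary \<open>X\<close> with \<open>rdiag n e * X = X * rdiag n d\<close>, so an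
  entry of \<open>X\<close> is nonzero only where \<open>e i = d j\<close>. There
  \<open>f (e i) = f (d j)\<close>, so \<open>X\<close> intertwines the images under
  \<open>f\<close> too.\<close>

lemma functional_calculus_conj:
 assumes U: "unitary_mat n U"
 shows "functional_calculus f (conj_by U (rdiag n d)) = conj_by U (rdiag n (%i. f (d i)))"
proof -
 let ?H = "conj_by U (rdiag n d)"
 have dim: "dim_row ?H = n" using carrier_matD(1)[OF conj_by_carrier[OF U rdiag_carrier(1)]] .
 have uniq: "conj_by W (rdiag n (%i. f (e i))) = conj_by U (rdiag n (%i. f (d i)))"
  if W: "unitary_mat n W" and eq: "?H = conj_by W (rdiag n e)" for W e
 proof -
  define X where "X = mat_adjoint W * U"
  have X: "unitary_mat n X" unfolding X_def by (intro unitary_mult unitary_adjoint W U)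
  note Xc = unitary_carrier[OF X]
  have e: "rdiag n e = conj_by X (rdiag n d)"
   unfolding X_def conj_by_mult[OF unitary_adjoint[OF W] U rdiag_carrier(1), symmetric] eq
    conj_by_adjoint(1)[OF W rdiag_carrier(1)] ..
  have eX: "rdiag n e * X = X * rdiag n d"
  proof -
   have "rdiag n e * X = X * rdiag n d * (mat_adjoint X * X)"
    unfolding e conj_by_def
    by (rule assoc_mult_mat[OF mult_carrier_mat[OF Xc rdiag_carrier(1)] mat_adjoint_carrier[OF Xc] Xc])
   thus ?thesis
    using unitary_left[OF X] right_mult_one_mat[OF mult_carrier_mat[OF Xc rdiag_carrier(1)]] by simp
  qed
  have 1: "(rdiag n g * X) $$ (i, j) = of_real (g i) * X $$ (i, j)" if "i < n" "j < n" for g i j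
  proof -
   have "(rdiag n g * X) $$ (i, j) = (\<Sum>l<n. if l = i then of_real (g i) * X $$ (i, j) else 0)"
    unfolding mult_index[OF rdiag_carrier(1) Xc that]
    by (intro sum.cong) (auto simp: rdiag_index that)
   thus ?thesis using that by simp
  qed
  have 2: "(X * rdiag n g) $$ (i, j) = X $$ (i, j) * of_real (g j)" if "i < n" "j < n" for g i j
  proof -
   have "(X * rdiag n g) $$ (i, j) = (\<Sum>l<n. if l = j then X $$ (i, j) * of_real (g j) else 0)"
    unfolding mult_index[OF Xc rdiag_carrier(1) that]
    by (intro sum.cong) (auto simp: rdiag_index that)
   thus ?thesis using that by simp
  qed
  have "rdiag n (%i. f (e i)) * X = X * rdiag n (%i. f (d i))"
  proof (rule eq_matI)
   fix i j assume "i < dim_row (X * rdiag n (%i. f (d i)))" "j < dim_col (X * rdiag n (%i. f (d i)))"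
   hence ij: "i < n" "j < n" using carrier_matD[OF Xc] by auto
   have "of_real (e i) * X $$ (i, j) = X $$ (i, j) * of_real (d j)"
    unfolding 1[OF ij, symmetric] 2[OF ij, symmetric] eX ..
   hence "of_real (e i) = (of_real (d j) :: complex) | X $$ (i, j) = 0" by (metis mult.commute mult_cancel_right)
   hence "e i = d j | X $$ (i, j) = 0" by simp
   thus "(rdiag n (%i. f (e i)) * X) $$ (i, j) = (X * rdiag n (%i. f (d i))) $$ (i, j)"
    by (auto simp: 1[OF ij] 2[OF ij] mult.commute)
  qed (use carrier_matD[OF Xc] in auto)
  hence "conj_by X (rdiag n (%i. f (d i))) = rdiag n (%i. f (e i)) * (X * mat_adjoint X)"
   unfolding conj_by_def using assoc_mult_mat[OF rdiag_carrier(1) Xc mat_adjoint_carrier[OF Xc], of "%i. f (e i)"] by simp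
  hence "conj_by X (rdiag n (%i. f (d i))) = rdiag n (%i. f (e i))"
   unfolding unitary_right[OF X] by (metis right_mult_one_mat rdiag_carrier(1))
  hence "conj_by W (rdiag n (%i. f (e i))) = conj_by W (conj_by (mat_adjoint W) (conj_by U (rdiag n (%i. f (d i)))))"
   unfolding X_def conj_by_mult[OF unitary_adjoint[OF W] U rdiag_carrier(1)] by simp
  thus ?thesis
   unfolding conj_by_adjoint(2)[OF W conj_by_carrier[OF U rdiag_carrier(1)]] .
 qed
 show ?thesis
  unfolding functional_calculus_def dim
 proof (rule the_equality)
  show "\<exists>V e. unitary_mat n V & ?H = V * mat_diag n (%i. complex_of_real (e i)) * mat_adjoint V \<and>
   conj_by U (rdiag n (%i. f (d i))) = V * mat_diag n (%i. complex_of_real (f (e i))) * mat_adjoint V"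
   using U unfolding conj_by_def rdiag_def by blast
 next
  fix B
  assume "\<exists>V e. unitary_mat n V & ?H = V * mat_diag n (%i. complex_of_real (e i)) * mat_adjoint V \<and>
   B = V * mat_diag n (%i. complex_of_real (f (e i))) * mat_adjoint V"
  then obtain V e where "unitary_mat n V" "?H = conj_by V (rdiag n e)" "B = conj_by V (rdiag n (%i. f (e i)))"
   unfolding conj_by_def rdiag_def by blast
  thus "B = conj_by U (rdiag n (%i. f (d i)))" using uniq by simp
 qed
qed

definition tr_fun :: "(real => real) => complex mat => real" where
 "tr_fun f H = Re (mat_trace (functional_calculus f H))"

lemma tr_fun_conj_rdiag: "unitary_mat n U ==> tr_fun f (conj_by U (rdiag n d)) = (\<Sum>i<n. f (d i))"
 by (simp only: tr_fun_def functional_calculus_conj mat_trace_conj_rdiag Re_complex_of_real)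

lemma tr_fun_rdiag: "tr_fun f (rdiag n d) = (\<Sum>i<n. f (d i))"
 using tr_fun_conj_rdiag[OF unitary_one, of f n d] by simp

lemma tr_fun_conj_by:
 assumes "unitary_mat n U" "herm n H"
 shows "tr_fun f (conj_by U H) = tr_fun f H"
proof -
 obtain W d where W: "unitary_mat n W" "H = conj_by W (rdiag n d)" using spectral[OF assms(2)] by blast
 hence "conj_by U H = conj_by (U * W) (rdiag n d)" using conj_by_mult[OF assms(1) W(1) rdiag_carrier(1)] by simp
 thus ?thesis using W tr_fun_conj_rdiag[OF unitary_mult[OF assms(1) W(1)]] tr_fun_conj_rdiag[OF W(1)] by simp
qed

section \<open>Lebesgue measure on Hermitian matrices and its unitary invariance\<close>

text \<open>
 The uniqueness argument for Haar measure: a homomorphism \<open>T\<close> of the underlying group which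
 leaves invariant a function \<open>h\<close> with \<open>0 < \<integral>h < \<infinity>\<close> preserves the measure.
\<close>

lemma nn_integral_hom_invariant:
 fixes M :: "'a measure" and add sub :: "'a => 'a => 'a"
 assumes sf: "sigma_finite_measure M"
  and T[measurable]: "T : M ->M M"
  and add[measurable]: "(%(x, y). add x y) : M XM M ->M M"
  and sub[measurable]: "(%(x, y). sub x y) : M XM M ->M M"
  and tr: "!!f d. f bm M ==> d : space M ==> (NI M (%x. f (add x d))) = NI M f"
  and rf: "!!f d. f bm M ==> d : space M ==> (NI M (%x. f (sub d x))) = NI M f"
  and surj: "!!x. x : space M ==> \<exists>d\<in>space M. T d = x"
  and hom: "!!x y. x : space M ==> y : space M ==> T (add x y) = add (T x) (T y)"
   "!!x y. x : space M ==> y : space M ==> T (sub x y) = sub (T x) (T y)"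
  and grp: "!!x y. x : space M ==> y : space M ==> sub (add x y) y = x"
   "!!x y. x : space M ==> y : space M ==> add x y = add y x"
  and h[measurable]: "h bm M" and hT: "!!x. x : space M ==> h (T x) = h x"
  and h0: "NI M h ~= 0" and h1: "NI M h ~= \<infinity>"
  and g[measurable]: "g bm M"
 shows "NI M (%x. g (T x)) = NI M g"
proof -
 interpret sigma_finite_measure M by fact
 interpret pair_sigma_finite M M by standard
 note [measurable] = measurable_Pair[THEN mcomp[OF _ add, unfolded case_prod_conv]]
  measurable_Pair[THEN mcomp[OF _ sub, unfolded case_prod_conv]]
 have Tsp: "T x : space M" if "x : space M" for x using measurable_space[OF T that] .
 have subsp: "sub x y : space M" if "x : space M" "y : space M" for x y
  using measurable_space[OF sub, of "(x, y)"] that by (simp add: space_pair_measure)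
 have shiftT: "NI M (%y. g (add x (T y))) = NI M (%y. g (T y))" if x: "x : space M" for x
 proof -
  obtain d where d: "d : space M" "T d = x" using surj[OF x] by blast
  have "NI M (%y. g (add x (T y))) = NI M (%y. g (T (add y d)))"
   using d grp(2)[OF x Tsp] by (intro nn_integral_cong) (simp add: hom)
  also have "... = NI M (%y. g (T y))"
   using tr[of "%y. g (T y)" d] d(1) by simp
  finally show ?thesis .
 qed
 have reflT: "NI M (%y. h (sub x (T y))) = NI M h" if x: "x : space M" for x
 proof -
  obtain d where d: "d : space M" "T d = x" using surj[OF x] by blast
  have "NI M (%y. h (sub x (T y))) = NI M (%y. h (T (sub d y)))"
   using d by (intro nn_integral_cong) (simp add: hom)
  also have "... = NI M (%y. h (sub d y))"
   using d(1) by (intro nn_integral_cong) (simp add: hT subsp)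
  also have "... = NI M h" using rf[OF h d(1)] .
  finally show ?thesis .
 qed
 \<comment> \<open>The double integral of \<open>h x * g (add x (T y))\<close> is evaluated in both
   orders. Integrating over \<open>x\<close> last gives the left side by \<open>shiftT\<close>;
   translating \<open>x\<close> by \<open>T y\<close> first and then integrating over
   \<open>y\<close> leaves the right side by \<open>reflT\<close>.\<close>
 have "NI M h * NI M (%y. g (T y)) = NI M (%x. NI M (%y. h x * g (add x (T y))))"
  by (subst nn_integral_multc[symmetric], measurable)
    (auto intro!: nn_integral_cong simp: nn_integral_cmult shiftT)
 also have "... = NI M (%y. NI M (%x. h x * g (add x (T y))))"
  by (rule Fubini'[symmetric]) measurable
 also have "... = NI M (%y. NI M (%x. h (sub x (T y)) * g x))"
 proof (rule nn_integral_cong)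
  fix y assume y: "y : space M"
  have "NI M (%x. h x * g (add x (T y))) = NI M (%x. h (sub (add x (T y)) (T y)) * g (add x (T y)))"
   using y by (intro nn_integral_cong) (simp add: grp Tsp)
  also have "... = NI M (%x. h (sub x (T y)) * g x)"
   using y Tsp by (intro tr[of "%x. h (sub x (T y)) * g x"]) measurable
  finally show "NI M (%x. h x * g (add x (T y))) = NI M (%x. h (sub x (T y)) * g x)" .
 qed
 also have "... = NI M (%x. NI M (%y. h (sub x (T y)) * g x))"
  by (rule Fubini') measurable
 also have "... = NI M h * NI M g"
  by (subst nn_integral_cmult[symmetric], measurable)
    (auto intro!: nn_integral_cong simp: nn_integral_multc reflT)
 finally show ?thesis using h0 h1 by (simp add: ennreal_mult_cancel_left)
qed

text \<open>Carries the translation and reflection invariance of one-dimensional Lebesgue measure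
  over to finite products, one coordinate at a time.\<close>

lemma nn_integral_PiM_component_map:
 assumes M: "product_sigma_finite M" and N: "product_sigma_finite N" and I: "finite I"
  and T[measurable]: "!!i. i : I ==> T i : M i ->M N i"
  and D: "!!i g. i : I ==> g bm N i ==> (NI (M i) (%x. g (T i x))) = NI (N i) g"
  and f: "f bm PiM I N"
 shows "NI (PiM I M) (%x. f (\<lambda>i\<in>I. T i (x i))) = NI (PiM I N) f"
 using I T D f
proof (induction I arbitrary: f rule: finite_induct)
 case empty
 show ?case by (simp add: PiM_empty nn_integral_count_space_finite restrict_def)
next
 case (insert i I)
 interpret M: product_sigma_finite M by fact
 interpret N: product_sigma_finite N by fact
 note T[measurable] = insert.prems(1)
 note f[measurable] = insert.prems(3)
 interpret Ni: sigma_finite_measure "N i" by (rule N.sigma_finite_measures)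
 have "(%x. \<lambda>j\<in>insert i I. T j (x j)) : PiM (insert i I) M ->M PiM (insert i I) N"
 proof (rule measurable_restrict)
  fix j assume j: "j : insert i I"
  show "(%x. T j (x j)) : PiM (insert i I) M ->M N j"
   by (rule mcomp[where N = "M j"]) (use j T in auto)
 qed
 hence m: "(%x. f (\<lambda>j\<in>insert i I. T j (x j))) bm PiM (insert i I) M"
  by (rule mcomp) (rule f)
 have sp: "(\<lambda>j\<in>I. T j (x j)) : space (PiM I N)" if "x : space (PiM I M)" for x
  using that T measurable_space[OF T] by (auto simp: space_PiM PiE_iff)
 have "NI (PiM (insert i I) M) (%x. f (\<lambda>j\<in>insert i I. T j (x j))) =
    NI (PiM I M) (%x. NI (M i) (%y. f ((\<lambda>j\<in>I. T j (x j))(i := T i y))))"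
  unfolding M.product_nn_integral_insert[OF insert.hyps m]
  using insert.hyps(2)
  by (intro nn_integral_cong arg_cong[where f=f]) (auto simp: fun_eq_iff)
 also have "... = NI (PiM I M) (%x. NI (N i) (%y. f ((\<lambda>j\<in>I. T j (x j))(i := y))))"
 proof (intro nn_integral_cong)
  fix x assume x: "x : space (PiM I M)"
  have "(%y. f ((\<lambda>j\<in>I. T j (x j))(i := y))) bm N i"
   using measurable_comp[OF measurable_component_update[OF sp[OF x] insert.hyps(2)] f] unfolding comp_def .
  thus "NI (M i) (%y. f ((\<lambda>j\<in>I. T j (x j))(i := T i y))) = NI (N i) (%y. f ((\<lambda>j\<in>I. T j (x j))(i := y)))"
   using insert.prems(2)[of i] by simp
 qed
 also have "... = NI (PiM I N) (%x. NI (N i) (%y. f (x(i := y))))"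
  by (rule insert.IH[of "%x. NI (N i) (%y. f (x(i := y)))"])
    (auto intro: T insert.prems(2) intro!: sigma_finite_measure.borel_measurable_nn_integral[OF N.sigma_finite_measures])
 also have "... = NI (PiM (insert i I) N) f"
  by (rule N.product_nn_integral_insert[OF insert.hyps f, symmetric])
 finally show ?case .
qed

section \<open>Real coordinates on Hermitian matrices\<close>

abbreviation LR :: "nat => (nat => real) measure" where
 "LR n == PiM {..<n} (%_. lborel)"

abbreviation LC :: "nat => (nat => complex) measure" where
 "LC n == PiM {..<n} (%_. lborel)"

abbreviation (input) "IX n == {..<n} \<times> {..<n::nat}"

abbreviation LX :: "nat => (nat \<times> nat => real) measure" where
 "LX n == PiM (IX n) (%_. lborel)"

abbreviation HL :: "nat => complex mat measure" where
 "HL n == hermitian_lebesgue n"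

lemma product_sigma_finite_lborel: "product_sigma_finite (%_. lborel :: 'a::euclidean_space measure)"
 by standard

text \<open>Inverse of \<open>hermitian_of n\<close>. The restriction makes it
  \<open>undefined\<close> off the index square, as the points of the space of \<open>LX n\<close>
  are.\<close>

definition hcoords :: "nat => complex mat => nat \<times> nat => real" where
 "hcoords n H = (\<lambda>(i, j)\<in>IX n. if i <= j then Re (H $$ (i, j)) else Im (H $$ (j, i)))"

lemma hermitian_of_carrier [simp]: "hermitian_of n x : carrier_mat n n"
 by (simp add: hermitian_of_def)

lemma hermitian_of_dim [simp]: "dim_row (hermitian_of n x) = n" "dim_col (hermitian_of n x) = n"
 by (simp_all add: hermitian_of_def)

lemma hermitian_of_index:
 "i < n ==> j < n ==> hermitian_of n x $$ (i, j) = (if i = j then complex_of_real (x (i, i))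
   else if i < j then Complex (x (i, j)) (x (j, i)) else Complex (x (j, i)) (- x (i, j)))"
 by (simp add: hermitian_of_def)

lemma herm_hermitian_of [simp]: "herm n (hermitian_of n x)"
 by (rule hermI) (auto simp: hermitian_of_index complex_eq_iff)

lemma hermitian_of_hcoords: "herm n H ==> hermitian_of n (hcoords n H) = H"
proof (rule eq_matI)
 fix i j assume H: "herm n H" and "i < dim_row H" "j < dim_col H"
 hence ij: "i < n" "j < n" using carrier_matD[OF hermD(1)[OF H]] by auto
 show "hermitian_of n (hcoords n H) $$ (i, j) = H $$ (i, j)"
  using herm_index[OF H ij] herm_index[OF H ij(2,1)] ij
  by (auto simp: hermitian_of_index hcoords_def complex_eq_iff)
qed (auto simp: hermitian_of_def dest: hermD(1))

lemma hcoords_hermitian_of: "x : space (LX n) ==> hcoords n (hermitian_of n x) = x"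
proof (rule ext)
 fix p :: "nat \<times> nat" assume x: "x : space (LX n)"
 obtain i j where p: "p = (i, j)" by (cases p)
 show "hcoords n (hermitian_of n x) p = x p"
 proof (cases "i < n & j < n")
  case True
  thus ?thesis by (auto simp: p hcoords_def hermitian_of_index)
 next
  case False
  hence "x p = undefined" using x by (auto simp: space_PiM PiE_def extensional_def p)
  thus ?thesis using False by (auto simp: hcoords_def p)
 qed
qed

lemma hcoords_space: "hcoords n H : space (LX n)"
 by (simp add: hcoords_def space_PiM)

lemma inj_on_hermitian_of: "inj_on (hermitian_of n) (space (LX n))"
 by (rule inj_on_inverseI[of _ "hcoords n"]) (rule hcoords_hermitian_of)

lemma space_HL: "space (HL n) = {H. herm n H}"
 unfolding hermitian_lebesgue_def space_embed_measure
proof (intro equalityI subsetI)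
 fix H assume "H : {H. herm n H}"
 hence "H = hermitian_of n (hcoords n H)" by (simp add: hermitian_of_hcoords)
 thus "H : hermitian_of n ` space (LX n)" using hcoords_space by blast
qed auto

lemma space_HL_D: "H : space (HL n) ==> herm n H"
 by (simp add: space_HL)

lemma measurable_hermitian_of [measurable]: "hermitian_of n : LX n ->M HL n"
 unfolding hermitian_lebesgue_def by (rule measurable_embed_measure2'[OF inj_on_hermitian_of])

lemma nn_integral_HL:
 "f bm HL n ==> (NI (HL n) f) = NI (LX n) (%x. f (hermitian_of n x))"
 unfolding hermitian_lebesgue_def by (rule nn_integral_embed_measure'[OF inj_on_hermitian_of])

lemma measurable_HL_dest:
 "(%x. f (hermitian_of n x)) : LX n ->M N ==> f : HL n ->M N"
 unfolding hermitian_lebesgue_def by (rule measurable_embed_measure1)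

lemma measurable_HL_entry [measurable (raw)]:
 assumes "i < n" "j < n" "f : N ->M HL n"
 shows "(%x. f x $$ (i, j)) bm N"
proof (rule mcomp[OF assms(3)], rule measurable_HL_dest)
 have c: "(%x. x (a, b)) bm LX n" if "a < n" "b < n" for a b
  using that by (auto intro!: measurable_component_singleton)
 show "(%x. hermitian_of n x $$ (i, j)) bm LX n"
  using assms(1,2) c unfolding hermitian_of_index[OF assms(1,2)]
  by (cases "i = j"; cases "i < j") (auto intro!: borel_measurable_complex_iff[THEN iffD2] mi)
qed

lemma measurable_HL_I:
 assumes "!!x. x : space N ==> herm n (f x)"
  and m: "!!i j. i < n ==> j < n ==> (%x. f x $$ (i, j)) bm N"
 shows "f : N ->M HL n"
proof -
 have "(%x. hcoords n (f x)) : N ->M LX n"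
  unfolding hcoords_def
 proof (rule measurable_restrict)
  fix p assume p: "p : IX n"
  obtain a b where ab: "p = (a, b)" "a < n" "b < n" using p by auto
  have "(%x. Re (f x $$ (a, b))) bm N" "(%x. Im (f x $$ (b, a))) bm N"
   by (rule borel_measurable_complex_iff[THEN iffD1, OF m[OF ab(2,3)], THEN conjunct1],
     rule borel_measurable_complex_iff[THEN iffD1, OF m[OF ab(3,2)], THEN conjunct2])
  thus "(%x. case p of (i, j) => if i <= j then Re (f x $$ (i, j)) else Im (f x $$ (j, i))) : N ->M lborel"
   using ab by (cases "a <= b") auto
 qed
 hence "(%x. hermitian_of n (hcoords n (f x))) : N ->M HL n"
  by (rule mcomp) measurable
 thus ?thesis
  by (rule measurable_cong[THEN iffD1, rotated]) (simp add: hermitian_of_hcoords assms(1))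
qed

lemma sigma_finite_HL: "sigma_finite_measure (HL n)"
proof -
 interpret finite_product_sigma_finite "%_. lborel :: real measure" "IX n"
  unfolding finite_product_sigma_finite_def finite_product_sigma_finite_axioms_def
  using product_sigma_finite_lborel by simp
 from sigma_finite_countable obtain A where
  A: "countable A" "A \<subseteq> sets (LX n)" "\<Union>A = space (LX n)" "\<forall>a\<in>A. emeasure (LX n) a ~= \<infinity>"
  by (elim exE conjE)
 show ?thesis
 proof (standard, intro exI[of _ "(`) (hermitian_of n) ` A"] conjI ballI)
  show "countable ((`) (hermitian_of n) ` A)" using A by simp
  show "(`) (hermitian_of n) ` A \<subseteq> sets (HL n)"
   unfolding hermitian_lebesgue_def using A by (auto intro: in_sets_embed_measure)
  show "\<Union> ((`) (hermitian_of n) ` A) = space (HL n)"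
   unfolding hermitian_lebesgue_def space_embed_measure using A(3) by blast
  fix a assume "a : (`) (hermitian_of n) ` A"
  then obtain b where b: "b : A" "a = hermitian_of n ` b" by auto
  show "emeasure (HL n) a ~= \<infinity>"
   unfolding hermitian_lebesgue_def b(2)
   using bspec[OF A(4) b(1)] emeasure_embed_measure_image'[OF inj_on_hermitian_of, of b n] A(2) b(1) by (simp add: subset_iff)
 qed
qed

section \<open>Invariance under translation, reflection and unitary conjugation\<close>

lemma herm_add: "herm n A ==> herm n B ==> herm n (A + B)"
proof -
 assume A: "herm n A" and B: "herm n B"
 note c = hermD(1)[OF A] hermD(1)[OF B]
 show ?thesis
 proof (rule hermI)
  show "A + B : carrier_mat n n" using c by simp
  fix i j assume ij: "i < n" "j < n"
  thus "(A + B) $$ (i, j) = cnj ((A + B) $$ (j, i))"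
   using c herm_index[OF A ij] herm_index[OF B ij] by simp
 qed
qed

lemma herm_minus: "herm n A ==> herm n B ==> herm n (A - B)"
proof -
 assume A: "herm n A" and B: "herm n B"
 note c = hermD(1)[OF A] hermD(1)[OF B]
 show ?thesis
 proof (rule hermI)
  show "A - B : carrier_mat n n" using c by (simp add: minus_carrier_mat)
  fix i j assume ij: "i < n" "j < n"
  thus "(A - B) $$ (i, j) = cnj ((A - B) $$ (j, i))"
   using c herm_index[OF A ij] herm_index[OF B ij] by simp
 qed
qed

lemma nn_integral_lborel_translate:
 fixes c :: "'a::euclidean_space"
 assumes "g bm borel"
 shows "NI lborel (%x. g (x + c)) = NI lborel g"
proof -
 have "NI lborel g = NI (distr lborel borel ((+) c)) g"
  by (simp add: lborel_distr_plus)
 also have "... = NI lborel (%x. g (c + x))"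
  using assms by (intro nn_integral_distr) auto
 finally show ?thesis by (simp add: add.commute)
qed

lemma nn_integral_lborel_reflect:
 fixes c :: "'a::euclidean_space"
 assumes "g bm borel"
 shows "NI lborel (%x. g (c - x)) = NI lborel g"
proof -
 have "(lborel :: 'a measure) = distr lborel borel (%x. c + (-1) *\<^sub>R x)"
  using lborel_affine[of "-1" c] by (simp add: density_1)
 hence "NI lborel g = NI (distr lborel borel (%x. c + (-1) *\<^sub>R x)) g"
  by simp
 also have "... = NI lborel (%x. g (c + (-1) *\<^sub>R x))"
  using assms by (intro nn_integral_distr) auto
 finally show ?thesis by simp
qed

lemma nn_integral_HL_translate:
 assumes f[measurable]: "f bm HL n" and D: "herm n D"
 shows "NI (HL n) (%H. f (H + D)) = NI (HL n) f"
proof -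
 have Dm: "(%H. H + D) : HL n ->M HL n"
 proof (rule measurable_HL_I)
  fix i j assume ij: "i < n" "j < n"
  have "(%H. H $$ (i, j) + D $$ (i, j)) bm HL n" using ij by measurable
  thus "(%H. (H + D) $$ (i, j)) bm HL n"
   by (rule measurable_cong[THEN iffD1, rotated]) (use ij hermD(1)[OF D] in auto)
 qed (use D herm_add space_HL_D in auto)
 have *: "hermitian_of n x + D = hermitian_of n (\<lambda>p\<in>IX n. x p + hcoords n D p)" for x
 proof (rule eq_matI)
  fix i j assume "i < dim_row (hermitian_of n (\<lambda>p\<in>IX n. x p + hcoords n D p))"
   "j < dim_col (hermitian_of n (\<lambda>p\<in>IX n. x p + hcoords n D p))"
  hence ij: "i < n" "j < n" by (auto simp: hermitian_of_def)
  show "(hermitian_of n x + D) $$ (i, j) = hermitian_of n (\<lambda>p\<in>IX n. x p + hcoords n D p) $$ (i, j)"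
   using ij hermD(1)[OF D] herm_index[OF D ij] herm_index[OF D ij(2,1)]
   by (auto simp: hermitian_of_index hcoords_def complex_eq_iff)
 qed (use hermD(1)[OF D] in \<open>auto simp: hermitian_of_def\<close>)
 have "NI (HL n) (%H. f (H + D)) = NI (LX n) (%x. f (hermitian_of n (\<lambda>p\<in>IX n. x p + hcoords n D p)))"
  unfolding nn_integral_HL[OF mcomp[OF Dm f]] * ..
 also have "... = NI (LX n) (%x. f (hermitian_of n x))"
  by (rule nn_integral_PiM_component_map[OF product_sigma_finite_lborel product_sigma_finite_lborel,
     where T = "%p x. x + hcoords n D p" and f = "%x. f (hermitian_of n x)"])
    (simp_all add: nn_integral_lborel_translate)
 finally show ?thesis by (simp add: nn_integral_HL)
qed

lemma nn_integral_HL_reflect: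
 assumes f[measurable]: "f bm HL n" and D: "herm n D"
 shows "NI (HL n) (%H. f (D - H)) = NI (HL n) f"
proof -
 have Dm: "(%H. D - H) : HL n ->M HL n"
 proof (rule measurable_HL_I)
  fix i j assume ij: "i < n" "j < n"
  have "(%H. D $$ (i, j) - H $$ (i, j)) bm HL n" using ij by measurable
  thus "(%H. (D - H) $$ (i, j)) bm HL n"
   by (rule measurable_cong[THEN iffD1, rotated]) (use ij hermD(1) space_HL_D in fastforce)
 qed (use D herm_minus space_HL_D in auto)
 have *: "D - hermitian_of n x = hermitian_of n (\<lambda>p\<in>IX n. hcoords n D p - x p)" for x
 proof (rule eq_matI)
  fix i j assume "i < dim_row (hermitian_of n (\<lambda>p\<in>IX n. hcoords n D p - x p))"
   "j < dim_col (hermitian_of n (\<lambda>p\<in>IX n. hcoords n D p - x p))"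
  hence ij: "i < n" "j < n" by (auto simp: hermitian_of_def)
  show "(D - hermitian_of n x) $$ (i, j) = hermitian_of n (\<lambda>p\<in>IX n. hcoords n D p - x p) $$ (i, j)"
   using ij hermD(1)[OF D] herm_index[OF D ij] herm_index[OF D ij(2,1)]
   by (auto simp: hermitian_of_index hcoords_def complex_eq_iff)
 qed (use hermD(1)[OF D] in \<open>auto simp: hermitian_of_def\<close>)
 have "NI (HL n) (%H. f (D - H)) = NI (LX n) (%x. f (hermitian_of n (\<lambda>p\<in>IX n. hcoords n D p - x p)))"
  unfolding nn_integral_HL[OF mcomp[OF Dm f]] * ..
 also have "... = NI (LX n) (%x. f (hermitian_of n x))"
  by (rule nn_integral_PiM_component_map[OF product_sigma_finite_lborel product_sigma_finite_lborel,
     where T = "%p x. hcoords n D p - x" and f = "%x. f (hermitian_of n x)"])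
    (simp_all add: nn_integral_lborel_reflect)
 finally show ?thesis by (simp add: nn_integral_HL)
qed

lemma tr_pow_2:
 assumes H: "herm n H"
 shows "tr_pow H 2 = (\<Sum>i<n. \<Sum>j<n. (cmod (H $$ (i, j)))^2)"
proof -
 note c = hermD(1)[OF H]
 have "H ^\<^sub>m 2 = H * H" using c by (simp add: numeral_2_eq_2)
 moreover have "(H * H) $$ (i, i) = of_real (\<Sum>j<n. (cmod (H $$ (i, j)))^2)" if i: "i < n" for i
 proof -
  have "(H * H) $$ (i, i) = (\<Sum>j<n. H $$ (i, j) * H $$ (j, i))" by (rule mult_index[OF c c i i])
  also have "... = (\<Sum>j<n. of_real ((cmod (H $$ (i, j)))^2))"
  proof (intro sum.cong refl)
   fix j assume "j : {..<n}"
   hence "H $$ (j, i) = cnj (H $$ (i, j))" using herm_index[OF H _ i, of j] by simp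
   thus "H $$ (i, j) * H $$ (j, i) = of_real ((cmod (H $$ (i, j)))^2)"
    using complex_norm_square[of "H $$ (i, j)"] by simp
  qed
  finally show ?thesis by simp
 qed
 ultimately show ?thesis using c by (simp add: tr_pow_def mat_trace_def del: of_real_sum)
qed

lemma measurable_mult_mat:
 assumes "!!x. x : space N ==> f x : carrier_mat n m" "!!x. x : space N ==> g x : carrier_mat m k"
  and "!!i j. i < n ==> j < m ==> (%x. f x $$ (i, j) :: complex) bm N"
  and "!!i j. i < m ==> j < k ==> (%x. g x $$ (i, j)) bm N"
  and ij: "i < n" "j < k"
 shows "(%x. (f x * g x) $$ (i, j)) bm N"
proof -
 have "(%x. \<Sum>l<m. f x $$ (i, l) * g x $$ (l, j)) bm N"
  using assms by (intro mi) auto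
 thus ?thesis
  by (rule measurable_cong[THEN iffD1, rotated]) (rule mult_index[OF assms(1,2) ij, symmetric])
qed

lemma measurable_pow_mat:
 assumes f: "f : N ->M HL n" and ij: "i < n" "j < n"
 shows "(%x. (f x ^\<^sub>m m) $$ (i, j)) bm N"
 using ij
proof (induction m arbitrary: i j)
 case 0
 have "(%x. (1\<^sub>m n :: complex mat) $$ (i, j)) bm N" by simp
 thus ?case
  by (rule measurable_cong[THEN iffD1, rotated])
    (use measurable_space[OF f] hermD(1) space_HL_D in fastforce)
next
 case (Suc m)
 have "f x : carrier_mat n n" if "x : space N" for x using hermD(1)[OF space_HL_D[OF measurable_space[OF f that]]] .
 thus ?case using Suc.prems unfolding pow_mat.simps
  by (intro measurable_mult_mat[where n = n and m = n and k = n] measurable_HL_entry[OF _ _ f] Suc.IH) auto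
qed

lemma measurable_tr_pow [measurable (raw)]:
 assumes f: "f : N ->M HL n"
 shows "(%x. tr_pow (f x) m) bm N"
proof -
 have "(%x. Re (\<Sum>i<n. (f x ^\<^sub>m m) $$ (i, i))) bm N"
  unfolding Re_sum
  by (intro mi) (auto intro!: measurable_pow_mat[OF f, THEN borel_measurable_complex_iff[THEN iffD1, THEN conjunct1]])
 thus ?thesis unfolding tr_pow_def mat_trace_def
 proof (rule measurable_cong[THEN iffD1, rotated])
  fix x assume "x : space N"
  hence "dim_row (f x ^\<^sub>m m) = n"
   using hermD(1)[OF space_HL_D[OF measurable_space[OF f]]] pow_carrier_mat[of "f x" n m] by auto
  thus "Re (\<Sum>i<n. (f x ^\<^sub>m m) $$ (i, i)) = Re (\<Sum>i<dim_row (f x ^\<^sub>m m). (f x ^\<^sub>m m) $$ (i, i))" by simp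
 qed
qed

lemma measurable_conj_by:
 assumes U: "unitary_mat n U"
 shows "conj_by U : HL n ->M HL n"
proof (rule measurable_HL_I)
 fix H assume "H : space (HL n)"
 thus "herm n (conj_by U H)" using herm_conj_by[OF U] space_HL_D by blast
next
 fix i j assume ij: "i < n" "j < n"
 note Uc = unitary_carrier[OF U]
 have c: "H : carrier_mat n n" if "H : space (HL n)" for H using hermD(1)[OF space_HL_D[OF that]] .
 show "(%H. conj_by U H $$ (i, j)) bm HL n"
  unfolding conj_by_def
  by (rule measurable_mult_mat[OF mult_carrier_mat[OF Uc c] mat_adjoint_carrier[OF Uc] measurable_mult_mat[OF Uc c] _ ij])
    (auto intro: measurable_HL_entry[OF _ _ measurable_ident_sets[OF refl]])
qed

lemma conj_by_add:
 assumes U: "unitary_mat n U" and c: "A : carrier_mat n n" "B : carrier_mat n n"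
 shows "conj_by U (A + B) = conj_by U A + conj_by U B" "conj_by U (A - B) = conj_by U A - conj_by U B"
proof -
 note Uc = unitary_carrier[OF U]
 note a = mat_adjoint_carrier[OF Uc]
 show "conj_by U (A + B) = conj_by U A + conj_by U B"
  unfolding conj_by_def mult_add_distrib_mat[OF Uc c]
   add_mult_distrib_mat[OF mult_carrier_mat[OF Uc c(1)] mult_carrier_mat[OF Uc c(2)] a] ..
 show "conj_by U (A - B) = conj_by U A - conj_by U B"
  unfolding conj_by_def mult_minus_distrib_mat[OF Uc c]
   minus_mult_distrib_mat[OF mult_carrier_mat[OF Uc c(1)] mult_carrier_mat[OF Uc c(2)] a] ..
qed

text \<open>\<open>tr_pow H 2\<close> is the squared Hilbert-Schmidt norm, so this is a unitarily
  invariant ball. Being caught between two cubes, it has an indicator with integral neither 0 nor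
  infinite, as the uniqueness argument requires of its reference function.\<close>

lemma emeasure_LX_ball:
 shows "emeasure (HL n) {H : space (HL n). tr_pow H 2 <= 1} ~= 0"
  and "emeasure (HL n) {H : space (HL n). tr_pow H 2 <= 1} ~= \<infinity>"
proof -
 interpret product_sigma_finite "%_::nat \<times> nat. lborel :: real measure" by standard
 let ?B = "{x : space (LX n). tr_pow (hermitian_of n x) 2 <= 1}"
 have "{H : space (HL n). tr_pow H 2 <= 1} = hermitian_of n ` ?B"
  unfolding hermitian_lebesgue_def space_embed_measure by auto
 moreover have B: "?B : sets (LX n)"
  by measurable
 ultimately have eq: "emeasure (HL n) {H : space (HL n). tr_pow H 2 <= 1} = emeasure (LX n) ?B"
  using emeasure_embed_measure_image'[OF inj_on_hermitian_of B] by (simp add: hermitian_lebesgue_def)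
 \<comment> \<open>Each of the n^2 squared entries is at most 2 e^2 on the small cube; this choice
   keeps their sum below 1.\<close>
 define e where "e = 1 / (2 * real n + 2)"
 have e: "e > 0" "2 * (real n)^2 * e^2 <= 1"
 proof -
  have "2 * (real n)^2 <= (2 * real n + 2)^2" by (simp add: power2_eq_square algebra_simps)
  thus "2 * (real n)^2 * e^2 <= 1" by (simp add: e_def power_divide divide_le_eq)
 qed (simp add: e_def)
 have 1: "(\<Pi>\<^sub>E p\<in>IX n. {-e..e}) \<subseteq> ?B"
 proof
  fix x assume x: "x : (\<Pi>\<^sub>E p\<in>IX n. {-e..e})"
  have xb: "(x p)^2 <= e^2" if "p : IX n" for p
  proof -
   have "\<bar>x p\<bar> <= e" using PiE_mem[OF x that] by auto
   thus ?thesis using power_mono[of "\<bar>x p\<bar>" e 2] by simp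
  qed
  have "(cmod (hermitian_of n x $$ (i, j)))^2 <= 2 * e^2" if "i < n" "j < n" for i j
  proof -
   have "(cmod (hermitian_of n x $$ (i, j)))^2 <= (x (i, j))^2 + (x (j, i))^2"
    using that by (auto simp: hermitian_of_index cmod_power2)
   thus ?thesis using xb[of "(i, j)"] xb[of "(j, i)"] that by auto
  qed
  hence "tr_pow (hermitian_of n x) 2 <= (\<Sum>i<n. \<Sum>j<n. 2 * e^2)"
   unfolding tr_pow_2[OF herm_hermitian_of] by (intro sum_mono) auto
  also have "... <= 1" using e by (simp add: power2_eq_square mult_ac)
  finally show "x : ?B" using x by (auto simp: space_PiM PiE_def)
 qed
 have 2: "?B \<subseteq> (\<Pi>\<^sub>E p\<in>IX n. {-1..1})"
 proof
  fix x assume x: "x : ?B"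
  have "x (i, j) : {-1..1}" if "i < n" "j < n" for i j
  proof -
   have le1: "(cmod (hermitian_of n x $$ (a, b)))^2 <= 1" if "a < n" "b < n" for a b
   proof -
    have "(cmod (hermitian_of n x $$ (a, b)))^2 <= (\<Sum>j<n. (cmod (hermitian_of n x $$ (a, j)))^2)"
     using that by (intro member_le_sum) auto
    also have "... <= (\<Sum>i<n. \<Sum>j<n. (cmod (hermitian_of n x $$ (i, j)))^2)"
     using that by (intro member_le_sum[of a _ "%i. \<Sum>j<n. (cmod (hermitian_of n x $$ (i, j)))^2"]) (auto intro: sum_nonneg)
    also have "... <= 1" using x tr_pow_2[OF herm_hermitian_of[of n x]] by simp
    finally show ?thesis .
   qed
   have "(x (i, j))^2 <= 1"
   proof (cases "i <= j")
    case True
    hence "(x (i, j))^2 <= (cmod (hermitian_of n x $$ (i, j)))^2"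
     using that by (auto simp: hermitian_of_index cmod_power2)
    thus ?thesis using le1[OF that] by linarith
   next
    case False
    hence "(x (i, j))^2 <= (cmod (hermitian_of n x $$ (j, i)))^2"
     using that by (auto simp: hermitian_of_index cmod_power2)
    thus ?thesis using le1[OF that(2,1)] by linarith
   qed
   thus ?thesis by (simp add: abs_square_le_1 abs_le_iff)
  qed
  thus "x : (\<Pi>\<^sub>E p\<in>IX n. {-1..1})" using x by (auto simp: space_PiM PiE_def)
 qed
 have em: "emeasure (LX n) (\<Pi>\<^sub>E p\<in>IX n. {-c..c}) = ennreal (2 * c) ^ card (IX n)" if "c > 0" for c :: real
  using emeasure_PiM[of "IX n" "%_. {-c..c}"] that by simp
 have bs: "(\<Pi>\<^sub>E p\<in>IX n. {-c..c}) : sets (LX n)" for c :: real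
  by (intro sets_PiM_I_finite) auto
 have "0 < emeasure (LX n) (\<Pi>\<^sub>E p\<in>IX n. {-e..e})"
  unfolding em[OF e(1)] using e(1) by (simp add: ennreal_power)
 also have "... <= emeasure (LX n) ?B" by (rule emeasure_mono[OF 1 B])
 finally show "emeasure (HL n) {H : space (HL n). tr_pow H 2 <= 1} ~= 0" by (simp add: eq)
 have "emeasure (LX n) ?B <= emeasure (LX n) (\<Pi>\<^sub>E p\<in>IX n. {-1..1})" by (rule emeasure_mono[OF 2 bs])
 also have "... < \<infinity>" unfolding em[of 1, simplified] by (simp add: ennreal_power power_less_top_ennreal)
 finally show "emeasure (HL n) {H : space (HL n). tr_pow H 2 <= 1} ~= \<infinity>" by (simp add: eq)
qed

text \<open>No Jacobian is computed: conjugation is a surjective homomorphism of the additive group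
  of Hermitian matrices and preserves the Hilbert-Schmidt ball, so
  \<open>nn_integral_hom_invariant\<close> applies.\<close>

theorem nn_integral_HL_conj_by:
 assumes U: "unitary_mat n U" and g: "g bm HL n"
 shows "NI (HL n) (%H. g (conj_by U H)) = NI (HL n) g"
proof -
 have cm: "A : carrier_mat n n" if "A : space (HL n)" for A using hermD(1)[OF space_HL_D[OF that]] .
 have e: "(%x. fst x $$ (i, j)) bm HL n XM HL n" "(%x. snd x $$ (i, j)) bm HL n XM HL n"
  if "i < n" "j < n" for i j
  by (rule measurable_HL_entry[OF that measurable_fst], rule measurable_HL_entry[OF that measurable_snd])
 have spp: "herm n (fst x)" "herm n (snd x)" if "x : space (HL n XM HL n)" for x
  using that by (auto simp: space_pair_measure space_HL)
 have opm: "(%(x, y). p x y) : HL n XM HL n ->M HL n"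
  if p: "!!x y i j. herm n x ==> herm n y ==> i < n ==> j < n ==> p x y $$ (i, j) = x $$ (i, j) + c * y $$ (i, j)"
   "!!x y. herm n x ==> herm n y ==> herm n (p x y)" for p and c :: complex
 proof (rule measurable_HL_I)
  fix i j assume ij: "i < n" "j < n"
  have "(%x. fst x $$ (i, j) + c * snd x $$ (i, j)) bm HL n XM HL n"
   by (intro mi e ij)
  thus "(%x. (case x of (x, y) => p x y) $$ (i, j)) bm HL n XM HL n"
   by (rule measurable_cong[THEN iffD1, rotated]) (simp add: case_prod_beta p(1) spp ij)
 qed (simp add: case_prod_beta p(2) spp)
 have addm: "(%(x, y). x + y) : HL n XM HL n ->M HL n"
  by (rule opm[of _ 1]) (auto simp: herm_add dest!: hermD(1))
 have subm: "(%(x, y). x - y) : HL n XM HL n ->M HL n"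
  by (rule opm[of _ "-1"]) (auto simp: herm_minus dest!: hermD(1))
 have surj: "\<exists>d\<in>space (HL n). conj_by U d = x" if x: "x : space (HL n)" for x
  by (rule bexI[of _ "conj_by (mat_adjoint U) x"])
    (rule conj_by_adjoint(2)[OF U cm[OF x]], simp only: space_HL mem_Collect_eq herm_conj_by[OF unitary_adjoint[OF U] space_HL_D[OF x]])
 have sa: "x + y - y = x" if "x : space (HL n)" "y : space (HL n)" for x y
  using carrier_matD[OF cm[OF that(1)]] carrier_matD[OF cm[OF that(2)]] by (intro eq_matI) simp_all
 have ac: "x + y = y + x" if "x : space (HL n)" "y : space (HL n)" for x y
  by (rule comm_add_mat[OF cm[OF that(1)] cm[OF that(2)]])
 have hT: "indicator {H : space (HL n). tr_pow H 2 <= 1} (conj_by U x) = (indicator {H : space (HL n). tr_pow H 2 <= 1} x :: ennreal)"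
  if x: "x : space (HL n)" for x
  unfolding indicator_def mem_Collect_eq tr_pow_conj_by[OF U cm[OF x]]
  using x herm_conj_by[OF U space_HL_D[OF x]] by (simp only: space_HL mem_Collect_eq)
 have "(%H. tr_pow H 2) -` {..1} \<inter> space (HL n) : sets (HL n)"
  by (rule measurable_sets[OF measurable_tr_pow[OF measurable_ident_sets[OF refl]]]) simp
 hence ms: "{H : space (HL n). tr_pow H 2 <= 1} : sets (HL n)"
  by (simp only: vimage_def atMost_iff Int_def mem_Collect_eq conj_commute)
 have hm: "indicator {H : space (HL n). tr_pow H 2 <= 1} bm HL n"
  by (rule borel_measurable_indicator[OF ms])
 have h01: "NI (HL n) (%x. indicator {H : space (HL n). tr_pow H 2 <= 1} x) ~= 0"
  "NI (HL n) (%x. indicator {H : space (HL n). tr_pow H 2 <= 1} x) ~= \<infinity>"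
  unfolding nn_integral_indicator[OF ms] by (rule emeasure_LX_ball)+
 have tr: "NI (HL n) (%x. f (x + d)) = NI (HL n) f" "NI (HL n) (%x. f (d - x)) = NI (HL n) f"
  if "f bm HL n" "d : space (HL n)" for f :: "complex mat => ennreal" and d
  by (rule nn_integral_HL_translate[OF that(1) space_HL_D[OF that(2)]],
    rule nn_integral_HL_reflect[OF that(1) space_HL_D[OF that(2)]])
 have ca: "conj_by U (x + y) = conj_by U x + conj_by U y"
  if "x : space (HL n)" "y : space (HL n)" for x y
  by (rule conj_by_add(1)[OF U cm[OF that(1)] cm[OF that(2)]])
 have cs: "conj_by U (x - y) = conj_by U x - conj_by U y"
  if "x : space (HL n)" "y : space (HL n)" for x y
  by (rule conj_by_add(2)[OF U cm[OF that(1)] cm[OF that(2)]])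
 show ?thesis
  by (rule nn_integral_hom_invariant[where M = "HL n" and T = "conj_by U" and add = "(+)" and sub = "(-)"
     and h = "indicator {H : space (HL n). tr_pow H 2 <= 1}", OF sigma_finite_HL measurable_conj_by[OF U] addm subm tr(1) tr(2) surj ca cs sa ac hm hT h01 g])
qed

section \<open>Lebesgue measure on monic polynomials\<close>

text \<open>Serves only as a measurable space, with the sigma-algebra generated by the coefficients.
  Integration over polynomials is done by \<open>PMI\<close>.\<close>

definition MP :: "real poly measure" where
 "MP = vimage_algebra UNIV coeff (PiM UNIV (%_. borel))"

lemma space_MP [simp]: "space MP = UNIV"
 by (simp add: MP_def)

lemma measurable_MP_I:
 assumes "!!k. (%x. coeff (f x) k) bm N"
 shows "f : N ->M MP"
 unfolding MP_def
 by (rule measurable_vimage_algebra2)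
   (use assms in \<open>auto intro!: measurable_PiM_single' simp: space_PiM\<close>)

lemma measurable_coeff [measurable (raw)]:
 assumes "f : N ->M MP"
 shows "(%x. coeff (f x) k) bm N"
proof -
 have "coeff : MP ->M PiM UNIV (%_. borel)"
  unfolding MP_def by (rule measurable_vimage_algebra1) (simp add: space_PiM)
 hence "(%p. coeff p k) bm MP"
  by (rule mcomp) (rule measurable_component_singleton, simp)
 thus ?thesis by (rule mcomp[OF assms])
qed

lemma measurable_pCons [measurable (raw)]:
 assumes "f bm N" "g : N ->M MP"
 shows "(%x. pCons (f x) (g x)) : N ->M MP"
proof (rule measurable_MP_I)
 fix k show "(%x. coeff (pCons (f x) (g x)) k) bm N"
  by (cases k) (use assms measurable_coeff in auto)
qed

lemma measurable_MP_add [measurable (raw)]: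
 assumes "f : N ->M MP" "g : N ->M MP"
 shows "(%x. f x + g x) : N ->M MP" "(%x. f x - g x) : N ->M MP"
proof -
 note c = measurable_coeff[OF assms(1)] measurable_coeff[OF assms(2)]
 show "(%x. f x + g x) : N ->M MP"
  by (rule measurable_MP_I) (unfold coeff_add, intro borel_measurable_add c)
 show "(%x. f x - g x) : N ->M MP"
  by (rule measurable_MP_I) (unfold coeff_diff, intro borel_measurable_diff c)
qed

lemma measurable_MP_mult [measurable (raw)]:
 assumes "f : N ->M MP" "g : N ->M MP"
 shows "(%x. f x * g x) : N ->M MP"
 by (rule measurable_MP_I)
   (unfold coeff_mult, intro borel_measurable_sum borel_measurable_times measurable_coeff assms)

lemma measurable_MP_smult [measurable (raw)]:
 assumes "f bm N" "g : N ->M MP"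
 shows "(%x. Polynomial.smult (f x) (g x)) : N ->M MP"
 by (rule measurable_MP_I) (unfold coeff_smult, intro borel_measurable_times assms measurable_coeff)

lemma measurable_MP_const [measurable (raw)]: "(%x. c) : N ->M MP"
 by (rule measurable_const) simp

lemma measurable_MP_pderiv [measurable (raw)]:
 assumes "g : N ->M MP"
 shows "(%x. pderiv (g x)) : N ->M MP"
 by (rule measurable_MP_I) (use measurable_coeff[OF assms] in \<open>simp add: coeff_pderiv\<close>)

text \<open>The degree is bounded by a fixed \<open>n\<close> on each of the countably many pieces.\<close>

lemma measurable_MP_poly [measurable (raw)]:
 assumes f: "f : N ->M MP" and g: "g bm N"
 shows "(%x. poly (f x) (g x)) bm N"
proof -
 \<comment> \<open>Writing the value as an infinite series of coefficients times powers, with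
   finitely many nonzero terms at each point, gives measurability uniformly in the degree.\<close>
 have "(%x. poly (f x) (g x)) = (%x. suminf (%i. coeff (f x) i * g x ^ i))"
  unfolding poly_altdef
  by (intro ext suminf_finite[symmetric]) (auto simp: coeff_eq_0)
 thus ?thesis
  using f g by (simp add: borel_measurable_suminf)
qed

text \<open>Lebesgue integration over the lower coefficients of monic polynomials of degree \<open>m\<close>.\<close>

primrec PMI :: "nat => (real poly => ennreal) => ennreal" where
 "PMI 0 F = F 1"
| "PMI (Suc m) F = PMI m (%Q. NI lborel (%d. F (pCons d Q)))"

lemma PMI_cong:
 assumes "!!P. degree P = m ==> lead_coeff P = 1 ==> F P = G P"
 shows "PMI m F = PMI m G"
 using assms
proof (induction m arbitrary: F G)
 case (Suc m)
 show ?case unfolding PMI.simps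
 proof (rule Suc.IH)
  fix Q :: "real poly" assume Q: "degree Q = m" "lead_coeff Q = 1"
  hence "Q ~= 0" by auto
  thus "NI lborel (%d. F (pCons d Q)) = NI lborel (%d. G (pCons d Q))"
   using Q by (intro nn_integral_cong Suc.prems) auto
 qed
qed simp

lemma measurable_PMI_inner:
 assumes "F bm MP"
 shows "(%Q. NI lborel (%d. F (pCons d Q))) bm MP"
proof -
 have "(%y. pCons (snd y) (fst y)) : MP XM lborel ->M MP" by measurable
 from mcomp[OF this assms]
 have "(%(Q, d). F (pCons d Q)) bm MP XM lborel" by (simp add: case_prod_beta)
 from lborel.borel_measurable_nn_integral[OF this] show ?thesis .
qed

lemma PMI_nn_integral_swap:
 assumes N: "sigma_finite_measure N" and F: "(%(x, Q). F x Q) bm N XM MP"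
 shows "NI N (%x. PMI m (F x)) = PMI m (%Q. NI N (%x. F x Q))"
 using F
proof (induction m arbitrary: F)
 case (Suc m)
 interpret N: sigma_finite_measure N by fact
 interpret pair_sigma_finite N "lborel :: real measure" by standard
 have m1: "(%y. (fst (fst y), pCons (snd y) (snd (fst y)))) : (N XM MP) XM lborel ->M N XM MP"
  by measurable
 from mcomp[OF this Suc.prems]
 have "(%(y, d). F (fst y) (pCons d (snd y))) bm (N XM MP) XM lborel"
  by (simp add: case_prod_beta)
 from lborel.borel_measurable_nn_integral[OF this]
 have m2: "(%(x, Q). NI lborel (%d. F x (pCons d Q))) bm N XM MP"
  by (simp add: case_prod_beta)
 have "NI N (%x. PMI (Suc m) (F x)) = PMI m (%Q. NI N (%x. NI lborel (%d. F x (pCons d Q))))"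
  unfolding PMI.simps by (rule Suc.IH[OF m2])
 also have "... = PMI m (%Q. NI lborel (%d. NI N (%x. F x (pCons d Q))))"
 proof (rule PMI_cong)
  fix Q
  have "(%y. (fst y, pCons (snd y) Q)) : N XM lborel ->M N XM MP" by measurable
  from mcomp[OF this Suc.prems]
  have "(%(x, d). F x (pCons d Q)) bm N XM lborel" by (simp add: case_prod_beta)
  from Fubini'[OF this]
  show "NI N (%x. NI lborel (%d. F x (pCons d Q))) = NI lborel (%d. NI N (%x. F x (pCons d Q)))" by simp
 qed
 finally show ?case by simp
qed simp

text \<open>
 Division by \<open>z - a\<close> instead of by \<open>z\<close> gives the same measure: the substitution is a
 translation of the remainder.
\<close>

lemma PMI_Suc_div:
 assumes "F bm MP"
 shows "PMI (Suc m) F = PMI m (%Q. NI lborel (%d. F ([:- a, 1:] * Q + [:d:])))"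
 using assms
proof (induction m arbitrary: F)
 case 0
 have m: "(%d. F [:d, 1:]) bm borel"
  by (rule mcomp[OF _ 0]) measurable
 have "NI lborel (%d. F [:d - a, 1:]) = NI lborel (%d. F [:d, 1:])"
  using nn_integral_lborel_translate[OF m, of "- a"] by simp
 thus ?case by (simp add: one_pCons)
next
 case (Suc m)
 have poly: "[:- a, 1:] * pCons e R + [:d:] = pCons (d - a * e) ([:- a, 1:] * R + [:e:])" for e d R
  by (simp add: algebra_simps)
 have m: "(%d. F (pCons d R)) bm borel" for R
  by (rule mcomp[OF _ Suc.prems]) measurable
 have "PMI (Suc m) (%Q. NI lborel (%d. F ([:- a, 1:] * Q + [:d:]))) =
   PMI m (%R. NI lborel (%e. NI lborel (%d. F (pCons d ([:- a, 1:] * R + [:e:])))))"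
  unfolding PMI.simps poly
  using nn_integral_lborel_translate[OF m, of "- a * _"] by (simp add: algebra_simps)
 also have "... = PMI (Suc m) (%Q. NI lborel (%d. F (pCons d Q)))"
  by (rule Suc.IH[symmetric]) (rule measurable_PMI_inner[OF Suc.prems])
 finally show ?case by simp
qed

text \<open>A summand of degree below \<open>m\<close> leaves the leading coefficient alone and
  translates the integration variables one by one.\<close>

lemma PMI_translate:
 assumes "F bm MP" "A = 0 | degree A < m"
 shows "PMI m (%Q. F (Q + A)) = PMI m F"
 using assms
proof (induction m arbitrary: F A)
 case (Suc m)
 obtain a A' where A: "A = pCons a A'" by (cases A)
 have m: "(%d. F (pCons d R)) bm borel" for R
  by (rule mcomp[OF _ Suc.prems(1)]) measurable
 have "PMI (Suc m) (%Q. F (Q + A)) = PMI m (%Q. NI lborel (%d. F (pCons d (Q + A'))))"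
  using nn_integral_lborel_translate[OF m, of a] by (simp add: A)
 also have "... = PMI (Suc m) F"
  using Suc.prems(2) Suc.IH[OF measurable_PMI_inner[OF Suc.prems(1)], of A'] by (auto simp: A split: if_splits)
 finally show ?case .
qed simp

text \<open>If a polynomial vanishes at \<open>x\<close> and \<open>R\<close> is its quotient by z,
  its constant term must be - x R(x). Passing from the quotient by z - x to the quotient by z is the
  change of variables of \<open>PMI_Suc_div\<close>.\<close>

lemma PMI_root_factor:
 assumes F: "F bm MP"
 shows "PMI m (%Q. F ([:- x, 1:] * Q)) = PMI m (%R. F (pCons (- x * poly R x) R))"
proof (cases m)
 case 0
 thus ?thesis by (simp add: one_pCons)
next
 case (Suc k)
 have poly: "[:- x, 1:] * pCons e S = pCons (- x * poly ([:- x, 1:] * S + [:e:]) x) ([:- x, 1:] * S + [:e:])" for e S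
  by simp
 have m: "(%R. F (pCons (- x * poly R x) R)) bm MP"
  by (rule mcomp[OF _ F]) measurable
 show ?thesis
  unfolding Suc PMI_Suc_div[OF m, of k x] unfolding PMI.simps poly ..
qed

section \<open>Real-rooted polynomials\<close>

text \<open>The open Weyl chamber, which fixes one labelling of each set of \<open>n\<close>
  distinct eigenvalues.\<close>

definition chm :: "nat => (nat => real) => bool" where
 "chm n x \<longleftrightarrow> (\<forall>i j. i < j --> j < n --> x i < x j)"

definition vdm :: "nat => (nat => 'a::comm_ring_1) => 'a" where
 "vdm n x = (\<Prod>j<n. \<Prod>i<j. x j - x i)"

definition pol :: "nat => (nat => real) => real poly" where
 "pol n x = (\<Prod>i<n. [:- x i, 1:])"

lemma pol_Suc: "pol (Suc n) x = [:- x n, 1:] * pol n x"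
 by (simp add: pol_def mult.commute)

lemma poly_pol: "poly (pol n x) t = (\<Prod>i<n. t - x i)"
 by (simp add: pol_def poly_prod)

lemma monic_pol: "degree (pol n x) = n & lead_coeff (pol n x) = 1"
proof (induction n)
 case (Suc n)
 hence "pol n x ~= 0" by auto
 hence "degree (pol (Suc n) x) = Suc n" using Suc by (simp add: pol_Suc degree_mult_eq del: mult_pCons_left)
 moreover have "lead_coeff (pol (Suc n) x) = 1" using conjunct2[OF Suc] unfolding pol_Suc lead_coeff_mult by simp
 ultimately show ?case by simp
qed (simp add: pol_def)

lemma vdm_Suc: "vdm (Suc n) x = vdm n x * (\<Prod>i<n. x n - x i)"
 by (simp add: vdm_def)

lemma vdm_pos: "chm n x ==> 0 < vdm n x"
 unfolding vdm_def chm_def by (intro prod_pos) auto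

lemma pol_cong: "(!!i. i < n ==> x i = y i) ==> pol n x = pol n y"
 by (simp add: pol_def)

lemma vdm_cong: "(!!i. i < n ==> x i = y i) ==> vdm n x = vdm n y"
 by (simp add: vdm_def)

lemma chm_cong: "(!!i. i < n ==> x i = y i) ==> chm n x = chm n y"
 by (auto simp: chm_def)

lemma chm_inj: "chm n x ==> inj_on x {..<n}"
proof (rule inj_onI)
 fix i j assume c: "chm n x" and ij: "i : {..<n}" "j : {..<n}" "x i = x j"
 have "i < j ==> x i < x j" "j < i ==> x j < x i" using c ij(1,2) unfolding chm_def by auto
 hence "~ i < j" "~ j < i" using ij(3) by force+
 thus "i = j" by simp
qed

lemma chm_Suc: "chm (Suc n) x \<longleftrightarrow> chm n x & (\<forall>i<n. x i < x n)"
 unfolding chm_def by (auto simp: less_Suc_eq)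

text \<open>Both tuples enumerate the root set of the common polynomial in increasing order.\<close>

lemma chm_unique:
 assumes "chm n x" "chm n y" "pol n x = pol n y"
 shows "i < n ==> x i = y i"
proof -
 have roots: "z ` {..<n} = {t. poly (pol n z) t = 0}" for z
  by (auto simp: poly_pol)
 have sl: "map z [0..<n] = sorted_list_of_set (z ` {..<n})" if "chm n z" for z
 proof (rule sorted_distinct_set_unique)
  show "sorted (map z [0..<n])"
   using that by (auto simp: sorted_iff_nth_mono chm_def le_less)
  show "distinct (map z [0..<n])"
   using chm_inj[OF that] by (simp add: distinct_map atLeast_upt)
 qed (auto simp: atLeast0LessThan)
 have "map x [0..<n] = map y [0..<n]"
  unfolding sl[OF assms(1)] sl[OF assms(2)] roots assms(3) ..
 thus "i < n ==> x i = y i" by simp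
qed

lemma monic_eq_pol:
 assumes "degree P = n" "lead_coeff P = 1" "inj_on x {..<n}" "!!i. i < n ==> poly P (x i) = 0"
 shows "P = pol n x"
proof (rule ccontr)
 assume ne: "P ~= pol n x"
 let ?D = "P - pol n x"
 have "?D ~= 0" using ne by simp
 have "coeff ?D n = 0" using assms(1,2) monic_pol[of n x] by auto
 moreover have "degree ?D <= n" using assms(1) monic_pol[of n x] by (intro degree_diff_le) auto
 ultimately have "degree ?D < n | n = 0"
  using leading_coeff_neq_0[OF \<open>?D \<noteq> 0\<close>] by (cases "degree ?D = n") auto
 moreover have "n ~= 0"
 proof
  assume "n = 0"
  then obtain a where "P = [:a:]" using assms(1) degree_eq_zeroE by blast
  hence "P = 1" using assms(2) by (simp add: one_pCons)
  thus False using ne \<open>n = 0\<close> by (simp add: pol_def)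
 qed
 moreover have "card (x ` {..<n}) <= card {t. poly ?D t = 0}"
  using assms(4) poly_roots_finite[OF \<open>?D \<noteq> 0\<close>] by (intro card_mono) (auto simp: poly_pol)
 ultimately show False
  using card_image[OF assms(3)] card_poly_roots_bound[OF \<open>?D \<noteq> 0\<close>] by simp
qed

text \<open>A finite certificate for \<open>n\<close> distinct real roots of a monic polynomial of
  degree \<open>n\<close>: the points of \<open>q\<close> separate the roots. With rational points
  there are only countably many certificates, which is what makes the roots measurable functions of
  the coefficients.\<close>

definition altsgn :: "nat => real poly => (nat => real) => bool" where
 "altsgn n P q \<longleftrightarrow> (\<forall>i j. i < j --> j <= n --> q i < q j) & (\<forall>i\<le>n. (-1) ^ (n - i) * poly P (q i) > 0)"

lemma altsgn_roots:
 assumes P: "degree P = n" "lead_coeff P = 1" and q: "altsgn n P q"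
 obtains x where "chm n x" "P = pol n x" "!!i. i < n ==> q i < x i & x i < q (Suc i)"
proof -
 have "\<exists>t. q i < t & t < q (Suc i) & poly P t = 0" if i: "i < n" for i
 proof -
  have lt: "q i < q (Suc i)" using q i unfolding altsgn_def by auto
  have s: "(-1) ^ (n - i) * poly P (q i) > 0" "(-1) ^ (n - Suc i) * poly P (q (Suc i)) > 0"
   using q i unfolding altsgn_def by auto
  have "n - i = Suc (n - Suc i)" using i by simp
  hence e: "(-1) ^ (n - i) = - ((-1) ^ (n - Suc i) :: real)" by simp
  have "poly P (q i) * poly P (q (Suc i)) < 0"
  proof (cases "even (n - Suc i)")
   case True
   thus ?thesis using s unfolding e by (simp add: mult_less_0_iff)
  next
   case False
   thus ?thesis using s unfolding e by (simp add: mult_less_0_iff)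
  qed
  thus ?thesis using poly_IVT[OF lt, of P] by auto
 qed
 then obtain x where x: "!!i. i < n ==> q i < x i & x i < q (Suc i) & poly P (x i) = 0" by metis
 have "chm n x" unfolding chm_def
 proof (intro allI impI)
  fix i j assume ij: "i < j" "j < n"
  have "x i < q (Suc i)" using x[of i] ij by auto
  also have "q (Suc i) <= q j"
   using q ij unfolding altsgn_def by (cases "Suc i = j") (auto intro: less_imp_le)
  also have "q j < x j" using x[OF ij(2)] by auto
  finally show "x i < x j" .
 qed
 moreover have "P = pol n x"
  by (rule monic_eq_pol[OF P chm_inj[OF calculation]]) (use x in auto)
 ultimately show ?thesis using that x by blast
qed

lemma pol_sign:
 assumes "!!k. k < i ==> x k < t" "!!k. i <= k ==> k < n ==> t < x k" "i <= n"
 shows "(-1) ^ (n - i) * poly (pol n x) t > 0"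
proof -
 have "(\<Prod>k<n. t - x k) = (\<Prod>k<i. t - x k) * (\<Prod>k\<in>{i..<n}. t - x k)"
  using assms(3) prod.union_disjoint[of "{..<i}" "{i..<n}" "%k. t - x k"]
  by (simp add: ivl_disj_un_one(2) ivl_disj_int_one(2))
 also have "(\<Prod>k\<in>{i..<n}. t - x k) = (-1) ^ (n - i) * (\<Prod>k\<in>{i..<n}. x k - t)"
  using prod.distrib[of "%_. -1" "%k. x k - t" "{i..<n}"] by simp
 finally have "(-1) ^ (n - i) * poly (pol n x) t = ((-1) ^ (n - i) * (-1) ^ (n - i)) * ((\<Prod>k<i. t - x k) * (\<Prod>k\<in>{i..<n}. x k - t))"
  by (simp add: poly_pol mult_ac)
 also have "((-1) ^ (n - i) * (-1) ^ (n - i)) = (1 :: real)"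
  by (simp add: power_add[symmetric])
 also have "1 * ((\<Prod>k<i. t - x k) * (\<Prod>k\<in>{i..<n}. x k - t)) > 0"
  using assms by (auto intro!: mult_pos_pos prod_pos)
 finally show ?thesis .
qed

lemma pol_altsgn_rat:
 assumes x: "chm n x" and i: "i < n" and a: "x i < a"
 shows "\<exists>q. (\<forall>k. q k : \<rat>) & altsgn n (pol n x) q & q (Suc i) < a"
proof -
 define lo where "lo k = (if k = 0 then x 0 - 1 else x (k - 1))" for k
 \<comment> \<open>The interval for \<open>q (Suc i)\<close> is cut at \<open>a\<close>, so that the
   certificate also witnesses that the root \<open>x i\<close> lies below \<open>a\<close>.\<close>
 define hi where "hi k = (let b = if k < n then x k else x (n - 1) + 1 in if k = Suc i then min a b else b)" for k
 have lh: "lo k < hi k" if "k <= n" for k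
 proof -
  have "lo k < (if k < n then x k else x (n - 1) + 1)"
   using x that i unfolding chm_def lo_def by auto
  thus ?thesis using a by (auto simp: hi_def lo_def Let_def)
 qed
 have "\<exists>r\<in>\<rat>. k <= n --> lo k < r & r < hi k" for k
  using Rats_dense_in_real[OF lh, of k] by (cases "k <= n") (auto intro: Rats_0)
 then obtain q where q: "!!k. q k : \<rat>" "!!k. k <= n ==> lo k < q k & q k < hi k" by metis
 have up: "q k < x j" if "k <= j" "j < n" for k j
 proof -
  have "q k < hi k" using q(2)[of k] that by simp
  also have "hi k <= x k" using that by (auto simp: hi_def Let_def)
  also have "x k <= x j" using x that unfolding chm_def by (cases "k = j") (auto intro: less_imp_le)
  finally show ?thesis .
 qed
 have dn: "x j < q k" if "j < k" "k <= n" for k j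
 proof -
  have "x j <= x (k - 1)" using x that unfolding chm_def by (cases "j = k - 1") (auto intro!: less_imp_le)
  also have "... = lo k" using that by (simp add: lo_def)
  also have "... < q k" using q(2)[of k] that by simp
  finally show ?thesis .
 qed
 have "altsgn n (pol n x) q" unfolding altsgn_def
 proof (intro conjI allI impI)
  fix k j assume "k < j" "j <= n"
  thus "q k < q j" using up[of k k] dn[of k j] by simp
 next
  fix k assume "k <= n"
  thus "(-1) ^ (n - k) * poly (pol n x) (q k) > 0" by (intro pol_sign) (auto intro: up dn)
 qed
 moreover have "q (Suc i) < a" using q(2)[of "Suc i"] i by (auto simp: hi_def Let_def split: if_splits)
 ultimately show ?thesis using q(1) by blast
qed

section \<open>The roots as measurable functions of the polynomial\<close>

definition realrooted :: "nat => real poly => bool" where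
 "realrooted n P \<longleftrightarrow> (\<exists>x. chm n x & P = pol n x)"

text \<open>The restriction places the tuple in the space of \<open>LR n\<close>. Polynomials that
  are not real-rooted get the constant tuple 0, so that \<open>rts n\<close> is defined and
  measurable on all of \<open>MP\<close>.\<close>

definition rts :: "nat => real poly => nat => real" where
 "rts n P = (if realrooted n P then restrict (SOME x. chm n x & P = pol n x) {..<n} else (\<lambda>i\<in>{..<n}. 0))"

lemma rts_realrooted:
 assumes "realrooted n P"
 shows "chm n (rts n P)" "pol n (rts n P) = P"
proof -
 define x where "x = (SOME x. chm n x & P = pol n x)"
 have x: "chm n x & P = pol n x"
  unfolding x_def using assms unfolding realrooted_def by (rule someI_ex)
 have r: "rts n P = restrict x {..<n}" using assms by (simp add: rts_def x_def)
 show "chm n (rts n P)" "pol n (rts n P) = P"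
  using x chm_cong[of n "restrict x {..<n}" x] pol_cong[of n "restrict x {..<n}" x] unfolding r by auto
qed

lemma realrooted_pol: "chm n x ==> realrooted n (pol n x)"
 by (auto simp: realrooted_def)

lemma rts_pol:
 assumes "chm n x" "x : space (LR n)"
 shows "rts n (pol n x) = x"
proof (rule ext)
 fix i
 note r = rts_realrooted[OF realrooted_pol[OF assms(1)]]
 show "rts n (pol n x) i = x i"
 proof (cases "i < n")
  case True
  thus ?thesis using chm_unique[OF r(1) assms(1) r(2)] by simp
 next
  case False
  thus ?thesis using assms(2) by (auto simp: rts_def space_PiM PiE_def extensional_def)
 qed
qed

lemma rts_space: "rts n P : space (LR n)"
 by (simp add: rts_def space_PiM)

text \<open>A root below \<open>a\<close> is detected by one of countably many rational sign
  certificates, each a condition on finitely many values of \<open>P\<close>. Measurability of the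
  roots follows without any continuity in the coefficients.\<close>

lemma rts_less_iff:
 assumes P: "degree P = n" "lead_coeff P = 1" and i: "i < n"
 shows "realrooted n P & rts n P i < a \<longleftrightarrow>
  (\<exists>qs :: rat list. length qs = Suc n & altsgn n P (%k. of_rat (qs ! k)) & of_rat (qs ! Suc i) < a)"
proof
 assume r: "realrooted n P & rts n P i < a"
 note R = rts_realrooted[OF conjunct1[OF r]]
 obtain q where q: "\<forall>k. q k : \<rat>" "altsgn n P q" "q (Suc i) < a"
  using pol_altsgn_rat[OF R(1) i, of a] r unfolding R(2) by auto
 have "\<forall>k. \<exists>r. q k = of_rat r" using q(1) by (auto elim: Rats_cases)
 then obtain q' :: "nat => rat" where q': "\<forall>k. q k = of_rat (q' k)" by (rule choice[THEN exE])
 show "\<exists>qs :: rat list. length qs = Suc n & altsgn n P (%k. of_rat (qs ! k)) & of_rat (qs ! Suc i) < a"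
 proof (intro exI[of _ "map q' [0..<Suc n]"] conjI)
  have e: "(map q' [0..<Suc n]) ! k = q' k" if "k <= n" for k
   using that by (simp del: upt_Suc)
  show "altsgn n P (%k. of_rat (map q' [0..<Suc n] ! k))"
   using q(2) e unfolding altsgn_def by (simp add: q' del: upt_Suc)
  show "of_rat (map q' [0..<Suc n] ! Suc i) < a"
   using q(3) i by (simp add: q' e del: upt_Suc)
 qed simp
next
 assume "\<exists>qs :: rat list. length qs = Suc n & altsgn n P (%k. of_rat (qs ! k)) & of_rat (qs ! Suc i) < a"
 then obtain qs :: "rat list" where qs: "altsgn n P (%k. of_rat (qs ! k))" "of_rat (qs ! Suc i) < a" by blast
 obtain x where x: "chm n x" "P = pol n x" "!!i. i < n ==> of_rat (qs ! i) < x i & x i < of_rat (qs ! Suc i)"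
  using altsgn_roots[OF P qs(1)] by blast
 have rr: "realrooted n P" unfolding x(2) by (rule realrooted_pol[OF x(1)])
 have "rts n P i = x i"
  using chm_unique[OF rts_realrooted(1)[OF rr] x(1) _ i] rts_realrooted(2)[OF rr] x(2) by simp
 thus "realrooted n P & rts n P i < a" using rr x(3)[OF i] qs(2) by simp
qed

text \<open>
 \<open>realrooted\<close> and \<open>rts\<close> are only known to be measurable on monic polynomials of the right
 degree, hence the following truncations to that set.
\<close>

definition monics :: "nat => real poly set" where
 "monics n = {P. coeff P n = 1 & (\<forall>k>n. coeff P k = 0)}"

lemma monics_iff: "P : monics n \<longleftrightarrow> degree P = n & lead_coeff P = 1"
proof
 assume P: "P : monics n"
 hence "degree P <= n" by (intro degree_le) (auto simp: monics_def)
 moreover have "n <= degree P" using P by (intro le_degree) (auto simp: monics_def)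
 ultimately have "degree P = n" by (rule antisym)
 thus "degree P = n & lead_coeff P = 1" using P by (auto simp: monics_def)
qed (auto simp: monics_def coeff_eq_0)

lemma monics_sets [measurable]: "monics n : sets MP"
proof -
 have "{P : space MP. coeff P n = 1 & (\<forall>k. k > n --> coeff P k = 0)} : sets MP"
  by measurable
 thus ?thesis by (simp add: monics_def)
qed

lemma realrooted_monics: "realrooted n P ==> P : monics n"
 using monic_pol by (auto simp: realrooted_def monics_iff)

lemma rts_less_sets:
 assumes "i < n"
 shows "{P. realrooted n P & rts n P i < a} : sets MP"
proof -
 have "{P. realrooted n P & rts n P i < a} = (\<Union>qs\<in>{qs :: rat list. length qs = Suc n & of_rat (qs ! Suc i) < a}.
   {P : monics n. altsgn n P (%k. of_rat (qs ! k))})"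
  using rts_less_iff[OF _ _ assms, of _ a] realrooted_monics[of n] by (auto simp: monics_iff)
 also have "... : sets MP"
 proof (rule sets.countable_UN'')
  fix qs :: "rat list" assume "qs : {qs :: rat list. length qs = Suc n & of_rat (qs ! Suc i) < a}"
  let ?q = "%k. of_rat (qs ! k) :: real"
  have "{P : space MP. \<forall>i\<in>{..n}. (-1) ^ (n - i) * poly P (?q i) > 0} : sets MP"
   by measurable
  hence "monics n \<inter> {P. \<forall>i\<le>n. (-1) ^ (n - i) * poly P (?q i) > 0} : sets MP"
   by (intro sets.Int) (auto simp: Ball_def)
  thus "{P : monics n. altsgn n P ?q} : sets MP"
   by (cases "\<forall>i j. i < j --> j <= n --> ?q i < ?q j") (auto simp: altsgn_def Int_def)
 qed auto
 finally show ?thesis .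
qed

text \<open>For positive degree, being real-rooted is the union over natural \<open>a\<close> of the
  measurable events that the smallest root lies below \<open>a\<close>. Degree 0 has no root to test
  and is treated apart.\<close>

lemma realrooted_sets [measurable]: "{P. realrooted n P} : sets MP"
proof (cases n)
 case 0
 have "{P. realrooted n P} = monics 0"
 proof (intro equalityI subsetI)
  fix P assume "P : monics 0"
  hence "P = pol 0 (%_. 0)" by (intro monic_eq_pol) (auto simp: monics_iff)
  thus "P : {P. realrooted n P}" using 0 by (auto simp: realrooted_def chm_def)
 qed (use realrooted_monics 0 in auto)
 thus ?thesis using monics_sets by simp
next
 case (Suc m)
 have "{P. realrooted n P} = (\<Union>a::nat. {P. realrooted n P & rts n P 0 < real a})"
  using reals_Archimedean2 by auto
 thus ?thesis using rts_less_sets[of 0 n] Suc by auto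
qed

lemma measurable_rts [measurable]: "rts n : MP ->M LR n"
proof -
 have "(%P. rts n P i) bm MP" if i: "i < n" for i
 proof (rule borel_measurable_iff_less[THEN iffD2], rule allI)
  fix a
  have "{P : space MP. rts n P i < a} =
   {P. realrooted n P & rts n P i < a} \<union> (if 0 < a then - {P. realrooted n P} else {})"
   using i by (auto simp: rts_def)
  moreover have "- {P. realrooted n P} : sets MP"
   using sets.compl_sets[OF realrooted_sets[of n]] by (simp add: Compl_eq_Diff_UNIV)
  ultimately show "{P : space MP. rts n P i < a} : sets MP" using rts_less_sets[OF i, of a] by simp
 qed
 thus ?thesis
  using rts_space[of n] by (intro measurable_PiM_single') (auto simp: space_PiM PiE_def)
qed

section \<open>Substitution in one real variable\<close>

text \<open>A bridge from the gauge integral, in which the change of variables is available, to the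
  nonnegative Lebesgue integral.\<close>

lemma nn_integral_eq_set_integral_lborel:
 fixes f :: "real => real"
 assumes [measurable]: "f bm borel" "S : sets borel" and pos: "!!x. f x >= 0"
  and ai: "f absolutely_integrable_on S"
 shows "NI lborel (%x. ennreal (f x) * indicator S x) = ennreal (integral S f)"
proof -
 have si: "integrable lebesgue (%x. indicator S x *\<^sub>R f x)"
  using ai by (simp add: set_integrable_def)
 have "NI lborel (%x. ennreal (f x) * indicator S x) = NI lborel (%x. ennreal (indicator S x *\<^sub>R f x))"
  by (intro nn_integral_cong) (auto simp: indicator_def)
 also have "... = NI lebesgue (%x. ennreal (indicator S x *\<^sub>R f x))"
  by (simp add: nn_integral_completion)
 also have "... = ennreal (LINT x|lebesgue. indicator S x *\<^sub>R f x)"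
  by (rule nn_integral_eq_integral[OF si]) (auto simp: pos)
 also have "(LINT x|lebesgue. indicator S x *\<^sub>R f x) = integral S f"
  using set_lebesgue_integral_eq_integral(2)[OF ai] by (simp add: set_lebesgue_integral_def)
 finally show ?thesis .
qed

text \<open>Boundedness of \<open>A\<close> makes its indicator absolutely integrable on the image,
  so that the change of variables for absolutely integrable functions can be invoked.\<close>

lemma nn_integral_substitution_inj_indicator:
 fixes g g' :: "real => real"
 assumes [measurable]: "S : sets borel" "g bm borel" "g' bm borel" "A : sets borel"
  and der: "!!x. x : S ==> (g has_real_derivative g' x) (at x)"
  and inj: "inj_on g S" and T[measurable]: "g ` S : sets borel" and bd: "A \<subseteq> {-c..c}"
 shows "NI lborel (%x. indicator A (g x) * ennreal \<bar>g' x\<bar> * indicator S x) = NI lborel (%y. indicator A y * indicator (g ` S) y)"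
proof -
 let ?f = "indicator A :: real => real"
 have SL: "S : sets lebesgue" by simp
 have "integrable lborel (indicator (A \<inter> g ` S) :: real => real)"
 proof (rule integrable_real_indicator)
  show "emeasure lborel (A \<inter> g ` S) < \<infinity>"
  proof -
   have "emeasure lborel (A \<inter> g ` S) <= emeasure lborel {-c..c}" using bd by (intro emeasure_mono) auto
   also have "... < \<infinity>" by (simp add: emeasure_lborel_Icc_eq)
   finally show ?thesis .
  qed
 qed simp
 hence "integrable lebesgue (indicator (A \<inter> g ` S) :: real => real)"
  by (simp add: integrable_completion)
 moreover have "(%x. indicator (g ` S) x *\<^sub>R ?f x) = indicator (A \<inter> g ` S)"
  by (auto simp: fun_eq_iff indicator_def)
 ultimately have "integrable lebesgue (%x. indicator (g ` S) x *\<^sub>R ?f x)"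
  by simp
 hence ai: "?f absolutely_integrable_on (g ` S)" by (simp add: set_integrable_def)
 from has_absolute_integral_change_of_variables_1'[OF SL _ inj, of g' ?f "integral (g ` S) ?f"]
 have *: "(%x. \<bar>g' x\<bar> * ?f (g x)) absolutely_integrable_on S \<and>
   integral S (%x. \<bar>g' x\<bar> * ?f (g x)) = integral (g ` S) ?f"
  using der ai by (auto intro: has_field_derivative_at_within)
 have "NI lborel (%x. indicator A (g x) * ennreal \<bar>g' x\<bar> * indicator S x) =
   NI lborel (%x. ennreal (\<bar>g' x\<bar> * ?f (g x)) * indicator S x)"
  by (intro nn_integral_cong) (auto simp: indicator_def)
 also have "... = ennreal (integral S (%x. \<bar>g' x\<bar> * ?f (g x)))"
  using * by (intro nn_integral_eq_set_integral_lborel) auto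
 also have "... = NI lborel (%y. ennreal (?f y) * indicator (g ` S) y)"
  using * ai by (subst nn_integral_eq_set_integral_lborel) auto
 also have "... = NI lborel (%y. indicator A y * indicator (g ` S) y)"
  by (intro nn_integral_cong) (auto simp: indicator_def)
 finally show ?thesis .
qed

text \<open>Both sides are integrals of \<open>f\<close> against a measure on the line. The two
  measures agree on bounded Borel sets, hence on all of them by monotone limits, and then on every
  nonnegative integrand.\<close>

lemma nn_integral_substitution_inj:
 fixes g g' :: "real => real"
 assumes S[measurable]: "S : sets borel" and g[measurable]: "g bm borel"
  and g'[measurable]: "g' bm borel"
  and f[measurable]: "f bm borel"
  and der: "!!x. x : S ==> (g has_real_derivative g' x) (at x)"
  and inj: "inj_on g S" and T[measurable]: "g ` S : sets borel"
 shows "NI lborel (%x. f (g x) * ennreal \<bar>g' x\<bar> * indicator S x) = NI lborel (%y. f y * indicator (g ` S) y)"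
proof -
 let ?D = "density lborel (%x. ennreal \<bar>g' x\<bar> * indicator S x)"
 let ?M = "distr ?D borel g" and ?N = "density lborel (indicator (g ` S))"
 have D: "NI ?M h = NI lborel (%x. h (g x) * ennreal \<bar>g' x\<bar> * indicator S x)" if [measurable]: "h bm borel" for h
  by (subst nn_integral_distr; simp add: nn_integral_density mult_ac)
 have N: "NI ?N h = NI lborel (%y. h y * indicator (g ` S) y)" if "h bm borel" for h
  using that by (subst nn_integral_density) (auto simp: mult.commute)
 have "?M = ?N"
 proof (rule measure_eqI)
  fix A assume "A : sets ?M"
  hence A[measurable]: "A : sets borel" by simp
  let ?A = "%c::nat. A \<inter> {- real c..real c}"
  have "(\<Union>c. ?A c) = A"
  proof safe
   fix y assume "y : A"
   obtain c :: nat where "\<bar>y\<bar> <= real c" using real_arch_simple by blast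
   with \<open>y \<in> A\<close> show "y : (\<Union>c. ?A c)" by (auto simp: abs_le_iff intro!: exI[of _ c])
  qed
  hence sup: "emeasure M A = (SUP c. emeasure M (?A c))" if "sets M = sets borel" for M
   using SUP_emeasure_incseq[of ?A M] that by (fastforce simp: incseq_def)
  have "emeasure ?M (?A c) = emeasure ?N (?A c)" for c
   using D[of "indicator (?A c)"] N[of "indicator (?A c)"] nn_integral_substitution_inj_indicator[OF S g g' _ der inj T, of "?A c" c] by simp
  thus "emeasure ?M A = emeasure ?N A" by (simp only: sup sets_distr sets_density sets_lborel)
 qed simp
 thus ?thesis using D[OF f] N[OF f] by simp
qed

section \<open>The density of the roots of a random monic polynomial\<close>

abbreviation (input) iv :: "bool => ennreal" where
 "iv b == of_bool b"

lemma measurable_chm: "{x : space (LR n). chm n x} : sets (LR n)"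
proof -
 have "{x : space (LR n). \<forall>j\<in>{..<n}. \<forall>i\<in>{..<j}. x i < x j} : sets (LR n)"
  by measurable
 moreover have "{x : space (LR n). chm n x} = {x : space (LR n). \<forall>j\<in>{..<n}. \<forall>i\<in>{..<j}. x i < x j}"
  by (auto simp: chm_def)
 ultimately show ?thesis by simp
qed

lemma measurable_chm_pred [measurable]: "Measurable.pred (LR n) (chm n)"
 using measurable_chm by (simp add: pred_def)

lemma measurable_chm_bool [mi]: "(%x. of_bool (chm n x) :: ennreal) bm LR n"
 by (rule mcomp[OF measurable_chm_pred]) simp

lemma measurable_realrooted_pred [measurable]: "Measurable.pred MP (realrooted n)"
 using realrooted_sets by (simp add: pred_def)

lemma measurable_component_LR [mi]: "i < n ==> (%x. x i) bm LR n"
 using measurable_component_singleton[of i "{..<n}" "%_. lborel :: real measure"] by simp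

lemma measurable_rdiag: "rdiag n : LR n ->M HL n"
proof (rule measurable_HL_I)
 fix i j assume ij: "i < n" "j < n"
 show "(%x. rdiag n x $$ (i, j)) bm LR n"
  using ij by (cases "i = j") (auto simp: rdiag_index intro!: borel_measurable_of_real mi simp del: of_real_eq_iff)
qed simp

lemma measurable_pol [measurable]: "pol n : LR n ->M MP"
proof -
 have "(%x. pol m x) : LR n ->M MP" if "m <= n" for m
  using that
 proof (induction m)
  case 0
  thus ?case by (simp add: pol_def measurable_MP_const)
 next
  case (Suc m)
  have "(%x. [:- x m, 1:] * pol m x) : LR n ->M MP"
   using Suc by (intro measurable_MP_mult measurable_pCons measurable_MP_const mi) auto
  thus ?case by (simp only: pol_Suc)
 qed
 thus ?thesis by auto
qed

lemma measurable_vdm [measurable, mi]: "(vdm n :: (nat => real) => real) bm LR n"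
 unfolding vdm_def
 by (intro mi) auto

lemma nn_integral_LR_Suc:
 assumes "f bm LR (Suc n)"
 shows "NI (LR (Suc n)) f = NI (LR n) (%x. NI lborel (%t. f (x(n := t))))"
  "NI (LR (Suc n)) f = NI lborel (%t. NI (LR n) (%x. f (x(n := t))))"
proof -
 interpret product_sigma_finite "%_::nat. lborel :: real measure" by standard
 have f: "f bm PiM (insert n {..<n}) (%_. lborel)" using assms by (simp add: lessThan_Suc)
 show "NI (LR (Suc n)) f = NI (LR n) (%x. NI lborel (%t. f (x(n := t))))"
  using product_nn_integral_insert[OF _ _ f] by (simp add: lessThan_Suc)
 show "NI (LR (Suc n)) f = NI lborel (%t. NI (LR n) (%x. f (x(n := t))))"
  using product_nn_integral_insert_rev[OF _ _ f] by (simp add: lessThan_Suc)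
qed

lemma vdm_upd: "vdm (Suc n) (x(n := t)) = vdm n x * (\<Prod>i<n. t - x i)"
 by (simp add: vdm_Suc) (intro arg_cong2[where f = "(*)"] vdm_cong refl, simp)

lemma pol_upd: "pol (Suc n) (x(n := t)) = [:- t, 1:] * pol n x"
 unfolding pol_Suc by (intro arg_cong2[where f = "(*)"] pol_cong) auto

lemma chm_upd: "chm (Suc n) (x(n := t)) \<longleftrightarrow> chm n x & (\<forall>i<n. x i < t)"
 unfolding chm_Suc using chm_cong[of n "x(n := t)" x] by auto

text \<open>
 Vieta: the density of the roots of a Lebesgue random monic polynomial.  The largest root \<open>t\<close> is
 split off; for a fixed quotient \<open>R\<close> of the polynomial by \<open>z\<close> its constant term is \<open>- t * poly R t\<close>.
\<close>

theorem PMI_roots: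
 assumes "F bm MP"
 shows "PMI n (%P. F P * of_bool (realrooted n P)) =
  NI (LR n) (%x. F (pol n x) * ennreal (vdm n x) * of_bool (chm n x))"
 using assms
proof (induction n arbitrary: F)
 case 0
 have "realrooted 0 1" by (auto simp: realrooted_def chm_def pol_def)
 thus ?case by (simp add: PiM_empty nn_integral_count_space_finite vdm_def chm_def pol_def)
next
 case (Suc n)
 note F[measurable] = Suc.prems
 \<comment> \<open>The event that \<open>P\<close> has \<open>Suc n\<close> distinct real roots and
   that the largest one is \<open>t\<close>.\<close>
 define E where "E t P \<longleftrightarrow> realrooted (Suc n) P & rts (Suc n) P n = t" for t P
 have Em[measurable]: "Measurable.pred (borel XM MP) (%z. E (fst z) (snd z))"
 proof -
  have "(%z. rts (Suc n) (snd z) n) bm borel XM MP"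
   by (rule mcomp[OF measurable_snd mcomp[OF measurable_rts measurable_component_LR]]) simp
  thus ?thesis unfolding E_def by measurable
 qed
 have E_mult: "E t ([:- t, 1:] * Q) \<longleftrightarrow> (\<exists>x. chm n x & (\<forall>i<n. x i < t) & Q = pol n x)" for t Q
 proof
  assume e: "E t ([:- t, 1:] * Q)"
  define x where "x = rts (Suc n) ([:- t, 1:] * Q)"
  have x: "chm (Suc n) x" "pol (Suc n) x = [:- t, 1:] * Q" "x n = t"
   using e rts_realrooted[of "Suc n" "[:- t, 1:] * Q"] unfolding E_def x_def by auto
  have "[:- t, 1:] * pol n x = [:- t, 1:] * Q" using x(2,3) by (simp only: pol_Suc)
  hence "pol n x = Q" by (simp only: mult_cancel_left) simp
  thus "\<exists>x. chm n x & (\<forall>i<n. x i < t) & Q = pol n x"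
   using x(1,3) unfolding chm_Suc by (intro exI[of _ x]) auto
 next
  assume "\<exists>x. chm n x & (\<forall>i<n. x i < t) & Q = pol n x"
  then obtain x where x: "chm n x" "\<forall>i<n. x i < t" "Q = pol n x" by blast
  have c: "chm (Suc n) (x(n := t))" using x by (simp add: chm_upd)
  have p: "pol (Suc n) (x(n := t)) = [:- t, 1:] * Q" by (simp only: pol_upd x(3))
  have rr: "realrooted (Suc n) ([:- t, 1:] * Q)" using realrooted_pol[OF c] by (simp only: p)
  have "rts (Suc n) ([:- t, 1:] * Q) n = (x(n := t)) n"
   by (rule chm_unique[OF rts_realrooted(1)[OF rr] c]) (simp_all only: rts_realrooted(2)[OF rr] p lessI)
  thus "E t ([:- t, 1:] * Q)" using rr by (simp add: E_def)
 qed
 have E_pol: "E t ([:- t, 1:] * pol n x) \<longleftrightarrow> (\<forall>i<n. x i < t)" if "chm n x" for t x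
  unfolding E_mult
 proof
  assume "\<exists>xa. chm n xa & (\<forall>i<n. xa i < t) & pol n x = pol n xa"
  then obtain z where z: "chm n z" "\<forall>i<n. z i < t" "pol n x = pol n z" by blast
  thus "\<forall>i<n. x i < t" using chm_unique[OF that z(1,3)] by auto
 qed (use that in auto)
 \<comment> \<open>At the largest root, the derivative equals the product of \<open>t - x i\<close>
   over the other roots. It is at once the factor of the Vandermonde product that involves
   \<open>t\<close> and the Jacobian of the substitution made below for fixed
   \<open>R\<close>.\<close>
 define G where "G t P = F P * ennreal \<bar>poly (pderiv P) t\<bar> * of_bool (E t P)" for t P
 have Gm: "(%(t, P). G t P) bm borel XM MP"
  unfolding G_def case_prod_beta by measurable
 have Gmt: "(%P. G t P) bm MP" for t
  using mcomp[OF measurable_Pair1'[of t borel MP] Gm] by simp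
 have G_mult: "G t ([:- t, 1:] * Q) = F ([:- t, 1:] * Q) * ennreal \<bar>poly Q t\<bar> * of_bool (E t ([:- t, 1:] * Q))" for t Q
 proof -
  have "poly (pderiv ([:- t, 1:] * Q)) t = poly Q t"
   unfolding pderiv_mult by (simp add: pderiv_pCons)
  thus ?thesis by (simp only: G_def)
 qed
 have "NI (LR (Suc n)) (%x. F (pol (Suc n) x) * ennreal (vdm (Suc n) x) * of_bool (chm (Suc n) x)) =
   NI lborel (%t. NI (LR n) (%x. G t ([:- t, 1:] * pol n x) * ennreal (vdm n x) * of_bool (chm n x)))"
 proof (subst nn_integral_LR_Suc(2), measurable, intro nn_integral_cong)
  fix t :: real and x
  show "F (pol (Suc n) (x(n := t))) * ennreal (vdm (Suc n) (x(n := t))) * of_bool (chm (Suc n) (x(n := t))) =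
   G t ([:- t, 1:] * pol n x) * ennreal (vdm n x) * of_bool (chm n x)"
  proof (cases "chm n x & (\<forall>i<n. x i < t)")
   case True
   hence p: "(\<Prod>i<n. t - x i) > 0" by (intro prod_pos) auto
   have v: "vdm n x > 0" using True vdm_pos by blast
   show ?thesis using True E_pol[of x t] p v
    by (simp only: pol_upd vdm_upd chm_upd G_mult poly_pol) (simp add: ennreal_mult mult_ac less_imp_le)
  next
   case False
   thus ?thesis using E_pol[of x t] by (simp only: chm_upd G_mult) auto
  qed
 qed
 also have "... = NI lborel (%t. PMI n (%Q. G t ([:- t, 1:] * Q) * of_bool (realrooted n Q)))"
 proof (intro nn_integral_cong)
  fix t :: real
  have "(%Q. [:- t, 1:] * Q) : MP ->M MP"
   by (intro measurable_MP_mult measurable_MP_const measurable_ident_sets refl)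
  hence "(%Q. G t ([:- t, 1:] * Q)) bm MP"
   by (rule mcomp[OF _ Gmt])
  from Suc.IH[OF this, symmetric]
  show "NI (LR n) (%x. G t ([:- t, 1:] * pol n x) * ennreal (vdm n x) * of_bool (chm n x)) =
   PMI n (%Q. G t ([:- t, 1:] * Q) * of_bool (realrooted n Q))" .
 qed
 also have "... = NI lborel (%t. PMI n (%Q. G t ([:- t, 1:] * Q)))"
 proof (intro nn_integral_cong PMI_cong)
  fix t Q
  show "G t ([:- t, 1:] * Q) * of_bool (realrooted n Q) = G t ([:- t, 1:] * Q)"
  proof (cases "realrooted n Q")
   case False
   hence "~ E t ([:- t, 1:] * Q)" unfolding E_mult realrooted_def by blast
   thus ?thesis by (simp only: G_mult) simp
  qed simp
 qed
 also have "... = NI lborel (%t. PMI n (%R. G t (pCons (- t * poly R t) R)))"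
  by (intro nn_integral_cong PMI_root_factor Gmt)
 also have "... = PMI n (%R. NI lborel (%t. G t (pCons (- t * poly R t) R)))"
 proof (rule PMI_nn_integral_swap)
  have "(%z. (fst z, pCons (- fst z * poly (snd z) (fst z)) (snd z))) : lborel XM MP ->M borel XM MP"
   by measurable
  from mcomp[OF this Gm]
  show "(%(t, R). G t (pCons (- t * poly R t) R)) bm lborel XM MP"
   by (simp add: case_prod_beta)
 qed standard
 also have "... = PMI n (%R. NI lborel (%d. F (pCons d R) * of_bool (realrooted (Suc n) (pCons d R))))"
 proof (rule PMI_cong)
  fix R :: "real poly"
  define g where "g t = - t * poly R t" for t
  define g' where "g' t = - poly (pderiv (pCons 0 R)) t" for t
  define S where "S = {t. E t (pCons (g t) R)}"
  have g: "g t = - poly (pCons 0 R) t" for t by (simp add: g_def)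
  have pd: "pderiv (pCons d R) = pderiv (pCons 0 R)" for d by (simp add: pderiv_pCons)
  have [measurable]: "g bm borel" "g' bm borel"
   unfolding g_def g'_def by measurable
  have Sm: "S : sets borel"
  proof -
   have "(%t. (t, pCons (g t) R)) : borel ->M borel XM MP" by measurable
   from mcomp[OF this Em]
   have "Measurable.pred borel (%t. E t (pCons (g t) R))" by simp
   thus ?thesis by (simp add: pred_def S_def)
  qed
  have der: "(g has_real_derivative g' t) (at t)" for t
   unfolding g g'_def by (intro DERIV_minus poly_DERIV)
  \<comment> \<open>On \<open>S\<close> the value \<open>t\<close> is recovered as the largest root
    of \<open>pCons (g t) R\<close>, although \<open>g\<close> need not be injective on the whole
    line.\<close>
  have inj: "inj_on g S"
  proof (rule inj_onI)
   fix s t assume "s : S" "t : S" "g s = g t"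
   thus "s = t" unfolding S_def E_def by auto
  qed
  have gS: "g ` S = {d. realrooted (Suc n) (pCons d R)}"
  proof (intro equalityI subsetI)
   fix d assume "d : {d. realrooted (Suc n) (pCons d R)}"
   hence rr: "realrooted (Suc n) (pCons d R)" by simp
   define t where "t = rts (Suc n) (pCons d R) n"
   have "poly (pol (Suc n) (rts (Suc n) (pCons d R))) t = 0"
    unfolding poly_pol t_def by simp
   hence "d = g t" unfolding rts_realrooted(2)[OF rr] g_def by simp
   hence "E t (pCons (g t) R)" using rr by (simp add: E_def t_def)
   thus "d : g ` S" using \<open>d = g t\<close> by (auto simp: S_def)
  qed (auto simp: S_def E_def)
  have gSm: "g ` S : sets borel"
  proof -
   have "Measurable.pred borel (%d. realrooted (Suc n) (pCons d R))"
    by measurable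
   thus ?thesis by (simp add: pred_def gS)
  qed
  have fm: "(%d. F (pCons d R)) bm borel" by measurable
  have "NI lborel (%t. G t (pCons (- t * poly R t) R)) = NI lborel (%t. F (pCons (g t) R) * ennreal \<bar>g' t\<bar> * indicator S t)"
  proof (intro nn_integral_cong)
   fix t
   have "- t * poly R t = g t" by (simp only: g_def)
   thus "G t (pCons (- t * poly R t) R) = F (pCons (g t) R) * ennreal \<bar>g' t\<bar> * indicator S t"
    unfolding G_def g'_def S_def pd[of "- t * poly R t"] by (simp add: indicator_def)
  qed
  also have "... = NI lborel (%d. F (pCons d R) * indicator (g ` S) d)"
   by (rule nn_integral_substitution_inj[OF Sm _ _ fm der inj gSm]) measurable
  also have "... = NI lborel (%d. F (pCons d R) * of_bool (realrooted (Suc n) (pCons d R)))"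
   by (intro nn_integral_cong) (auto simp: gS indicator_def)
  finally show "NI lborel (%t. G t (pCons (- t * poly R t) R)) = NI lborel (%d. F (pCons d R) * of_bool (realrooted (Suc n) (pCons d R)))" .
 qed
 finally show ?case by simp
qed

section \<open>Interlacing\<close>

text \<open>
 \<open>apol n y r h\<close> is the characteristic polynomial of the Hermitian matrix obtained by bordering
 \<open>diag(y)\<close> with a vector \<open>v\<close>, \<open>r i = |v i|\<^sup>2\<close>, and the corner entry \<open>h\<close>.
\<close>

primrec apol :: "nat => (nat => real) => (nat => real) => real => real poly" where
 "apol 0 y r h = [:- h, 1:]"
| "apol (Suc n) y r h = [:- y n, 1:] * apol n y r h - Polynomial.smult (r n) (pol n y)"

lemma apol_cong: "(!!i. i < n ==> r i = r' i) ==> apol n y r h = apol n y r' h"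
 by (induction n) auto

lemma monic_apol: "degree (apol n y r h) = Suc n & lead_coeff (apol n y r h) = 1"
proof (induction n)
 case (Suc n)
 let ?A = "[:- y n, 1:] * apol n y r h" and ?B = "Polynomial.smult (r n) (pol n y)"
 have nz: "apol n y r h ~= 0" using Suc by auto
 have dA: "degree ?A = Suc (Suc n)" using Suc nz by (simp add: degree_mult_eq del: mult_pCons_left)
 have lA: "lead_coeff ?A = 1" using conjunct2[OF Suc] unfolding lead_coeff_mult by simp
 have dB: "degree ?B <= n" using monic_pol[of n y] degree_smult_le[of "r n" "pol n y"] by simp
 have "degree (?A - ?B) = degree ?A" using degree_add_eq_left[of "- ?B" ?A] dA dB by simp
 moreover have "coeff ?B (Suc (Suc n)) = 0" using dB by (intro coeff_eq_0) simp
 ultimately show ?case using dA lA by (simp del: mult_pCons_left)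
qed simp

lemma measurable_apol:
 assumes "f bm N" "!!i. i < n ==> (%x. g x i) bm N"
 shows "(%x. apol n y (g x) (f x)) : N ->M MP"
 using assms(2)
proof (induction n)
 case 0
 show ?case unfolding apol.simps
  by (intro measurable_pCons mi assms(1) measurable_MP_const)
next
 case (Suc n)
 show ?case unfolding apol.simps
  by (intro measurable_MP_add(2) measurable_MP_mult measurable_MP_const measurable_MP_smult Suc) (auto intro: Suc.prems)
qed

lemma measurable_apol_pair: "(%z. apol n y (fst z) (snd z)) : LR n XM lborel ->M MP"
 by (intro measurable_apol mcomp[OF measurable_fst measurable_component_LR]) auto

lemma measurable_apol_section: "(%h. apol n y r h) : borel ->M MP"
 by (intro measurable_apol) auto

lemma measurable_apol_integral:
 assumes "F bm MP"
 shows "(%r. NI lborel (%h. F (apol n y r h))) bm LR n"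
 using lborel.borel_measurable_nn_integral[of "%r h. F (apol n y r h)" "LR n"]
  mcomp[OF measurable_apol_pair assms] by (simp add: case_prod_beta)

text \<open>The map from (r, h) to polynomials is affine, with Jacobian \<open>vdm n y\<close>. In
  the induction the new variable multiplies \<open>pol n y\<close>, which splits into a multiple of
  z - y_n and the remainder \<open>c\<close>, the product of the y_n - y_i. The multiple shifts the
  quotient by a polynomial of lower degree and disappears by \<open>PMI_translate\<close>; the
  remainder scales the constant term by \<open>c\<close>, the new factor of the Vandermonde
  product.\<close>

lemma nn_integral_apol:
 assumes y: "chm n y" and F: "F bm MP"
 shows "ennreal (vdm n y) * NI (LR n) (%r. NI lborel (%h. F (apol n y r h))) = PMI (Suc n) F"
 using assms
proof (induction n arbitrary: F)
 case 0
 have "NI lborel (%h. F [:- h, 1:]) = NI lborel (%h. F [:h, 1:])"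
  using nn_integral_lborel_reflect[of "%h. F [:h, 1:]" 0] mcomp[OF _ 0(2), of "%h. [:h, 1:]" borel]
  by (simp add: measurable_pCons measurable_MP_const)
 thus ?case by (simp add: PiM_empty nn_integral_count_space_finite vdm_def one_pCons)
next
 case (Suc n)
 have y: "chm n y" "!!i. i < n ==> y i < y n" using Suc.prems(1) by (auto simp: chm_Suc)
 define c where "c = poly (pol n y) (y n)"
 have c: "c > 0" unfolding c_def poly_pol using y(2) by (intro prod_pos) auto
 define Y where "Y = synthetic_div (pol n y) (y n)"
 have Y: "pol n y = [:- y n, 1:] * Y + [:c:]"
  using synthetic_div_correct'[of "y n" "pol n y"] by (simp only: Y_def c_def)
 have dY: "degree Y < Suc n" using monic_pol[of n y] by (simp add: Y_def degree_synthetic_div)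
 note F = Suc.prems(2)
 define G where "G t Q = F ([:- y n, 1:] * Q - Polynomial.smult t (pol n y))" for t Q
 have G: "G t Q = F ([:- y n, 1:] * (Q + Polynomial.smult (- t) Y) + [:- t * c:])" for t Q
 proof -
  have "A * Q - Polynomial.smult t (A * Y + [:c:]) = A * (Q + Polynomial.smult (- t) Y) + [:- t * c:]" for A
   by (simp add: algebra_simps smult_add_right)
  thus ?thesis unfolding G_def Y by (simp only:)
 qed
 define K where "K t Q = F ([:- y n, 1:] * Q + [:- t * c:])" for t Q
 have Gm: "(%Q. G t Q) bm MP" for t
  unfolding G_def
  by (rule mcomp[OF _ F]) (intro measurable_MP_add(2) measurable_MP_mult measurable_MP_const measurable_ident_sets refl)
 have Km: "(%Q. K t Q) bm MP" for t
  unfolding K_def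
  by (rule mcomp[OF _ F]) (intro measurable_MP_add(1) measurable_MP_mult measurable_MP_const measurable_ident_sets refl)
 have m: "(%x. NI lborel (%h. F (apol (Suc n) y x h))) bm LR (Suc n)"
  by (rule measurable_apol_integral[OF F])
 have "NI (LR (Suc n)) (%r. NI lborel (%h. F (apol (Suc n) y r h))) =
   NI lborel (%t. NI (LR n) (%r. NI lborel (%h. G t (apol n y r h))))"
  unfolding nn_integral_LR_Suc(2)[OF m]
 proof (intro nn_integral_cong)
  fix t h :: real and r :: "nat => real"
  have "apol n y (r(n := t)) h = apol n y r h" by (rule apol_cong) auto
  thus "F (apol (Suc n) y (r(n := t)) h) = G t (apol n y r h)" by (simp add: G_def del: mult_pCons_left)
 qed
 also have "ennreal (vdm n y) * ... = NI lborel (%t. ennreal (vdm n y) * NI (LR n) (%r. NI lborel (%h. G t (apol n y r h))))"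
 proof (rule nn_integral_cmult[symmetric])
  have "(%x. (snd (fst x), apol n y (snd (fst x)) (snd x))) : ((lborel :: real measure) XM LR n) XM lborel ->M LR n XM MP"
   by (intro measurable_Pair measurable_apol mcomp[OF measurable_fst measurable_snd] measurable_snd
     mcomp[OF mcomp[OF measurable_fst measurable_snd] measurable_component_LR]) auto
  hence a: "(%x. apol n y (snd (fst x)) (snd x)) : ((lborel :: real measure) XM LR n) XM lborel ->M MP"
   by (simp add: measurable_pair_iff o_def)
  have t: "(%x. fst (fst x)) bm ((lborel :: real measure) XM LR n) XM (lborel :: real measure)"
   by measurable
  have "(%x. G (fst (fst x)) (apol n y (snd (fst x)) (snd x))) bm ((lborel :: real measure) XM LR n) XM lborel"
   unfolding G_def
   by (rule mcomp[OF _ F]) (intro measurable_MP_add(2) measurable_MP_mult measurable_MP_const measurable_MP_smult a t)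
  hence "(%z. NI lborel (%h. G (fst z) (apol n y (snd z) h))) bm (lborel :: real measure) XM LR n"
   using lborel.borel_measurable_nn_integral[of "%z h. G (fst z) (apol n y (snd z) h)" "(lborel :: real measure) XM LR n"]
   by (simp add: case_prod_beta)
  moreover have "sigma_finite_measure (LR n)"
   by (rule product_sigma_finite.sigma_finite[OF product_sigma_finite_lborel]) simp
  ultimately show "(%t. NI (LR n) (%r. NI lborel (%h. G t (apol n y r h)))) bm lborel"
   using sigma_finite_measure.borel_measurable_nn_integral[of "LR n" "%t r. NI lborel (%h. G t (apol n y r h))" "lborel"]
   by (simp add: case_prod_beta)
 qed
 also have "... = NI lborel (%t. PMI (Suc n) (G t))"
  by (intro nn_integral_cong Suc.IH y(1) Gm)
 also have "... = NI lborel (%t. PMI (Suc n) (K t))"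
 proof (intro nn_integral_cong)
  fix t :: real
  have "PMI (Suc n) (%Q. K t (Q + Polynomial.smult (- t) Y)) = PMI (Suc n) (K t)"
   using dY degree_smult_le[of "- t" Y] by (intro PMI_translate Km) auto
  moreover have "PMI (Suc n) (G t) = PMI (Suc n) (%Q. K t (Q + Polynomial.smult (- t) Y))"
   by (rule PMI_cong) (simp only: G K_def)
  ultimately show "PMI (Suc n) (G t) = PMI (Suc n) (K t)" by simp
 qed
 also have "... = PMI (Suc n) (%Q. NI lborel (%t. K t Q))"
 proof (rule PMI_nn_integral_swap)
  show "(%(t, Q). K t Q) bm lborel XM MP"
   unfolding K_def case_prod_beta
   by (rule mcomp[OF _ F])
     (intro measurable_MP_add(1) measurable_MP_mult measurable_MP_const measurable_pCons measurable_snd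
      borel_measurable_times borel_measurable_uminus borel_measurable_const, simp_all)
 qed standard
 finally have 1: "ennreal (vdm n y) * NI (LR (Suc n)) (%r. NI lborel (%h. F (apol (Suc n) y r h))) = PMI (Suc n) (%Q. NI lborel (%t. K t Q))" .
 have 2: "ennreal c * NI lborel (%t. K t Q) = NI lborel (%d. F ([:- y n, 1:] * Q + [:d:]))" for Q
 proof -
  have "(%d. F ([:- y n, 1:] * Q + [:d:])) bm borel"
   by (rule mcomp[OF _ F])
     (intro measurable_MP_add(1) measurable_MP_const measurable_pCons measurable_ident_sets, simp_all)
  from nn_integral_real_affine[OF this, of "- c" 0]
  show ?thesis using c by (simp add: K_def mult.commute[of c])
 qed
 have cm: "PMI m (%Q. a * H Q) = a * PMI m H" if "H bm MP" for m a H
  using that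
 proof (induction m arbitrary: H)
  case (Suc m)
  have "(%d. H (pCons d Q)) bm borel" for Q
   by (rule mcomp[OF _ Suc.prems]) (intro measurable_pCons measurable_MP_const measurable_ident_sets, simp)
  hence "PMI (Suc m) (%Q. a * H Q) = PMI m (%Q. a * NI lborel (%d. H (pCons d Q)))"
   by (simp add: nn_integral_cmult)
  also have "... = a * PMI (Suc m) H" using Suc.IH[OF measurable_PMI_inner[OF Suc.prems]] by simp
  finally show ?case .
 qed simp
 have Kint: "(%Q. NI lborel (%t. K t Q)) bm MP"
 proof -
  have "(%(Q, t). K t Q) bm MP XM lborel"
   unfolding K_def case_prod_beta
   by (rule mcomp[OF _ F])
     (intro measurable_MP_add(1) measurable_MP_mult measurable_MP_const measurable_pCons measurable_fst
      borel_measurable_times borel_measurable_uminus borel_measurable_const, simp_all)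
  from lborel.borel_measurable_nn_integral[OF this] show ?thesis .
 qed
 have v: "ennreal (vdm (Suc n) y) = ennreal c * ennreal (vdm n y)"
  using vdm_pos[OF y(1)] c by (simp add: vdm_Suc c_def poly_pol ennreal_mult mult.commute less_imp_le)
 have "ennreal (vdm (Suc n) y) * NI (LR (Suc n)) (%r. NI lborel (%h. F (apol (Suc n) y r h))) =
   PMI (Suc n) (%Q. NI lborel (%d. F ([:- y n, 1:] * Q + [:d:])))"
  unfolding v mult.assoc 1 cm[OF Kint, symmetric] 2 ..
 also have "... = PMI (Suc (Suc n)) F" by (rule PMI_Suc_div[OF F, symmetric])
 finally show ?case .
qed

section \<open>Interlacing read off from signs\<close>

definition intl :: "nat => (nat => real) => (nat => real) => bool" where
 "intl n y x \<longleftrightarrow> (\<forall>i<n. x i < y i & y i < x (Suc i))"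

lemma intl_chm: "intl n m x ==> chm (Suc n) x ==> chm n m"
 unfolding chm_def
proof (intro allI impI)
 fix i j assume a: "intl n m x" "\<forall>i j. i < j --> j < Suc n --> x i < x j" and ij: "i < j" "j < n"
 have "m i < x (Suc i)" using a ij by (auto simp: intl_def)
 also have "x (Suc i) <= x j" using a(2) ij by (cases "Suc i = j") (auto intro: less_imp_le)
 also have "x j < m j" using a ij by (auto simp: intl_def)
 finally show "m i < m j" .
qed

lemma poly_large:
 assumes "lead_coeff P = (1 :: real)"
 shows "\<exists>b>B. poly P b > 0"
proof -
 obtain m where m: "\<forall>x\<ge>m. poly P x >= lead_coeff P" using poly_pinfty_gt_lc[of P] assms by auto
 hence "poly P (max m (B + 1)) > 0" using assms by (smt (verit) max.cobounded1)
 thus ?thesis by (intro exI[of _ "max m (B + 1)"]) auto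
qed

lemma poly_small:
 assumes P: "lead_coeff P = (1 :: real)" "degree P = n"
 shows "\<exists>a<B. (-1) ^ n * poly P a > 0"
proof -
 let ?P = "Polynomial.smult ((-1) ^ n) (pcompose P [:0, -1:])"
 have "lead_coeff (pcompose P [:0, -1:]) = (-1) ^ n"
  using lead_coeff_comp[of "[:0, -1:]" P] P by simp
 hence "lead_coeff ?P = 1" by (simp add: lead_coeff_smult power_mult_distrib[symmetric])
 from poly_large[OF this, of "- B"] obtain b where "b > - B" "poly ?P b > 0" by blast
 thus ?thesis by (intro exI[of _ "- b"]) (auto simp: poly_pcompose)
qed

text \<open>Signs at the \<open>n\<close> points alone give n - 1 roots. A point far to the left and
  one far to the right, where the leading term fixes the sign, complete them to a full certificate
  for \<open>Suc n\<close> roots, one in each gap.\<close>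

lemma interlacing_iff:
 assumes y: "chm n y" and P: "degree P = Suc n" "lead_coeff P = 1"
 shows "(\<forall>i<n. (-1) ^ (n - i) * poly P (y i) > 0) \<longleftrightarrow> (\<exists>x. chm (Suc n) x & P = pol (Suc n) x & intl n y x)"
proof
 assume s: "\<forall>i<n. (-1) ^ (n - i) * poly P (y i) > 0"
 obtain a where a: "a < (if n = 0 then 0 else y 0)" "(-1) ^ Suc n * poly P a > 0" using poly_small[OF P(2,1)] by blast
 obtain b where b: "b > (if n = 0 then 0 else y (n - 1))" "poly P b > 0" using poly_large[OF P(2)] by blast
 define q where "q k = (if k = 0 then a else if k <= n then y (k - 1) else b)" for k
 have alt: "altsgn (Suc n) P q" unfolding altsgn_def
 proof (intro conjI allI impI)
  fix i j assume ij: "i < j" "j <= Suc n"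
  have ya: "a < y k" if "k < n" for k
   using a that y unfolding chm_def by (cases "k = 0") (auto split: if_splits intro: less_trans)
  have yb: "y k < b" if "k < n" for k
  proof (cases "k = n - 1")
   case False
   hence "y k < y (n - 1)" using y that unfolding chm_def by auto
   thus ?thesis using b(1) that by simp
  qed (use b(1) that in auto)
  have ab: "a < b" using a b ya[of 0] yb[of 0] by (cases n) auto
  show "q i < q j" using ij ya[of "j - 1"] yb[of "i - 1"] ab y unfolding chm_def q_def by auto
 next
  fix i assume i: "i <= Suc n"
  show "(-1) ^ (Suc n - i) * poly P (q i) > 0"
  proof (cases "i = 0 | i = Suc n")
   case True
   thus ?thesis using a b by (auto simp: q_def)
  next
   case False
   hence "i - 1 < n" "n - (i - 1) = Suc n - i" "q i = y (i - 1)" using i by (auto simp: q_def)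
   thus ?thesis using s by force
  qed
 qed
 obtain x where x: "chm (Suc n) x" "P = pol (Suc n) x" "!!i. i < Suc n ==> q i < x i & x i < q (Suc i)"
  using altsgn_roots[OF P alt] by blast
 have "intl n y x" unfolding intl_def
 proof (intro allI impI)
  fix i assume "i < n"
  thus "x i < y i & y i < x (Suc i)" using x(3)[of i] x(3)[of "Suc i"] by (auto simp: q_def)
 qed
 thus "\<exists>x. chm (Suc n) x & P = pol (Suc n) x & intl n y x" using x by blast
next
 assume "\<exists>x. chm (Suc n) x & P = pol (Suc n) x & intl n y x"
 then obtain x where x: "chm (Suc n) x" "P = pol (Suc n) x" "intl n y x" by blast
 show "\<forall>i<n. (-1) ^ (n - i) * poly P (y i) > 0"
 proof (intro allI impI)
  fix i assume i: "i < n"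
  have xy: "x i < y i" "y i < x (Suc i)" using x(3) i by (auto simp: intl_def)
  have "(-1) ^ (Suc n - Suc i) * poly (pol (Suc n) x) (y i) > 0"
  proof (rule pol_sign)
   fix k assume "k < Suc i"
   hence "x k <= x i" using x(1) i unfolding chm_def by (cases "k = i") (auto intro!: less_imp_le)
   thus "x k < y i" using xy by simp
  next
   fix k assume "Suc i <= k" "k < Suc n"
   hence "x (Suc i) <= x k" using x(1) i unfolding chm_def by (cases "k = Suc i") (auto intro!: less_imp_le)
   thus "y i < x k" using xy by simp
  qed (use i in simp)
  thus "(-1) ^ (n - i) * poly P (y i) > 0" by (simp add: x(2))
 qed
qed

text \<open>The value at y_i is - r_i times the product of the y_i - y_k over k \<noteq> i, whose
  sign is known in the chamber. So the sign condition sees exactly the sign of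
  \<open>r i\<close>.\<close>

lemma apol_sign_iff:
 "chm n y ==> (\<forall>i<n. (-1) ^ (n - i) * poly (apol n y r h) (y i) > 0) \<longleftrightarrow> (\<forall>i<n. 0 < r i)"
proof (induction n)
 case (Suc n)
 have y: "chm n y" "!!i. i < n ==> y i < y n" using Suc.prems by (auto simp: chm_Suc)
 have 1: "(-1) ^ (Suc n - i) * poly (apol (Suc n) y r h) (y i) > 0 \<longleftrightarrow> (-1) ^ (n - i) * poly (apol n y r h) (y i) > 0"
  if i: "i < n" for i
 proof -
  have "poly (pol n y) (y i) = 0" unfolding poly_pol using i by auto
  hence "poly (apol (Suc n) y r h) (y i) = (y i - y n) * poly (apol n y r h) (y i)"
   by (simp add: algebra_simps)
  moreover have "(-1) ^ (Suc n - i) = - ((-1) ^ (n - i) :: real)" using i by (simp add: Suc_diff_le)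
  ultimately have "(-1) ^ (Suc n - i) * poly (apol (Suc n) y r h) (y i) = (y n - y i) * ((-1) ^ (n - i) * poly (apol n y r h) (y i))"
   by (simp add: algebra_simps)
  thus ?thesis using y(2)[OF i] by (simp add: zero_less_mult_iff)
 qed
 have c: "(\<Prod>i<n. y n - y i) > 0" using y(2) by (intro prod_pos) auto
 have "poly (apol (Suc n) y r h) (y n) = - (r n * (\<Prod>i<n. y n - y i))"
  by (simp add: poly_pol)
 hence 2: "(-1) ^ (Suc n - n) * poly (apol (Suc n) y r h) (y n) > 0 \<longleftrightarrow> r n > 0"
  using c unfolding \<open>poly (apol (Suc n) y r h) (y n) = _\<close> by (simp add: zero_less_mult_iff Suc_diff_le)
 show ?case
  unfolding All_less_Suc using 1 2 Suc.IH[OF y(1)] by auto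
qed simp

text \<open>The last factor is the Schur complement of the diagonal block; its vanishing is the
  secular equation for the eigenvalues of the bordered matrix.\<close>

lemma poly_apol:
 "(!!k. k < n ==> z ~= y k) ==> poly (apol n y r h) z = (\<Prod>k<n. z - y k) * (z - h - (\<Sum>i<n. r i / (z - y i)))"
proof (induction n)
 case (Suc n)
 have z: "z - y n ~= 0" using Suc.prems[of n] by simp
 have IH: "poly (apol n y r h) z = (\<Prod>k<n. z - y k) * (z - h - (\<Sum>i<n. r i / (z - y i)))"
  using Suc by simp
 have "poly (apol (Suc n) y r h) z = (z - y n) * poly (apol n y r h) z - r n * (\<Prod>k<n. z - y k)"
  by (simp add: poly_pol algebra_simps)
 hence "poly (apol (Suc n) y r h) z = (\<Prod>k<n. z - y k) * ((z - y n) * (z - h - (\<Sum>i<n. r i / (z - y i))) - r n)"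
  unfolding IH by (simp only: algebra_simps)
 also have "(z - y n) * (z - h - (\<Sum>i<n. r i / (z - y i))) - r n = (z - y n) * (z - h - (\<Sum>i<Suc n. r i / (z - y i)))"
  using z by (simp add: right_diff_distrib distrib_left)
 finally show ?case by (simp only: prod.lessThan_Suc mult.assoc)
qed simp

lemma apol_interlacing:
 assumes y: "chm n y" and r: "!!i. i < n ==> 0 < r i"
 shows "realrooted (Suc n) (apol n y r h)" "intl n y (rts (Suc n) (apol n y r h))"
proof -
 obtain x where x: "chm (Suc n) x" "apol n y r h = pol (Suc n) x" "intl n y x"
  using interlacing_iff[OF y, of "apol n y r h"] monic_apol[of n y r h] apol_sign_iff[OF y] r by blast
 show rr: "realrooted (Suc n) (apol n y r h)" unfolding x(2) by (rule realrooted_pol[OF x(1)])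
 have "rts (Suc n) (apol n y r h) i = x i" if "i < Suc n" for i
  using chm_unique[OF rts_realrooted(1)[OF rr] x(1) _ that] rts_realrooted(2)[OF rr] x(2) by simp
 thus "intl n y (rts (Suc n) (apol n y r h))" using x(3) by (simp add: intl_def)
qed

text \<open>The conditional law of the spectrum \<open>x\<close> of the bordered matrix given the
  spectrum \<open>y\<close> of its corner: density vdm(x) / vdm(y) on the tuples that interlace
  \<open>y\<close>. The affine change to coefficients is followed by the passage to roots, and
  positivity of \<open>r\<close> turns into interlacing.\<close>

theorem nn_integral_interlacing:
 assumes y: "chm n y" and g: "g bm LR (Suc n)"
 shows "ennreal (vdm n y) * NI (LR n) (%r. of_bool (\<forall>i<n. 0 < r i) * NI lborel (%h. g (rts (Suc n) (apol n y r h)))) =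
  NI (LR (Suc n)) (%x. g x * ennreal (vdm (Suc n) x) * of_bool (chm (Suc n) x & intl n y x))"
proof -
 define A where "A P \<longleftrightarrow> (\<forall>i<n. (-1) ^ (n - i) * poly P (y i) > 0)" for P :: "real poly"
 define F where "F P = g (rts (Suc n) P) * of_bool (A P)" for P
 have Am: "Measurable.pred MP A"
 proof -
  have "{P : space MP. \<forall>i\<in>{..<n}. (-1) ^ (n - i) * poly P (y i) > 0} : sets MP" by measurable
  thus ?thesis by (simp add: pred_def A_def Ball_def)
 qed
 have F: "F bm MP"
  unfolding F_def using Am mcomp[OF measurable_rts g] by measurable
 have mg: "(%h. g (rts (Suc n) (apol n y r h))) bm borel" for r
  by (rule mcomp[OF mcomp[OF measurable_apol_section measurable_rts] g])
 have "NI (LR n) (%r. of_bool (\<forall>i<n. 0 < r i) * NI lborel (%h. g (rts (Suc n) (apol n y r h)))) =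
   NI (LR n) (%r. NI lborel (%h. F (apol n y r h)))"
  using mg by (intro nn_integral_cong) (simp add: F_def A_def apol_sign_iff[OF y] nn_integral_cmult[symmetric] mult.commute)
 hence "ennreal (vdm n y) * NI (LR n) (%r. of_bool (\<forall>i<n. 0 < r i) * NI lborel (%h. g (rts (Suc n) (apol n y r h)))) = PMI (Suc n) F"
  using nn_integral_apol[OF y F] by simp
 also have "... = PMI (Suc n) (%P. F P * of_bool (realrooted (Suc n) P))"
 proof (rule PMI_cong)
  fix P :: "real poly" assume "degree P = Suc n" "lead_coeff P = 1"
  hence "A P ==> realrooted (Suc n) P"
   using interlacing_iff[OF y, of P] realrooted_pol unfolding A_def by blast
  thus "F P = F P * of_bool (realrooted (Suc n) P)" by (auto simp: F_def)
 qed
 also have "... = NI (LR (Suc n)) (%x. F (pol (Suc n) x) * ennreal (vdm (Suc n) x) * of_bool (chm (Suc n) x))"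
  by (rule PMI_roots[OF F])
 also have "... = NI (LR (Suc n)) (%x. g x * ennreal (vdm (Suc n) x) * of_bool (chm (Suc n) x & intl n y x))"
 proof (rule nn_integral_cong)
  fix x assume x: "x : space (LR (Suc n))"
  show "F (pol (Suc n) x) * ennreal (vdm (Suc n) x) * of_bool (chm (Suc n) x) = g x * ennreal (vdm (Suc n) x) * of_bool (chm (Suc n) x & intl n y x)"
  proof (cases "chm (Suc n) x")
   case True
   have "A (pol (Suc n) x) \<longleftrightarrow> intl n y x"
   proof
    assume "A (pol (Suc n) x)"
    then obtain z where z: "chm (Suc n) z" "pol (Suc n) x = pol (Suc n) z" "intl n y z"
     using interlacing_iff[OF y, of "pol (Suc n) x"] monic_pol[of "Suc n" x] unfolding A_def by blast
    thus "intl n y x" using chm_unique[OF True z(1,2)] by (auto simp: intl_def)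
   next
    assume "intl n y x"
    thus "A (pol (Suc n) x)"
     using interlacing_iff[OF y, of "pol (Suc n) x"] monic_pol[of "Suc n" x] True unfolding A_def by blast
   qed
   thus ?thesis using True by (simp add: F_def rts_pol[OF True x])
  qed simp
 qed
 finally show ?thesis .
qed

section \<open>Integrals over Hermitian matrices through interlacing patterns\<close>

lemma complex_lborel: "(lborel :: complex measure) = distr (lborel XM lborel) borel (%(a, b). Complex a b)"
proof (rule lborel_eqI)
 have m: "(%(a, b). Complex a b) : lborel XM lborel ->M borel"
  unfolding case_prod_beta by (rule borel_measurable_complex_iff[THEN iffD2]) simp
 fix l u :: complex assume lu: "!!b. b : Basis ==> l \<bullet> b <= u \<bullet> b"
 hence le: "Re l <= Re u" "Im l <= Im u" using lu[of 1] lu[of \<i>] by (auto simp: Basis_complex_def)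
 have "emeasure (distr (lborel XM lborel) borel (%(a, b). Complex a b)) (box l u) =
   emeasure (lborel XM lborel) ({Re l<..<Re u} \<times> {Im l<..<Im u})"
  by (subst emeasure_distr[OF m])
    (auto intro!: arg_cong2[where f = emeasure] simp: box_def Basis_complex_def space_pair_measure)
 also have "... = ennreal (Re u - Re l) * ennreal (Im u - Im l)"
  by (subst lborel.emeasure_pair_measure_Times) (use le in auto)
 also have "... = ennreal (\<Prod>b\<in>Basis. (u - l) \<bullet> b)"
  using le by (auto simp: Basis_complex_def ennreal_mult[symmetric])
 finally show "emeasure (distr (lborel XM lborel) borel (%(a, b). Complex a b)) (box l u) = ennreal (\<Prod>b\<in>Basis. (u - l) \<bullet> b)" .
qed simp

lemma measurable_Complex [measurable (raw)]:
 assumes "f bm N" "g bm N"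
 shows "(%x. Complex (f x) (g x)) bm N"
 by (rule borel_measurable_complex_iff[THEN iffD2]) (simp add: assms)

lemma nn_integral_complex:
 assumes "f bm borel"
 shows "NI lborel f = NI lborel (%a. NI lborel (%b. f (Complex a b)))"
proof -
 have m: "(%(a, b). Complex a b) : lborel XM lborel ->M borel"
  unfolding case_prod_beta by measurable
 have "NI lborel f = NI (lborel XM lborel) (%p. f (Complex (fst p) (snd p)))"
  by (subst complex_lborel, subst nn_integral_distr[OF m]) (use assms in \<open>auto simp: case_prod_beta\<close>)
 also have "... = NI lborel (%a. NI lborel (%b. f (Complex a b)))"
  by (subst lborel.nn_integral_fst[symmetric]) (auto intro!: mcomp[OF _ assms])
 finally show ?thesis .
qed

text \<open>A disc of radius sqrt a has area pi a, so the squared modulus carries planar Lebesgue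
  measure to pi times Lebesgue measure on the half-line. All powers of pi in the spectral formulas
  come from here.\<close>

lemma nn_integral_polar:
 assumes "f bm borel"
 shows "NI lborel (%z. f ((cmod z)^2)) = ennreal pi * NI lborel (%r. of_bool (0 < r) * f r)"
proof -
 let ?M = "distr lborel borel (%z. (cmod z)^2)" and ?N = "density lborel (%r::real. ennreal pi * of_bool (0 < r))"
 have eM: "emeasure ?M {..a} = ennreal (pi * max 0 a)" for a
 proof -
  have "emeasure ?M {..a} = emeasure lborel ((%z. (cmod z)^2) -` {..a} \<inter> space lborel)"
   by (rule emeasure_distr) simp_all
  also have "(%z. (cmod z)^2) -` {..a} \<inter> space lborel = (if a < 0 then {} else cball 0 (sqrt a))"
  proof (rule Set.set_eqI)
   fix z :: complex
   have "sqrt ((cmod z)^2) = cmod z" by (rule real_sqrt_unique) auto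
   hence "(cmod z)^2 <= a \<longleftrightarrow> cmod z <= sqrt a"
    using real_sqrt_le_iff[of "(cmod z)^2" a] by (simp only:)
   moreover have "~ (cmod z)^2 <= a" if "a < 0" using that zero_le_power2[of "cmod z"] by linarith
   ultimately show "z : (%z. (cmod z)^2) -` {..a} \<inter> space lborel \<longleftrightarrow> z : (if a < 0 then {} else cball 0 (sqrt a))"
    by (cases "a < 0")
      (simp_all only: vimage_eq Int_iff atMost_iff space_lborel space_borel UNIV_I mem_cball dist_0_norm if_True if_False empty_iff simp_thms)
  qed
  also have "emeasure lborel (if a < 0 then {} else cball (0 :: complex) (sqrt a)) = ennreal (pi * max 0 a)"
   by (simp add: emeasure_cball unit_ball_vol_2)
  finally show ?thesis .
 qed
 have eN: "emeasure ?N {..a} = ennreal (pi * max 0 a)" for a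
 proof -
  have "emeasure ?N {..a} = NI lborel (%r. ennreal pi * indicator {0<..a} r)"
   by (subst emeasure_density) (auto intro!: nn_integral_cong simp: indicator_def)
  also have "... = ennreal pi * emeasure lborel {0<..a}"
   by (subst nn_integral_cmult) auto
  also have "... = ennreal (pi * max 0 a)"
   by (simp add: ennreal_mult max_def)
  finally show ?thesis .
 qed
 have borel_atMost: "sets (borel :: real measure) = sigma_sets UNIV (range atMost)"
  by (subst borel_eq_atMost) simp
 have "?M = ?N"
 proof (rule measure_eqI_generator_eq[where E = "range atMost" and \<Omega> = UNIV and A = "%i::nat. {..real i}"])
  show "Int_stable (range (atMost :: real => real set))"
   by (auto simp: Int_stable_def)
  show "!!X. X : range atMost ==> emeasure ?M X = emeasure ?N X" using eM eN by auto
  show "sets ?M = sigma_sets UNIV (range atMost)" "sets ?N = sigma_sets UNIV (range atMost)"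
   unfolding sets_distr sets_density sets_lborel by (rule borel_atMost)+
  show "(\<Union>i::nat. {..real i}) = UNIV" using real_arch_simple by auto
 qed (auto simp: eM)
 hence "NI ?M f = NI ?N f" by simp
 moreover have "NI ?M f = NI lborel (%z. f ((cmod z)^2))"
  using assms by (intro nn_integral_distr) auto
 moreover have "NI ?N f = NI lborel (%r. ennreal pi * of_bool (0 < r) * f r)"
  using assms by (intro nn_integral_density) auto
 moreover have "... = ennreal pi * NI lborel (%r. of_bool (0 < r) * f r)"
  using assms by (subst nn_integral_cmult[symmetric]) (auto simp: mult.assoc)
 ultimately show ?thesis by simp
qed

lemma measurable_component_LC [mi]: "i < n ==> (%x. x i) bm LC n"
 using measurable_component_singleton[of i "{..<n}" "%_. lborel :: complex measure"] by simp

lemma nn_integral_LC_Suc: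
 assumes "f bm LC (Suc n)"
 shows "NI (LC (Suc n)) f = NI (LC n) (%x. NI lborel (%t. f (x(n := t))))"
  "NI (LC (Suc n)) f = NI lborel (%t. NI (LC n) (%x. f (x(n := t))))"
proof -
 interpret product_sigma_finite "%_::nat. lborel :: complex measure" by standard
 have f: "f bm PiM (insert n {..<n}) (%_. lborel)" using assms by (simp add: lessThan_Suc)
 show "NI (LC (Suc n)) f = NI (LC n) (%x. NI lborel (%t. f (x(n := t))))"
  using product_nn_integral_insert[OF _ _ f] by (simp add: lessThan_Suc)
 show "NI (LC (Suc n)) f = NI lborel (%t. NI (LC n) (%x. f (x(n := t))))"
  using product_nn_integral_insert_rev[OF _ _ f] by (simp add: lessThan_Suc)
qed

lemma sigma_finite_LR: "sigma_finite_measure (LR n)"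
 by (rule product_sigma_finite.sigma_finite[OF product_sigma_finite_lborel]) simp

lemma sigma_finite_LC: "sigma_finite_measure (LC n)"
 by (rule product_sigma_finite.sigma_finite[OF product_sigma_finite_lborel]) simp

lemmas measurable_NI_LR = sigma_finite_measure.borel_measurable_nn_integral[OF sigma_finite_LR]
lemmas measurable_NI_LC = sigma_finite_measure.borel_measurable_nn_integral[OF sigma_finite_LC]

lemma measurable_upd_LR [measurable]: "(%z. (fst z)(n := snd z)) : LR n XM lborel ->M LR (Suc n)"
 using measurable_add_dim[of n "{..<n}" "%_. lborel :: real measure"] by (simp add: case_prod_beta lessThan_Suc)

lemma measurable_sqnorms: "(%v. \<lambda>i\<in>{..<n}. (cmod (v i))^2) : LC n ->M LR n"
 by (rule measurable_restrict) (auto intro!: mi borel_measurable_norm)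

lemma nn_integral_LC_polar:
 assumes "f bm LR n"
 shows "NI (LC n) (%v. f (\<lambda>i\<in>{..<n}. (cmod (v i))^2)) =
  ennreal (pi ^ n) * NI (LR n) (%r. of_bool (\<forall>i<n. 0 < r i) * f r)"
 using assms
proof (induction n arbitrary: f)
 case 0
 show ?case by (simp add: PiM_empty nn_integral_count_space_finite restrict_def)
next
 case (Suc n)
 note f = Suc.prems
 have upd: "(%z. f ((fst z)(n := snd z))) bm LR n XM lborel"
  by (rule mcomp[OF measurable_upd_LR f])
 have f1: "(%r. f (r(n := t))) bm LR n" for t
  using mcomp[OF measurable_Pair[OF measurable_ident_sets[OF refl] measurable_const[of t lborel]] upd] by simp
 have pos: "Measurable.pred (LR n) (%r. \<forall>i<n. 0 < r i)"
 proof -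
  have "{r : space (LR n). \<forall>i\<in>{..<n}. 0 < r i} : sets (LR n)" by measurable
  thus ?thesis by (simp add: pred_def Ball_def)
 qed
 have pos1: "Measurable.pred (LR (Suc n)) (%r. \<forall>i<Suc n. 0 < r i)"
 proof -
  have "{r : space (LR (Suc n)). \<forall>i\<in>{..<Suc n}. 0 < r i} : sets (LR (Suc n))" by measurable
  thus ?thesis by (simp add: pred_def Ball_def)
 qed
 have gm: "(%t. NI (LR n) (%r. of_bool (\<forall>i<n. 0 < r i) * f (r(n := t)))) bm borel"
 proof -
  have "(%(t, r). of_bool (\<forall>i<n. 0 < r i) * f (r(n := t))) bm borel XM LR n"
  proof -
   have "(%z. f ((snd z)(n := fst z))) bm borel XM LR n"
   proof -
    have "(%z. (snd z, fst z)) : borel XM LR n ->M LR n XM (lborel :: real measure)"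
     by (rule measurable_Pair[OF measurable_snd]) simp
    from mcomp[OF this upd] show ?thesis by simp
   qed
   moreover have "Measurable.pred (borel XM LR n) (%z. \<forall>i<n. 0 < snd z i)"
    using mcomp[OF measurable_snd pos] by simp
   ultimately show ?thesis unfolding case_prod_beta by measurable
  qed
  from sigma_finite_measure.borel_measurable_nn_integral[OF sigma_finite_LR this] show ?thesis .
 qed
 have m: "(%v. f (\<lambda>i\<in>{..<Suc n}. (cmod (v i))^2)) bm LC (Suc n)"
  by (rule mcomp[OF measurable_sqnorms f])
 have "NI (LC (Suc n)) (%v. f (\<lambda>i\<in>{..<Suc n}. (cmod (v i))^2)) =
   NI lborel (%z. NI (LC n) (%v. f ((\<lambda>i\<in>{..<n}. (cmod (v i))^2)(n := (cmod z)^2))))"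
  unfolding nn_integral_LC_Suc(2)[OF m]
  by (intro nn_integral_cong arg_cong[where f = f]) (auto simp: fun_eq_iff)
 also have "... = NI lborel (%z. ennreal (pi ^ n) * NI (LR n) (%r. of_bool (\<forall>i<n. 0 < r i) * f (r(n := (cmod z)^2))))"
  by (intro nn_integral_cong Suc.IH f1)
 also have "... = ennreal (pi ^ n) * NI lborel (%z. NI (LR n) (%r. of_bool (\<forall>i<n. 0 < r i) * f (r(n := (cmod z)^2))))"
  by (rule nn_integral_cmult) (auto intro: mcomp[OF _ gm])
 also have "NI lborel (%z. NI (LR n) (%r. of_bool (\<forall>i<n. 0 < r i) * f (r(n := (cmod z)^2)))) =
   ennreal pi * NI lborel (%t. of_bool (0 < t) * NI (LR n) (%r. of_bool (\<forall>i<n. 0 < r i) * f (r(n := t))))"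
  by (rule nn_integral_polar[OF gm])
 also have "NI lborel (%t. of_bool (0 < t) * NI (LR n) (%r. of_bool (\<forall>i<n. 0 < r i) * f (r(n := t)))) =
   NI (LR (Suc n)) (%r. of_bool (\<forall>i<Suc n. 0 < r i) * f r)"
 proof -
  have m2: "(%r. of_bool (\<forall>i<Suc n. 0 < r i) * f r) bm LR (Suc n)"
   using pos1 f by measurable
  have "(\<forall>i<Suc n. 0 < (r(n := t)) i) \<longleftrightarrow> 0 < t & (\<forall>i<n. 0 < r i)" for r :: "nat => real" and t
   unfolding All_less_Suc by auto
  thus ?thesis
   unfolding nn_integral_LR_Suc(2)[OF m2]
   by (intro nn_integral_cong) (simp only: of_bool_conj, simp)
 qed
 finally show ?case by (simp add: ennreal_mult mult_ac)
qed

section \<open>Unitary maps acting on border vectors\<close>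

definition cmv :: "nat => complex mat => (nat => complex) => nat => complex" where
 "cmv n U v = (\<lambda>i\<in>{..<n}. \<Sum>j<n. U $$ (i, j) * v j)"

lemma cmv_mult:
 assumes "A : carrier_mat n n" "B : carrier_mat n n"
 shows "cmv n A (cmv n B v) = cmv n (A * B) v"
proof (rule ext)
 fix i
 show "cmv n A (cmv n B v) i = cmv n (A * B) v i"
 proof (cases "i < n")
  case True
  have "(\<Sum>j<n. A $$ (i, j) * (\<Sum>k<n. B $$ (j, k) * v k)) = (\<Sum>k<n. (\<Sum>j<n. A $$ (i, j) * B $$ (j, k)) * v k)"
   unfolding sum_distrib_left sum_distrib_right by (subst sum.swap) (simp add: mult.assoc)
  also have "... = (\<Sum>k<n. (A * B) $$ (i, k) * v k)"
   by (intro sum.cong refl) (simp add: mult_index[OF assms True])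
  finally show ?thesis using True by (simp add: cmv_def)
 qed (simp add: cmv_def)
qed

lemma cmv_one: "v : space (LC n) ==> cmv n (1\<^sub>m n) v = v"
proof (rule ext)
 fix i assume v: "v : space (LC n)"
 have "(\<Sum>j<n. (1\<^sub>m n :: complex mat) $$ (i, j) * v j) = (\<Sum>j<n. if j = i then v i else 0)" if "i < n"
  using that by (intro sum.cong) auto
 thus "cmv n (1\<^sub>m n) v i = v i"
  using v by (auto simp: cmv_def space_PiM PiE_def extensional_def)
qed

lemma cmv_norm:
 assumes U: "unitary_mat n U"
 shows "(\<Sum>i<n. (cmod (cmv n U v i))^2) = (\<Sum>i<n. (cmod (v i))^2)"
proof -
 note Uc = unitary_carrier[OF U]
 note UU = unitary_columns[OF U]
 have "complex_of_real (\<Sum>i<n. (cmod (cmv n U v i))^2) = (\<Sum>i<n. cnj (cmv n U v i) * cmv n U v i)"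
  by (rule sum_cnj_mult_self[symmetric])
 also have "... = (\<Sum>i<n. \<Sum>k<n. \<Sum>j<n. cnj (v k) * v j * (cnj (U $$ (i, k)) * U $$ (i, j)))"
 proof (intro sum.cong refl)
  fix i assume "i : {..<n}"
  hence "cnj (cmv n U v i) * cmv n U v i = (\<Sum>k<n. cnj (U $$ (i, k) * v k)) * (\<Sum>j<n. U $$ (i, j) * v j)"
   by (simp add: cmv_def)
  also have "... = (\<Sum>k<n. \<Sum>j<n. cnj (v k) * v j * (cnj (U $$ (i, k)) * U $$ (i, j)))"
   unfolding sum_product by (intro sum.cong refl) (simp add: mult_ac)
  finally show "cnj (cmv n U v i) * cmv n U v i = (\<Sum>k<n. \<Sum>j<n. cnj (v k) * v j * (cnj (U $$ (i, k)) * U $$ (i, j)))" .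
 qed
 also have "... = (\<Sum>k<n. \<Sum>j<n. \<Sum>i<n. cnj (v k) * v j * (cnj (U $$ (i, k)) * U $$ (i, j)))"
  by (subst sum.swap, rule sum.cong[OF refl], rule sum.swap)
 also have "... = (\<Sum>k<n. \<Sum>j<n. cnj (v k) * v j * (if k = j then 1 else 0))"
  by (intro sum.cong refl) (simp add: sum_distrib_left[symmetric] UU)
 also have "... = (\<Sum>k<n. cnj (v k) * v k)"
  by (intro sum.cong refl) (simp add: if_distrib[of "%x. _ * x"] cong: if_cong)
 also have "... = complex_of_real (\<Sum>i<n. (cmod (v i))^2)" by (rule sum_cnj_mult_self)
 finally show ?thesis using of_real_eq_iff by blast
qed

lemma measurable_cmv: "cmv n U : LC n ->M LC n"
 unfolding cmv_def
 by (rule measurable_restrict) (auto intro!: mi)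

lemma emeasure_LC_ball:
 shows "emeasure (LC n) {v : space (LC n). (\<Sum>i<n. (cmod (v i))^2) <= 1} ~= 0"
  and "emeasure (LC n) {v : space (LC n). (\<Sum>i<n. (cmod (v i))^2) <= 1} ~= \<infinity>"
  and "{v : space (LC n). (\<Sum>i<n. (cmod (v i))^2) <= 1} : sets (LC n)"
proof -
 interpret product_sigma_finite "%_::nat. lborel :: complex measure" by standard
 let ?B = "{v : space (LC n). (\<Sum>i<n. (cmod (v i))^2) <= 1}"
 have "(%v. \<Sum>i<n. (cmod (v i))^2) bm LC n"
  by (auto intro!: mi borel_measurable_norm)
 thus B: "?B : sets (LC n)" by measurable
 define e where "e = 1 / (real n + 1)"
 have e: "e > 0" "real n * e^2 <= 1"
 proof -
  have "real n <= (real n + 1)^2" by (simp add: power2_eq_square algebra_simps)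
  thus "real n * e^2 <= 1" by (simp add: e_def power_divide divide_le_eq)
 qed (simp add: e_def)
 have 1: "(\<Pi>\<^sub>E i\<in>{..<n}. cball 0 e) \<subseteq> ?B"
 proof
  fix v assume v: "v : (\<Pi>\<^sub>E i\<in>{..<n}. cball (0::complex) e)"
  have "(cmod (v i))^2 <= e^2" if "i < n" for i
  proof (rule power_mono)
   show "cmod (v i) <= e" using PiE_mem[OF v, of i] that by simp
  qed simp
  hence "(\<Sum>i<n. (cmod (v i))^2) <= (\<Sum>i<n. e^2)" by (intro sum_mono) auto
  thus "v : ?B" using e v by (auto simp: space_PiM PiE_def)
 qed
 have 2: "?B \<subseteq> (\<Pi>\<^sub>E i\<in>{..<n}. cball 0 1)"
 proof
  fix v assume v: "v : ?B"
  have "cmod (v i) <= 1" if "i < n" for i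
  proof -
   have "(cmod (v i))^2 <= (\<Sum>i<n. (cmod (v i))^2)" using that by (intro member_le_sum) auto
   hence "(cmod (v i))^2 <= 1" using v by auto
   thus ?thesis by (simp add: abs_square_le_1)
  qed
  thus "v : (\<Pi>\<^sub>E i\<in>{..<n}. cball 0 1)" using v by (auto simp: space_PiM PiE_def)
 qed
 have em: "emeasure (LC n) (\<Pi>\<^sub>E i\<in>{..<n}. cball 0 c) = ennreal (pi * c^2) ^ n" if "c > 0" for c :: real
  using emeasure_PiM[of "{..<n}" "%_. cball 0 c"] that by (simp add: emeasure_cball unit_ball_vol_2)
 have bs: "(\<Pi>\<^sub>E i\<in>{..<n}. cball 0 c) : sets (LC n)" for c :: real
  by (intro sets_PiM_I_finite) auto
 have "0 < emeasure (LC n) (\<Pi>\<^sub>E i\<in>{..<n}. cball 0 e)"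
  unfolding em[OF e(1)] using e(1) by (simp add: ennreal_power)
 also have "... <= emeasure (LC n) ?B" by (rule emeasure_mono[OF 1 B])
 finally show "emeasure (LC n) ?B ~= 0" by simp
 have "emeasure (LC n) ?B <= emeasure (LC n) (\<Pi>\<^sub>E i\<in>{..<n}. cball 0 1)" by (rule emeasure_mono[OF 2 bs])
 also have "... < \<infinity>" unfolding em[of 1, simplified] by (simp add: power_less_top_ennreal)
 finally show "emeasure (LC n) ?B ~= \<infinity>" by simp
qed

text \<open>The uniqueness argument again, now with the additive group of vectors and the Euclidean
  unit ball.\<close>

lemma nn_integral_cmv:
 assumes U: "unitary_mat n U" and g: "g bm LC n"
 shows "NI (LC n) (%v. g (cmv n U v)) = NI (LC n) g"
proof -
 let ?B = "{v : space (LC n). (\<Sum>i<n. (cmod (v i))^2) <= 1}"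
 let ?add = "%x y. \<lambda>i\<in>{..<n}. x i + (y i :: complex)" and ?sub = "%x y. \<lambda>i\<in>{..<n}. x i - (y i :: complex)"
 note Uc = unitary_carrier[OF U]
 have vext: "v i = undefined" if "v : space (LC n)" "~ i < n" for v i
  using that by (auto simp: space_PiM PiE_def extensional_def)
 have c1: "(%z. fst z i) bm LC n XM LC n" "(%z. snd z i) bm LC n XM LC n"
  if "i < n" for i
  by (rule mcomp[OF measurable_fst measurable_component_LC[OF that]],
    rule mcomp[OF measurable_snd measurable_component_LC[OF that]])
 have addm: "(%(x, y). ?add x y) : LC n XM LC n ->M LC n"
  unfolding case_prod_beta by (rule measurable_restrict) (auto intro!: mi c1)
 have subm: "(%(x, y). ?sub x y) : LC n XM LC n ->M LC n"
  unfolding case_prod_beta by (rule measurable_restrict) (auto intro!: mi c1)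
 have tr: "NI (LC n) (%x. f (?add x d)) = NI (LC n) f" if "f bm LC n" "d : space (LC n)" for f d
  by (rule nn_integral_PiM_component_map[OF product_sigma_finite_lborel product_sigma_finite_lborel,
     where T = "%i x. x + d i" and f = f]) (use that in \<open>simp_all add: nn_integral_lborel_translate\<close>)
 have rf: "NI (LC n) (%x. f (?sub d x)) = NI (LC n) f" if "f bm LC n" "d : space (LC n)" for f d
  by (rule nn_integral_PiM_component_map[OF product_sigma_finite_lborel product_sigma_finite_lborel,
     where T = "%i x. d i - x" and f = f]) (use that in \<open>simp_all add: nn_integral_lborel_reflect\<close>)
 have surj: "\<exists>d\<in>space (LC n). cmv n U d = x" if x: "x : space (LC n)" for x
 proof (rule bexI)
  show "cmv n U (cmv n (mat_adjoint U) x) = x"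
   unfolding cmv_mult[OF Uc mat_adjoint_carrier[OF Uc]] unitary_right[OF U] by (rule cmv_one[OF x])
  show "cmv n (mat_adjoint U) x : space (LC n)" by (simp add: cmv_def space_PiM)
 qed
 have hom: "cmv n U (?add x y) = ?add (cmv n U x) (cmv n U y)" "cmv n U (?sub x y) = ?sub (cmv n U x) (cmv n U y)" for x y
  unfolding cmv_def
  by (rule restrict_ext, simp add: distrib_left sum.distrib)
    (rule restrict_ext, simp add: right_diff_distrib sum_subtractf)
 have grp: "?sub (?add x y) y = x" if "x : space (LC n)" "y : space (LC n)" for x y
 proof (rule ext)
  fix i show "?sub (?add x y) y i = x i" using vext[OF that(1), of i] by (cases "i < n") simp_all
 qed
 have comm: "?add x y = ?add y x" for x y by (simp only: add.commute)
 have csp: "cmv n U v : space (LC n)" for v by (simp add: cmv_def space_PiM)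
 have hT: "indicator ?B (cmv n U x) = (indicator ?B x :: ennreal)" if "x : space (LC n)" for x
  using that csp[of x] cmv_norm[OF U, of x] by (simp add: indicator_def)
 have hm: "indicator ?B bm LC n" by (rule borel_measurable_indicator[OF emeasure_LC_ball(3)])
 have h01: "NI (LC n) (%x. indicator ?B x) ~= 0" "NI (LC n) (%x. indicator ?B x) ~= \<infinity>"
  unfolding nn_integral_indicator[OF emeasure_LC_ball(3)] by (rule emeasure_LC_ball(1), rule emeasure_LC_ball(2))
 show ?thesis
  by (rule nn_integral_hom_invariant[where M = "LC n" and T = "cmv n U" and add = ?add and sub = ?sub and h = "indicator ?B",
     OF sigma_finite_LC measurable_cmv addm subm tr rf surj hom grp comm hm hT h01 g])
qed

section \<open>Bordered matrices\<close>

definition bord :: "nat => complex mat => (nat => complex) => real => complex mat" where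
 "bord n H v h = Matrix.mat (Suc n) (Suc n) (%(i, j).
   if i < n & j < n then H $$ (i, j) else if i < n then v i else if j < n then cnj (v j) else complex_of_real h)"

lemma bord_carrier [simp]: "bord n H v h : carrier_mat (Suc n) (Suc n)"
 by (simp add: bord_def)

lemma bord_index:
 "i < n ==> j < n ==> bord n H v h $$ (i, j) = H $$ (i, j)"
 "i < n ==> bord n H v h $$ (i, n) = v i"
 "j < n ==> bord n H v h $$ (n, j) = cnj (v j)"
 "bord n H v h $$ (n, n) = complex_of_real h"
 by (auto simp: bord_def)

lemma herm_bord: "herm n H ==> herm (Suc n) (bord n H v h)"
proof (rule hermI)
 fix i j assume "herm n H" "i < Suc n" "j < Suc n"
 thus "bord n H v h $$ (i, j) = cnj (bord n H v h $$ (j, i))"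
  using herm_index[of n H i j] by (auto simp: less_Suc_eq bord_index)
qed simp

lemma measurable_bord:
 assumes A: "A : N ->M HL n" and b: "!!i. i < n ==> (%x. b x i) bm N" and c: "c bm N"
 shows "(%x. bord n (A x) (b x) (c x)) : N ->M HL (Suc n)"
proof (rule measurable_HL_I)
 fix x assume "x : space N"
 thus "herm (Suc n) (bord n (A x) (b x) (c x))"
  using measurable_space[OF A] space_HL_D by (intro herm_bord) blast
next
 fix i j assume ij: "i < Suc n" "j < Suc n"
 have cn: "(%x. cnj (b x i)) bm N" if "i < n" for i
  using b[OF that] by (rule mcomp) (simp add: borel_measurable_continuous_onI continuous_on_cnj)
 show "(%x. bord n (A x) (b x) (c x) $$ (i, j)) bm N"
  using ij b cn c measurable_HL_entry[OF _ _ A, of i j] by (auto simp: less_Suc_eq bord_index)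
qed

lemma nn_integral_PiM_reindex:
 fixes t :: "'i => 'j"
 assumes K: "finite K" and t: "inj_on t K" and M: "sigma_finite_measure M"
  and f: "f bm PiM (t ` K) (%_. M)"
 shows "NI (PiM (t ` K) (%_. M)) f = NI (PiM K (%_. M)) (%y. f (\<lambda>p\<in>t ` K. y (the_inv_into K t p)))"
proof -
 let ?r = "%y. \<lambda>p\<in>t ` K. y (the_inv_into K t p)"
 have inv: "the_inv_into K t (t k) = k" if "k : K" for k using the_inv_into_f_f[OF t that] .
 interpret K: finite_product_sigma_finite "%_. M" K
  unfolding finite_product_sigma_finite_def finite_product_sigma_finite_axioms_def product_sigma_finite_def
  using M K by simp
 interpret T: product_sigma_finite "%_. M" unfolding product_sigma_finite_def using M by simp
 have r: "?r : PiM K (%_. M) ->M PiM (t ` K) (%_. M)"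
 proof (rule measurable_restrict)
  fix p assume "p : t ` K"
  thus "(%y. y (the_inv_into K t p)) : PiM K (%_. M) ->M M"
   using inv by (auto intro!: measurable_component_singleton)
 qed
 have "distr (PiM K (%_. M)) (PiM (t ` K) (%_. M)) ?r = PiM (t ` K) (%_. M)"
 proof (rule T.PiM_eqI)
  fix A assume A: "!!i. i : t ` K ==> A i : sets M"
  have "emeasure (distr (PiM K (%_. M)) (PiM (t ` K) (%_. M)) ?r) (Pi\<^sub>E (t ` K) A) =
   emeasure (PiM K (%_. M)) (?r -` Pi\<^sub>E (t ` K) A \<inter> space (PiM K (%_. M)))"
   using A K by (intro emeasure_distr[OF r] sets_PiM_I_finite) auto
  also have "?r -` Pi\<^sub>E (t ` K) A \<inter> space (PiM K (%_. M)) = Pi\<^sub>E K (%k. A (t k))"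
  proof (rule Set.set_eqI)
   fix y
   show "y : ?r -` Pi\<^sub>E (t ` K) A \<inter> space (PiM K (%_. M)) \<longleftrightarrow> y : Pi\<^sub>E K (%k. A (t k))"
   proof
    assume y: "y : ?r -` Pi\<^sub>E (t ` K) A \<inter> space (PiM K (%_. M))"
    have "y k : A (t k)" if "k : K" for k
     using y that PiE_mem[of "?r y" "t ` K" A "t k"] by (simp add: inv)
    thus "y : Pi\<^sub>E K (%k. A (t k))" using y by (auto simp: space_PiM PiE_iff)
   next
    assume y: "y : Pi\<^sub>E K (%k. A (t k))"
    have "y k : space M" if "k : K" for k
     using PiE_mem[OF y that] A[of "t k"] that sets.sets_into_space by blast
    thus "y : ?r -` Pi\<^sub>E (t ` K) A \<inter> space (PiM K (%_. M))"
     using y by (auto simp: space_PiM PiE_iff inv)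
   qed
  qed
  also have "emeasure (PiM K (%_. M)) (Pi\<^sub>E K (%k. A (t k))) = (\<Prod>k\<in>K. emeasure M (A (t k)))"
   using A by (intro K.measure_times) auto
  also have "... = (\<Prod>i\<in>t ` K. emeasure M (A i))"
   using t by (simp add: prod.reindex)
  finally show "emeasure (distr (PiM K (%_. M)) (PiM (t ` K) (%_. M)) ?r) (Pi\<^sub>E (t ` K) A) = (\<Prod>i\<in>t ` K. emeasure M (A i))" .
 qed (use K in auto)
 hence "NI (PiM (t ` K) (%_. M)) f = NI (distr (PiM K (%_. M)) (PiM (t ` K) (%_. M)) ?r) f"
  by simp
 also have "... = NI (PiM K (%_. M)) (%y. f (?r y))"
  by (rule nn_integral_distr[OF r]) (simp add: f)
 finally show ?thesis .
qed

lemma nn_integral_HL_Suc: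
 assumes f: "f bm HL (Suc n)"
 shows "NI (HL (Suc n)) f = NI (HL n) (%H. NI (LC n) (%v. NI lborel (%h. f (bord n H v h))))"
proof -
 interpret product_sigma_finite "%_::nat \<times> nat. lborel :: real measure" by standard
 interpret C: product_sigma_finite "%_::nat. lborel :: complex measure" by standard
 interpret LC: sigma_finite_measure "LC n" by (rule sigma_finite_LC)
 let ?M = "(LX n XM LC n) XM (lborel :: real measure)"
 \<comment> \<open>In the coordinates of \<open>hermitian_of\<close>, the last column holds the real
   parts of the border vector and the last row its imaginary parts.\<close>
 define c where "c w = (\<lambda>p\<in>IX (Suc n). if p = (n, n) then snd w else if snd p = n then Re (snd (fst w) (fst p))
   else if fst p = n then Im (snd (fst w) (snd p)) else fst (fst w) p)" for w :: "((nat \<times> nat => real) \<times> (nat => complex)) \<times> real"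
 have X: "(%w. fst (fst w) p) bm ?M" if "p : IX n" for p
  using mcomp[OF mcomp[OF measurable_fst measurable_fst] measurable_component_singleton[OF that, of "%_. lborel :: real measure"]] by simp
 have V: "(%w. snd (fst w) i) bm ?M" if "i < n" for i
  by (rule mcomp[OF mcomp[OF measurable_fst measurable_snd] measurable_component_LC[OF that]])
 have cm: "c : ?M ->M LX (Suc n)" unfolding c_def
 proof (rule measurable_restrict)
  fix p assume p: "p : IX (Suc n)"
  obtain i j where ij: "p = (i, j)" by (cases p)
  have "(%w. if p = (n, n) then snd w else if j = n then Re (snd (fst w) i) else if i = n then Im (snd (fst w) j) else fst (fst w) p) bm ?M"
   using p X[of p] mcomp[OF V[of i] borel_measurable_Re] mcomp[OF V[of j] borel_measurable_Im] by (auto simp: ij less_Suc_eq)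
  thus "(%w. if p = (n, n) then snd w else if snd p = n then Re (snd (fst w) (fst p)) else if fst p = n then Im (snd (fst w) (snd p)) else fst (fst w) p) : ?M ->M lborel"
   unfolding ij fst_conv snd_conv by simp
 qed
 \<comment> \<open>A product measure is determined by its values on boxes. The preimage of a box is
   a box for the corner, a rectangle \<open>?z i\<close> in the plane of each border entry, and a
   set for the last diagonal entry.\<close>
 have D: "distr ?M (LX (Suc n)) c = LX (Suc n)"
 proof (rule PiM_eqI)
  fix A :: "nat \<times> nat => real set" assume A: "!!p. p : IX (Suc n) ==> A p : sets lborel"
  let ?e = "emeasure (lborel :: real measure)" and ?z = "%i. {z. Re z : A (i, n) & Im z : A (n, i)}"
  let ?X = "Pi\<^sub>E (IX n) A" and ?V = "Pi\<^sub>E {..<n} ?z"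
  have z: "?z i : sets borel" "emeasure lborel (?z i) = ?e (A (i, n)) * ?e (A (n, i))" if "i < n" for i
  proof -
   have a[measurable]: "A (i, n) : sets borel" "A (n, i) : sets borel" using A[of "(i, n)"] A[of "(n, i)"] that by auto
   show z: "?z i : sets borel" by measurable
   have "emeasure lborel (?z i) = NI lborel (%a. NI lborel (%b. indicator (?z i) (Complex a b)))"
    using nn_integral_complex[of "indicator (?z i)"] z by simp
   also have "... = NI lborel (%a. indicator (A (i, n)) a * NI lborel (indicator (A (n, i))))"
    by (subst nn_integral_cmult[symmetric]) (auto intro!: nn_integral_cong simp: indicator_def)
   finally show "emeasure lborel (?z i) = ?e (A (i, n)) * ?e (A (n, i))" by (simp add: nn_integral_multc)
  qed
  have X': "?X : sets (LX n)" and V': "?V : sets (LC n)" and n: "A (n, n) : sets lborel"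
   using A z by (auto intro!: sets_PiM_I_finite)
  have eX: "emeasure (LX n) ?X = (\<Prod>p\<in>IX n. ?e (A p))" using A by (intro emeasure_PiM) auto
  have eV: "emeasure (LC n) ?V = (\<Prod>i<n. ?e (A (i, n)) * ?e (A (n, i)))" using z by (subst C.emeasure_PiM) auto
  have "c -` Pi\<^sub>E (IX (Suc n)) A \<inter> space ?M = (?X \<times> ?V) \<times> A (n, n)"
  proof (rule Set.set_eqI)
   fix w :: "((nat \<times> nat => real) \<times> (nat => complex)) \<times> real"
   obtain x v h where w: "w = ((x, v), h)" by (metis surj_pair)
   have "c w : Pi\<^sub>E (IX (Suc n)) A \<longleftrightarrow> (\<forall>i<n. \<forall>j<n. x (i, j) : A (i, j)) & (\<forall>i<n. Re (v i) : A (i, n) & Im (v i) : A (n, i)) & h : A (n, n)"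
    unfolding c_def restrict_PiE_iff w Ball_def split_paired_All mem_Sigma_iff lessThan_iff less_Suc_eq by auto
   thus "w : c -` Pi\<^sub>E (IX (Suc n)) A \<inter> space ?M \<longleftrightarrow> w : (?X \<times> ?V) \<times> A (n, n)"
    by (auto simp: w space_pair_measure space_PiM PiE_iff)
  qed
  hence "emeasure (distr ?M (LX (Suc n)) c) (Pi\<^sub>E (IX (Suc n)) A) = (\<Prod>p\<in>IX n. ?e (A p)) * (\<Prod>i<n. ?e (A (i, n)) * ?e (A (n, i))) * ?e (A (n, n))"
   using A z X' V' n by (subst emeasure_distr[OF cm])
    (auto simp: lborel.emeasure_pair_measure_Times LC.emeasure_pair_measure_Times eX eV intro!: sets_PiM_I_finite)
  also have "... = (\<Prod>p\<in>IX (Suc n). ?e (A p))"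
  proof -
   have "(\<Prod>p\<in>IX m. ?e (A p)) = (\<Prod>i<m. \<Prod>j<m. ?e (A (i, j)))" for m
    by (simp add: prod.cartesian_product case_prod_unfold)
   thus ?thesis by (simp add: prod.distrib mult_ac)
  qed
  finally show "emeasure (distr ?M (LX (Suc n)) c) (Pi\<^sub>E (IX (Suc n)) A) = (\<Prod>p\<in>IX (Suc n). ?e (A p))" .
 qed auto
 have mb: "(%w. bord n (fst (fst w)) (snd (fst w)) (snd w)) : (HL n XM LC n) XM lborel ->M HL (Suc n)"
  by (rule measurable_bord[OF mcomp[OF measurable_fst measurable_fst]])
   (auto intro!: mcomp[OF mcomp[OF measurable_fst measurable_snd] measurable_component_LC])
 have herm: "hermitian_of (Suc n) (c w) = bord n (hermitian_of n (fst (fst w))) (snd (fst w)) (snd w)" for w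
  by (rule eq_matI) (auto simp: bord_def hermitian_of_def c_def less_Suc_eq complex_eq_iff)
 let ?G = "%H v. NI lborel (%h. f (bord n H v h))"
 have G: "(%z. ?G (fst z) (snd z)) bm HL n XM LC n"
  using lborel.borel_measurable_nn_integral[of "%w h. f (bord n (fst w) (snd w) h)"] mcomp[OF mb f] by (simp add: case_prod_beta)
 have "NI (HL (Suc n)) f = NI ?M (%w. f (hermitian_of (Suc n) (c w)))"
  using nn_integral_distr[OF cm, of "%x. f (hermitian_of (Suc n) x)"] mcomp[OF measurable_hermitian_of f] by (simp add: D nn_integral_HL[OF f])
 also have "... = NI (LX n XM LC n) (%u. NI lborel (%h. f (hermitian_of (Suc n) (c (u, h)))))"
  by (rule lborel.nn_integral_fst[symmetric]) (rule mcomp[OF cm mcomp[OF measurable_hermitian_of f]])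
 also have "... = NI (LX n) (%x. NI (LC n) (?G (hermitian_of n x)))"
 proof -
  have "(%z. ?G (hermitian_of n (fst z)) (snd z)) bm LX n XM LC n"
   using mcomp[OF measurable_Pair[OF mcomp[OF measurable_fst measurable_hermitian_of] measurable_snd] G] by simp
  from LC.nn_integral_fst[OF this] show ?thesis by (simp only: herm fst_conv snd_conv)
 qed
 also have "... = NI (HL n) (%H. NI (LC n) (?G H))"
  using LC.borel_measurable_nn_integral[of ?G "HL n"] G by (intro nn_integral_HL[symmetric]) (simp add: case_prod_beta)
 finally show ?thesis .
qed

lemma AE_LC_nonzero: "AE v in LC n. \<forall>i<n. v i ~= 0"
proof -
 interpret finite_product_sigma_finite "%_. lborel :: complex measure" "{..<n}"
  unfolding finite_product_sigma_finite_def finite_product_sigma_finite_axioms_def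
  using product_sigma_finite_lborel by simp
 have "AE v in LC n. v i ~= 0" if i: "i < n" for i
 proof (rule AE_I)
  let ?S = "\<Pi>\<^sub>E j\<in>{..<n}. if j = i then {0} else (UNIV :: complex set)"
  show "{v : space (LC n). ~ v i ~= 0} \<subseteq> ?S"
   by (auto simp: space_PiM PiE_iff extensional_def)
  show "?S : sets (LC n)" by (intro sets_PiM_I_finite) auto
  have "emeasure (LC n) ?S = (\<Prod>j<n. emeasure lborel (if j = i then {0} else (UNIV :: complex set)))"
   by (intro measure_times) auto
  also have "... = 0" using i by (intro prod_zero) (auto intro!: bexI[of _ i])
  finally show "emeasure (LC n) ?S = 0" .
 qed
 hence "AE v in LC n. \<forall>i\<in>{..<n}. v i ~= 0"
  by (intro AE_finite_allI) auto
 thus ?thesis by (simp add: Ball_def)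
qed

text \<open>An eigenvector for x_j has entries v_i / (x_j - y_i), followed by 1: the first
  \<open>n\<close> rows then hold identically and the last row is the secular equation. Interlacing
  keeps the denominators away from 0. Comparing traces expresses the corner entry \<open>h\<close>
  through the two spectra.\<close>

lemma arrow_diagonalize:
 fixes h :: real
 assumes y: "chm n y" and v: "!!i. i < n ==> v i ~= 0"
 defines "x == rts (Suc n) (apol n y (\<lambda>i\<in>{..<n}. (cmod (v i))^2) h)"
 shows "\<exists>U. unitary_mat (Suc n) U & bord n (rdiag n y) v h = conj_by U (rdiag (Suc n) x)"
  and "(\<Sum>i<n. y i) + h = (\<Sum>i<Suc n. x i)"
proof -
 let ?r = "\<lambda>i\<in>{..<n}. (cmod (v i))^2"
 have r: "0 < ?r i" if "i < n" for i using v[OF that] that by simp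
 note I = apol_interlacing[OF y, where r = "?r" and h = h, OF r]
 have rr: "realrooted (Suc n) (apol n y ?r h)" and il: "intl n y x" using I unfolding x_def by blast+
 have cx: "chm (Suc n) x" and px: "pol (Suc n) x = apol n y ?r h"
  using rts_realrooted[OF rr] unfolding x_def by blast+
 have ne: "x j ~= y k" if "j < Suc n" "k < n" for j k
 proof (cases "j <= k")
  case True
  hence "x j <= x k" using cx that unfolding chm_def by (cases "j = k") (auto intro!: less_imp_le)
  thus ?thesis using il that unfolding intl_def by force
 next
  case False
  have "x (Suc k) <= x j"
  proof (cases "j = Suc k")
   case False
   hence "Suc k < j" using \<open>\<not> j \<le> k\<close> by simp
   thus ?thesis using cx that(1) unfolding chm_def by (meson less_imp_le)
  qed simp
  thus ?thesis using il that unfolding intl_def by force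
 qed
 have root: "x j - h - (\<Sum>i<n. ?r i / (x j - y i)) = 0" if j: "j < Suc n" for j
 proof -
  have "poly (pol (Suc n) x) (x j) = 0"
   unfolding poly_pol by (rule prod_zero[OF finite_lessThan bexI[of _ j]]) (use j in simp_all)
  hence "poly (apol n y ?r h) (x j) = 0" unfolding px .
  hence "(\<Prod>k<n. x j - y k) * (x j - h - (\<Sum>i<n. ?r i / (x j - y i))) = 0"
   using poly_apol[of n "x j" y ?r h, OF ne[OF j]] by (simp only:)
  moreover have "(\<Prod>k<n. x j - y k) ~= 0" using ne[OF j] by simp
  ultimately show ?thesis by simp
 qed
 define u where "u j i = (if i < n then v i / complex_of_real (x j - y i) else 1)" for j i
 show ex: "\<exists>U. unitary_mat (Suc n) U & bord n (rdiag n y) v h = conj_by U (rdiag (Suc n) x)"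
 proof (rule distinct_eigenvalues_diagonalize[where u = u])
  show "herm (Suc n) (bord n (rdiag n y) v h)" by (rule herm_bord[OF herm_rdiag])
  show "inj_on x {..<Suc n}" by (rule chm_inj[OF cx])
  show "\<exists>l<Suc n. u j l ~= 0" for j by (rule exI[of _ n]) (simp add: u_def)
  fix j i assume j: "j < Suc n" and i: "i < Suc n"
  show "(\<Sum>l<Suc n. bord n (rdiag n y) v h $$ (i, l) * u j l) = complex_of_real (x j) * u j i"
  proof (cases "i < n")
   case True
   have "(\<Sum>l<n. bord n (rdiag n y) v h $$ (i, l) * u j l) = (\<Sum>l<n. if l = i then complex_of_real (y i) * u j i else 0)"
    using True by (intro sum.cong) (auto simp: bord_index rdiag_index)
   also have "... = complex_of_real (y i) * u j i" using True by simp
   finally have "(\<Sum>l<Suc n. bord n (rdiag n y) v h $$ (i, l) * u j l) = complex_of_real (y i) * (v i / complex_of_real (x j - y i)) + v i"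
    using True by (simp add: bord_index u_def)
   also have "... = complex_of_real (x j) * (v i / complex_of_real (x j - y i))"
    using ne[OF j True] by (simp add: field_simps)
   finally show ?thesis using True by (simp only: u_def if_True)
  next
   case False
   hence i: "i = n" using i by simp
   have "(\<Sum>l<n. bord n (rdiag n y) v h $$ (n, l) * u j l) = (\<Sum>l<n. complex_of_real (?r l / (x j - y l)))"
   proof (intro sum.cong refl)
    fix l assume l: "l : {..<n}"
    have "cnj (v l) * v l = complex_of_real ((cmod (v l))^2)"
     using complex_norm_square[of "v l"] by (simp add: mult.commute)
    thus "bord n (rdiag n y) v h $$ (n, l) * u j l = complex_of_real (?r l / (x j - y l))"
     using l by (simp add: bord_index u_def)
   qed
   hence "(\<Sum>l<Suc n. bord n (rdiag n y) v h $$ (n, l) * u j l) = complex_of_real ((\<Sum>l<n. ?r l / (x j - y l)) + h)"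
    by (simp add: bord_index u_def)
   also have "(\<Sum>l<n. ?r l / (x j - y l)) + h = x j" using root[OF j] by simp
   finally show ?thesis unfolding i by (simp add: u_def)
  qed
 qed
 then obtain U where U: "unitary_mat (Suc n) U" "bord n (rdiag n y) v h = conj_by U (rdiag (Suc n) x)" by blast
 have "mat_trace (bord n (rdiag n y) v h) = complex_of_real ((\<Sum>i<n. y i) + h)"
  by (simp add: mat_trace_def bord_def rdiag_index)
 moreover have "mat_trace (bord n (rdiag n y) v h) = complex_of_real (\<Sum>i<Suc n. x i)"
  unfolding U(2) by (rule mat_trace_conj_rdiag[OF U(1)])
 ultimately show "(\<Sum>i<n. y i) + h = (\<Sum>i<Suc n. x i)" using of_real_eq_iff by metis
qed

section \<open>Integrating out the border, one row at a time\<close>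

definition uinv :: "nat => (complex mat => 'a) => bool" where
 "uinv n f \<longleftrightarrow> (\<forall>U H. unitary_mat n U --> herm n H --> f (conj_by U H) = f H)"

lemma uinvD: "uinv n f ==> unitary_mat n U ==> herm n H ==> f (conj_by U H) = f H"
 by (simp add: uinv_def)

text \<open>Extending \<open>U\<close> by a last diagonal entry 1 rotates corner and border vector
  together and fixes the last diagonal entry.\<close>

lemma bord_conj_by:
 assumes U: "unitary_mat n U" and H: "herm n H"
 shows "\<exists>W. unitary_mat (Suc n) W & (\<forall>v h. bord n (conj_by U H) (cmv n U v) h = conj_by W (bord n H v h))"
proof -
 note Uc = unitary_carrier[OF U] and Hc = hermD(1)[OF H]
 define W where "W = Matrix.mat (Suc n) (Suc n) (%(i, j). if i < n & j < n then U $$ (i, j) else if i = j then 1 else 0)"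
 have Wi: "i < n ==> j < n ==> W $$ (i, j) = U $$ (i, j)" "i < n ==> W $$ (i, n) = 0"
  "j < n ==> W $$ (n, j) = 0" "W $$ (n, n) = 1" for i j by (auto simp: W_def)
 have Wc: "W : carrier_mat (Suc n) (Suc n)" by (simp add: W_def)
 note UU = unitary_columns[OF U]
 have W: "unitary_mat (Suc n) W"
 proof (rule unitary_matI[OF Wc])
  fix i j assume ij: "i < Suc n" "j < Suc n"
  show "(\<Sum>l<Suc n. cnj (W $$ (l, i)) * W $$ (l, j)) = (if i = j then 1 else 0)"
   using ij UU by (cases "i < n"; cases "j < n") (auto simp: Wi less_Suc_eq)
 qed
 have "bord n (conj_by U H) (cmv n U v) h = conj_by W (bord n H v h)" for v h
 proof -
  let ?B = "bord n H v h" and ?C = "bord n (conj_by U H) (cmv n U v) h"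
  have CU: "(\<Sum>l<n. conj_by U H $$ (i, l) * U $$ (l, j)) = (\<Sum>l<n. U $$ (i, l) * H $$ (l, j))" if "i < n" "j < n" for i j
  proof -
   have "conj_by U H * U = U * H * (mat_adjoint U * U)"
    unfolding conj_by_def by (rule assoc_mult_mat[OF mult_carrier_mat[OF Uc Hc] mat_adjoint_carrier[OF Uc] Uc])
   hence "conj_by U H * U = U * H"
    unfolding unitary_left[OF U] right_mult_one_mat[OF mult_carrier_mat[OF Uc Hc]] .
   thus ?thesis
    unfolding mult_index[OF conj_by_carrier[OF U Hc] Uc that, symmetric] mult_index[OF Uc Hc that, symmetric] by simp
  qed
  have vU: "(\<Sum>l<n. cnj (cmv n U v l) * U $$ (l, j)) = cnj (v j)" if "j < n" for j
  proof -
   have "(\<Sum>l<n. cnj (cmv n U v l) * U $$ (l, j)) = (\<Sum>l<n. \<Sum>k<n. cnj (v k) * (cnj (U $$ (l, k)) * U $$ (l, j)))"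
    by (intro sum.cong refl) (simp add: cmv_def sum_distrib_right sum_distrib_left mult_ac)
   also have "... = (\<Sum>k<n. cnj (v k) * (\<Sum>l<n. cnj (U $$ (l, k)) * U $$ (l, j)))"
    by (subst sum.swap) (simp add: sum_distrib_left)
   also have "... = (\<Sum>k<n. if k = j then cnj (v j) else 0)"
    by (intro sum.cong refl) (auto simp: UU that)
   finally show ?thesis using that by simp
  qed
  have "?C * W = W * ?B"
  proof (rule eq_matI)
   fix i j assume "i < dim_row (W * ?B)" "j < dim_col (W * ?B)"
   hence ij: "i < Suc n" "j < Suc n" using Wc by (auto simp: bord_def)
   have "(\<Sum>l<Suc n. ?C $$ (i, l) * W $$ (l, j)) = (\<Sum>l<Suc n. W $$ (i, l) * ?B $$ (l, j))"
    using ij CU[of i j] vU[of j] by (auto simp: less_Suc_eq Wi bord_index cmv_def)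
   thus "(?C * W) $$ (i, j) = (W * ?B) $$ (i, j)"
    unfolding mult_index[OF bord_carrier Wc ij] mult_index[OF Wc bord_carrier ij] .
  qed (use Wc in \<open>auto simp: bord_def\<close>)
  hence "W * ?B * mat_adjoint W = ?C * (W * mat_adjoint W)"
   using assoc_mult_mat[OF bord_carrier[of n "conj_by U H" "cmv n U v" h] Wc mat_adjoint_carrier[OF Wc]] by simp
  thus ?thesis
   unfolding conj_by_def unitary_right[OF W] right_mult_one_mat[OF bord_carrier] by simp
 qed
 thus ?thesis using W by blast
qed

text \<open>The Laplace transform in the direction \<open>diag(\<xi>)\<close> of Lebesgue measure on the Gelfand-Tsetlin patterns with top row \<open>l\<close>.\<close>

primrec GTD :: "nat => (nat => real) => (nat => real) => ennreal" where
 "GTD 0 \<xi> l = 1"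
| "GTD (Suc n) \<xi> l = NI (LR n) (%m. of_bool (intl n m l) *
   ennreal (exp (- \<xi> n * ((\<Sum>i<Suc n. l i) - (\<Sum>i<n. m i)))) * GTD n \<xi> m)"

lemma measurable_intl: "Measurable.pred (LR (Suc n) XM LR n) (%z. intl n (snd z) (fst z))"
proof -
 have a: "(%z. fst z i) bm LR (Suc n) XM LR n" if "i < Suc n" for i
  by (rule mcomp[OF measurable_fst measurable_component_LR[OF that]])
 have b: "(%z. snd z i) bm LR (Suc n) XM LR n" if "i < n" for i
  by (rule mcomp[OF measurable_snd measurable_component_LR[OF that]])
 have "{z : space (LR (Suc n) XM LR n). \<forall>i\<in>{..<n}. fst z i < snd z i & snd z i < fst z (Suc i)} : sets (LR (Suc n) XM LR n)"
  using a b by measurable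
 thus ?thesis by (simp add: pred_def intl_def Ball_def)
qed

lemma measurable_sum_LR: "k <= n ==> (%x. \<Sum>i<k. x i) bm LR n"
 by (intro mi) auto

text \<open>
 The factor \<open>exp (- \<xi> n * h)\<close> is a function of the spectra of the matrix and of its
 corner, since \<open>h\<close> is the difference of their traces.
\<close>

lemma measurable_GTD: "GTD n \<xi> bm LR n"
proof (induction n)
 case (Suc n)
 have "(%(l, m). of_bool (intl n m l) * ennreal (exp (- \<xi> n * ((\<Sum>i<Suc n. l i) - (\<Sum>i<n. m i)))) * GTD n \<xi> m)
   bm LR (Suc n) XM LR n"
  unfolding case_prod_beta
  using measurable_intl mcomp[OF measurable_fst measurable_sum_LR[of "Suc n" "Suc n"], of "LR n"]
   mcomp[OF measurable_snd measurable_sum_LR[of n n], of "LR (Suc n)"]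
   mcomp[OF measurable_snd Suc, of "LR (Suc n)"]
  by (intro mi) (auto intro: measurable_of_bool)
 from sigma_finite_measure.borel_measurable_nn_integral[OF sigma_finite_LR this]
 show ?case by (simp only: GTD.simps)
qed simp

text \<open>Induction on the size. Integrating the border out of \<open>f\<close> leaves a function
  of the corner that is again unitarily invariant, so the hypothesis for \<open>n\<close> replaces
  the corner by its spectrum. For a diagonal corner the border integral is the interlacing law, and
  the interlacing conditions of all steps make up the Gelfand-Tsetlin pattern.\<close>

theorem nn_integral_HL_GT:
 assumes "f bm HL n" "uinv n f"
 shows "NI (HL n) (%H. f H * ennreal (exp (- (\<Sum>i<n. \<xi> i * Re (H $$ (i, i)))))) =
  ennreal (pi ^ (\<Sum>i<n. i)) * NI (LR n) (%l. f (rdiag n l) * ennreal (vdm n l) * GTD n \<xi> l * of_bool (chm n l))"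
 using assms
proof (induction n arbitrary: f)
 case 0
 have "hermitian_of 0 (%_. undefined) = rdiag 0 (%_. undefined)"
  by (rule eq_matI) auto
 moreover have "(%H. f H * ennreal (exp (- (\<Sum>i<0. \<xi> i * Re (H $$ (i, i)))))) bm HL 0"
  using 0 by simp
 ultimately show ?case
  by (simp add: nn_integral_HL 0 PiM_empty nn_integral_count_space_finite vdm_def chm_def)
next
 case (Suc n)
 note f = Suc.prems(1) and inv = Suc.prems(2)
 define w where "w H = ennreal (exp (- (\<Sum>i<n. \<xi> i * Re (H $$ (i, i)))))" for H :: "complex mat"
 define e where "e h = ennreal (exp (- (\<xi> n * h)))" for h
 define G where "G H = NI (LC n) (%v. NI lborel (%h. f (bord n H v h) * e h))" for H
 have em: "e bm borel" unfolding e_def by measurable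
 have dm: "(%H. \<Sum>i<k. \<xi> i * Re (H $$ (i, i))) bm HL m" if "k <= m" for k m
 proof (intro mi)
  fix i assume "i : {..<k}"
  hence "i < m" using that by simp
  thus "(%H. Re (H $$ (i, i))) bm HL m"
   by (intro borel_measurable_complex_iff[THEN iffD1, THEN conjunct1]) (rule measurable_HL_entry[OF _ _ measurable_ident_sets[OF refl]])
 qed
 have wm: "w bm HL n"
  unfolding w_def by (intro mi dm) simp
 have mb: "(%w. bord n (fst (fst w)) (snd (fst w)) (snd w)) : (HL n XM LC n) XM lborel ->M HL (Suc n)"
  by (rule measurable_bord[OF mcomp[OF measurable_fst measurable_fst]])
    (auto intro!: mcomp[OF mcomp[OF measurable_fst measurable_snd] measurable_component_LC])
 have m3: "(%z. f (bord n (fst (fst z)) (snd (fst z)) (snd z)) * e (snd z)) bm (HL n XM LC n) XM lborel"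
  using mcomp[OF mb f] mcomp[OF measurable_snd em[folded measurable_lborel1], of "HL n XM LC n"]
  by (intro mi) auto
 have m2: "(%z. NI lborel (%h. f (bord n (fst z) (snd z) h) * e h)) bm HL n XM LC n"
  using lborel.borel_measurable_nn_integral[of "%z h. f (bord n (fst z) (snd z) h) * e h" "HL n XM LC n"] m3
  by (simp add: case_prod_beta)
 have Gm: "G bm HL n"
  unfolding G_def
  using measurable_NI_LC[of "%H v. NI lborel (%h. f (bord n H v h) * e h)" "HL n" n] m2
  by (simp add: case_prod_beta)
 have m2s: "(%v. NI lborel (%h. f (bord n H v h) * e h)) bm LC n" if "H : space (HL n)" for H
  using mcomp[OF measurable_Pair1'[OF that] m2] by simp
 have m1s: "(%h. f (bord n H v h) * e h) bm borel" if "H : space (HL n)" "v : space (LC n)" for H v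
 proof -
  have "(H, v) : space (HL n XM LC n)" using that by (simp add: space_pair_measure)
  from mcomp[OF measurable_Pair1'[OF this, of lborel] m3] show ?thesis by simp
 qed
 \<comment> \<open>Rotating the corner is undone by rotating the border vector, under which Lebesgue
   measure is invariant.\<close>
 have Ginv: "uinv n G" unfolding uinv_def
 proof (intro allI impI)
  fix U H assume U: "unitary_mat n U" and H: "herm n H"
  obtain W where W: "unitary_mat (Suc n) W" "!!v h. bord n (conj_by U H) (cmv n U v) h = conj_by W (bord n H v h)"
   using bord_conj_by[OF U H] by blast
  have UH: "conj_by U H : space (HL n)" using herm_conj_by[OF U H] by (simp add: space_HL)
  have "G (conj_by U H) = NI (LC n) (%v. NI lborel (%h. f (bord n (conj_by U H) (cmv n U v) h) * e h))"
   unfolding G_def by (rule nn_integral_cmv[OF U m2s[OF UH], symmetric])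
  also have "... = G H"
   unfolding G_def W(2) uinvD[OF inv W(1) herm_bord[OF H]] ..
  finally show "G (conj_by U H) = G H" .
 qed
 define D where "D x = f (rdiag (Suc n) x) * ennreal (vdm (Suc n) x) * of_bool (chm (Suc n) x)" for x
 define L where "L m x = of_bool (intl n m x) * e ((\<Sum>i<Suc n. x i) - (\<Sum>i<n. m i))" for m x
 have Dm: "D bm LR (Suc n)" unfolding D_def by (intro mi mcomp[OF measurable_rdiag f])
 have Lm: "(%z. L (snd z) (fst z)) bm LR (Suc n) XM LR n" unfolding L_def
 proof (intro borel_measurable_times_ennreal)
  show "(%z. of_bool (intl n (snd z) (fst z)) :: ennreal) bm LR (Suc n) XM LR n"
   by (rule mcomp[OF measurable_intl]) simp
  show "(%z. e ((\<Sum>i<Suc n. fst z i) - (\<Sum>i<n. snd z i))) bm LR (Suc n) XM LR n"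
   by (intro mcomp[OF _ em] mi mcomp[OF measurable_fst measurable_sum_LR] mcomp[OF measurable_snd measurable_sum_LR]) auto
 qed
 let ?K = "%m x. D x * (L m x * GTD n \<xi> m)"
 have Km: "(%z. ?K (snd z) (fst z)) bm LR (Suc n) XM LR n"
  by (intro borel_measurable_times_ennreal Lm mcomp[OF measurable_fst Dm] mcomp[OF measurable_snd measurable_GTD])
 \<comment> \<open>The factor \<open>vdm n m\<close> is supplied by the formula for size
   \<open>n\<close> and is just what the interlacing law consumes. Vanishing border entries, for
   which interlacing would not be strict, form a null set.\<close>
 have Gdiag: "ennreal (vdm n m) * G (rdiag n m) = ennreal (pi ^ n) * NI (LR (Suc n)) (%x. D x * L m x)"
  if m: "chm n m" for m
 proof -
  define g where "g x = f (rdiag (Suc n) x) * e ((\<Sum>i<Suc n. x i) - (\<Sum>i<n. m i))" for x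
  have gm: "g bm LR (Suc n)"
   unfolding g_def
   by (intro mi mcomp[OF measurable_rdiag f] mcomp[OF _ em] measurable_sum_LR) simp
  define \<phi> where "\<phi> r = NI lborel (%h. g (rts (Suc n) (apol n m r h)))" for r
  have \<phi>m: "\<phi> bm LR n"
   unfolding \<phi>_def using measurable_apol_integral[OF mcomp[OF measurable_rts gm]] by simp
  have "G (rdiag n m) = NI (LC n) (%v. \<phi> (\<lambda>i\<in>{..<n}. (cmod (v i))^2))"
   unfolding G_def
  proof (rule nn_integral_cong_AE)
   show "AE v in LC n. NI lborel (%h. f (bord n (rdiag n m) v h) * e h) = \<phi> (\<lambda>i\<in>{..<n}. (cmod (v i))^2)"
    using AE_LC_nonzero[of n]
   proof eventually_elim
    case (elim v)
    show ?case unfolding \<phi>_def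
    proof (rule nn_integral_cong)
     fix h :: real
     define x where "x = rts (Suc n) (apol n m (\<lambda>i\<in>{..<n}. (cmod (v i))^2) h)"
     have v: "!!i. i < n ==> v i ~= 0" using elim by blast
     obtain U where U: "unitary_mat (Suc n) U" "bord n (rdiag n m) v h = conj_by U (rdiag (Suc n) x)"
      using arrow_diagonalize(1)[where n = n and v = v and h = h and y = m, OF m v] unfolding x_def by blast
     have "h = (\<Sum>i<Suc n. x i) - (\<Sum>i<n. m i)"
      using arrow_diagonalize(2)[where n = n and v = v and h = h and y = m, OF m v] unfolding x_def by linarith
     thus "f (bord n (rdiag n m) v h) * e h = g x"
      unfolding g_def U(2) uinvD[OF inv U(1) herm_rdiag] by (simp only:)
    qed
   qed
  qed
  also have "... = ennreal (pi ^ n) * NI (LR n) (%r. of_bool (\<forall>i<n. 0 < r i) * \<phi> r)"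
   by (rule nn_integral_LC_polar[OF \<phi>m])
  finally have "ennreal (vdm n m) * G (rdiag n m) = ennreal (pi ^ n) * (ennreal (vdm n m) * NI (LR n) (%r. of_bool (\<forall>i<n. 0 < r i) * \<phi> r))"
   by (simp only: mult.left_commute)
  also have "... = ennreal (pi ^ n) * NI (LR (Suc n)) (%x. g x * ennreal (vdm (Suc n) x) * of_bool (chm (Suc n) x & intl n m x))"
   unfolding \<phi>_def nn_integral_interlacing[OF m gm] ..
  finally show ?thesis unfolding g_def D_def L_def of_bool_conj by (simp only: mult_ac)
 qed
 have fw: "(%H. f H * ennreal (exp (- (\<Sum>i<Suc n. \<xi> i * Re (H $$ (i, i)))))) bm HL (Suc n)"
  by (intro mi f dm order_refl)
 have "NI (HL (Suc n)) (%H. f H * ennreal (exp (- (\<Sum>i<Suc n. \<xi> i * Re (H $$ (i, i)))))) =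
   NI (HL n) (%H. NI (LC n) (%v. NI lborel (%h. w H * (f (bord n H v h) * e h))))"
  unfolding nn_integral_HL_Suc[OF fw]
 proof (intro nn_integral_cong)
  fix H v and h :: real
  have "(\<Sum>i<Suc n. \<xi> i * Re (bord n H v h $$ (i, i))) = (\<Sum>i<n. \<xi> i * Re (H $$ (i, i))) + \<xi> n * h"
   by (simp add: bord_index)
  thus "f (bord n H v h) * ennreal (exp (- (\<Sum>i<Suc n. \<xi> i * Re (bord n H v h $$ (i, i))))) = w H * (f (bord n H v h) * e h)"
   by (simp add: w_def e_def exp_add exp_diff ennreal_mult[symmetric] divide_inverse exp_minus mult_ac)
 qed
 also have "... = NI (HL n) (%H. G H * w H)"
 proof (rule nn_integral_cong)
  fix H assume H: "H : space (HL n)"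
  have "NI (LC n) (%v. NI lborel (%h. w H * (f (bord n H v h) * e h))) = NI (LC n) (%v. w H * NI lborel (%h. f (bord n H v h) * e h))"
   by (intro nn_integral_cong nn_integral_cmult) (use m1s[OF H] in simp)
  also have "... = w H * G H" unfolding G_def by (rule nn_integral_cmult[OF m2s[OF H]])
  finally show "NI (LC n) (%v. NI lborel (%h. w H * (f (bord n H v h) * e h))) = G H * w H" by (simp only: mult.commute)
 qed
 also have "... = ennreal (pi ^ (\<Sum>i<n. i)) * NI (LR n) (%m. G (rdiag n m) * ennreal (vdm n m) * GTD n \<xi> m * of_bool (chm n m))"
  unfolding w_def by (rule Suc.IH[OF Gm Ginv])
 also have "NI (LR n) (%m. G (rdiag n m) * ennreal (vdm n m) * GTD n \<xi> m * of_bool (chm n m)) =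
   NI (LR n) (%m. ennreal (pi ^ n) * NI (LR (Suc n)) (%x. ?K m x))"
 proof (rule nn_integral_cong)
  fix m assume msp: "m : space (LR n)"
  show "G (rdiag n m) * ennreal (vdm n m) * GTD n \<xi> m * of_bool (chm n m) = ennreal (pi ^ n) * NI (LR (Suc n)) (%x. ?K m x)"
  proof (cases "chm n m")
   case True
   have "(%x. D x * L m x) bm LR (Suc n)"
    using mcomp[OF measurable_Pair2'[OF msp] Lm] by (intro borel_measurable_times_ennreal Dm) simp
   from nn_integral_multc[OF this, of "GTD n \<xi> m"] Gdiag[OF True] True show ?thesis by (simp add: mult_ac)
  next
   case False
   hence "?K m x = 0" for x using intl_chm[of n m x] by (auto simp: D_def L_def)
   thus ?thesis using False by (simp only: nn_integral_const mult_zero_left mult_zero_right simp_thms of_bool_eq)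
  qed
 qed
 also have "... = ennreal (pi ^ n) * NI (LR n) (%m. NI (LR (Suc n)) (%x. ?K m x))"
 proof (rule nn_integral_cmult)
  have "(%z. ?K (fst z) (snd z)) bm LR n XM LR (Suc n)"
   using mcomp[OF measurable_Pair[OF measurable_snd measurable_fst] Km] by simp
  thus "(%m. NI (LR (Suc n)) (%x. ?K m x)) bm LR n"
   using measurable_NI_LR[of ?K "LR n" "Suc n"] by (simp add: case_prod_beta)
 qed
 also have "NI (LR n) (%m. NI (LR (Suc n)) (%x. ?K m x)) = NI (LR (Suc n)) (%x. NI (LR n) (%m. ?K m x))"
 proof -
  interpret pair_sigma_finite "LR (Suc n)" "LR n"
   unfolding pair_sigma_finite_def using sigma_finite_LR by blast
  show ?thesis using Fubini'[of "%x m. ?K m x"] Km by (simp add: case_prod_beta)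
 qed
 also have "... = NI (LR (Suc n)) (%x. f (rdiag (Suc n) x) * ennreal (vdm (Suc n) x) * GTD (Suc n) \<xi> x * of_bool (chm (Suc n) x))"
 proof (rule nn_integral_cong)
  fix x assume x: "x : space (LR (Suc n))"
  have "(%m. L m x * GTD n \<xi> m) bm LR n"
   using mcomp[OF measurable_Pair1'[OF x] Lm] by (intro borel_measurable_times_ennreal measurable_GTD) simp
  hence "NI (LR n) (%m. ?K m x) = D x * NI (LR n) (%m. L m x * GTD n \<xi> m)" by (rule nn_integral_cmult)
  also have "NI (LR n) (%m. L m x * GTD n \<xi> m) = GTD (Suc n) \<xi> x"
   by (simp only: GTD.simps L_def e_def mult_minus_left)
  finally show "NI (LR n) (%m. ?K m x) = f (rdiag (Suc n) x) * ennreal (vdm (Suc n) x) * GTD (Suc n) \<xi> x * of_bool (chm (Suc n) x)"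
   by (simp only: D_def mult_ac)
 qed
 also have "ennreal (pi ^ (\<Sum>i<n. i)) * (ennreal (pi ^ n) * NI (LR (Suc n)) (%x. f (rdiag (Suc n) x) * ennreal (vdm (Suc n) x) * GTD (Suc n) \<xi> x * of_bool (chm (Suc n) x))) =
  ennreal (pi ^ (\<Sum>i<Suc n. i)) * NI (LR (Suc n)) (%x. f (rdiag (Suc n) x) * ennreal (vdm (Suc n) x) * GTD (Suc n) \<xi> x * of_bool (chm (Suc n) x))"
  by (simp only: sum.lessThan_Suc power_add ennreal_mult[OF zero_le_power[OF pi_ge_zero] zero_le_power[OF pi_ge_zero]] mult.assoc)
 finally show ?case .
qed

section \<open>Alternants and the Harish-Chandra integral\<close>

definition AD :: "nat => (nat => 'b => 'a::comm_ring_1) => (nat => 'b) => 'a" where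
 "AD n \<psi> x = det (Matrix.mat n n (%(i, j). \<psi> j (x i)))"

lemma AD_leibniz: "AD n \<psi> x = (\<Sum>p | p permutes {0..<n}. signof p * (\<Prod>i<n. \<psi> (p i) (x i)))"
 unfolding AD_def det_def'[OF mat_carrier]
 by (intro sum.cong refl arg_cong2[where f = "(*)"] prod.cong) (auto simp: permutes_in_image[of _ "{0..<n}", simplified] atLeast0LessThan)

lemma AD_cong: "(!!i j. i < n ==> j < n ==> \<psi> j (x i) = \<phi> j (y i)) ==> AD n \<psi> x = AD n \<phi> y"
 unfolding AD_def by (intro arg_cong[where f = det] cong_mat) auto

lemma AD_permute: "p permutes {0..<n} ==> AD n \<psi> (x o p) = signof p * AD n \<psi> x"
proof -
 assume p: "p permutes {0..<n}"
 have "det (Matrix.mat n n (%(i, j). Matrix.mat n n (%(i, j). \<psi> j (x i)) $$ (p i, j))) = signof p * AD n \<psi> x"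
  unfolding AD_def by (rule det_permute_rows[OF mat_carrier p])
 moreover have "Matrix.mat n n (%(i, j). Matrix.mat n n (%(i, j). \<psi> j (x i)) $$ (p i, j)) = Matrix.mat n n (%(i, j). \<psi> j ((x o p) i))"
  using permutes_in_image[OF p] by (intro cong_mat) auto
 ultimately show ?thesis by (simp add: AD_def)
qed

lemma AD_row_scale: "AD n (%j t. c t * \<psi> j t) x = (\<Prod>i<n. c (x i)) * AD n \<psi> x"
 by (simp add: AD_leibniz prod.distrib sum_distrib_left mult_ac)

lemma AD_col_scale: "AD n (%j t. d j * \<psi> j t) x = (\<Prod>j<n. d j) * AD n \<psi> x"
proof -
 have "(\<Prod>i<n. d (p i)) = (\<Prod>j<n. d j)" if "p permutes {0..<n}" for p
  using prod.permute[of p "{..<n}" d] that by (simp add: atLeast0LessThan o_def)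
 thus ?thesis
  unfolding AD_leibniz prod.distrib sum_distrib_left by (intro sum.cong refl) (simp add: mult_ac)
qed

text \<open>Subtracting from each row the preceding one turns the constant first column into the
  first unit vector; what remains is the block of differences.\<close>

lemma AD_differences:
 fixes P :: "nat => 'b => 'a::idom"
 shows "AD (Suc n) (%j t. case j of 0 => 1 | Suc j => P j t) x
  = det (Matrix.mat n n (%(i, j). P j (x (Suc i)) - P j (x i)))"
proof -
 define A where "A = Matrix.mat (Suc n) (Suc n) (%(i, j). case j of 0 => 1 | Suc j => P j (x i))"
 define L where "L = Matrix.mat (Suc n) (Suc n) (%(i, j). if i = j then 1 else if i = Suc j then - 1 else (0::'a))"
 define B where "B = four_block_mat (1\<^sub>m 1) (Matrix.mat 1 n (%(i, j). P j (x 0))) (0\<^sub>m n 1)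
   (Matrix.mat n n (%(i, j). P j (x (Suc i)) - P j (x i)))"
 have Ac: "A : carrier_mat (Suc n) (Suc n)" and Lc: "L : carrier_mat (Suc n) (Suc n)"
  by (simp_all add: A_def L_def)
 have "L * A = B"
 proof (rule eq_matI)
  fix i j assume "i < dim_row B" "j < dim_col B"
  hence ij: "i < Suc n" "j < Suc n" by (auto simp: B_def)
  have "(\<Sum>k<Suc n. L $$ (i, k) * A $$ (k, j)) = (\<Sum>k<Suc n. (if i = k then A $$ (k, j) else 0) - (if i = Suc k then A $$ (k, j) else 0))"
   using ij by (intro sum.cong) (auto simp: L_def)
  also have "... = A $$ (i, j) - (if i = 0 then 0 else A $$ (i - 1, j))"
   unfolding sum_subtractf using ij by (cases i) (simp_all add: sum.delta)
  also have "... = B $$ (i, j)"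
   using ij by (cases i; cases j) (auto simp: A_def B_def)
  finally show "(L * A) $$ (i, j) = B $$ (i, j)" unfolding mult_index[OF Lc Ac ij] .
 qed (auto simp: B_def L_def A_def)
 moreover have "det L = 1"
  by (subst det_lower_triangular[OF _ Lc]) (auto simp: L_def prod_list_diag_prod)
 moreover have "det B = det (Matrix.mat n n (%(i, j). P j (x (Suc i)) - P j (x i)))"
  unfolding B_def by (subst det_four_block_mat_lower_left_zero) auto
 ultimately show ?thesis
  using det_mult[OF Lc Ac] by (simp add: AD_def A_def)
qed

text \<open>A unit triangular matrix \<open>T\<close> replaces the monomials by the Newton
  polynomials \<open>pol j x\<close>. Their values at the nodes form a lower triangular matrix with
  the factors of the Vandermonde product on its diagonal.\<close>

lemma vandermonde: "AD n (%j t. t ^ j) x = vdm n (x :: nat => real)"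
proof -
 define V where "V = Matrix.mat n n (%(i, j). x i ^ j)"
 define T where "T = Matrix.mat n n (%(m, j). coeff (pol j x) m)"
 define L where "L = Matrix.mat n n (%(i, j). \<Prod>k<j. x i - x k)"
 have Vc: "V : carrier_mat n n" and Tc: "T : carrier_mat n n" and Lc: "L : carrier_mat n n"
  by (simp_all add: V_def T_def L_def)
 have "V * T = L"
 proof (rule eq_matI)
  fix i j assume "i < dim_row L" "j < dim_col L"
  hence ij: "i < n" "j < n" by (auto simp: L_def)
  have "(\<Sum>m<n. V $$ (i, m) * T $$ (m, j)) = (\<Sum>m<n. coeff (pol j x) m * x i ^ m)"
   using ij by (intro sum.cong) (auto simp: V_def T_def)
  also have "... = (\<Sum>m\<le>degree (pol j x). coeff (pol j x) m * x i ^ m)"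
   using ij monic_pol[of j x] by (intro sum.mono_neutral_right) (auto simp: coeff_eq_0)
  also have "... = L $$ (i, j)" using ij by (simp add: poly_altdef[symmetric] poly_pol L_def)
  finally show "(V * T) $$ (i, j) = L $$ (i, j)" unfolding mult_index[OF Vc Tc ij] .
 qed (auto simp: V_def T_def L_def)
 moreover have "det T = 1"
 proof -
  have "coeff (pol j x) m = 0" if "j < m" for j m using that monic_pol[of j x] by (simp add: coeff_eq_0)
  moreover have "coeff (pol j x) j = 1" for j using monic_pol[of j x] by (auto dest: arg_cong[where f = "coeff _"])
  ultimately show ?thesis
   by (subst det_upper_triangular[OF _ Tc]) (auto simp: T_def prod_list_diag_prod)
 qed
 moreover have "det L = vdm n x"
  by (subst det_lower_triangular[OF _ Lc]) (auto simp: L_def prod_list_diag_prod vdm_def atLeast0LessThan)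
 ultimately show ?thesis using det_mult[OF Vc Tc] by (simp add: AD_def V_def)
qed

lemma continuous_AD:
 fixes \<psi> :: "nat => 'b => real"
 assumes "!!i j. i < n ==> j < n ==> ((%k. \<psi>' k j (y k i)) \<longlongrightarrow> \<psi> j (x i)) F"
 shows "((%k. AD n (\<psi>' k) (y k)) \<longlongrightarrow> AD n \<psi> x) F"
 unfolding AD_leibniz
 by (intro tendsto_sum tendsto_mult tendsto_const tendsto_prod assms)
   (auto simp: permutes_in_image[of _ "{0..<n}", simplified])

lemma measurable_AD:
 fixes \<psi> :: "'c => nat => 'b => real"
 assumes "!!i j. i < n ==> j < n ==> (%w. \<psi> w j (y w i)) bm M"
 shows "(%w. AD n (\<psi> w) (y w)) bm M"
 unfolding AD_leibniz
 by (intro mi assms)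
   (auto simp: permutes_in_image[of _ "{0..<n}", simplified])

section \<open>Alternants integrated over interlacing points\<close>

text \<open>The region interlacing \<open>l\<close> is a product of intervals, so every Leibniz term
  factorises and integrates to differences of the primitives \<open>P j\<close>. By
  \<open>AD_differences\<close> these form an alternant with one more row and a constant column. The
  factor \<open>c\<close> makes the integrand nonnegative.\<close>

lemma nn_integral_interlacing_AD:
 assumes l: "chm (Suc n) l"
  and D: "!!j t. j < n ==> (P j has_real_derivative \<phi> j t) (at t)"
  and cont: "!!j. j < n ==> continuous_on UNIV (\<phi> j)"
  and pos: "!!m. intl n m l ==> 0 <= c * AD n \<phi> m"
 defines "v == c * AD (Suc n) (%j t. case j of 0 => 1 | Suc j => P j t) l"
 shows "NI (LR n) (%m. of_bool (intl n m l) * ennreal (c * AD n \<phi> m)) = ennreal v" and "0 <= v"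
proof -
 interpret product_sigma_finite "%_::nat. lborel :: real measure" by (rule product_sigma_finite_lborel)
 define F where "F m = indicator {m. intl n m l} m * (c * AD n \<phi> m)" for m
 define g where "g j i t = indicator {l i<..<l (Suc i)} t * \<phi> j t" for j i t
 have g: "has_bochner_integral lborel (g j i) (P j (l (Suc i)) - P j (l i))" if "j < n" "i < n" for i j
 proof -
  have le: "l i <= l (Suc i)" using l that unfolding chm_def by (simp add: less_imp_le)
  have "has_bochner_integral lborel (%t. \<phi> j t * indicator {l i..l (Suc i)} t) (P j (l (Suc i)) - P j (l i))"
   by (rule has_bochner_integral_FTC_Icc_real[OF le D[OF that(1)]])
     (use cont[OF that(1)] continuous_on_eq_continuous_at[of UNIV "\<phi> j"] in auto)
  moreover have "AE t in lborel. \<phi> j t * indicator {l i..l (Suc i)} t = g j i t"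
   using AE_lborel_singleton[of "l i"] AE_lborel_singleton[of "l (Suc i)"]
   by eventually_elim (auto simp: g_def indicator_def)
  moreover have "\<phi> j bm borel" by (rule borel_measurable_continuous_onI[OF cont[OF that(1)]])
  ultimately show ?thesis
   by (subst (asm) has_bochner_integral_cong_AE[where g = "g j i"]) (auto simp: g_def cong: measurable_cong)
 qed
 have F_eq: "F m = c * (\<Sum>p | p permutes {0..<n}. signof p * (\<Prod>i<n. g (p i) i (m i)))" for m
 proof -
  have "indicator {m. intl n m l} m = (\<Prod>i<n. indicator {l i<..<l (Suc i)} (m i) :: real)"
   by (auto simp: indicator_def intl_def prod_eq_1_iff)
  thus ?thesis by (simp add: F_def AD_leibniz g_def prod.distrib sum_distrib_left mult_ac)
 qed
 have pn: "p i < n" if "p permutes {0..<n}" "i < n" for p i using permutes_in_image[OF that(1), of i] that by simp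
 have int: "integrable (LR n) (%m. \<Prod>i<n. g (p i) i (m i))" if "p permutes {0..<n}" for p
  using g pn[OF that] by (intro product_integrable_prod) (auto simp: has_bochner_integral_iff)
 have "integral\<^sup>L (LR n) F = c * (\<Sum>p | p permutes {0..<n}. signof p * (LINT m|LR n. (\<Prod>i<n. g (p i) i (m i))))"
  unfolding F_eq using int by (subst integral_mult_right_zero, subst Bochner_Integration.integral_sum) auto
 also have "... = c * (\<Sum>p | p permutes {0..<n}. signof p * (\<Prod>i<n. P (p i) (l (Suc i)) - P (p i) (l i)))"
 proof (intro arg_cong2[where f = "(*)"] sum.cong refl)
  fix p assume "p : {p. p permutes {0..<n}}"
  hence p: "p permutes {0..<n}" by simp
  show "(LINT m|LR n. (\<Prod>i<n. g (p i) i (m i))) = (\<Prod>i<n. P (p i) (l (Suc i)) - P (p i) (l i))"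
   using g pn[OF p] by (subst product_integral_prod) (auto simp: has_bochner_integral_iff intro!: prod.cong)
 qed
 also have "(\<Sum>p | p permutes {0..<n}. signof p * (\<Prod>i<n. P (p i) (l (Suc i)) - P (p i) (l i))) =
   det (Matrix.mat n n (%(i, j). P j (l (Suc i)) - P j (l i)))"
  unfolding det_def'[OF mat_carrier] using pn by (intro sum.cong refl) (simp add: atLeast0LessThan)
 finally have val: "integral\<^sup>L (LR n) F = v" unfolding v_def AD_differences .
 have F0: "0 <= F m" for m using pos[of m] by (auto simp: F_def indicator_def)
 have Fi: "integrable (LR n) F"
  unfolding F_eq using int by (intro Bochner_Integration.integrable_mult_right Bochner_Integration.integrable_sum) auto
 have "NI (LR n) (%m. of_bool (intl n m l) * ennreal (c * AD n \<phi> m)) = NI (LR n) (%m. ennreal (F m))"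
  by (intro nn_integral_cong) (simp add: F_def indicator_def)
 also have "... = ennreal v" unfolding nn_integral_eq_integral[OF Fi AE_I2[OF F0]] val ..
 finally show "NI (LR n) (%m. of_bool (intl n m l) * ennreal (c * AD n \<phi> m)) = ennreal v" .
 show "0 <= v" unfolding val[symmetric] by (rule Bochner_Integration.integral_nonneg[OF F0])
qed

text \<open>The volume of the Gelfand-Tsetlin polytope. Each integration raises the degree of every
  column by one, dividing it by the new degree; over all levels these divisors multiply to the
  product of factorials.\<close>

lemma GTD_0: "chm n l ==> GTD n (%_. 0) l = ennreal (vdm n l / (\<Prod>i<n. fact i))"
proof (induction n arbitrary: l)
 case (Suc n)
 let ?c = "1 / (\<Prod>i<n. fact i) :: real"
 have c: "0 < ?c" by (simp add: prod_pos)
 have pos: "0 <= ?c * AD n (%j t. t ^ j) m" if "intl n m l" for m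
  unfolding vandermonde using c vdm_pos[OF intl_chm[OF that Suc.prems]] by simp
 have "GTD (Suc n) (%_. 0) l = NI (LR n) (%m. of_bool (intl n m l) * ennreal (?c * AD n (%j t. t ^ j) m))"
  unfolding GTD.simps vandermonde
  using Suc.IH[OF intl_chm[OF _ Suc.prems]] by (intro nn_integral_cong) auto
 also have "... = ennreal (?c * AD (Suc n) (%j t. case j of 0 => 1 | Suc j => t ^ Suc j / real (Suc j)) l)"
 proof (rule nn_integral_interlacing_AD(1)[OF Suc.prems _ _ pos])
  show "((%t. t ^ Suc j / real (Suc j)) has_real_derivative t ^ j) (at t)" for j t
   using DERIV_cdivide[OF DERIV_pow[of "Suc j" t], of "real (Suc j)"] by simp
 qed (auto intro!: continuous_intros)
 also have "AD (Suc n) (%j t. case j of 0 => 1 | Suc j => t ^ Suc j / real (Suc j)) l =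
   AD (Suc n) (%j t. (case j of 0 => 1 | Suc j => 1 / real (Suc j)) * t ^ j) l"
  by (rule AD_cong) (auto split: nat.split)
 also have "... = (1 / fact n) * vdm (Suc n) l"
  unfolding AD_col_scale vandermonde prod.lessThan_Suc_shift by (simp add: fact_prod_Suc prod_dividef atLeast0LessThan)
 finally show ?case by simp
qed (simp add: vdm_def)

text \<open>The columns are reversed so that the determinants for \<open>n\<close> and \<open>Suc n\<close> are related without signs.\<close>

definition XD :: "nat => (nat => real) => (nat => real) => real" where
 "XD n l \<xi> = AD n (%j t. exp (- \<xi> (n - Suc j) * t)) l"

text \<open>The determinantal form of the Harish-Chandra integral. Integrating an exponential column
  divides it by \<open>\<xi> n - \<xi> (n - Suc j)\<close>, and these divisors are the factors by
  which \<open>vdm (Suc n) \<xi>\<close> exceeds \<open>vdm n \<xi>\<close>; distinctness keeps them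
  nonzero.\<close>

theorem GTD_eq:
 assumes "chm n l" "inj_on \<xi> {..<n}"
 shows "GTD n \<xi> l = ennreal (XD n l \<xi> / vdm n \<xi>)" and "0 <= XD n l \<xi> / vdm n \<xi>"
proof -
 have "GTD n \<xi> l = ennreal (XD n l \<xi> / vdm n \<xi>) & 0 <= XD n l \<xi> / vdm n \<xi>" using assms
 proof (induction n arbitrary: l)
  case (Suc n)
  have inj: "inj_on \<xi> {..<n}" by (rule inj_on_subset[OF Suc.prems(2)]) auto
  note IH = Suc.IH[OF intl_chm[OF _ Suc.prems(1)] inj]
  \<comment> \<open>The weight exp(\<xi>_n times the sum of the m_i) is distributed over the rows.
    In the alternant of size \<open>Suc n\<close> the same row factor turns the column of \<xi>_n
    into the constant column.\<close>
  let ?\<phi> = "%j t. exp (\<xi> n * t) * exp (- \<xi> (n - Suc j) * t)"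
  let ?P = "%j t. exp ((\<xi> n - \<xi> (n - Suc j)) * t) / (\<xi> n - \<xi> (n - Suc j))"
  let ?c = "exp (- \<xi> n * (\<Sum>i<Suc n. l i)) / vdm n \<xi>"
  have ne: "\<xi> n ~= \<xi> (n - Suc j)" if "j < n" for j using inj_onD[OF Suc.prems(2), of n "n - Suc j"] that by fastforce
  have \<phi>: "?c * AD n ?\<phi> m = exp (- \<xi> n * ((\<Sum>i<Suc n. l i) - (\<Sum>i<n. m i))) * (XD n m \<xi> / vdm n \<xi>)" for m
  proof -
   have "(\<Prod>i<n. exp (\<xi> n * m i)) = exp (\<xi> n * (\<Sum>i<n. m i))" by (simp add: exp_sum sum_distrib_left)
   thus ?thesis
    unfolding AD_row_scale XD_def right_diff_distrib mult_minus_left by (simp only: exp_diff exp_minus) (simp add: field_simps)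
  qed
  have pos: "0 <= ?c * AD n ?\<phi> m" if "intl n m l" for m
   unfolding \<phi> using IH[OF that] by (intro mult_nonneg_nonneg) auto
  have D: "(?P j has_real_derivative ?\<phi> j t) (at t)" if "j < n" for j t
  proof -
   have "((%t. exp ((\<xi> n - \<xi> (n - Suc j)) * t) / (\<xi> n - \<xi> (n - Suc j))) has_real_derivative
     exp ((\<xi> n - \<xi> (n - Suc j)) * t) * (\<xi> n - \<xi> (n - Suc j)) / (\<xi> n - \<xi> (n - Suc j))) (at t)"
    by (rule DERIV_cdivide) (auto intro!: derivative_eq_intros)
   thus ?thesis using ne[OF that] by (simp add: exp_add[symmetric] left_diff_distrib)
  qed
  have "?c * AD (Suc n) (%j t. case j of 0 => 1 | Suc j => ?P j t) l
    = ?c * AD (Suc n) (%j t. (case j of 0 => 1 | Suc j => 1 / (\<xi> n - \<xi> (n - Suc j))) * (exp (\<xi> n * t) * exp (- \<xi> (Suc n - Suc j) * t))) l"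
   by (intro arg_cong2[where f = "(*)"] AD_cong refl) (auto split: nat.split simp: exp_add[symmetric] left_diff_distrib)
  also have "... = (\<Prod>j<n. 1 / (\<xi> n - \<xi> (n - Suc j))) * XD (Suc n) l \<xi> / vdm n \<xi>"
  proof -
   have "(\<Prod>i<Suc n. exp (\<xi> n * l i)) = exp (\<xi> n * (\<Sum>i<Suc n. l i))" by (simp only: exp_sum[OF finite_lessThan] sum_distrib_left)
   moreover have "(\<Prod>j<Suc n. case j of 0 => 1 | Suc j => 1 / (\<xi> n - \<xi> (n - Suc j))) = (\<Prod>j<n. 1 / (\<xi> n - \<xi> (n - Suc j)))"
    by (subst prod.lessThan_Suc_shift) simp
   ultimately show ?thesis
    unfolding AD_col_scale AD_row_scale XD_def mult_minus_left exp_minus by (simp only:) (simp add: field_simps)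
  qed
  also have "(\<Prod>j<n. 1 / (\<xi> n - \<xi> (n - Suc j))) = 1 / (\<Prod>j<n. \<xi> n - \<xi> j)"
   by (simp add: prod_dividef prod.nat_diff_reindex[of "%j. \<xi> n - \<xi> j"])
  finally have v: "?c * AD (Suc n) (%j t. case j of 0 => 1 | Suc j => ?P j t) l = XD (Suc n) l \<xi> / vdm (Suc n) \<xi>"
   by (simp add: vdm_Suc)
  have "GTD (Suc n) \<xi> l = NI (LR n) (%m. of_bool (intl n m l) * ennreal (?c * AD n ?\<phi> m))"
   unfolding GTD.simps \<phi> using IH by (intro nn_integral_cong) (auto simp: ennreal_mult simp del: sum.lessThan_Suc times_divide_eq_right)
  also have "... = ennreal (XD (Suc n) l \<xi> / vdm (Suc n) \<xi>)"
   unfolding v[symmetric]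
   by (rule nn_integral_interlacing_AD(1)[OF Suc.prems(1) D _ pos]) (auto intro!: continuous_intros)
  finally have 1: "GTD (Suc n) \<xi> l = ennreal (XD (Suc n) l \<xi> / vdm (Suc n) \<xi>)" .
  have "0 <= XD (Suc n) l \<xi> / vdm (Suc n) \<xi>"
   unfolding v[symmetric]
   by (rule nn_integral_interlacing_AD(2)[OF Suc.prems(1) D _ pos]) (auto intro!: continuous_intros)
  with 1 show ?case by blast
 qed (simp add: XD_def AD_def vdm_def)
 thus "GTD n \<xi> l = ennreal (XD n l \<xi> / vdm n \<xi>)" "0 <= XD n l \<xi> / vdm n \<xi>" by blast+
qed

text \<open>For nonnegative data, interlacing bounds the sum of the lower row by that of the upper
  one, so every exponent is at most 0. Together with \<open>GTD_0\<close> this is a bound uniform in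
  \<open>\<xi>\<close>, used for dominated convergence.\<close>

lemma GTD_mono:
 assumes "chm n l" "!!i. i < n ==> 0 <= l i" "!!i. i < n ==> 0 <= \<xi> i"
 shows "GTD n \<xi> l <= GTD n (%_. 0) l"
 using assms
proof (induction n arbitrary: l)
 case (Suc n)
 show ?case unfolding GTD.simps
 proof (rule nn_integral_mono)
  fix m
  have "of_bool (intl n m l) * ennreal (exp (- \<xi> n * ((\<Sum>i<Suc n. l i) - (\<Sum>i<n. m i)))) * GTD n \<xi> m
    <= of_bool (intl n m l) * 1 * GTD n (%_. 0) m" if i: "intl n m l"
  proof (intro mult_mono mult_left_mono)
   have "(\<Sum>i<n. m i) <= (\<Sum>i<n. l (Suc i))" using i by (intro sum_mono) (auto simp: intl_def less_imp_le)
   also have "... <= (\<Sum>i<Suc n. l i)" using Suc.prems(2) unfolding sum.lessThan_Suc_shift by simp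
   finally have "- \<xi> n * ((\<Sum>i<Suc n. l i) - (\<Sum>i<n. m i)) <= 0"
    using Suc.prems(3)[of n] by (simp add: mult_nonneg_nonneg del: sum.lessThan_Suc)
   thus "ennreal (exp (- \<xi> n * ((\<Sum>i<Suc n. l i) - (\<Sum>i<n. m i)))) <= 1"
    by (simp add: ennreal_le_1 del: sum.lessThan_Suc)
   have "0 <= m i" if "i < n" for i using i Suc.prems(2)[of i] that by (force simp: intl_def)
   thus "GTD n \<xi> m <= GTD n (%_. 0) m" using Suc.IH[OF intl_chm[OF i Suc.prems(1)]] Suc.prems(3) by simp
  qed auto
  thus "of_bool (intl n m l) * ennreal (exp (- \<xi> n * ((\<Sum>i<Suc n. l i) - (\<Sum>i<n. m i)))) * GTD n \<xi> m
    <= of_bool (intl n m l) * ennreal (exp (- 0 * ((\<Sum>i<Suc n. l i) - (\<Sum>i<n. m i)))) * GTD n (%_. 0) m"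
   by (cases "intl n m l") simp_all
 qed
qed simp

section \<open>Spectral integration\<close>

lemma sorting_permutation:
 fixes x :: "nat => real"
 assumes "inj_on x {..<n}"
 shows "\<exists>!p. p permutes {0..<n} & chm n (x o p)"
proof -
 define s where "s = sorted_list_of_set (x ` {..<n})"
 have s: "length s = n" "sorted_wrt (<) s" "set s = x ` {..<n}"
  using card_image[OF assms] by (simp_all add: s_def strict_sorted_iff)
 define p where "p i = (if i < n then the_inv_into {..<n} x (s ! i) else i)" for i
 have xp: "x (p i) = s ! i" if "i < n" for i
  using that s f_the_inv_into_f[OF assms, of "s ! i"] nth_mem[of i s] by (auto simp: p_def)
 have pm: "p i : {0..<n}" if "i < n" for i
  using that s the_inv_into_into[OF assms, of "s ! i" "{..<n}"] nth_mem[of i s] by (auto simp: p_def)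
 have inj: "inj_on p {0..<n}"
 proof (rule inj_onI)
  fix i j assume "i : {0..<n}" "j : {0..<n}" "p i = p j"
  thus "i = j" using xp[of i] xp[of j] s(1) s(2) by (auto simp: strict_sorted_iff distinct_conv_nth)
 qed
 have p: "p permutes {0..<n}"
 proof (rule bij_imp_permutes)
  show "bij_betw p {0..<n} {0..<n}"
   using inj pm by (simp add: bij_betw_def endo_inj_surj image_subset_iff)
 qed (simp add: p_def)
 show ?thesis
 proof (rule ex1I[of _ p])
  show "p permutes {0..<n} & chm n (x o p)"
   using p xp s(1) sorted_wrt_nth_less[OF s(2)] by (auto simp: chm_def)
 next
  fix q assume q: "q permutes {0..<n} & chm n (x o q)"
  have pol: "pol n (x o r) = pol n x" if "r permutes {0..<n}" for r
   using prod.permute[of r "{..<n}" "%i. [:- x i, 1:]"] that by (simp add: pol_def o_def atLeast0LessThan)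
  have "chm n (x o p)" using xp s(1) sorted_wrt_nth_less[OF s(2)] by (auto simp: chm_def)
  hence "x (q i) = x (p i)" if "i < n" for i
   using chm_unique[of n "x o q" "x o p"] q pol[OF p] pol[of q] that by simp
  moreover have "q i < n" "p i < n" if "i < n" for i
   using permutes_in_image[of q "{0..<n}" i] q pm[OF that] that by auto
  ultimately have "q i = p i" if "i < n" for i using inj_onD[OF assms] that by blast
  moreover have "q i = p i" if "~ i < n" for i
   using that p q permutes_not_in[of q "{0..<n}" i] permutes_not_in[of p "{0..<n}" i] by auto
  ultimately show "q = p" by blast
 qed
qed

lemma AE_LR_Suc:
 assumes P: "Measurable.pred (LR (Suc n)) P" and A: "AE x in LR n. AE t in lborel. P (x(n := t))"
 shows "AE x in LR (Suc n). P x"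
proof -
 have "NI (LR (Suc n)) (%x. of_bool (~ P x)) = NI (LR n) (%x. NI lborel (%t. of_bool (~ P (x(n := t)))))"
  using P by (intro nn_integral_LR_Suc(1)) simp
 also have "... = NI (LR n) (%x. 0)"
 proof (rule nn_integral_cong_AE, use A in eventually_elim)
  fix x assume "AE t in lborel. P (x(n := t))"
  hence "NI lborel (%t. of_bool (~ P (x(n := t)))) = NI lborel (%(t::real). 0)"
   by (intro nn_integral_cong_AE) (auto elim: eventually_mono)
  thus "NI lborel (%t. of_bool (~ P (x(n := t)))) = 0" by simp
 qed
 finally have "NI (LR (Suc n)) (%x. of_bool (~ P x)) = 0" by simp
 hence "AE x in LR (Suc n). (of_bool (~ P x) :: ennreal) = 0"
  using P by (subst (asm) nn_integral_0_iff_AE) auto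
 thus ?thesis by (auto elim: eventually_mono split: if_splits)
qed

text \<open>Given the others, the last coordinate has to avoid the finite set of 0 and the
  \<plusminus>x_j. Squares matter because the kernels below have \<open>vdm n (sq x)\<close> in the
  denominator.\<close>

lemma AE_LR_nondegenerate: "AE x in LR n. \<forall>i<n. x i ~= 0 & (\<forall>j<i. (x i)^2 ~= (x j)^2)"
proof (induction n)
 case (Suc n)
 have c: "(%x. x i) bm LR k" if "i < k" for i k by (rule measurable_component_LR[OF that])
 have "{x : space (LR (Suc n)). \<forall>i\<in>{..<Suc n}. x i ~= 0 & (\<forall>j\<in>{..<i}. (x i)^2 ~= (x j)^2)} : sets (LR (Suc n))"
  by (intro sets.sets_Collect_finite_All sets.sets_Collect_conj borel_measurable_neq mi c finite_lessThan) auto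
 hence m: "Measurable.pred (LR (Suc n)) (%x. \<forall>i<Suc n. x i ~= 0 & (\<forall>j<i. (x i)^2 ~= (x j)^2))"
  unfolding pred_def Ball_def lessThan_iff .
 show ?case
 proof (rule AE_LR_Suc[OF m], use Suc in eventually_elim)
  fix x :: "nat => real" assume x: "\<forall>i<n. x i ~= 0 & (\<forall>j<i. (x i)^2 ~= (x j)^2)"
  have "insert 0 (\<Union>j<n. {x j, - x j}) : null_sets lborel" by (intro finite_imp_null_set_lborel) simp
  from AE_not_in[OF this] show "AE t in lborel. \<forall>i<Suc n. (x(n := t)) i ~= 0 & (\<forall>j<i. ((x(n := t)) i)^2 ~= ((x(n := t)) j)^2)"
   by (rule AE_mp) (use x in \<open>auto simp: less_Suc_eq power2_eq_iff\<close>)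
 qed
qed simp

lemma nn_integral_LR_permute:
 assumes p: "p permutes {0..<n}" and f: "f bm LR n"
 shows "NI (LR n) (%x. f (x o p)) = NI (LR n) f"
proof -
 define t where "t = Hilbert_Choice.inv p"
 have t: "t permutes {0..<n}" unfolding t_def by (rule permutes_inv[OF p])
 have im: "t ` {..<n} = {..<n}" using permutes_image[OF t] by (simp add: atLeast0LessThan)
 have inj: "inj_on t {..<n}" by (rule permutes_inj_on[OF t])
 have "NI (LR n) f = NI (LR n) (%y. f (\<lambda>i\<in>{..<n}. y (the_inv_into {..<n} t i)))"
  using nn_integral_PiM_reindex[OF finite_lessThan inj lborel.sigma_finite_measure_axioms, of f] f by (simp add: im)
 also have "... = NI (LR n) (%x. f (x o p))"
 proof (rule nn_integral_cong)
  fix y assume y: "y : space (LR n)"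
  have "(\<lambda>i\<in>{..<n}. y (the_inv_into {..<n} t i)) = y o p"
  proof
   fix i
   show "(\<lambda>i\<in>{..<n}. y (the_inv_into {..<n} t i)) i = (y o p) i"
   proof (cases "i < n")
    case True
    have "p i < n" using permutes_in_image[OF p, of i] True by simp
    moreover have "t (p i) = i" using permutes_inverses[OF p] by (simp add: t_def)
    ultimately have "the_inv_into {..<n} t i = p i" using the_inv_into_f_eq[OF inj, of "p i" i] by simp
    thus ?thesis using True by simp
   next
    case False
    thus ?thesis using y permutes_not_in[OF p, of i] by (auto simp: space_PiM PiE_def extensional_def)
   qed
  qed
  thus "f (\<lambda>i\<in>{..<n}. y (the_inv_into {..<n} t i)) = f (y o p)" by simp
 qed
 finally show ?thesis ..
qed

lemma measurable_LR_permute: "p permutes {0..<n} ==> (%x. x o p) : LR n ->M LR n"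
proof -
 assume p: "p permutes {0..<n}"
 have "(%x. \<lambda>i\<in>{..<n}. x (p i)) : LR n ->M LR n"
  using permutes_in_image[OF p] by (intro measurable_restrict) (auto intro!: measurable_component_singleton)
 moreover have "(\<lambda>i\<in>{..<n}. x (p i)) = x o p" if "x : space (LR n)" for x
  using that permutes_not_in[OF p] by (auto simp: fun_eq_iff space_PiM PiE_def extensional_def)
 ultimately show ?thesis by (subst measurable_cong[where g = "%x. \<lambda>i\<in>{..<n}. x (p i)"]) auto
qed

text \<open>Almost every tuple is sorted by exactly one permutation, and all permuted chambers
  contribute equally.\<close>

lemma nn_integral_LR_chamber:
 assumes f: "f bm LR n"
  and sym: "!!p x. p permutes {0..<n} ==> f (x o p) = f x"
 shows "NI (LR n) f = fact n * NI (LR n) (%x. f x * of_bool (chm n x))"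
proof -
 have m: "(%x. f x * of_bool (chm n x)) bm LR n"
  by (intro mi f mcomp[OF measurable_chm_pred]) simp
 have "NI (LR n) f = NI (LR n) (%x. (\<Sum>p | p permutes {0..<n}. f (x o p) * of_bool (chm n (x o p))))"
 proof (rule nn_integral_cong_AE)
  show "AE x in LR n. f x = (\<Sum>p | p permutes {0..<n}. f (x o p) * of_bool (chm n (x o p)))"
   using AE_LR_nondegenerate[of n]
  proof eventually_elim
   case (elim x)
   have "inj_on x {..<n}"
   proof (rule linorder_inj_onI)
    fix i j assume "i < j" "i : {..<n}" "j : {..<n}"
    thus "x i ~= x j" using elim by fastforce
   qed auto
   from sorting_permutation[OF this] obtain p where
    p: "p permutes {0..<n}" "chm n (x o p)" "!!q. q permutes {0..<n} ==> chm n (x o q) ==> q = p" by blast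
   have "(\<Sum>q | q permutes {0..<n}. f (x o q) * of_bool (chm n (x o q))) = (\<Sum>q | q permutes {0..<n}. if q = p then f x else 0)"
   proof (intro sum.cong refl)
    fix q assume "q : {q. q permutes {0..<n}}"
    hence q: "q permutes {0..<n}" by simp
    show "f (x o q) * of_bool (chm n (x o q)) = (if q = p then f x else 0)"
     unfolding sym[OF q] using p(2) p(3)[OF q] by (cases "q = p") auto
   qed
   thus ?case using p(1) by (simp add: finite_permutations)
  qed
 qed
 also have "... = (\<Sum>p | p permutes {0..<n}. NI (LR n) (%x. f (x o p) * of_bool (chm n (x o p))))"
 proof (rule nn_integral_sum)
  fix p assume "p : {p. p permutes {0..<n}}"
  hence p: "p permutes {0..<n}" by simp
  show "(%x. f (x o p) * of_bool (chm n (x o p))) bm LR n"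
   by (rule mcomp[OF measurable_LR_permute[OF p] m])
 qed
 also have "... = (\<Sum>p | p permutes {0..<n}. NI (LR n) (%x. f x * of_bool (chm n x)))"
 proof (intro sum.cong refl)
  fix p assume "p : {p. p permutes {0..<n}}"
  hence p: "p permutes {0..<n}" by simp
  show "NI (LR n) (%x. f (x o p) * of_bool (chm n (x o p))) = NI (LR n) (%x. f x * of_bool (chm n x))"
   by (rule nn_integral_LR_permute[OF p m])
 qed
 also have "... = fact n * NI (LR n) (%x. f x * of_bool (chm n x))"
  using card_permutations[of "{0..<n}" n] by simp
 finally show ?thesis .
qed

text \<open>For a polynomial, the trace of the functional calculus is a combination of the
  measurable \<open>tr_pow\<close>. Polynomials approximating \<open>f\<close> within 1 / (k + 1) on
  [-k, k] converge at every point, hence on every spectrum.\<close>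

lemma measurable_tr_fun:
 assumes f: "continuous_on UNIV f"
 shows "tr_fun f bm HL n"
proof -
 have "\<exists>g. real_polynomial_function g & (\<forall>x\<in>{- real k..real k}. \<bar>f x - g x\<bar> < 1 / Suc k)" for k
  by (rule Stone_Weierstrass_real_polynomial_function[of "{- real k..real k}" f "1 / Suc k"])
    (auto intro: continuous_on_subset[OF f])
 hence "\<exists>g. \<forall>k. real_polynomial_function (g k) & (\<forall>x\<in>{- real k..real k}. \<bar>f x - g k x\<bar> < 1 / Suc k)"
  by (intro choice allI)
 then obtain g where g: "!!k. real_polynomial_function (g k)"
  "!!k x. x : {- real k..real k} ==> \<bar>f x - g k x\<bar> < 1 / Suc k" by blast
 have m: "tr_fun (g k) bm HL n" for k
 proof -
  obtain a m where a: "g k = (%x. \<Sum>i\<le>m. a i * x ^ i)" using g(1)[of k] real_polynomial_function_iff_sum by blast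
  have "tr_fun (g k) H = (\<Sum>i\<le>m. a i * tr_pow H i)" if H: "H : space (HL n)" for H :: "complex mat"
  proof -
   obtain U d where U: "unitary_mat n U" "H = conj_by U (rdiag n d)" using spectral[OF space_HL_D[OF H]] by blast
   have "tr_fun (g k) H = (\<Sum>j<n. \<Sum>i\<le>m. a i * d j ^ i)" unfolding U(2) tr_fun_conj_rdiag[OF U(1)] a ..
   also have "... = (\<Sum>i\<le>m. a i * (\<Sum>j<n. d j ^ i))" by (subst sum.swap) (simp add: sum_distrib_left)
   also have "... = (\<Sum>i\<le>m. a i * tr_pow H i)"
    unfolding U(2) tr_pow_conj_by[OF U(1) rdiag_carrier(1)] tr_pow_rdiag ..
   finally show ?thesis .
  qed
  moreover have "(%H. \<Sum>i\<le>m. a i * tr_pow H i) bm HL n"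
   by (intro mi measurable_tr_pow[OF measurable_ident_sets[OF refl]])
  ultimately show ?thesis by (subst measurable_cong) auto
 qed
 show ?thesis
 proof (rule borel_measurable_LIMSEQ_real[where u = "%k. tr_fun (g k)", OF _ m])
  fix H assume H: "H : space (HL n)"
  obtain U d where U: "unitary_mat n U" "H = conj_by U (rdiag n d)" using spectral[OF space_HL_D[OF H]] by blast
  have "(%k. g k t) \<longlonglongrightarrow> f t" for t
  proof (rule metric_LIMSEQ_I)
   fix e :: real assume "0 < e"
   then obtain m where m: "1 / Suc m < e" using nat_approx_posE by blast
   have "dist (g k t) (f t) < e" if "max m (nat \<lceil>\<bar>t\<bar>\<rceil>) <= k" for k
   proof -
    have "\<bar>t\<bar> <= real k" using that by linarith
    hence "\<bar>f t - g k t\<bar> < 1 / Suc k" by (intro g(2)) (auto simp: abs_le_iff)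
    also have "1 / Suc k <= 1 / Suc m" using that by (intro divide_left_mono) auto
    finally show ?thesis using m by (simp add: dist_real_def abs_minus_commute)
   qed
   thus "\<exists>N. \<forall>k\<ge>N. dist (g k t) (f t) < e" by blast
  qed
  thus "(%k. tr_fun (g k) H) \<longlonglongrightarrow> tr_fun f H"
   unfolding U(2) tr_fun_conj_rdiag[OF U(1)] by (intro tendsto_sum)
 qed
qed

section \<open>The trace pairing and Weyl's integration formula\<close>

definition pr :: "complex mat => complex mat => real" where
 "pr L A = Re (mat_trace (L * A))"

lemma pr_conj_by:
 assumes U: "unitary_mat n U" and c: "herm n L" "herm n A"
 shows "pr (conj_by U L) (conj_by U A) = pr L A"
 unfolding pr_def conj_by_prod[OF U hermD(1)[OF c(1)] hermD(1)[OF c(2)]]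
 by (simp only: mat_trace_conj_by[OF U mult_carrier_mat[OF hermD(1)[OF c(1)] hermD(1)[OF c(2)]]])

lemma herm_pow: "herm n H ==> herm n (H ^\<^sub>m k)"
proof -
 assume H: "herm n H"
 obtain U d where U: "unitary_mat n U" "H = conj_by U (rdiag n d)" using spectral[OF H] by blast
 show ?thesis
  unfolding U(2) conj_by_pow[OF U(1) rdiag_carrier(1)] rdiag_pow by (rule herm_conj_by[OF U(1) herm_rdiag])
qed

lemma pr_sum: "L : carrier_mat n n ==> A : carrier_mat n n ==> pr L A = (\<Sum>i<n. \<Sum>k<n. Re (L $$ (i, k) * A $$ (k, i)))"
 unfolding pr_def mat_trace_def Re_sum[symmetric]
 by (intro arg_cong[where f = Re] sum.cong) (auto simp only: mult_index index_mult_mat carrier_matD lessThan_iff)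

lemma pr_rdiag_left: "A : carrier_mat n n ==> pr (rdiag n l) A = (\<Sum>i<n. l i * Re (A $$ (i, i)))"
proof -
 assume A: "A : carrier_mat n n"
 have "pr (rdiag n l) A = (\<Sum>i<n. \<Sum>k<n. if k = i then l i * Re (A $$ (i, i)) else 0)"
  unfolding pr_sum[OF rdiag_carrier(1) A] by (intro sum.cong refl) (simp add: rdiag_index)
 thus ?thesis by simp
qed

lemma pr_rdiag_right: "A : carrier_mat n n ==> pr A (rdiag n l) = (\<Sum>i<n. l i * Re (A $$ (i, i)))"
 using pr_rdiag_left[of A n l] mat_trace_comm[of A n n "rdiag n l", OF _ rdiag_carrier(1)] unfolding pr_def by simp

lemma measurable_pr:
 assumes "f : N ->M HL n" "g : N ->M HL n"
 shows "(%x. pr (f x) (g x ^\<^sub>m k)) bm N"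
proof -
 have m: "(%x. \<Sum>i<n. \<Sum>j<n. Re (f x $$ (i, j) * (g x ^\<^sub>m k) $$ (j, i))) bm N"
 proof (intro mi)
  fix i j assume "i : {..<n}" "j : {..<n}"
  hence ij: "i < n" "j < n" by simp_all
  show "(%x. Re (f x $$ (i, j) * (g x ^\<^sub>m k) $$ (j, i))) bm N"
   by (rule borel_measurable_complex_iff[THEN iffD1, THEN conjunct1,
      OF borel_measurable_times[OF measurable_HL_entry[OF ij assms(1)] measurable_pow_mat[OF assms(2) ij(2,1)]]])
 qed
 have eq: "pr (f x) (g x ^\<^sub>m k) = (\<Sum>i<n. \<Sum>j<n. Re (f x $$ (i, j) * (g x ^\<^sub>m k) $$ (j, i)))" if "x : space N" for x
  by (rule pr_sum[OF hermD(1)[OF space_HL_D[OF measurable_space[OF assms(1) that]]]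
     hermD(1)[OF herm_pow[OF space_HL_D[OF measurable_space[OF assms(2) that]]]]])
 show ?thesis by (rule iffD2[OF measurable_cong[OF eq] m])
qed

text \<open>The case \<xi> = 0 of \<open>nn_integral_HL_GT\<close>: the volume of the patterns
  supplies the second Vandermonde factor and the product of factorials.\<close>

lemma weyl:
 assumes f: "f bm HL n" "uinv n f"
 shows "NI (HL n) f = ennreal (pi ^ (\<Sum>i<n. i) / (\<Prod>i<n. fact i)) *
  NI (LR n) (%l. f (rdiag n l) * ennreal ((vdm n l)^2) * of_bool (chm n l))"
proof -
 let ?F = "1 / (\<Prod>i<n. fact i) :: real"
 have F: "0 <= ?F" by (simp add: prod_nonneg)
 have m: "(%l. f (rdiag n l) * ennreal ((vdm n l)^2) * of_bool (chm n l)) bm LR n"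
  by (intro mi mcomp[OF measurable_rdiag f(1)])
 have "NI (HL n) f = NI (HL n) (%H. f H * ennreal (exp (- (\<Sum>i<n. 0 * Re (H $$ (i, i))))))" by simp
 also have "... = ennreal (pi ^ (\<Sum>i<n. i)) * NI (LR n) (%l. f (rdiag n l) * ennreal (vdm n l) * GTD n (%_. 0) l * of_bool (chm n l))"
  by (rule nn_integral_HL_GT[OF f])
 also have "NI (LR n) (%l. f (rdiag n l) * ennreal (vdm n l) * GTD n (%_. 0) l * of_bool (chm n l))
   = NI (LR n) (%l. ennreal ?F * (f (rdiag n l) * ennreal ((vdm n l)^2) * of_bool (chm n l)))"
 proof (rule nn_integral_cong)
  fix l
  have "ennreal (vdm n l) * GTD n (%_. 0) l = ennreal ?F * ennreal ((vdm n l)^2)" if "chm n l"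
   using vdm_pos[OF that] F unfolding GTD_0[OF that]
   by (simp add: ennreal_mult[symmetric] prod_pos power2_eq_square less_imp_le)
  hence "f (rdiag n l) * (ennreal (vdm n l) * GTD n (%_. 0) l) = f (rdiag n l) * (ennreal ?F * ennreal ((vdm n l)^2))"
   if "chm n l" using that by simp
  thus "f (rdiag n l) * ennreal (vdm n l) * GTD n (%_. 0) l * of_bool (chm n l) =
    ennreal ?F * (f (rdiag n l) * ennreal ((vdm n l)^2) * of_bool (chm n l))"
   by (cases "chm n l") (simp_all only: mult_ac of_bool_eq mult_1_right mult_1_left mult_zero_right mult_zero_left simp_thms)
 qed
 also have "... = ennreal ?F * NI (LR n) (%l. f (rdiag n l) * ennreal ((vdm n l)^2) * of_bool (chm n l))"
  by (rule nn_integral_cmult[OF m])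
 also have "ennreal (pi ^ (\<Sum>i<n. i)) * (ennreal ?F * NI (LR n) (%l. f (rdiag n l) * ennreal ((vdm n l)^2) * of_bool (chm n l))) =
   ennreal (pi ^ (\<Sum>i<n. i) * ?F) * NI (LR n) (%l. f (rdiag n l) * ennreal ((vdm n l)^2) * of_bool (chm n l))"
  using F by (simp only: ennreal_mult mult.assoc zero_le_power pi_ge_zero)
 finally show ?thesis by simp
qed

lemma uinv_tr_pow: "uinv n (%H. tr_pow H m)"
 unfolding uinv_def using tr_pow_conj_by hermD(1) by blast

lemma measurable_tr_pow_HL: "(%H. tr_pow H m) bm HL n"
 by (rule measurable_tr_pow[OF measurable_ident_sets[OF refl]])

text \<open>On the ball all eigenvalues lie in [-r, r], which bounds the Vandermonde product.
  Bounded functions supported in such balls are therefore integrable, which the truncations below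
  rely on.\<close>

lemma nn_integral_HL_ball: "NI (HL n) (%H. of_bool (tr_pow H 2 <= R)) < \<infinity>"
proof -
 interpret finite_product_sigma_finite "%_. lborel :: real measure" "{..<n}"
  unfolding finite_product_sigma_finite_def finite_product_sigma_finite_axioms_def
  using product_sigma_finite_lborel by simp
 define r where "r = sqrt (max R 0)"
 let ?f = "%H. of_bool (tr_pow H 2 <= R) :: ennreal"
 have fm: "?f bm HL n"
 proof -
  have "Measurable.pred (HL n) (%H. tr_pow H 2 <= R)"
   unfolding pred_def by (intro borel_measurable_le measurable_tr_pow_HL mi)
  from mcomp[OF this] show ?thesis by simp
 qed
 have u: "uinv n ?f" using uinvD[OF uinv_tr_pow[of n 2]] by (simp add: uinv_def)
 let ?B = "\<Pi>\<^sub>E i\<in>{..<n}. {- r..r}"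
 let ?c = "\<Prod>j<n. \<Prod>i<j. 2 * r"
 have c0: "0 <= ?c" by (intro prod_nonneg ballI) (simp add: r_def)
 have le: "?f (rdiag n l) * ennreal ((vdm n l)^2) * of_bool (chm n l) <= ennreal (?c^2) * indicator ?B l"
  if l: "l : space (LR n)" for l
 proof (cases "(\<Sum>i<n. (l i)^2) <= R & chm n l")
  case True
  have b: "\<bar>l i\<bar> <= r" if "i < n" for i
  proof -
   have "(l i)^2 <= (\<Sum>i<n. (l i)^2)" using that by (intro member_le_sum) auto
   also have "... <= max R 0" using conjunct1[OF True] by (simp add: le_max_iff_disj)
   finally have "(l i)^2 <= max R 0" .
   thus ?thesis unfolding r_def by (rule real_le_rsqrt[of "\<bar>l i\<bar>", simplified])
  qed
  have "l : ?B" using l b by (auto simp: space_PiM PiE_def abs_le_iff) (metis minus_le_iff)+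
  moreover have "vdm n l <= ?c" unfolding vdm_def
  proof (rule prod_mono)
   fix j assume j: "j : {..<n}"
   have "0 <= l j - l i & l j - l i <= 2 * r" if "i : {..<j}" for i
    using True b[of j] b[of i] j that by (auto simp: chm_def less_imp_le abs_le_iff)
   thus "0 <= (\<Prod>i<j. l j - l i) & (\<Prod>i<j. l j - l i) <= (\<Prod>i<j. 2 * r)"
    by (intro conjI prod_nonneg prod_mono ballI) blast+
  qed
  ultimately show ?thesis using True vdm_pos[of n l] by (auto simp: tr_pow_rdiag intro!: ennreal_leI power_mono)
 next
  case False
  thus ?thesis by (auto simp: tr_pow_rdiag)
 qed
 have "NI (LR n) (%l. ?f (rdiag n l) * ennreal ((vdm n l)^2) * of_bool (chm n l)) <= NI (LR n) (%l. ennreal (?c^2) * indicator ?B l)"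
  by (rule nn_integral_mono[OF le])
 also have "... = ennreal (?c^2) * (\<Prod>i<n. emeasure lborel {- r..r})"
  using measure_times[of "%_. {- r..r}"] sets_PiM_I_finite[of "{..<n}" "%_. {- r..r}"] by (subst nn_integral_cmult_indicator) auto
 also have "... < \<infinity>" by (simp add: r_def ennreal_mult_less_top ennreal_power power_less_top_ennreal)
 finally show ?thesis
  unfolding weyl[OF fm u] by (simp add: ennreal_mult_less_top)
qed

text \<open>A strict gap P(z) > Q(z) would persist on a small cube around \<open>z\<close> by
  continuity, against the equality of the integrals over that cube. Exchanging \<open>P\<close> and
  \<open>Q\<close> gives the other inequality.\<close>

lemma local_averages_eq:
 fixes P Q :: "(nat => real) => ennreal"
 assumes \<delta>0: "0 < \<delta>0"
  and eq: "!!\<delta>. 0 < \<delta> ==> \<delta> < \<delta>0 ==> NI (LR n) (%l. of_bool (\<forall>i<n. \<bar>l i - z i\<bar> < \<delta>) * P l) =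
    NI (LR n) (%l. of_bool (\<forall>i<n. \<bar>l i - z i\<bar> < \<delta>) * Q l)"
  and P: "!!L. (!!k i. i < n ==> \<bar>L k i - z i\<bar> < \<delta>0) ==> (!!i. i < n ==> (%k. L k i) \<longlonglongrightarrow> z i) ==> (%k. P (L k)) \<longlonglongrightarrow> P z"
  and Q: "!!L. (!!k i. i < n ==> \<bar>L k i - z i\<bar> < \<delta>0) ==> (!!i. i < n ==> (%k. L k i) \<longlonglongrightarrow> z i) ==> (%k. Q (L k)) \<longlonglongrightarrow> Q z"
 shows "P z <= Q z"
proof (rule ccontr)
 interpret finite_product_sigma_finite "%_. lborel :: real measure" "{..<n}"
  unfolding finite_product_sigma_finite_def finite_product_sigma_finite_axioms_def
  using product_sigma_finite_lborel by simp
 assume "~ P z <= Q z"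
 then obtain c d where cd: "Q z < c" "c < d" "d < P z" using dense[of "Q z"] dense by (metis not_le)
 have "\<exists>\<delta>>0. \<delta> < \<delta>0 & (\<forall>l. (\<forall>i<n. \<bar>l i - z i\<bar> < \<delta>) --> Q l < c & d < P l)"
 proof (rule ccontr)
  assume a: "~ ?thesis"
  have "\<exists>l. (\<forall>i<n. \<bar>l i - z i\<bar> < \<delta>0 / (real k + 2)) & ~ (Q l < c & d < P l)" for k
  proof -
   have "0 < \<delta>0 / (real k + 2)" "\<delta>0 / (real k + 2) < \<delta>0" using \<delta>0 by (auto simp: divide_less_eq)
   with a show ?thesis by blast
  qed
  hence "\<exists>L. \<forall>k. (\<forall>i<n. \<bar>L k i - z i\<bar> < \<delta>0 / (real k + 2)) & ~ (Q (L k) < c & d < P (L k))" by (intro choice allI)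
  then obtain L where L: "!!k i. i < n ==> \<bar>L k i - z i\<bar> < \<delta>0 / (real k + 2)" "!!k. ~ (Q (L k) < c & d < P (L k))" by blast
  have box: "\<bar>L k i - z i\<bar> < \<delta>0" if "i < n" for k i
  proof -
   have "\<delta>0 / (real k + 2) < \<delta>0" using \<delta>0 by (auto simp: divide_less_eq)
   thus ?thesis using L(1)[OF that, of k] by linarith
  qed
  have conv: "(%k. L k i) \<longlonglongrightarrow> z i" if "i < n" for i
  proof (rule Lim_transform_bound[where g = "%k. \<delta>0 / (real k + 2)", THEN LIM_zero_cancel])
   show "\<forall>\<^sub>F k in sequentially. norm (L k i - z i) <= norm (\<delta>0 / (real k + 2))" using less_imp_le[OF L(1)[OF that]] \<delta>0 by (intro always_eventually allI) simp
   have "filterlim (%k. 2 + real k) at_top sequentially"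
    by (rule filterlim_tendsto_add_at_top[OF tendsto_const filterlim_real_sequentially])
   thus "(%k. \<delta>0 / (real k + 2)) \<longlonglongrightarrow> 0"
    by (intro real_tendsto_divide_at_top[OF tendsto_const]) (simp add: add.commute)
  qed
  have "\<forall>\<^sub>F k in sequentially. Q (L k) < c" using order_tendstoD(2)[OF Q[OF box conv] cd(1)] .
  moreover have "\<forall>\<^sub>F k in sequentially. d < P (L k)" using order_tendstoD(1)[OF P[OF box conv] cd(3)] .
  ultimately have "\<forall>\<^sub>F k in sequentially. False" by eventually_elim (use L(2) in blast)
  thus False by simp
 qed
 then obtain \<delta> where \<delta>: "0 < \<delta>" "\<delta> < \<delta>0" "!!l. (\<forall>i<n. \<bar>l i - z i\<bar> < \<delta>) ==> Q l < c & d < P l" by blast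
 define B where "B l = (of_bool (\<forall>i<n. \<bar>l i - z i\<bar> < \<delta>) :: ennreal)" for l
 let ?B = "\<Pi>\<^sub>E i\<in>{..<n}. {z i - \<delta><..<z i + \<delta>}"
 have Bs: "?B : sets (LR n)" by (intro sets_PiM_I_finite) auto
 have Bi: "B l = indicator ?B l" if "l : space (LR n)" for l
 proof -
  have "l i : {z i - \<delta><..<z i + \<delta>} \<longleftrightarrow> \<bar>l i - z i\<bar> < \<delta>" for i by (auto simp: abs_less_iff)
  thus ?thesis using that by (simp add: B_def indicator_def space_PiM PiE_iff Ball_def del: greaterThanLessThan_iff)
 qed
 have c_int: "NI (LR n) (%l. B l * c) = c * ennreal ((2 * \<delta>) ^ n)" for c
 proof -
  have "NI (LR n) (%l. B l * c) = NI (LR n) (%l. c * indicator ?B l)" by (intro nn_integral_cong) (simp add: Bi mult.commute)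
  also have "... = c * (\<Prod>i<n. emeasure lborel {z i - \<delta><..<z i + \<delta>})"
   unfolding nn_integral_cmult_indicator[OF Bs] by (subst measure_times) auto
  also have "(\<Prod>i<n. emeasure lborel {z i - \<delta><..<z i + \<delta>}) = ennreal ((2 * \<delta>) ^ n)"
   using \<delta>(1) by (simp add: ennreal_power)
  finally show ?thesis .
 qed
 have "d * ennreal ((2 * \<delta>) ^ n) <= NI (LR n) (%l. B l * P l)"
  unfolding c_int[symmetric] using \<delta>(3) by (intro nn_integral_mono) (auto simp: B_def less_imp_le)
 also have "... = NI (LR n) (%l. B l * Q l)" unfolding B_def by (rule eq[OF \<delta>(1,2)])
 also have "... <= c * ennreal ((2 * \<delta>) ^ n)"
  unfolding c_int[symmetric] using \<delta>(3) by (intro nn_integral_mono) (auto simp: B_def less_imp_le)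
 also have "... < d * ennreal ((2 * \<delta>) ^ n)"
  using cd(2) \<delta>(1) by (intro ennreal_mult_strict_right_mono) auto
 finally show False by simp
qed

section \<open>Laplace transforms of invariant functions\<close>

text \<open>With half the external field for \<open>L\<close>, and the exponentiated potential times
  an observable for \<open>f\<close>, this is the matrix model up to its normalising
  constant.\<close>

definition lap :: "nat => (complex mat => ennreal) => complex mat => ennreal" where
 "lap n f L = NI (HL n) (%H. f H * ennreal (exp (- pr L (H ^\<^sub>m 2))))"

abbreviation sq :: "(nat => real) => nat => real" where "sq x == %i. (x i)^2"

text \<open>The Harish-Chandra quotient of \<open>GTD_eq\<close> in the direction of the squared
  eigenvalues, since \<open>L\<close> is coupled to the square of \<open>H\<close>.\<close>

definition hck :: "nat => (nat => real) => (nat => real) => real" where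
 "hck n l x = XD n l (sq x) / vdm n (sq x)"

lemma measurable_lap_kernel:
 assumes f: "f bm HL n"
 shows "(%z. f (snd z) * ennreal (exp (- pr (fst z) (snd z ^\<^sub>m 2)))) bm HL n XM HL n"
proof (intro borel_measurable_times_ennreal)
 show "(%z. f (snd z)) bm HL n XM HL n" by (rule mcomp[OF measurable_snd f])
 have "(%z. - pr (fst z) (snd z ^\<^sub>m 2)) bm HL n XM HL n"
  by (rule borel_measurable_uminus[OF measurable_pr[OF measurable_fst measurable_snd]])
 from mcomp[OF mcomp[OF this borel_measurable_exp] measurable_ennreal]
 show "(%z. ennreal (exp (- pr (fst z) (snd z ^\<^sub>m 2)))) bm HL n XM HL n" .
qed

lemma measurable_lap:
 assumes f: "f bm HL n"
 shows "lap n f bm HL n"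
 unfolding lap_def
 using sigma_finite_measure.borel_measurable_nn_integral[OF sigma_finite_HL, of "%L H. f H * ennreal (exp (- pr L (H ^\<^sub>m 2)))" "HL n" n]
  measurable_lap_kernel[OF f] by (simp add: case_prod_beta)

lemma measurable_lap_section:
 assumes f: "f bm HL n" and L: "L : space (HL n)"
 shows "(%H. f H * ennreal (exp (- pr L (H ^\<^sub>m 2)))) bm HL n"
 using mcomp[OF measurable_Pair1'[OF L] measurable_lap_kernel[OF f]] by simp

lemma pow2_conj_by: "unitary_mat n U ==> herm n H ==> conj_by U H ^\<^sub>m 2 = conj_by U (H ^\<^sub>m 2)"
 by (rule conj_by_pow[OF _ hermD(1)])

lemma uinv_lap:
 assumes f: "f bm HL n" "uinv n f"
 shows "uinv n (lap n f)"
 unfolding uinv_def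
proof (intro allI impI)
 fix U L assume U: "unitary_mat n U" and L: "herm n L"
 have UL: "conj_by U L : space (HL n)" using herm_conj_by[OF U L] by (simp add: space_HL)
 have "lap n f (conj_by U L) = NI (HL n) (%H. f (conj_by U H) * ennreal (exp (- pr (conj_by U L) (conj_by U H ^\<^sub>m 2))))"
  unfolding lap_def by (rule nn_integral_HL_conj_by[OF U measurable_lap_section[OF f(1) UL], symmetric])
 also have "... = lap n f L" unfolding lap_def
 proof (rule nn_integral_cong)
  fix H assume "H : space (HL n)"
  hence H: "herm n H" by (rule space_HL_D)
  show "f (conj_by U H) * ennreal (exp (- pr (conj_by U L) (conj_by U H ^\<^sub>m 2))) = f H * ennreal (exp (- pr L (H ^\<^sub>m 2)))"
   unfolding uinvD[OF f(2) U H] pow2_conj_by[OF U H] pr_conj_by[OF U L herm_pow[OF H]] ..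
 qed
 finally show "lap n f (conj_by U L) = lap n f L" .
qed

lemma measurable_hck: "(%z. hck n (fst z) (snd z)) bm LR n XM LR n"
 unfolding hck_def XD_def
proof (intro borel_measurable_divide measurable_AD)
 have c: "(%z. snd z i) bm LR n XM LR n" "(%z. fst z i) bm LR n XM LR n" if "i < n" for i
  by (rule mcomp[OF measurable_snd measurable_component_LR[OF that]],
    rule mcomp[OF measurable_fst measurable_component_LR[OF that]])
 fix i j assume "i < n" "j < n"
 hence j: "n - Suc j < n" and i: "i < n" by auto
 show "(%z. exp (- (snd z (n - Suc j))\<^sup>2 * fst z i)) bm LR n XM LR n"
  by (rule mcomp[OF borel_measurable_times[OF borel_measurable_uminus[OF borel_measurable_power[OF c(1)[OF j]]] c(2)[OF i]] borel_measurable_exp])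
next
 have "(vdm n :: (nat => real) => real) bm LR n" by (rule measurable_vdm)
 have "(%x. vdm n (sq x)) bm LR n"
  unfolding vdm_def
  by (intro mi) auto
 thus "(%z. vdm n (sq (snd z))) bm LR n XM LR n"
  by (rule mcomp[OF measurable_snd])
qed

lemma measurable_hck_fixed [mi]: "hck n l bm LR n"
proof -
 have "hck n (restrict l {..<n}) x = hck n l x" for x
  unfolding hck_def XD_def by (intro arg_cong2[where f = "(/)"] AD_cong) auto
 moreover have "restrict l {..<n} : space (LR n)" by (simp add: space_PiM)
 from mcomp[OF measurable_Pair1'[OF this] measurable_hck]
 have "(%x. hck n (restrict l {..<n}) x) bm LR n" by simp
 ultimately show ?thesis by simp
qed

lemma AE_LR_sq_inj: "AE x in LR n. inj_on (sq x) {..<n}"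
 using AE_LR_nondegenerate[of n]
proof eventually_elim
 case (elim x)
 show ?case
 proof (rule linorder_inj_onI)
  fix i j assume "i < j" "i : {..<n}" "j : {..<n}"
  thus "(x i)^2 ~= (x j)^2" using elim by fastforce
 qed auto
qed

text \<open>
 Both sides of the duality evaluate the integral of \<open>g(L) f(H) exp (- Tr (L H\<^sup>2))\<close> over
 pairs of Hermitian matrices; this replaces averaging over the unitary group.
\<close>

lemma lap_duality:
 assumes f: "f bm HL n" "uinv n f" and g: "g bm HL n" "uinv n g"
 shows "NI (LR n) (%l. g (rdiag n l) * lap n f (rdiag n l) * ennreal ((vdm n l)^2) * of_bool (chm n l)) =
  NI (LR n) (%l. g (rdiag n l) * (ennreal (pi ^ (\<Sum>i<n. i)) * ennreal (vdm n l) *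
    NI (LR n) (%x. f (rdiag n x) * ennreal ((vdm n x)^2) * of_bool (chm n x) * ennreal (hck n l x))) * of_bool (chm n l))"
proof -
 interpret HH: pair_sigma_finite "HL n" "HL n"
  unfolding pair_sigma_finite_def using sigma_finite_HL by blast
 interpret RR: pair_sigma_finite "LR n" "LR n"
  unfolding pair_sigma_finite_def using sigma_finite_LR by blast
 let ?s = "ennreal (pi ^ (\<Sum>i<n. i))" and ?c = "ennreal (pi ^ (\<Sum>i<n. i) / (\<Prod>i<n. fact i))"
 \<comment> \<open>The inner integral when L is integrated first. It is unitarily invariant, and at
   H = diag(x) it is the integral of \<open>g\<close> against exp(- Tr(\<xi> L)) with \<xi> the
   squares of \<open>x\<close>, which \<open>nn_integral_HL_GT\<close> evaluates.\<close>
 define S where "S H = NI (HL n) (%L. g L * ennreal (exp (- pr L (H ^\<^sub>m 2))))" for H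
 define F where "F x = f (rdiag n x) * ennreal ((vdm n x)^2) * of_bool (chm n x)" for x
 define G where "G l = g (rdiag n l) * ennreal (vdm n l) * of_bool (chm n l)" for l
 have k: "(%z. g (fst z) * (f (snd z) * ennreal (exp (- pr (fst z) (snd z ^\<^sub>m 2))))) bm HL n XM HL n"
  by (intro borel_measurable_times_ennreal mcomp[OF measurable_fst g(1)] measurable_lap_kernel f)
 have k2: "(%z. g (fst z) * ennreal (exp (- pr (fst z) (snd z ^\<^sub>m 2)))) bm HL n XM HL n"
  using measurable_lap_kernel[of "%_. 1" n] by (intro borel_measurable_times_ennreal mcomp[OF measurable_fst g(1)]) simp
 have Sm: "S bm HL n"
 proof -
  have "(%z. g (snd z) * ennreal (exp (- pr (snd z) (fst z ^\<^sub>m 2)))) bm HL n XM HL n"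
   using mcomp[OF measurable_Pair[OF measurable_snd measurable_fst] k2] by simp
  thus ?thesis unfolding S_def
   using sigma_finite_measure.borel_measurable_nn_integral[OF sigma_finite_HL, of "%H L. g L * ennreal (exp (- pr L (H ^\<^sub>m 2)))" "HL n" n]
   by (simp add: case_prod_beta)
 qed
 have k2s: "(%L. g L * ennreal (exp (- pr L (H ^\<^sub>m 2)))) bm HL n" if "H : space (HL n)" for H
  using mcomp[OF measurable_Pair2'[OF that] k2] by simp
 have Su: "uinv n S" unfolding uinv_def
 proof (intro allI impI)
  fix U H assume U: "unitary_mat n U" and H: "herm n H"
  have UH: "conj_by U H : space (HL n)" using herm_conj_by[OF U H] by (simp add: space_HL)
  have "S (conj_by U H) = NI (HL n) (%L. g (conj_by U L) * ennreal (exp (- pr (conj_by U L) (conj_by U H ^\<^sub>m 2))))"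
   unfolding S_def by (rule nn_integral_HL_conj_by[OF U k2s[OF UH], symmetric])
  also have "... = S H" unfolding S_def
  proof (rule nn_integral_cong)
   fix L assume "L : space (HL n)"
   hence L: "herm n L" by (rule space_HL_D)
   show "g (conj_by U L) * ennreal (exp (- pr (conj_by U L) (conj_by U H ^\<^sub>m 2))) = g L * ennreal (exp (- pr L (H ^\<^sub>m 2)))"
    unfolding uinvD[OF g(2) U L] pow2_conj_by[OF U H] pr_conj_by[OF U L herm_pow[OF H]] ..
  qed
  finally show "S (conj_by U H) = S H" .
 qed
 have rm: "(%l. h (rdiag n l)) bm LR n" if "h bm HL n" for h :: "complex mat => ennreal"
  by (rule mcomp[OF measurable_rdiag that])
 have Fm: "F bm LR n" unfolding F_def by (intro mi rm[OF f(1)])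
 have Gm: "G bm LR n" unfolding G_def by (intro mi rm[OF g(1)])
 have Km: "(%z. F (snd z) * (G (fst z) * ennreal (hck n (fst z) (snd z)))) bm LR n XM LR n"
  by (intro mi mcomp[OF measurable_snd Fm] mcomp[OF measurable_fst Gm] mcomp[OF measurable_hck measurable_ennreal])
 have hm1: "(%l. ennreal (hck n l x)) bm LR n" if "x : space (LR n)" for x
  using mcomp[OF mcomp[OF measurable_Pair2'[OF that] measurable_hck] measurable_ennreal] by simp
 have hm2: "(%x. ennreal (hck n l x)) bm LR n" if "l : space (LR n)" for l
  using mcomp[OF mcomp[OF measurable_Pair1'[OF that] measurable_hck] measurable_ennreal] by simp
 have Sd: "S (rdiag n x) = ?s * NI (LR n) (%l. G l * GTD n (sq x) l)" for x
 proof -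
  have "S (rdiag n x) = NI (HL n) (%L. g L * ennreal (exp (- (\<Sum>i<n. sq x i * Re (L $$ (i, i))))))"
   unfolding S_def rdiag_pow
   by (intro nn_integral_cong) (simp add: pr_rdiag_right[OF hermD(1)[OF space_HL_D]])
  also have "... = ?s * NI (LR n) (%l. g (rdiag n l) * ennreal (vdm n l) * GTD n (sq x) l * of_bool (chm n l))"
   by (rule nn_integral_HL_GT[OF g])
  finally show ?thesis unfolding G_def by (simp only: mult_ac)
 qed
 have "?c * NI (LR n) (%l. g (rdiag n l) * lap n f (rdiag n l) * ennreal ((vdm n l)^2) * of_bool (chm n l)) = NI (HL n) (%L. g L * lap n f L)"
  using weyl[OF borel_measurable_times_ennreal[OF g(1) measurable_lap[OF f(1)]]] uinvD[OF g(2)] uinvD[OF uinv_lap[OF f]] by (simp add: uinv_def)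
 also have "... = NI (HL n) (%L. NI (HL n) (%H. g L * (f H * ennreal (exp (- pr L (H ^\<^sub>m 2))))))"
  unfolding lap_def using measurable_lap_section[OF f(1)] by (intro nn_integral_cong nn_integral_cmult[symmetric]) auto
 also have "... = NI (HL n) (%H. NI (HL n) (%L. g L * (f H * ennreal (exp (- pr L (H ^\<^sub>m 2))))))"
  using HH.Fubini'[of "%L H. g L * (f H * ennreal (exp (- pr L (H ^\<^sub>m 2))))"] k by (simp add: case_prod_beta)
 also have "... = NI (HL n) (%H. f H * S H)" unfolding S_def
 proof (rule nn_integral_cong)
  fix H assume "H : space (HL n)"
  thus "NI (HL n) (%L. g L * (f H * ennreal (exp (- pr L (H ^\<^sub>m 2))))) = f H * NI (HL n) (%L. g L * ennreal (exp (- pr L (H ^\<^sub>m 2))))"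
   using nn_integral_cmult[OF k2s, of H "f H"] by (simp only: mult.left_commute)
 qed
 also have "... = ?c * NI (LR n) (%x. F x * S (rdiag n x))"
  using weyl[OF borel_measurable_times_ennreal[OF f(1) Sm]] uinvD[OF f(2)] uinvD[OF Su] by (simp add: uinv_def F_def mult_ac)
 also have "NI (LR n) (%x. F x * S (rdiag n x)) = NI (LR n) (%x. ?s * NI (LR n) (%l. F x * (G l * ennreal (hck n l x))))"
 proof (rule nn_integral_cong_AE)
  have "AE x in LR n. x : space (LR n)" by simp
  thus "AE x in LR n. F x * S (rdiag n x) = ?s * NI (LR n) (%l. F x * (G l * ennreal (hck n l x)))"
   using AE_LR_sq_inj[of n]
  proof eventually_elim
   case (elim x)
   have "G l * GTD n (sq x) l = G l * ennreal (hck n l x)" for l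
    using GTD_eq(1)[OF _ elim(2)] by (cases "chm n l") (simp_all add: G_def hck_def)
   hence "S (rdiag n x) = ?s * NI (LR n) (%l. G l * ennreal (hck n l x))" unfolding Sd by simp
   thus ?case
    using nn_integral_cmult[OF borel_measurable_times_ennreal[OF Gm hm1[OF elim(1)]], of "F x"] by (simp add: mult_ac)
  qed
 qed
 also have "... = ?s * NI (LR n) (%x. NI (LR n) (%l. F x * (G l * ennreal (hck n l x))))"
 proof (rule nn_integral_cmult)
  have "(%z. F (fst z) * (G (snd z) * ennreal (hck n (snd z) (fst z)))) bm LR n XM LR n"
   using mcomp[OF measurable_Pair[OF measurable_snd measurable_fst] Km] by simp
  thus "(%x. NI (LR n) (%l. F x * (G l * ennreal (hck n l x)))) bm LR n"
   using measurable_NI_LR[of "%x l. F x * (G l * ennreal (hck n l x))" "LR n" n]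
   by (simp add: case_prod_beta)
 qed
 also have "NI (LR n) (%x. NI (LR n) (%l. F x * (G l * ennreal (hck n l x)))) = NI (LR n) (%l. NI (LR n) (%x. F x * (G l * ennreal (hck n l x))))"
  using RR.Fubini'[of "%l x. F x * (G l * ennreal (hck n l x))"] Km by (simp add: case_prod_beta)
 also have "?s * ... = NI (LR n) (%l. ?s * NI (LR n) (%x. F x * (G l * ennreal (hck n l x))))"
 proof (rule nn_integral_cmult[symmetric])
  show "(%l. NI (LR n) (%x. F x * (G l * ennreal (hck n l x)))) bm LR n"
   using measurable_NI_LR[of "%l x. F x * (G l * ennreal (hck n l x))" "LR n" n] Km
   by (simp add: case_prod_beta)
 qed
 also have "... = NI (LR n) (%l. g (rdiag n l) * (?s * ennreal (vdm n l) * NI (LR n) (%x. F x * ennreal (hck n l x))) * of_bool (chm n l))"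
 proof (rule nn_integral_cong)
  fix l assume l: "l : space (LR n)"
  have "NI (LR n) (%x. F x * (G l * ennreal (hck n l x))) = G l * NI (LR n) (%x. F x * ennreal (hck n l x))"
   using nn_integral_cmult[OF borel_measurable_times_ennreal[OF Fm hm2[OF l]], of "G l"] by (simp only: mult.left_commute)
  thus "?s * NI (LR n) (%x. F x * (G l * ennreal (hck n l x))) =
    g (rdiag n l) * (?s * ennreal (vdm n l) * NI (LR n) (%x. F x * ennreal (hck n l x))) * of_bool (chm n l)"
   by (simp only: G_def mult_ac)
 qed
 finally have "?c * NI (LR n) (%l. g (rdiag n l) * lap n f (rdiag n l) * ennreal ((vdm n l)^2) * of_bool (chm n l)) =
  ?c * NI (LR n) (%l. g (rdiag n l) * (?s * ennreal (vdm n l) * NI (LR n) (%x. F x * ennreal (hck n l x))) * of_bool (chm n l))" .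
 moreover have "0 < pi ^ (\<Sum>i<n. i) / (\<Prod>i<n. fact i)" by (simp add: prod_pos)
 hence "?c ~= 0" by (simp add: ennreal_eq_0_iff not_le)
 ultimately show ?thesis unfolding F_def by (simp only: ennreal_mult_cancel_left ennreal_neq_top simp_thms)
qed

lemma strict_mono_endo_eq:
 fixes \<sigma> :: "nat => nat"
 assumes mono: "!!i j. i < j ==> j < n ==> \<sigma> i < \<sigma> j" and le: "!!i. i < n ==> \<sigma> i < n" and i: "i < n"
 shows "\<sigma> i = i"
proof (rule antisym)
 have "d < n - i ==> \<sigma> i + d <= \<sigma> (i + d)" for d
 proof (induction d)
  case (Suc d)
  hence "Suc (i + d) < n" by linarith
  thus ?case using Suc mono[of "i + d" "i + Suc d"] by simp
 qed simp
 moreover have "n - 1 - i < n - i" "i + (n - 1 - i) = n - 1" using i by auto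
 ultimately have "\<sigma> i + (n - 1 - i) <= \<sigma> (n - 1)" by metis
 with le[of "n - 1"] i show "\<sigma> i <= i" by linarith
 have "i < n ==> i <= \<sigma> i" for i
 proof (induction i)
  case (Suc i)
  thus ?case using mono[of i "Suc i"] by simp
 qed simp
 thus "i <= \<sigma> i" using i .
qed

text \<open>The test functions of the duality must be unitarily invariant and measurable. The trace
  of a tent function at z_j is positive exactly if some eigenvalue is within \<delta> of z_j; as the
  tents are disjoint and both tuples sorted, the i-th eigenvalue has to be the one near z_i.\<close>

lemma spectral_box:
 assumes z: "!!i j. i < j ==> j < n ==> z i + \<delta> <= z j - \<delta>" and \<delta>: "0 < \<delta>" and l: "chm n l"
 shows "(\<forall>j<n. 0 < tr_fun (%t. max 0 (\<delta> - \<bar>t - z j\<bar>)) (rdiag n l)) \<longleftrightarrow> (\<forall>i<n. \<bar>l i - z i\<bar> < \<delta>)"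
proof -
 have pos: "0 < tr_fun (%t. max 0 (\<delta> - \<bar>t - z j\<bar>)) (rdiag n l) \<longleftrightarrow> (\<exists>i<n. \<bar>l i - z j\<bar> < \<delta>)" for j
  unfolding tr_fun_rdiag
 proof
  assume a: "0 < (\<Sum>i<n. max 0 (\<delta> - \<bar>l i - z j\<bar>))"
  show "\<exists>i<n. \<bar>l i - z j\<bar> < \<delta>"
  proof (rule ccontr)
   assume "~ ?thesis"
   hence "max 0 (\<delta> - \<bar>l i - z j\<bar>) = 0" if "i < n" for i using that by (meson diff_gt_0_iff_gt max.absorb1 not_less)
   hence "(\<Sum>i<n. max 0 (\<delta> - \<bar>l i - z j\<bar>)) = 0" by (intro sum.neutral) simp
   with a show False by (simp only: less_irrefl)
  qed
 next
  assume "\<exists>i<n. \<bar>l i - z j\<bar> < \<delta>"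
  then obtain i where "i < n" "\<bar>l i - z j\<bar> < \<delta>" by blast
  thus "0 < (\<Sum>i<n. max 0 (\<delta> - \<bar>l i - z j\<bar>))" by (intro sum_pos2[of _ i]) auto
 qed
 show ?thesis unfolding pos
 proof
  assume "\<forall>j<n. \<exists>i<n. \<bar>l i - z j\<bar> < \<delta>"
  hence "\<forall>j\<in>{..<n}. \<exists>i. i < n & \<bar>l i - z j\<bar> < \<delta>" by simp
  from bchoice[OF this] obtain \<sigma> where \<sigma>: "!!j. j < n ==> \<sigma> j < n" "!!j. j < n ==> \<bar>l (\<sigma> j) - z j\<bar> < \<delta>" by auto
  have "\<sigma> i < \<sigma> j" if "i < j" "j < n" for i j
  proof (rule ccontr)
   assume "~ \<sigma> i < \<sigma> j"
   moreover have "i < n" using that by simp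
   ultimately have "\<sigma> i = \<sigma> j | \<sigma> j < \<sigma> i" "\<sigma> i < n" using \<sigma>(1)[of i] by linarith+
   hence "l (\<sigma> j) <= l (\<sigma> i)" using l unfolding chm_def by (elim disjE) (auto intro: less_imp_le)
   thus False using z[OF that] \<sigma>(2)[OF that(2)] \<sigma>(2)[OF \<open>i < n\<close>] by linarith
  qed
  from strict_mono_endo_eq[of n \<sigma>, OF this \<sigma>(1)] show "\<forall>i<n. \<bar>l i - z i\<bar> < \<delta>" using \<sigma>(2) by simp
 qed auto
qed

lemma pow2_diag: "herm n H ==> i < n ==> Re ((H ^\<^sub>m 2) $$ (i, i)) = (\<Sum>j<n. (cmod (H $$ (i, j)))^2)"
proof -
 assume H: "herm n H" and i: "i < n"
 note c = hermD(1)[OF H]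
 have "(H ^\<^sub>m 2) $$ (i, i) = (\<Sum>j<n. H $$ (i, j) * H $$ (j, i))"
  using c mult_index[OF c c i i] by (simp add: numeral_2_eq_2)
 also have "... = (\<Sum>j<n. complex_of_real ((cmod (H $$ (i, j)))^2))"
 proof (intro sum.cong refl)
  fix j assume "j : {..<n}"
  hence "H $$ (j, i) = cnj (H $$ (i, j))" using herm_index[OF H, of j i] i by simp
  thus "H $$ (i, j) * H $$ (j, i) = complex_of_real ((cmod (H $$ (i, j)))^2)" using complex_norm_square[of "H $$ (i, j)"] by simp
 qed
 finally show ?thesis by simp
qed

lemma pr_pow2_nonneg: "herm n H ==> (!!i. i < n ==> 0 <= l i) ==> 0 <= pr (rdiag n l) (H ^\<^sub>m 2)"
 unfolding pr_rdiag_left[OF hermD(1)[OF herm_pow]]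
 by (intro sum_nonneg mult_nonneg_nonneg) (auto simp: pow2_diag intro: sum_nonneg)

text \<open>Tested on spectral boxes, \<open>lap_duality\<close> equates averages over small cubes
  around \<open>z\<close>, and both sides depend continuously on the spectrum. The bound on
  \<open>f\<close> makes it integrable, so \<open>f\<close> itself dominates on the matrix side; on
  the eigenvalue side the kernel is dominated by the pattern volume.\<close>

lemma lap_chamber_bounded:
 assumes f: "(%H. f H) bm HL n" "uinv n f" and bd: "!!H. f H <= ennreal C * of_bool (tr_pow H 2 <= R)"
  and z: "chm n z" "!!i. i < n ==> 0 < z i"
 shows "lap n f (rdiag n z) * ennreal (vdm n z) = ennreal (pi ^ (\<Sum>i<n. i)) *
   NI (LR n) (%x. f (rdiag n x) * ennreal ((vdm n x)^2) * of_bool (chm n x) * ennreal (hck n z x))"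
proof -
 let ?s = "ennreal (pi ^ (\<Sum>i<n. i))"
 define F where "F x = f (rdiag n x) * ennreal ((vdm n x)^2) * of_bool (chm n x)" for x
 define P where "P l = lap n f (rdiag n l) * ennreal ((vdm n l)^2)" for l
 define Q where "Q l = ?s * ennreal (vdm n l) * NI (LR n) (%x. F x * ennreal (hck n l x))" for l
 \<comment> \<open>Cubes of radius at most the minimum of this set stay inside the chamber and in
   the nonnegative orthant. The element 1 keeps the set nonempty when there are no
   eigenvalues.\<close>
 define S where "S = insert 1 (z ` {..<n} \<union> (%(i, j). (z j - z i) / 2) ` {(i, j). i < j & j < n})"
 have "{(i, j). i < j & j < n} \<subseteq> {..<n} \<times> {..<n}" by auto
 hence S: "finite S" "S ~= {}" unfolding S_def using finite_subset by fastforce+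
 define \<delta>0 where "\<delta>0 = Min S"
 have "\<forall>s\<in>S. 0 < s" using z by (auto simp: S_def chm_def)
 hence \<delta>0: "0 < \<delta>0" unfolding \<delta>0_def using S by simp
 have \<delta>z: "\<delta>0 <= z i" if "i < n" for i unfolding \<delta>0_def using that S by (intro Min_le) (auto simp: S_def)
 have gap: "z i + \<delta>0 <= z j - \<delta>0" if "i < j" "j < n" for i j
 proof -
  have "\<delta>0 <= (z j - z i) / 2" unfolding \<delta>0_def using that S by (intro Min_le) (auto simp: S_def)
  thus ?thesis by simp
 qed
 have box: "chm n l" "!!i. i < n ==> 0 <= l i" if "!!i. i < n ==> \<bar>l i - z i\<bar> < \<delta>0" for l
 proof -
  show "chm n l" unfolding chm_def
  proof (intro allI impI)
   fix i j assume ij: "i < j" "j < n"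
   thus "l i < l j" using that[of i] that[of j] gap[OF ij] by (auto simp: abs_less_iff)
  qed
  show "0 <= l i" if "i < n" for i using \<delta>z[OF that] \<open>\<And>i. i < n \<Longrightarrow> \<bar>l i - z i\<bar> < \<delta>0\<close>[OF that] by (auto simp: abs_less_iff)
 qed
 have Fm: "F bm LR n" unfolding F_def
  by (intro mi mcomp[OF measurable_rdiag f(1)])
 have hm: "(%x. ennreal (hck n l x)) bm LR n" for l
  by (intro mi)
 have fin: "NI (HL n) f < \<infinity>"
 proof -
  have "NI (HL n) f <= NI (HL n) (%H. ennreal C * of_bool (tr_pow H 2 <= R))" by (rule nn_integral_mono[OF bd])
  also have "... = ennreal C * NI (HL n) (%H. of_bool (tr_pow H 2 <= R))"
  proof (rule nn_integral_cmult)
   have "Measurable.pred (HL n) (%H. tr_pow H 2 <= R)"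
    unfolding pred_def by (intro borel_measurable_le measurable_tr_pow_HL mi)
   from mcomp[OF this] show "(%H. of_bool (tr_pow H 2 <= R) :: ennreal) bm HL n" by simp
  qed
  also have "... < \<infinity>" using nn_integral_HL_ball[of n R] by (simp add: ennreal_mult_less_top)
  finally show ?thesis .
 qed
 have finF: "NI (LR n) F < \<infinity>"
 proof -
  have "0 < pi ^ (\<Sum>i<n. i) / (\<Prod>i<n. fact i)" by (simp add: prod_pos)
  thus ?thesis using fin unfolding weyl[OF f] F_def[symmetric] by (auto simp: ennreal_mult_less_top ennreal_eq_0_iff not_le)
 qed
 have vdm_lim: "(%k. vdm n (L k)) \<longlonglongrightarrow> vdm n z" if "!!i. i < n ==> (%k. L k i) \<longlonglongrightarrow> z i" for L
  unfolding vdm_def using that by (intro tendsto_prod tendsto_diff) auto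
 have P: "(%k. P (L k)) \<longlonglongrightarrow> P z"
  if b: "!!k i. i < n ==> \<bar>L k i - z i\<bar> < \<delta>0" and c: "!!i. i < n ==> (%k. L k i) \<longlonglongrightarrow> z i" for L
 proof -
  have "(%k. lap n f (rdiag n (L k))) \<longlonglongrightarrow> lap n f (rdiag n z)" unfolding lap_def
  proof (rule nn_integral_dominated_convergence[where w = f])
   have rs: "rdiag n l : space (HL n)" for l by (simp add: space_HL)
   show "(%H. f H * ennreal (exp (- pr (rdiag n (L k)) (H ^\<^sub>m 2)))) bm HL n" for k
    by (rule measurable_lap_section[OF f(1) rs])
   show "(%H. f H * ennreal (exp (- pr (rdiag n z) (H ^\<^sub>m 2)))) bm HL n"
    by (rule measurable_lap_section[OF f(1) rs])
   show "AE H in HL n. f H * ennreal (exp (- pr (rdiag n (L k)) (H ^\<^sub>m 2))) <= f H" for k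
   proof (rule AE_I2)
    fix H assume H: "H : space (HL n)"
    have "0 <= pr (rdiag n (L k)) (H ^\<^sub>m 2)"
     by (rule pr_pow2_nonneg[OF space_HL_D[OF H]]) (rule box(2)[OF b])
    hence "ennreal (exp (- pr (rdiag n (L k)) (H ^\<^sub>m 2))) <= 1" by simp
    thus "f H * ennreal (exp (- pr (rdiag n (L k)) (H ^\<^sub>m 2))) <= f H" using mult_left_mono[of _ 1 "f H"] by simp
   qed
   show "AE H in HL n. (%k. f H * ennreal (exp (- pr (rdiag n (L k)) (H ^\<^sub>m 2)))) \<longlonglongrightarrow> f H * ennreal (exp (- pr (rdiag n z) (H ^\<^sub>m 2)))"
   proof (rule AE_I2)
    fix H assume "H : space (HL n)"
    hence H: "herm n H" by (rule space_HL_D)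
    show "(%k. f H * ennreal (exp (- pr (rdiag n (L k)) (H ^\<^sub>m 2)))) \<longlonglongrightarrow> f H * ennreal (exp (- pr (rdiag n z) (H ^\<^sub>m 2)))"
     unfolding pr_rdiag_left[OF hermD(1)[OF herm_pow[OF H]]]
     by (rule tendsto_mult_ennreal[OF tendsto_const]) (auto intro!: tendsto_intros c)
   qed
  qed (use f(1) fin in auto)
  moreover have "(%k. ennreal ((vdm n (L k))^2)) \<longlonglongrightarrow> ennreal ((vdm n z)^2)" by (intro tendsto_ennrealI tendsto_power vdm_lim c)
  ultimately show ?thesis unfolding P_def using vdm_pos[OF z(1)] by (intro tendsto_mult_ennreal) auto
 qed
 have Q: "(%k. Q (L k)) \<longlonglongrightarrow> Q z"
  if b: "!!k i. i < n ==> \<bar>L k i - z i\<bar> < \<delta>0" and c: "!!i. i < n ==> (%k. L k i) \<longlonglongrightarrow> z i" for L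
 proof -
  \<comment> \<open>A bound for the Vandermonde products along the sequence; by
    \<open>GTD_mono\<close> and \<open>GTD_0\<close> the kernel then stays below
    \<open>M / d\<close> for almost all \<open>x\<close>.\<close>
  from convergent_imp_Bseq[OF convergentI[OF vdm_lim[OF c]]] obtain M where M: "!!k. \<bar>vdm n (L k)\<bar> <= M"
   by (auto simp: Bseq_def)
  define d where "d = (\<Prod>i<n. fact i :: real)"
  have d: "0 < d" by (simp add: d_def prod_pos)
  have "(%k. NI (LR n) (%x. F x * ennreal (hck n (L k) x))) \<longlonglongrightarrow> (NI (LR n) (%x. F x * ennreal (hck n z x)))"
  proof (rule nn_integral_dominated_convergence[where w = "%x. F x * ennreal (M / d)"])
   show "AE x in LR n. F x * ennreal (hck n (L k) x) <= F x * ennreal (M / d)" for k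
    using AE_LR_sq_inj[of n]
   proof eventually_elim
    case (elim x)
    have ch: "chm n (L k)" by (rule box(1)) (rule b)
    have "ennreal (hck n (L k) x) = GTD n (sq x) (L k)" using GTD_eq(1)[OF ch elim] unfolding hck_def ..
    also have "... <= GTD n (%_. 0) (L k)" by (rule GTD_mono[OF ch box(2)[OF b]]) simp_all
    also have "... = ennreal (vdm n (L k) / d)" unfolding d_def by (rule GTD_0[OF ch])
    also have "... <= ennreal (M / d)" using M[of k] d by (intro ennreal_leI divide_right_mono) auto
    finally show ?case by (rule mult_left_mono) simp
   qed
   show "AE x in LR n. (%k. F x * ennreal (hck n (L k) x)) \<longlonglongrightarrow> F x * ennreal (hck n z x)"
   proof (rule AE_I2)
    fix x
    have "F x < \<infinity>"
    proof -
     have "f (rdiag n x) < \<infinity>"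
      by (rule le_less_trans[OF bd]) (simp add: ennreal_mult_less_top)
     thus ?thesis by (simp add: F_def ennreal_mult_less_top)
    qed
    moreover have "(%k. hck n (L k) x) \<longlonglongrightarrow> hck n z x"
     unfolding hck_def XD_def divide_inverse
     by (intro tendsto_mult[OF _ tendsto_const] continuous_AD tendsto_intros c) auto
    ultimately show "(%k. F x * ennreal (hck n (L k) x)) \<longlonglongrightarrow> F x * ennreal (hck n z x)"
     by (intro tendsto_mult_ennreal tendsto_const tendsto_ennrealI) auto
   qed
   show "NI (LR n) (%x. F x * ennreal (M / d)) < \<infinity>"
    unfolding nn_integral_multc[OF Fm] using finF by (simp add: ennreal_mult_less_top)
  qed (intro mi Fm hm)+
  moreover have "(%k. ennreal (vdm n (L k))) \<longlonglongrightarrow> ennreal (vdm n z)" by (intro tendsto_ennrealI vdm_lim c)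
  ultimately show ?thesis unfolding Q_def
   using vdm_pos[OF z(1)] by (intro tendsto_mult_ennreal tendsto_const) (auto simp: ennreal_mult_eq_top_iff)
 qed
 have eq: "NI (LR n) (%l. of_bool (\<forall>i<n. \<bar>l i - z i\<bar> < \<delta>) * P l) = NI (LR n) (%l. of_bool (\<forall>i<n. \<bar>l i - z i\<bar> < \<delta>) * Q l)"
  if \<delta>: "0 < \<delta>" "\<delta> < \<delta>0" for \<delta>
 proof -
  define G where "G L = (of_bool (\<forall>j<n. 0 < tr_fun (%t. max 0 (\<delta> - \<bar>t - z j\<bar>)) L) :: ennreal)" for L
  have Gm: "G bm HL n"
  proof -
   have "{L : space (HL n). \<forall>j\<in>{..<n}. 0 < tr_fun (%t. max 0 (\<delta> - \<bar>t - z j\<bar>)) L} : sets (HL n)"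
    by (intro sets.sets_Collect_finite_All finite_lessThan borel_measurable_less mi measurable_tr_fun continuous_intros)
   hence "Measurable.pred (HL n) (%L. \<forall>j<n. 0 < tr_fun (%t. max 0 (\<delta> - \<bar>t - z j\<bar>)) L)"
    unfolding pred_def Ball_def lessThan_iff .
   thus ?thesis unfolding G_def by (rule mcomp) simp
  qed
  have Gu: "uinv n G" unfolding uinv_def G_def by (simp add: tr_fun_conj_by)
  have G: "G (rdiag n l) * (of_bool (chm n l) * c) = of_bool (\<forall>i<n. \<bar>l i - z i\<bar> < \<delta>) * c" for l c
  proof (cases "chm n l")
   case True
   have "z i + \<delta> <= z j - \<delta>" if "i < j" "j < n" for i j using gap[OF that] \<delta> by simp
   from spectral_box[OF this \<delta>(1) True] show ?thesis unfolding G_def using True by simp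
  next
   case False
   have "chm n l" if a: "\<forall>i<n. \<bar>l i - z i\<bar> < \<delta>"
   proof (rule box(1))
    show "\<bar>l i - z i\<bar> < \<delta>0" if "i < n" for i using a[rule_format, OF that] \<delta>(2) by (rule order.strict_trans)
   qed
   with False have "~ (\<forall>i<n. \<bar>l i - z i\<bar> < \<delta>)" by blast
   thus ?thesis using False by simp
  qed
  show ?thesis
   using lap_duality[OF f Gm Gu] unfolding P_def Q_def F_def[symmetric] G[symmetric] by (simp only: mult_ac)
 qed
 have "P z <= Q z" by (rule local_averages_eq[OF \<delta>0 eq P Q])
 moreover have "Q z <= P z" by (rule local_averages_eq[OF \<delta>0 eq[symmetric] Q P])
 ultimately have "P z = Q z" by (rule antisym)
 hence "ennreal (vdm n z) * (lap n f (rdiag n z) * ennreal (vdm n z)) =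
   ennreal (vdm n z) * (?s * NI (LR n) (%x. F x * ennreal (hck n z x)))"
  unfolding P_def Q_def using vdm_pos[OF z(1)] by (simp add: power2_eq_square ennreal_mult mult_ac)
 moreover have "ennreal (vdm n z) ~= 0" using vdm_pos[OF z(1)] by (simp add: ennreal_eq_0_iff not_le)
 ultimately show ?thesis unfolding F_def by (simp only: ennreal_mult_cancel_left ennreal_neq_top simp_thms)
qed

lemma truncation_LIMSEQ:
 fixes f t :: "'a => real"
 assumes m: "f bm M" "t bm M" "w bm M"
 shows "(%k. NI M (%y. (ennreal (min (f y) (real k)) * of_bool (t y <= real k)) * w y)) \<longlonglongrightarrow> (NI M (%y. ennreal (f y) * w y))"
proof (rule nn_integral_LIMSEQ)
 show "incseq (%k y. (ennreal (min (f y) (real k)) * of_bool (t y <= real k)) * w y)"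
  by (intro monoI le_funI mult_mono ennreal_leI) (auto simp: of_bool_def)
 show "(%y. (ennreal (min (f y) (real k)) * of_bool (t y <= real k)) * w y) bm M" for k
  using m by measurable
 show "(%k. (ennreal (min (f y) (real k)) * of_bool (t y <= real k)) * w y) \<longlonglongrightarrow> ennreal (f y) * w y" for y
 proof (rule tendsto_eventually)
  have "\<forall>\<^sub>F k in sequentially. max (f y) (t y) <= real k"
   using eventually_ge_at_top[of "nat \<lceil>max (f y) (t y)\<rceil>"] by eventually_elim linarith
  thus "\<forall>\<^sub>F k in sequentially. (ennreal (min (f y) (real k)) * of_bool (t y <= real k)) * w y = ennreal (f y) * w y"
   by eventually_elim simp
 qed
qed

text \<open>Monotone convergence along truncations in height and in Hilbert-Schmidt norm, both of
  which preserve unitary invariance.\<close>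

lemma lap_chamber:
 fixes f :: "complex mat => real"
 assumes f: "f bm HL n" "uinv n f" and z: "chm n z" "!!i. i < n ==> 0 < z i"
 shows "lap n f (rdiag n z) * ennreal (vdm n z) = ennreal (pi ^ (\<Sum>i<n. i)) *
   NI (LR n) (%x. f (rdiag n x) * ennreal ((vdm n x)^2) * of_bool (chm n x) * ennreal (hck n z x))"
proof -
 define g where "g k H = ennreal (min (f H) (real k)) * of_bool (tr_pow H 2 <= real k)" for k :: nat and H
 have gm: "g k bm HL n" for k
 proof -
  have "Measurable.pred (HL n) (%H. tr_pow H 2 <= real k)"
   unfolding pred_def by (intro borel_measurable_le measurable_tr_pow_HL mi)
  hence "(%H. of_bool (tr_pow H 2 <= real k) :: ennreal) bm HL n" by (rule mcomp) simp
  thus ?thesis unfolding g_def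
   by (intro mi borel_measurable_min f(1))
 qed
 have gu: "uinv n (g k)" for k
  unfolding uinv_def g_def using uinvD[OF f(2)] uinvD[OF uinv_tr_pow[of n 2]] by simp
 have bd: "g k H <= ennreal (real k) * of_bool (tr_pow H 2 <= real k)" for k H
  unfolding g_def by (intro mult_right_mono ennreal_leI) auto
 define w where "w H = ennreal (exp (- pr (rdiag n z) (H ^\<^sub>m 2)))" for H
 have wm: "w bm HL n"
  using measurable_lap_section[of "%_. 1" n "rdiag n z"] unfolding w_def[abs_def] mult_1_left space_HL by simp
 define v where "v x = ennreal ((vdm n x)^2) * of_bool (chm n x) * ennreal (hck n z x)" for x
 have vm: "v bm LR n"
  unfolding v_def by (intro mi)
 have 1: "(%k. lap n (g k) (rdiag n z) * ennreal (vdm n z)) \<longlonglongrightarrow> lap n f (rdiag n z) * ennreal (vdm n z)"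
  unfolding lap_def w_def[symmetric] g_def
  by (intro tendsto_mult_ennreal tendsto_const truncation_LIMSEQ f(1) measurable_tr_pow_HL wm) (use vdm_pos[OF z(1)] in auto)
 have 2: "(%k. ennreal (pi ^ (\<Sum>i<n. i)) * NI (LR n) (%x. g k (rdiag n x) * v x)) \<longlonglongrightarrow>
   ennreal (pi ^ (\<Sum>i<n. i)) * NI (LR n) (%x. ennreal (f (rdiag n x)) * v x)"
  unfolding g_def
  by (intro tendsto_mult_ennreal tendsto_const truncation_LIMSEQ mcomp[OF measurable_rdiag f(1)]
    mcomp[OF measurable_rdiag measurable_tr_pow_HL] vm) (auto simp: ennreal_eq_0_iff not_le)
 have "lap n (g k) (rdiag n z) * ennreal (vdm n z) = ennreal (pi ^ (\<Sum>i<n. i)) * NI (LR n) (%x. g k (rdiag n x) * v x)" for k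
  using lap_chamber_bounded[OF gm gu bd z] unfolding v_def by (simp only: mult.assoc)
 from LIMSEQ_unique[OF 1[unfolded this] 2] show ?thesis unfolding v_def by (simp only: mult.assoc)
qed

section \<open>The symmetric form of the eigenvalue kernel\<close>

text \<open>Up to sign, the product of (x_i - x_j) / (x_i + x_j) times det exp(- l_i x_j^2), divided
  by the Vandermonde product of \<open>l\<close>. In contrast to \<open>hck\<close> it is symmetric
  in \<open>x\<close> and in \<open>l\<close>, and nonnegative for distinct
  \<open>l\<close>.\<close>

definition kap :: "nat => (nat => real) => (nat => real) => real" where
 "kap n l x = (vdm n x)^2 * (hck n l x / vdm n l)"

lemma vdm_permute: "p permutes {0..<n} ==> vdm n (x o p) = signof p * vdm n (x :: nat => real)"
 using AD_permute[of p n "%j t. t ^ j" x] by (simp add: vandermonde)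

text \<open>Makes the antisymmetry in \<open>\<xi>\<close> visible. The constant is the sign of the
  reversal of the columns and depends on \<open>n\<close> alone.\<close>

lemma XD_transpose: "\<exists>c. \<forall>l \<xi>. XD n l \<xi> = c * AD n (%j t. exp (- t * l j)) \<xi>"
proof -
 define r where "r i = (if i < n then n - Suc i else i)" for i
 have "r permutes {0..<n}"
  by (rule bij_imp_permutes) (auto simp: r_def intro!: bij_betw_byWitness[where f' = r])
 from AD_permute[OF this] have "AD n (%j t. exp (- t * l j)) (\<xi> o r) = signof r * AD n (%j t. exp (- t * l j)) \<xi>" for l \<xi> :: "nat => real" .
 moreover have "XD n l \<xi> = AD n (%j t. exp (- t * l j)) (\<xi> o r)" for l \<xi>
  unfolding XD_def AD_def
  by (subst det_transpose[symmetric, OF mat_carrier]) (auto intro!: arg_cong[where f = det] eq_matI simp: r_def)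
 ultimately show ?thesis by auto
qed

lemma kap_permute: "p permutes {0..<n} ==> kap n l (x o p) = kap n l x"
proof -
 assume p: "p permutes {0..<n}"
 obtain c where c: "!!\<xi>. XD n l \<xi> = c * AD n (%j t. exp (- t * l j)) \<xi>" using XD_transpose[of n] by blast
 have s: "sq (x o p) = sq x o p" by auto
 have "(signof p)^2 = (1 :: real)" by (simp add: sign_def)
 moreover have "(signof p :: real) ~= 0" by (simp add: sign_def)
 ultimately show ?thesis
  unfolding kap_def hck_def s c AD_permute[OF p] vdm_permute[OF p] by (simp add: power_mult_distrib)
qed

lemma hck_permute: "p permutes {0..<n} ==> hck n (l o p) x / vdm n (l o p) = hck n l x / vdm n l"
proof -
 assume p: "p permutes {0..<n}"
 have "(signof p :: real) ~= 0" by (simp add: sign_def)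
 thus ?thesis unfolding hck_def XD_def AD_permute[OF p] vdm_permute[OF p] by simp
qed

lemma kap_nonneg: "inj_on l {..<n} ==> 0 <= kap n l x"
proof -
 assume "inj_on l {..<n}"
 from sorting_permutation[OF this] obtain p where p: "p permutes {0..<n}" "chm n (l o p)" by blast
 have "0 <= hck n (l o p) x"
 \<comment> \<open>If two squares coincide, division by 0 makes the kernel 0; otherwise it is the
   value of a nonnegative pattern integral.\<close>
 proof (cases "vdm n (sq x) = 0")
  case False
  have "inj_on (sq x) {..<n}"
  proof (rule linorder_inj_onI)
   fix i j assume ij: "i < j" "i : {..<n}" "j : {..<n}"
   show "(x i)^2 ~= (x j)^2"
   proof
    assume "(x i)^2 = (x j)^2"
    hence "(\<Prod>k<j. sq x j - sq x k) = 0" using ij by (intro prod_zero bexI[of _ i]) auto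
    hence "vdm n (sq x) = 0" unfolding vdm_def by (intro prod_zero bexI[OF _ ij(3)]) auto
    with False show False ..
   qed
  qed auto
  thus ?thesis unfolding hck_def by (rule GTD_eq(2)[OF p(2)])
 qed (simp add: hck_def)
 hence "0 <= hck n (l o p) x / vdm n (l o p)" using vdm_pos[OF p(2)] by simp
 thus ?thesis unfolding hck_permute[OF p(1)] kap_def by (intro mult_nonneg_nonneg) auto
qed

lemma measurable_kap: "kap n l bm LR n"
 unfolding kap_def[abs_def] by (intro mi)

text \<open>The left side depends on \<open>l\<close> only through the spectrum and
  \<open>kap\<close> is symmetric in \<open>l\<close>, so sorting \<open>l\<close> reduces to the
  chamber case. Symmetry in \<open>x\<close> unfolds the chamber to all tuples, whence the
  factorial.\<close>

theorem lap_spectral: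
 fixes f :: "complex mat => real"
 assumes f: "f bm HL n" "uinv n f" and l: "inj_on l {..<n}" "!!i. i < n ==> 0 < l i"
 shows "lap n f (rdiag n l) = ennreal (pi ^ (\<Sum>i<n. i) / fact n) * NI (LR n) (%x. ennreal (f (rdiag n x)) * ennreal (kap n l x))"
proof -
 from sorting_permutation[OF l(1)] obtain p where p: "p permutes {0..<n}" "chm n (l o p)" by blast
 have p': "q permutes {..<n}" if "q permutes {0..<n}" for q using that by (simp add: atLeast0LessThan)
 have pos: "0 < (l o p) i" if "i < n" for i using l(2) permutes_in_image[OF p(1), of i] that by simp
 define v where "v = vdm n (l o p)"
 have v: "0 < v" unfolding v_def by (rule vdm_pos[OF p(2)])
 let ?g = "%x. ennreal (f (rdiag n x)) * ennreal (kap n l x)"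
 have gm: "?g bm LR n"
  by (intro mi mcomp[OF measurable_rdiag f(1)] measurable_kap)
 have inv: "h (rdiag n (x o q)) = h (rdiag n x)" if "q permutes {0..<n}" "uinv n h" for q x and h :: "complex mat => 'b"
 proof -
  from permute_rdiag[OF p'[OF that(1)], of x] obtain U where U: "unitary_mat n U" "rdiag n (x o q) = conj_by U (rdiag n x)" by blast
  show ?thesis unfolding U(2) by (rule uinvD[OF that(2) U(1) herm_rdiag])
 qed
 hence chamber: "NI (LR n) ?g = fact n * NI (LR n) (%x. ?g x * of_bool (chm n x))"
  by (intro nn_integral_LR_chamber gm) (simp only: kap_permute inv[OF _ f(2)])
 have k: "ennreal ((vdm n x)^2) * ennreal (hck n (l o p) x) = ennreal v * ennreal (kap n l x)" for x
 proof -
  have "kap n l x = (vdm n x)^2 * (hck n (l o p) x / v)" using hck_permute[OF p(1), where l = l and x = x] by (simp add: kap_def v_def)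
  hence "v * kap n l x = (vdm n x)^2 * hck n (l o p) x" using v by simp
  thus ?thesis using v kap_nonneg[OF l(1), of x] by (simp add: ennreal_mult'[symmetric])
 qed
 have "uinv n (lap n f)"
  by (rule uinv_lap[OF mcomp[OF f(1) measurable_ennreal]]) (simp add: uinv_def uinvD[OF f(2)])
 from inv[OF p(1) this, of l] have "ennreal v * lap n f (rdiag n l) = ennreal (pi ^ (\<Sum>i<n. i)) *
   NI (LR n) (%x. f (rdiag n x) * ennreal ((vdm n x)^2) * of_bool (chm n x) * ennreal (hck n (l o p) x))"
  using lap_chamber[OF f p(2) pos] unfolding v_def by (simp only: mult.commute)
 also have "NI (LR n) (%x. f (rdiag n x) * ennreal ((vdm n x)^2) * of_bool (chm n x) * ennreal (hck n (l o p) x))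
   = NI (LR n) (%x. ennreal v * (?g x * of_bool (chm n x)))"
 proof (rule nn_integral_cong)
  fix x
  have "ennreal (f (rdiag n x)) * ennreal ((vdm n x)^2) * of_bool (chm n x) * ennreal (hck n (l o p) x) =
    (ennreal ((vdm n x)^2) * ennreal (hck n (l o p) x)) * (ennreal (f (rdiag n x)) * of_bool (chm n x))" by (simp only: mult_ac)
  thus "ennreal (f (rdiag n x)) * ennreal ((vdm n x)^2) * of_bool (chm n x) * ennreal (hck n (l o p) x) = ennreal v * (?g x * of_bool (chm n x))"
   unfolding k by (simp only: mult_ac)
 qed
 also have "... = ennreal v * NI (LR n) (%x. ?g x * of_bool (chm n x))"
  by (intro nn_integral_cmult mi gm mcomp[OF measurable_chm_pred]) simp
 finally have "ennreal v * lap n f (rdiag n l) = ennreal v * (ennreal (pi ^ (\<Sum>i<n. i)) * NI (LR n) (%x. ?g x * of_bool (chm n x)))"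
  by (simp only: mult.left_commute)
 hence "lap n f (rdiag n l) = ennreal (pi ^ (\<Sum>i<n. i)) * NI (LR n) (%x. ?g x * of_bool (chm n x))"
  using v by (simp add: ennreal_mult_cancel_left ennreal_eq_0_iff)
 also have "ennreal (pi ^ (\<Sum>i<n. i)) = ennreal (pi ^ (\<Sum>i<n. i) / fact n) * fact n"
  by (simp add: ennreal_fact[symmetric] ennreal_mult'[symmetric])
 finally show ?thesis unfolding chamber by (simp only: mult.assoc)
qed

section \<open>The matrix model as an eigenvalue integral\<close>

text \<open>Polynomial growth in product form: closed under sums and products, and adapted to
  integrals that factorise over the eigenvalues.\<close>

definition bnd :: "nat => ((nat => real) => real) => bool" where
 "bnd n f \<longleftrightarrow> (\<exists>C M. 0 <= C & (\<forall>x. \<bar>f x\<bar> <= C * (\<Prod>i<n. 1 + \<bar>x i\<bar>) ^ M))"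

definition pbd :: "nat => ((nat => real) => real) => bool" where
 "pbd n f \<longleftrightarrow> f bm LR n & bnd n f"

definition grow :: "nat => (complex mat => real) => bool" where
 "grow n F \<longleftrightarrow> F bm HL n & uinv n F & bnd n (%x. F (rdiag n x))"

lemma factor_le_prod:
 fixes x :: "nat => real"
 assumes "i < n"
 shows "1 + \<bar>x i\<bar> <= (\<Prod>i<n. 1 + \<bar>x i\<bar>)"
proof -
 from assms have "(\<Prod>i<n. 1 + \<bar>x i\<bar>) = (1 + \<bar>x i\<bar>) * (\<Prod>i\<in>{..<n} - {i}. 1 + \<bar>x i\<bar>)" by (intro prod.remove) auto
 moreover have "1 <= (\<Prod>i\<in>{..<n} - {i}. 1 + \<bar>x i\<bar>)" by (intro prod_ge_1) auto
 ultimately show ?thesis using mult_left_mono[of 1 _ "1 + \<bar>x i\<bar>"] by simp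
qed

lemma bnd_intros:
 shows "bnd n (%_. c)" "i < n ==> bnd n (%x. x i)" "bnd n f ==> bnd n (%x. \<bar>f x\<bar>)"
  and "bnd n f ==> bnd n g ==> bnd n (%x. f x + g x)" "bnd n f ==> bnd n g ==> bnd n (%x. f x * g x)"
proof -
 have P1: "1 <= (\<Prod>i<n. 1 + \<bar>x i\<bar>)" for x :: "nat => real" by (intro prod_ge_1) auto
 show "bnd n (%_. c)" unfolding bnd_def by (intro exI[of _ "\<bar>c\<bar>"] exI[of _ 0]) auto
 show "bnd n (%x. x i)" if "i < n"
 proof -
  have "\<bar>x i\<bar> <= 1 * (\<Prod>i<n. 1 + \<bar>x i\<bar>) ^ 1" for x :: "nat => real" using factor_le_prod[OF that, of x] by simp
  thus ?thesis unfolding bnd_def by (meson zero_le_one)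
 qed
 show "bnd n (%x. \<bar>f x\<bar>)" if "bnd n f" using that by (simp add: bnd_def)
 assume "bnd n f" "bnd n g"
 then obtain C M C' M' where f: "0 <= C" "!!x. \<bar>f x\<bar> <= C * (\<Prod>i<n. 1 + \<bar>x i\<bar>) ^ M"
  and g: "0 <= C'" "!!x. \<bar>g x\<bar> <= C' * (\<Prod>i<n. 1 + \<bar>x i\<bar>) ^ M'"
  unfolding bnd_def by blast
 have "\<bar>f x + g x\<bar> <= (C + C') * (\<Prod>i<n. 1 + \<bar>x i\<bar>) ^ (M + M')" for x
 proof -
  let ?P = "\<Prod>i<n. 1 + \<bar>x i\<bar>"
  have "?P ^ M <= ?P ^ (M + M')" "?P ^ M' <= ?P ^ (M + M')" using P1[of x] by (auto intro!: power_increasing)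
  hence "C * ?P ^ M + C' * ?P ^ M' <= (C + C') * ?P ^ (M + M')"
   unfolding distrib_right using f(1) g(1) by (intro add_mono mult_left_mono) auto
  thus ?thesis using f(2)[of x] g(2)[of x] by linarith
 qed
 thus "bnd n (%x. f x + g x)" unfolding bnd_def using f(1) g(1) by (intro exI[of _ "C + C'"] exI[of _ "M + M'"]) auto
 have "\<bar>f x * g x\<bar> <= (C * C') * (\<Prod>i<n. 1 + \<bar>x i\<bar>) ^ (M + M')" for x
  using mult_mono[OF f(2) g(2), of x x] f(1) P1[of x] by (simp add: abs_mult power_add mult_ac)
 thus "bnd n (%x. f x * g x)" unfolding bnd_def using f(1) g(1) by (intro exI[of _ "C * C'"] exI[of _ "M + M'"]) auto
qed

lemma pbd_intros:
 shows "pbd n (%_. c)" "i < n ==> pbd n (%x. x i)"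
  and "pbd n f ==> pbd n g ==> pbd n (%x. f x + g x)" "pbd n f ==> pbd n g ==> pbd n (%x. f x * g x)"
 by (auto simp: pbd_def intro: bnd_intros mi)

lemma pbd_sum: "(!!i. i : A ==> pbd n (f i)) ==> pbd n (%x. \<Sum>i\<in>A. f i x)"
 by (induction A rule: infinite_finite_induct) (auto intro: pbd_intros)

lemma pbd_prod: "(!!i. i : A ==> pbd n (f i)) ==> pbd n (%x. \<Prod>i\<in>A. f i x)"
 by (induction A rule: infinite_finite_induct) (auto intro: pbd_intros)

lemma pbd_power: "pbd n f ==> pbd n (%x. f x ^ k)"
 by (induction k) (auto intro: pbd_intros)

lemma grow_intros:
 shows "grow n (%_. c)" "grow n (%H. tr_pow H m)"
  and "grow n F ==> grow n G ==> grow n (%H. F H + G H)" "grow n F ==> grow n G ==> grow n (%H. F H * G H)"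
  and "grow n F ==> grow n (%H. \<bar>F H\<bar>)"
proof -
 have "pbd n (%x. tr_pow (rdiag n x) m)" unfolding tr_pow_rdiag by (intro pbd_sum pbd_power pbd_intros(2)) simp
 thus "grow n (%H. tr_pow H m)" using measurable_tr_pow_HL uinv_tr_pow by (auto simp: grow_def pbd_def)
qed (auto simp: grow_def uinv_def intro: bnd_intros)

lemma grow_sum: "(!!i. i : A ==> grow n (F i)) ==> grow n (%H. \<Sum>i\<in>A. F i H)"
 by (induction A rule: infinite_finite_induct) (auto intro: grow_intros)

lemma grow_prod: "(!!i. i : A ==> grow n (F i)) ==> grow n (%H. \<Prod>i\<in>A. F i H)"
 by (induction A rule: infinite_finite_induct) (auto intro: grow_intros)

lemma grow_power: "grow n F ==> grow n (%H. F H ^ k)"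
 by (induction k) (auto intro: grow_intros)

lemma nn_integral_LR_prod:
 assumes "!!i. i < n ==> g i bm borel"
 shows "NI (LR n) (%x. (\<Prod>i<n. g i (x i))) = (\<Prod>i<n. NI lborel (%t. g i t))"
proof -
 interpret product_sigma_finite "%_::nat. lborel :: real measure" by (rule product_sigma_finite_lborel)
 show ?thesis using assms by (intro product_nn_integral_prod) auto
qed

text \<open>The size \<open>n\<close> may have either parity, because the reduction removes one
  eigenvalue at a time and passes through odd sizes.\<close>

locale matrix_model =
 fixes lam :: "real list" and V0 :: "real => real" and n :: nat
 assumes len: "length lam = n" and pos: "!!i. i < n ==> 0 < lam ! i" and cont: "continuous_on UNIV V0"
  and mom: "!!i k. i < n ==> integrable lborel (%x::real. x ^ k * exp (- (1/2) * lam ! i * x^2 + V0 x))"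
begin

definition cN :: real where
 "cN = sqrt (\<Prod>i<n. \<Prod>j<n. lam ! i + lam ! j) / (2 powr (real n / 2) * (2 * pi) powr ((real n)^2 / 2))"

lemma cN_pos: "0 < cN"
 unfolding cN_def using pos by (intro divide_pos_pos real_sqrt_gt_zero prod_pos ballI add_pos_pos mult_pos_pos) auto

definition eV :: "complex mat => real" where "eV H = exp (tr_fun V0 H)"

lemma eV: "eV bm HL n" "uinv n eV" "0 < eV H" "eV (rdiag n x) = (\<Prod>i<n. exp (V0 (x i)))"
 unfolding eV_def[abs_def]
 by (rule mcomp[OF measurable_tr_fun[OF cont] borel_measurable_exp])
   (simp_all add: uinv_def tr_fun_conj_by tr_fun_rdiag exp_sum)

lemma half_pr: "Re (mat_trace (field_mat lam * H ^\<^sub>m 2)) = 2 * pr (rdiag n (%i. lam ! i / 2)) (H ^\<^sub>m 2)" if "herm n H"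
proof -
 have "Re (mat_trace (field_mat lam * H ^\<^sub>m 2)) = pr (rdiag n (%i. lam ! i)) (H ^\<^sub>m 2)"
  by (simp add: pr_def field_mat_def rdiag_def len)
 thus ?thesis
  unfolding pr_rdiag_left[OF hermD(1)[OF herm_pow[OF that]]] by (simp add: sum_distrib_left sum_negf)
qed

definition gw :: "complex mat => real" where "gw H = cN * exp (- pr (rdiag n (%i. lam ! i / 2)) (H ^\<^sub>m 2)) * eV H"

lemma gw: "gw bm HL n" "0 <= gw H"
proof -
 have "(%H. pr (rdiag n (%i. lam ! i / 2)) (H ^\<^sub>m 2)) bm HL n"
  by (rule measurable_pr[OF measurable_const measurable_ident_sets[OF refl]]) (simp add: space_HL)
 thus "gw bm HL n" unfolding gw_def[abs_def]
  by (intro mi eV)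
 show "0 <= gw H" unfolding gw_def using cN_pos eV(3)[of H] by (intro mult_nonneg_nonneg) auto
qed

lemma mu0_density: "mu0 lam V0 = density (HL n) (%H. ennreal (gw H))"
proof -
 have e: "(%H. ennreal (exp (Re (mat_trace (functional_calculus V0 H))))) bm HL n"
  using mcomp[OF eV(1) measurable_ennreal] by (simp add: eV_def tr_fun_def)
 have g: "gauss_measure lam = density (HL n) (%H. ennreal (cN * exp (- pr (rdiag n (%i. lam ! i / 2)) (H ^\<^sub>m 2))))"
  unfolding gauss_measure_def Let_def len cN_def[symmetric]
 proof (rule density_cong)
  have p: "(%H. ennreal (cN * exp (- pr (rdiag n (%i. lam ! i / 2)) (H ^\<^sub>m 2)))) bm HL n"
   by (intro mi measurable_pr[OF measurable_const measurable_ident_sets[OF refl]])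
     (simp add: space_HL)
  thus "(%H. ennreal (cN * exp (- pr (rdiag n (%i. lam ! i / 2)) (H ^\<^sub>m 2)))) bm HL n" .
  show "(%H. ennreal (cN * exp (- (1/2) * Re (mat_trace (field_mat lam * H ^\<^sub>m 2))))) bm HL n"
   using p by (rule measurable_cong[THEN iffD1, rotated]) (simp add: half_pr space_HL)
 qed (auto simp: half_pr space_HL intro!: AE_I2)
 show ?thesis unfolding mu0_def g
 proof (subst density_density_eq)
  show "density (HL n) (%H. ennreal (cN * exp (- pr (rdiag n (%i. lam ! i / 2)) (H ^\<^sub>m 2))) * ennreal (exp (Re (mat_trace (functional_calculus V0 H)))))
    = density (HL n) (%H. ennreal (gw H))"
   using cN_pos by (intro arg_cong[where f = "density (HL n)"] ext) (simp add: gw_def eV_def tr_fun_def ennreal_mult)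
 qed (use e gw(1) in \<open>auto intro!: mi measurable_pr[OF measurable_const measurable_ident_sets[OF refl]] simp: space_HL\<close>)
qed

lemma mom_abs: "i < n ==> NI lborel (%t. ennreal ((1 + \<bar>t\<bar>) ^ M * exp (- (1/2) * lam ! i * t^2 + V0 t))) < \<infinity>"
proof -
 assume i: "i < n"
 have I: "integrable lborel (%t. 2 ^ M * (t ^ 0 * exp (- (1/2) * lam ! i * t^2 + V0 t) + t ^ (2 * M) * exp (- (1/2) * lam ! i * t^2 + V0 t)))"
  by (intro integrable_mult_right Bochner_Integration.integrable_add mom i)
 have le: "(1 + \<bar>t\<bar>) ^ M <= 2 ^ M * (1 + t ^ (2 * M))" for t :: real
 proof (cases "\<bar>t\<bar> <= 1")
  case True
  hence "(1 + \<bar>t\<bar>) ^ M <= 2 ^ M" by (intro power_mono) auto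
  moreover have "2 ^ M * 1 <= 2 ^ M * (1 + t ^ (2 * M))" by (intro mult_left_mono) auto
  ultimately show ?thesis by linarith
 next
  case False
  hence "(1 + \<bar>t\<bar>) ^ M <= (2 * \<bar>t\<bar>) ^ M" by (intro power_mono) auto
  also have "... <= 2 ^ M * \<bar>t\<bar> ^ (2 * M)" unfolding power_mult_distrib using False by (intro mult_left_mono power_increasing) auto
  also have "... <= 2 ^ M * (1 + t ^ (2 * M))" by (simp add: power_mult)
  finally show ?thesis .
 qed
 have "NI lborel (%t. ennreal ((1 + \<bar>t\<bar>) ^ M * exp (- (1/2) * lam ! i * t^2 + V0 t))) <=
  NI lborel (%t. ennreal (norm (2 ^ M * (t ^ 0 * exp (- (1/2) * lam ! i * t^2 + V0 t) + t ^ (2 * M) * exp (- (1/2) * lam ! i * t^2 + V0 t)))))"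
 proof (intro nn_integral_mono ennreal_leI)
  fix t :: real
  show "(1 + \<bar>t\<bar>) ^ M * exp (- (1/2) * lam ! i * t^2 + V0 t) <=
   norm (2 ^ M * (t ^ 0 * exp (- (1/2) * lam ! i * t^2 + V0 t) + t ^ (2 * M) * exp (- (1/2) * lam ! i * t^2 + V0 t)))"
   using mult_right_mono[OF le[of t], of "exp (- (1/2) * lam ! i * t^2 + V0 t)"]
   by (simp add: distrib_right mult.assoc power_mult abs_mult)
 qed
 also have "... < \<infinity>" by (rule conjunct2[OF iffD1[OF integrable_iff_bounded I]])
 finally show ?thesis .
qed

text \<open>Replacing every \<lambda>_i in the Gaussian by the smallest one, \<open>m\<close>, gives
  a unitarily invariant majorant, to which Weyl's formula applies whether or not the \<lambda>_i are
  distinct. After bounding the Vandermonde product the integral factorises into moments that belong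
  to that one \<lambda>_i.\<close>

lemma grow_integrable:
 assumes F: "grow n F"
 shows "integrable (mu0 lam V0) F"
proof -
 obtain m where m: "!!i. i < n ==> m <= lam ! i" "n = 0 | (\<exists>i<n. m = lam ! i)"
 proof (cases "n = 0")
  case False
  hence "Min ((!) lam ` {..<n}) : (!) lam ` {..<n}" by (intro Min_in) auto
  thus ?thesis by (intro that[of "Min ((!) lam ` {..<n})"]) auto
 qed auto
 obtain C M where C: "0 <= C" "!!x. \<bar>F (rdiag n x)\<bar> <= C * (\<Prod>i<n. 1 + \<bar>x i\<bar>) ^ M" and Fm: "F bm HL n" and Fu: "uinv n F"
  using F unfolding grow_def bnd_def by blast
 define G where "G H = ennreal (\<bar>F H\<bar> * (exp (- (m / 2) * tr_pow H 2) * eV H))" for H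
 have Gm: "G bm HL n" unfolding G_def[abs_def]
  by (intro mi borel_measurable_abs Fm eV measurable_tr_pow_HL)
 have Gu: "uinv n G" unfolding uinv_def G_def using uinvD[OF Fu] uinvD[OF eV(2)] uinvD[OF uinv_tr_pow[of n 2]] by simp
 define e where "e t = ennreal ((1 + \<bar>t\<bar>) ^ (M + 4 * n * n) * exp (- (1/2) * m * t^2 + V0 t))" for t
 have P1: "1 <= (\<Prod>i<n. 1 + \<bar>x i\<bar>)" for x :: "nat => real" by (intro prod_ge_1) auto
 have vb: "(vdm n x)^2 <= (\<Prod>i<n. 1 + \<bar>x i\<bar>) ^ (4 * n * n)" for x :: "nat => real"
 proof -
  let ?P = "\<Prod>i<n. 1 + \<bar>x i\<bar>"
  note 1 = factor_le_prod[of _ n x]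
  have "\<bar>vdm n x\<bar> <= (\<Prod>j<n. \<Prod>i<j. ?P^2)" unfolding vdm_def abs_prod
  proof (intro prod_mono conjI abs_ge_zero prod_nonneg ballI)
   fix j i assume "j : {..<n}" "i : {..<j}"
   hence "(1 + \<bar>x j\<bar>) * (1 + \<bar>x i\<bar>) <= ?P * ?P" using 1[of i] 1[of j] P1[of x] by (intro mult_mono) auto
   moreover have "\<bar>x j - x i\<bar> <= (1 + \<bar>x j\<bar>) * (1 + \<bar>x i\<bar>)" by (simp add: algebra_simps) (smt (verit) mult_nonneg_nonneg)
   ultimately show "\<bar>x j - x i\<bar> <= ?P^2" by (simp add: power2_eq_square)
  qed
  also have "... <= (\<Prod>j<n. ?P ^ (2 * n))"
   using P1[of x] by (intro prod_mono conjI) (auto simp: power_mult[symmetric] intro!: power_increasing)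
  also have "... = ?P ^ (2 * n * n)" by (simp add: power_mult)
  finally have "\<bar>vdm n x\<bar>^2 <= (?P ^ (2 * n * n))^2" by (intro power_mono) auto
  thus ?thesis by (simp add: power_mult[symmetric] mult_ac)
 qed
 have "NI (mu0 lam V0) (%H. ennreal (norm (F H))) = NI (HL n) (%H. ennreal (gw H) * ennreal (norm (F H)))"
  unfolding mu0_density using gw(1) Fm by (intro nn_integral_density) auto
 also have "... <= NI (HL n) (%H. ennreal cN * G H)"
 proof (rule nn_integral_mono)
  fix H assume "H : space (HL n)"
  hence H: "herm n H" by (rule space_HL_D)
  have "m / 2 * tr_pow H 2 <= pr (rdiag n (%i. lam ! i / 2)) (H ^\<^sub>m 2)"
   unfolding pr_rdiag_left[OF hermD(1)[OF herm_pow[OF H]]] tr_pow_2[OF H] sum_distrib_left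
  proof (rule sum_mono)
   fix i assume "i : {..<n}"
   thus "(\<Sum>j<n. m / 2 * (cmod (H $$ (i, j)))^2) <= lam ! i / 2 * Re ((H ^\<^sub>m 2) $$ (i, i))"
    using m(1) by (simp only: pow2_diag[OF H] lessThan_iff sum_distrib_left[symmetric]) (intro mult_right_mono sum_nonneg, auto)
  qed
  hence "gw H * \<bar>F H\<bar> <= cN * (\<bar>F H\<bar> * (exp (- (m / 2) * tr_pow H 2) * eV H))"
   unfolding gw_def using cN_pos eV(3)[of H] mult_left_mono[of "exp (- pr (rdiag n (%i. lam ! i / 2)) (H ^\<^sub>m 2))" "exp (- (m / 2) * tr_pow H 2)" "cN * eV H * \<bar>F H\<bar>"]
   by (simp add: mult_ac)
  thus "ennreal (gw H) * ennreal (norm (F H)) <= ennreal cN * G H"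
   using cN_pos gw(2)[of H] unfolding G_def by (simp add: ennreal_mult'[symmetric] ennreal_leI)
 qed
 also have "... = ennreal cN * NI (HL n) G" by (rule nn_integral_cmult[OF Gm])
 also have "... < \<infinity>"
 proof -
  have "NI (LR n) (%x. G (rdiag n x) * ennreal ((vdm n x)^2) * of_bool (chm n x)) <= NI (LR n) (%x. ennreal C * (\<Prod>i<n. e (x i)))"
  proof (rule nn_integral_mono)
   fix x :: "nat => real"
   let ?P = "\<Prod>i<n. 1 + \<bar>x i\<bar>" and ?E = "\<Prod>i<n. exp (- (1/2) * m * (x i)^2 + V0 (x i))"
   have E: "exp (- (m / 2) * tr_pow (rdiag n x) 2) * eV (rdiag n x) = ?E"
    unfolding eV(4) tr_pow_rdiag sum_distrib_left exp_sum[OF finite_lessThan] prod.distrib[symmetric]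
    by (intro prod.cong refl) (simp add: exp_add[symmetric])
   have E0: "0 <= ?E" by (intro prod_nonneg) auto
   have "\<bar>F (rdiag n x)\<bar> * ?E * (vdm n x)^2 <= C * ?P ^ M * ?E * ?P ^ (4 * n * n)"
    using C vb[of x] P1[of x] E0 by (intro mult_mono mult_nonneg_nonneg) auto
   hence "ennreal (\<bar>F (rdiag n x)\<bar> * ?E * (vdm n x)^2) <= ennreal C * ennreal (?P ^ (M + 4 * n * n) * ?E)"
    unfolding ennreal_mult'[OF C(1), symmetric] by (intro ennreal_leI) (simp add: power_add mult_ac)
   also have "ennreal (?P ^ (M + 4 * n * n) * ?E) = (\<Prod>i<n. e (x i))"
    unfolding prod_power_distrib prod.distrib[symmetric] e_def by (rule prod_ennreal[symmetric]) auto
   finally have "G (rdiag n x) * ennreal ((vdm n x)^2) <= ennreal C * (\<Prod>i<n. e (x i))"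
    unfolding G_def E by (simp add: ennreal_mult''[symmetric])
   thus "G (rdiag n x) * ennreal ((vdm n x)^2) * of_bool (chm n x) <= ennreal C * (\<Prod>i<n. e (x i))"
    by (cases "chm n x") simp_all
  qed
  also have "... = ennreal C * (\<Prod>i<n. NI lborel e)"
  proof -
   have em: "e bm borel" unfolding e_def[abs_def] using borel_measurable_continuous_onI[OF cont] by measurable
   have "(%x. \<Prod>i<n. e (x i)) bm LR n"
    by (intro borel_measurable_prod_ennreal mcomp[OF measurable_component_LR em]) simp
   thus ?thesis using nn_integral_LR_prod[of n "%_. e"] em by (simp add: nn_integral_cmult)
  qed
  also have "... < \<infinity>"
  proof -
   have "(\<Prod>i<n. NI lborel e) < \<infinity>"
    using m(2) mom_abs[of _ "M + 4 * n * n"] unfolding e_def by (auto simp: power_less_top_ennreal)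
   thus ?thesis by (simp add: ennreal_mult_less_top)
  qed
  finally show ?thesis unfolding weyl[OF Gm Gu] by (simp add: ennreal_mult_less_top)
 qed
 finally show ?thesis
  using Fm by (intro integrableI_bounded) (simp_all add: mu0_density)
qed

definition W :: "(nat => real) => real" where
 "W x = cN * (pi ^ (\<Sum>i<n. i) / fact n) * (\<Prod>i<n. exp (V0 (x i))) * kap n (%i. lam ! i / 2) x"

lemma W_measurable: "W bm LR n"
 unfolding W_def[abs_def]
 by (intro mi measurable_kap mcomp[OF measurable_component_LR borel_measurable_continuous_onI[OF cont]]) simp

context
 assumes dist: "distinct lam"
begin

lemma W_nonneg: "0 <= W x"
proof -
 have "inj_on (%i. lam ! i / 2) {..<n}" using dist len by (auto simp: inj_on_def nth_eq_iff_index_eq)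
 thus ?thesis unfolding W_def using cN_pos kap_nonneg by (intro mult_nonneg_nonneg prod_nonneg) auto
qed

lemma spectral_nonneg:
 assumes F: "F bm HL n" "uinv n F" "!!H. 0 <= F H"
 shows "NI (mu0 lam V0) (%H. ennreal (F H)) = NI (LR n) (%x. ennreal (F (rdiag n x) * W x))"
proof -
 let ?l = "%i. lam ! i / 2"
 have l: "inj_on ?l {..<n}" "!!i. i < n ==> 0 < ?l i" using dist len pos by (auto simp: inj_on_def nth_eq_iff_index_eq)
 have gm: "(%H. F H * eV H) bm HL n" by (intro mi F eV)
 have gu: "uinv n (%H. F H * eV H)" using F(2) eV(2) by (simp add: uinv_def)
 let ?c = "pi ^ (\<Sum>i<n. i) / fact n"
 have "NI (mu0 lam V0) (%H. ennreal (F H)) = NI (HL n) (%H. ennreal (gw H) * ennreal (F H))"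
  unfolding mu0_density using gw(1) F by (intro nn_integral_density) auto
 also have "... = NI (HL n) (%H. ennreal cN * (ennreal (F H * eV H) * ennreal (exp (- pr (rdiag n ?l) (H ^\<^sub>m 2)))))"
  using cN_pos eV(3) F(3) by (intro nn_integral_cong) (simp add: gw_def ennreal_mult'[symmetric] ennreal_mult''[symmetric] less_imp_le mult_ac)
 also have "... = ennreal cN * lap n (%H. ennreal (F H * eV H)) (rdiag n ?l)"
  unfolding lap_def using measurable_lap_section[OF mcomp[OF gm measurable_ennreal], of "rdiag n ?l"]
  by (intro nn_integral_cmult) (simp add: space_HL)
 also have "... = NI (LR n) (%x. ennreal cN * (ennreal ?c * (ennreal (F (rdiag n x) * eV (rdiag n x)) * ennreal (kap n ?l x))))"
 proof -
  have m: "(%x. ennreal (F (rdiag n x) * eV (rdiag n x)) * ennreal (kap n ?l x)) bm LR n"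
   by (intro mi measurable_kap mcomp[OF measurable_rdiag gm])
  show ?thesis using lap_spectral[OF gm gu l] m by (simp add: nn_integral_cmult)
 qed
 also have "... = NI (LR n) (%x. ennreal (F (rdiag n x) * W x))"
  using cN_pos F(3) kap_nonneg[OF l(1)] eV(3)
  by (intro nn_integral_cong) (simp add: W_def eV(4)[symmetric] ennreal_mult'[symmetric] ennreal_mult''[symmetric] less_imp_le mult_ac)
 finally show ?thesis .
qed

text \<open>\<open>F\<close> is the difference of F + |F| and |F|, both nonnegative, invariant and
  of polynomial growth.\<close>

theorem integral_spectral:
 assumes F: "grow n F"
 shows "integrable (LR n) (%x. F (rdiag n x) * W x)" "(LINT H|mu0 lam V0. F H) = (LINT x|LR n. F (rdiag n x) * W x)"
proof -
 have nonneg: "integrable (LR n) (%x. G (rdiag n x) * W x) & (LINT H|mu0 lam V0. G H) = (LINT x|LR n. G (rdiag n x) * W x)"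
  if G: "grow n G" "!!H. 0 <= G H" for G
 proof -
  have m: "G bm HL n" "uinv n G" using G by (auto simp: grow_def)
  have mW: "(%x. G (rdiag n x) * W x) bm LR n"
   by (intro mi W_measurable mcomp[OF measurable_rdiag m(1)])
  have eq: "NI (mu0 lam V0) (%H. ennreal (G H)) = NI (LR n) (%x. ennreal (G (rdiag n x) * W x))"
   by (rule spectral_nonneg[OF m G(2)])
  have fin: "NI (mu0 lam V0) (%H. ennreal (G H)) < \<infinity>"
   using grow_integrable[OF G(1)] G(2) by (simp add: integrable_iff_bounded)
  have "integrable (LR n) (%x. G (rdiag n x) * W x)"
   using mW fin eq G(2) W_nonneg by (intro integrableI_nonneg) auto
  moreover have "(LINT H|mu0 lam V0. G H) = (LINT x|LR n. G (rdiag n x) * W x)"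
   using G(2) W_nonneg m mW eq by (subst (1 2) integral_eq_nn_integral) (auto simp: mu0_density)
  ultimately show ?thesis by blast
 qed
 note A = nonneg[OF grow_intros(5)[OF F]] and B = nonneg[OF grow_intros(3)[OF F grow_intros(5)[OF F]]]
 have 1: "integrable (LR n) (%x. \<bar>F (rdiag n x)\<bar> * W x)" "integrable (LR n) (%x. (F (rdiag n x) + \<bar>F (rdiag n x)\<bar>) * W x)"
  using A B by auto
 have "integrable (LR n) (%x. (F (rdiag n x) + \<bar>F (rdiag n x)\<bar>) * W x - \<bar>F (rdiag n x)\<bar> * W x)"
  by (rule Bochner_Integration.integrable_diff[OF 1(2,1)])
 thus I: "integrable (LR n) (%x. F (rdiag n x) * W x)" by (simp add: algebra_simps)
 have "(LINT H|mu0 lam V0. F H) = (LINT H|mu0 lam V0. F H + \<bar>F H\<bar>) - (LINT H|mu0 lam V0. \<bar>F H\<bar>)"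
  using grow_integrable[OF F] grow_integrable[OF grow_intros(5)[OF F]] by simp
 also have "... = (LINT x|LR n. (F (rdiag n x) + \<bar>F (rdiag n x)\<bar>) * W x) - (LINT x|LR n. \<bar>F (rdiag n x)\<bar> * W x)"
  using A B by auto
 also have "... = (LINT x|LR n. F (rdiag n x) * W x)"
  by (subst Bochner_Integration.integral_diff[OF 1(2,1), symmetric]) (simp add: algebra_simps)
 finally show "(LINT H|mu0 lam V0. F H) = (LINT x|LR n. F (rdiag n x) * W x)" .
qed

end

end

section \<open>Coefficients of the formal exponentials\<close>

type_synonym expo = "nat \<Rightarrow>\<^sub>0 nat"

abbreviation lk :: "expo => nat => nat" where "lk == Poly_Mapping.lookup"
abbreviation ky :: "expo => nat set" where "ky == Poly_Mapping.keys"
abbreviation splits :: "expo => (expo \<times> expo) set" where "splits a == {(b, c). b + c = a}"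

text \<open>A constant of its own because the simplifier rewrites \<open>1\<close> in \<open>single k 1\<close> to \<open>Suc 0\<close>.\<close>

definition un :: "nat => expo" where "un k = Poly_Mapping.single k 1"

lemma un: "lk (un k) j = (if j = k then 1 else 0)" "ky (un k) = {k}"
 by (simp_all add: un_def lookup_single when_def)

definition mpow :: "(nat => 'a::comm_ring_1) => expo => 'a" where "mpow p a = (\<Prod>k\<in>ky a. p k ^ lk a k)"
definition afact :: "expo => 'a::field_char_0" where "afact a = (\<Prod>k\<in>ky a. fact (lk a k))"
text \<open>The coefficient of the monomial \<open>a\<close> in the exponential of the linear form
  with coefficients \<open>p\<close>.\<close>

definition tmon :: "(nat => 'a) => expo => 'a::field_char_0" where "tmon p a = mpow p a / afact a"
definition sz :: "expo => nat" where "sz a = (\<Sum>k\<in>ky a. lk a k)"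
text \<open>The weighted degree in which \<open>t\<^sub>2\<^sub>k\<^sub>+\<^sub>1\<close> has degree
  2k + 1. It records the power of z that comes with a monomial.\<close>

definition wt :: "expo => nat" where "wt a = (\<Sum>k\<in>ky a. (2 * k + 1) * lk a k)"

lemma superset:
 assumes "finite K" "ky a \<subseteq> K"
 shows "mpow p a = (\<Prod>k\<in>K. p k ^ lk a k)" "(afact a :: 'b::field_char_0) = (\<Prod>k\<in>K. fact (lk a k))"
  "sz a = (\<Sum>k\<in>K. lk a k)" "wt a = (\<Sum>k\<in>K. (2 * k + 1) * lk a k)"
 unfolding mpow_def afact_def sz_def wt_def using assms
 by (intro prod.mono_neutral_left sum.mono_neutral_left ballI; simp add: in_keys_iff)+

lemma un_split: "k : ky a ==> a = un k + (a - un k)"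
 by (rule poly_mapping_eqI) (auto simp: lookup_add lookup_minus un in_keys_iff)

lemma un_add:
 "mpow p (un k + b) = p k * mpow p b" "sz (un k + b) = Suc (sz b)" "wt (un k + b) = (2 * k + 1) + wt b"
 "(afact (un k + b) :: 'b::field_char_0) = of_nat (lk (un k + b) k) * afact b"
proof -
 let ?K = "insert k (ky b)"
 have K: "finite ?K" "ky (un k + b) \<subseteq> ?K" "ky b \<subseteq> ?K" "k : ?K"
  by (auto simp: in_keys_iff lookup_add un split: if_splits)
 have l: "lk (un k + b) j = (if j = k then Suc (lk b j) else lk b j)" for j
  by (auto simp: lookup_add un)
 show "mpow p (un k + b) = p k * mpow p b" "sz (un k + b) = Suc (sz b)" "wt (un k + b) = (2 * k + 1) + wt b"
  "(afact (un k + b) :: 'b) = of_nat (lk (un k + b) k) * afact b"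
  unfolding superset[OF K(1,2)] superset[OF K(1,3)] l
   prod.remove[OF K(1,4)] sum.remove[OF K(1,4)] by (simp_all add: mult_ac algebra_simps del: prod.insert sum.insert)
qed

lemma ky_zero: "sz a = 0 \<longleftrightarrow> a = 0" "mpow p 0 = 1" "afact 0 = 1" "wt 0 = 0" "wt a = 0 \<longleftrightarrow> a = 0" "ky a = {} \<longleftrightarrow> a = 0"
 by (auto simp: sz_def mpow_def afact_def wt_def in_keys_iff intro!: poly_mapping_eqI)

lemma tmon_rec: "k : ky a ==> p k * tmon p (a - un k) = of_nat (lk a k) * tmon p a"
proof -
 assume k: "k : ky a"
 hence "lk a k ~= 0" by (simp add: in_keys_iff)
 thus ?thesis
  using un_add(1)[of p k "a - un k"] un_add(4)[of k "a - un k", where 'b = 'a] un_split[OF k]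
  by (simp add: tmon_def)
qed

lemma tcoeff_simps:
 "tcoeff (F + G) a = tcoeff F a + tcoeff G a" "tcoeff (F - G) a = tcoeff F a - tcoeff G a" "tcoeff 0 a = 0"
 "tcoeff 1 a = (if a = 0 then 1 else 0)" "tcoeff (F * G) a = (\<Sum>(b, c)\<in>splits a. tcoeff F b * tcoeff G c)"
 "tcoeff (c *\<^sub>R (K :: 'b::{real_algebra_1,comm_ring_1} tseries)) a = c *\<^sub>R tcoeff K a"
 by (simp_all add: plus_tseries_def minus_tseries_def zero_tseries_def one_tseries_def times_tseries_def scaleR_tseries_def)

lemma tcoeff_sum: "tcoeff (\<Sum>i\<in>A. F i) a = (\<Sum>i\<in>A. tcoeff (F i) a)"
 by (induction A rule: infinite_finite_induct) (auto simp: tcoeff_simps)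

lemma tcoeff_tconst_mult: "tcoeff (tconst c * G) a = c * tcoeff G a"
proof -
 have "tcoeff (tconst c * G) a = (\<Sum>(b, d)\<in>{(0, a)}. tcoeff (tconst c) b * tcoeff G d)"
  unfolding tcoeff_simps by (rule sum.mono_neutral_right) (auto simp: finite_splits tconst_def split: if_splits)
 thus ?thesis by (simp add: tconst_def)
qed

lemma sum_splits_un: "(\<Sum>(b, c)\<in>splits a. if b : range un then f (the_elem (ky b)) c else 0) = (\<Sum>k\<in>ky a. f k (a - un k))"
proof -
 have "(\<Sum>(b, c)\<in>splits a. if b : range un then f (the_elem (ky b)) c else 0) =
   (\<Sum>(b, c)\<in>(%k. (un k, a - un k)) ` ky a. if b : range un then f (the_elem (ky b)) c else 0)"
 proof (rule sum.mono_neutral_right[OF finite_splits])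
  show "(%k. (un k, a - un k)) ` ky a \<subseteq> splits a" using un_split by auto
  show "\<forall>z\<in>splits a - (%k. (un k, a - un k)) ` ky a. (case z of (b, c) => if b : range un then f (the_elem (ky b)) c else 0) = 0"
  proof
   fix z assume z: "z : splits a - (%k. (un k, a - un k)) ` ky a"
   obtain b c where bc: "z = (b, c)" "b + c = a" using z by auto
   have "b ~: range un"
   proof
    assume "b : range un"
    then obtain k where k: "b = un k" by blast
    hence "k : ky a" "a - un k = c" using bc(2) by (auto simp: in_keys_iff lookup_add un)
    with z bc k show False by blast
   qed
   thus "(case z of (b, c) => if b : range un then f (the_elem (ky b)) c else 0) = 0" by (simp add: bc)
  qed
 qed
 also have "... = (\<Sum>k\<in>ky a. f k (a - un k))"
 proof (subst sum.reindex)
  show "inj_on (%k. (un k, a - un k)) (ky a)" by (rule inj_onI) (metis Pair_inject un(2) the_elem_eq)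
 qed (simp add: un)
 finally show ?thesis .
qed

lemma tcoeff_tlin: "tcoeff (tlin p) b = (if b : range un then p (the_elem (ky b)) else 0)"
proof (cases "b : range un")
 case True
 then obtain k where k: "b = un k" by blast
 have "tcoeff (tlin p) b = Sum_any (%j. if j = k then p k else 0)"
  unfolding tlin_def tsum_def tcoeff_Abs tcoeff_tconst_mult tvar_def un_def[symmetric] k
 proof (intro arg_cong[where f = Sum_any] ext)
  fix j
  have "un k = un j \<longleftrightarrow> j = k" by (metis un(2) the_elem_eq)
  thus "p j * (if un k = un j then 1 else 0) = (if j = k then p k else 0)" by simp
 qed
 thus ?thesis by (simp add: k un)
next
 case False
 hence "b ~= un k" for k by blast
 thus ?thesis
  unfolding tlin_def tsum_def tcoeff_Abs tcoeff_tconst_mult tvar_def un_def[symmetric] by auto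
qed

lemma tcoeff_tlin_mult: "tcoeff (tlin p * G) a = (\<Sum>k\<in>ky a. p k * tcoeff G (a - un k))"
 unfolding tcoeff_simps tcoeff_tlin sum_splits_un[of "%k c. p k * tcoeff G c", symmetric] by (intro sum.cong) auto

lemma tcoeff_tlin_power: "tcoeff (tlin p ^ i) a = (if sz a = i then fact i * tmon p a else (0::'a::field_char_0))"
proof (induction i arbitrary: a)
 case 0
 show ?case by (auto simp: tcoeff_simps ky_zero tmon_def)
next
 case (Suc i)
 have "tcoeff (tlin p ^ Suc i) a = (\<Sum>k\<in>ky a. (if sz a = Suc i then fact i * (of_nat (lk a k) * tmon p a) else 0))"
  unfolding power_Suc tcoeff_tlin_mult
 proof (rule sum.cong[OF refl])
  fix k assume k: "k : ky a"
  hence "sz a = Suc (sz (a - un k))" using un_add(2)[of k "a - un k"] un_split[OF k] by simp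
  thus "p k * tcoeff (tlin p ^ i) (a - un k) = (if sz a = Suc i then fact i * (of_nat (lk a k) * tmon p a) else 0)"
   unfolding Suc using tmon_rec[OF k, of p] by (auto simp: mult.left_commute)
 qed
 also have "... = (if sz a = Suc i then fact i * (of_nat (sz a) * tmon p a) else 0)"
 proof -
  have "(\<Sum>k\<in>ky a. of_nat (lk a k)) = (of_nat (sz a) :: 'a)" by (simp add: sz_def)
  thus ?thesis by (simp add: sum_distrib_left[symmetric] sum_distrib_right[symmetric])
 qed
 finally show ?case by (simp add: mult_ac)
qed

theorem tcoeff_texp: "tcoeff (texp (tlin p)) a = tmon p a"
proof -
 have "tcoeff (texp (tlin p)) a = Sum_any (%i. if i = sz a then tmon p a else 0)"
  unfolding texp_def tsum_def tcoeff_Abs tcoeff_tconst_mult tcoeff_tlin_power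
  by (intro arg_cong[where f = Sum_any] ext) auto
 thus ?thesis by simp
qed

text \<open>The hypothesis is Euler's identity for the exponential of a linear form, read
  coefficientwise; it determines the coefficients by induction on the total degree.\<close>

lemma tmon_unique:
 fixes X :: "expo => 'a::field_char_0"
 assumes "X 0 = 1" "!!a. of_nat (sz a) * X a = (\<Sum>k\<in>ky a. p k * X (a - un k))"
 shows "X a = tmon p a"
proof (induction "sz a" arbitrary: a)
 case 0
 thus ?case using assms(1) by (simp add: ky_zero tmon_def)
next
 case (Suc i)
 have "of_nat (sz a) * X a = (\<Sum>k\<in>ky a. of_nat (lk a k) * tmon p a)"
  unfolding assms(2)
 proof (rule sum.cong[OF refl])
  fix k assume k: "k : ky a"
  hence "i = sz (a - un k)" using un_add(2)[of k "a - un k"] un_split[OF k] Suc(2) by simp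
  thus "p k * X (a - un k) = of_nat (lk a k) * tmon p a" using Suc(1) tmon_rec[OF k, of p] by simp
 qed
 also have "... = of_nat (sz a) * tmon p a" by (simp add: sz_def sum_distrib_right[symmetric])
 finally show ?case using Suc(2) by (metis mult_left_cancel of_nat_eq_0_iff nat.distinct(1))
qed

lemma sz_wt_add: "sz (a + b) = sz a + sz b" "wt (a + b) = wt a + wt b"
proof -
 have K: "finite (ky a \<union> ky b)" "ky (a + b) \<subseteq> ky a \<union> ky b" "ky a \<subseteq> ky a \<union> ky b" "ky b \<subseteq> ky a \<union> ky b"
  using keys_add[of a b] by auto
 show "sz (a + b) = sz a + sz b" "wt (a + b) = wt a + wt b"
  unfolding superset[OF K(1,2)] superset[OF K(1,3)] superset[OF K(1,4)]
  by (simp_all add: lookup_add sum.distrib algebra_simps)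
qed

text \<open>The exponential of a sum is the product of the exponentials: by the product rule for the
  Euler operator, the product satisfies the recursion that characterises
  \<open>tmon\<close>.\<close>

theorem tmon_add: "tmon (%k. p k + q k) a = (\<Sum>(b, c)\<in>splits a. tmon p b * tmon q c :: 'a::field_char_0)"
proof -
 define X where "X a = (\<Sum>(b, c)\<in>splits a. tmon p b * tmon q c)" for a
 define E where "E p = (texp (tlin p) :: 'a tseries)" for p
 have X: "X a = tcoeff (E p * E q) a" for a by (simp add: X_def E_def tcoeff_simps tcoeff_texp)
 have e: "of_nat (sz a) * tmon p a = tcoeff (tlin p * E p) a" for p and a
 proof -
  have "(\<Sum>k\<in>ky a. p k * tmon p (a - un k)) = (\<Sum>k\<in>ky a. of_nat (lk a k) * tmon p a)" by (intro sum.cong refl tmon_rec)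
  thus ?thesis unfolding tcoeff_tlin_mult E_def tcoeff_texp by (simp add: sz_def sum_distrib_right)
 qed
 have "X a = tmon (%k. p k + q k) a"
 proof (rule tmon_unique)
  have "splits 0 = {(0, 0)}" by (auto simp: add_eq_0_iff_both_eq_0 poly_mapping_eq_iff lookup_add fun_eq_iff)
  thus "X 0 = 1" by (simp add: X_def tmon_def ky_zero)
  fix a
  have "of_nat (sz a) * X a = (\<Sum>(b, c)\<in>splits a. of_nat (sz b) * tmon p b * tmon q c + tmon p b * (of_nat (sz c) * tmon q c))"
   unfolding X_def sum_distrib_left by (intro sum.cong) (auto simp: sz_wt_add algebra_simps)
  also have "... = tcoeff ((tlin p * E p) * E q + E p * (tlin q * E q)) a"
   unfolding e tcoeff_simps(1,5)[of _ _ a] by (simp add: case_prod_beta sum.distrib E_def tcoeff_texp)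
  also have "(tlin p * E p) * E q + E p * (tlin q * E q) = tlin p * (E p * E q) + tlin q * (E p * E q)" by (simp add: algebra_simps)
  also have "tcoeff ... a = (\<Sum>k\<in>ky a. (p k + q k) * X (a - un k))"
   unfolding X tcoeff_simps(1) tcoeff_tlin_mult by (simp add: sum.distrib algebra_simps)
  finally show "of_nat (sz a) * X a = (\<Sum>k\<in>ky a. (p k + q k) * X (a - un k))" .
 qed
 thus ?thesis by (simp add: X_def)
qed

section \<open>Monomial expansion of the elementary Schur Q-functions\<close>

lemma finite_wt: "finite {c. wt c = n}"
proof -
 have le: "k <= n & lk c k <= n" if "wt c = n" "k : ky c" for c k
 proof -
  have "(2 * k + 1) * lk c k <= n" unfolding that(1)[symmetric] wt_def using that(2) by (intro member_le_sum) auto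
  moreover have "1 <= lk c k" using that(2) by (simp add: in_keys_iff)
  hence "(2 * k + 1) * 1 <= (2 * k + 1) * lk c k" by (rule mult_le_mono2)
  moreover have "1 * lk c k <= (2 * k + 1) * lk c k" by (rule mult_le_mono1) simp
  ultimately have "(2 * k + 1) * 1 <= n" "1 * lk c k <= n" by (metis order_trans)+
  thus ?thesis by simp
 qed
 let ?S = "\<Sum>k\<le>n. Poly_Mapping.single k n"
 have "lk ?S k = (if k <= n then n else 0)" for k
  by (simp add: lookup_sum lookup_single when_def)
 moreover have "lk c k <= (if k <= n then n else 0)" if "wt c = n" for c k
  using le[OF that, of k] by (cases "k : ky c") (auto simp: in_keys_iff)
 ultimately have "c + (?S - c) = ?S" if "wt c = n" for c
  using that by (intro poly_mapping_eqI) (simp only: lookup_add lookup_minus le_add_diff_inverse)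
 hence "{c. wt c = n} \<subseteq> fst ` splits ?S" by force
 thus ?thesis using finite_splits[of ?S] finite_surj by blast
qed

lemma mpow_scaleR: "mpow (%j. c j *\<^sub>R (u j :: 'a::{real_algebra_1,comm_ring_1})) a = mpow c a *\<^sub>R mpow u a"
proof -
 have [simp]: "(c k *\<^sub>R u k) ^ i = c k ^ i *\<^sub>R u k ^ i" for k i
  by (induction i) (simp_all add: mult_ac)
 have "(\<Prod>k\<in>A. (c k *\<^sub>R u k) ^ m k) = (\<Prod>k\<in>A. c k ^ m k) *\<^sub>R (\<Prod>k\<in>A. u k ^ m k)" for A and m :: "nat => nat"
  by (induction A rule: infinite_finite_induct) (simp_all add: mult_ac)
 thus ?thesis by (simp add: mpow_def)
qed

text \<open>The multinomial theorem: the i-th power of the odd series collects the exponent vectors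
  of size \<open>i\<close>, and the factorials of the exponential series cancel the
  numerators.\<close>

lemma schur_q_expansion:
 fixes u :: "nat => 'a::{real_algebra_1,comm_ring_1}"
 shows "schur_q u n = (\<Sum>c | wt c = n. (1 / afact c) *\<^sub>R mpow (%j. 2 * u j) c)"
proof -
 define G where "G = Abs_fps (%n. if odd n then 2 * u (n div 2) else 0)"
 have pw: "fps_nth (G ^ i) n = (\<Sum>c | wt c = n & sz c = i. (fact i / afact c) *\<^sub>R mpow (%j. 2 * u j) c)" for i n
 proof (induction i arbitrary: n)
  case 0
  have "{c. wt c = n & sz c = 0} = (if n = 0 then {0} else {})" by (auto simp: ky_zero)
  thus ?case by (auto simp: ky_zero)
 next
  case (Suc i)
  let ?f = "%c. (fact i / afact c) *\<^sub>R mpow (%j. 2 * u j) c"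
  have "fps_nth (G ^ Suc i) n = (\<Sum>m\<in>{0..n}. if odd m then \<Sum>c | wt c = n - m & sz c = i. 2 * u (m div 2) * ?f c else 0)"
   unfolding power_Suc fps_mult_nth Suc by (intro sum.cong) (auto simp: G_def sum_distrib_left)
  also have "... = (\<Sum>m\<in>{m\<in>{0..n}. odd m}. \<Sum>c | wt c = n - m & sz c = i. 2 * u (m div 2) * ?f c)"
   by (rule sum.inter_filter[symmetric]) simp
  also have "... = (\<Sum>(m, c)\<in>(SIGMA m:{m\<in>{0..n}. odd m}. {c. wt c = n - m & sz c = i}). 2 * u (m div 2) * ?f c)"
   by (rule sum.Sigma) (auto intro: finite_subset[OF _ finite_wt])
  \<comment> \<open>An odd exponent 2k + 1 split off from a product is a marked variable
    \<open>k\<close> in the enlarged exponent vector.\<close>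
  also have "... = (\<Sum>(c, k)\<in>(SIGMA c:{c. wt c = n & sz c = Suc i}. ky c). 2 * u k * ?f (c - un k))"
  proof (rule sum.reindex_bij_witness[where j = "%(m, c). (un (m div 2) + c, m div 2)" and i = "%(c, k). (2 * k + 1, c - un k)"], goal_cases)
   case (1 a)
   thus ?case by (auto elim!: oddE)
  next
   case (2 a)
   thus ?case by (auto simp: un_add in_keys_iff lookup_add un elim!: oddE)
  next
   case (3 b)
   then obtain c k where b: "b = (c, k)" "wt c = n" "sz c = Suc i" "k : ky c" by auto
   thus ?case using un_split[of k c] by simp
  next
   case (4 b)
   then obtain c k where b: "b = (c, k)" "wt c = n" "sz c = Suc i" "k : ky c" by auto
   thus ?case using un_split[of k c] un_add(2,3)[of k "c - un k"] by auto
  next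
   case (5 a)
   thus ?case by auto
  qed
  also have "... = (\<Sum>c | wt c = n & sz c = Suc i. \<Sum>k\<in>ky c. 2 * u k * ?f (c - un k))"
   by (rule sum.Sigma[symmetric]) (auto intro: finite_subset[OF _ finite_wt])
  also have "... = (\<Sum>c | wt c = n & sz c = Suc i. (fact (Suc i) / afact c) *\<^sub>R mpow (%j. 2 * u j) c)"
  proof (rule sum.cong[OF refl])
   fix c assume c: "c : {c. wt c = n & sz c = Suc i}"
   have "2 * u k * ?f (c - un k) = (fact i / afact c * real (lk c k)) *\<^sub>R mpow (%j. 2 * u j) c" if k: "k : ky c" for k
   proof -
    have "lk c k ~= 0" using k by (simp add: in_keys_iff)
    hence "fact i / afact (c - un k) = fact i / afact c * real (lk c k)"
     using un_add(4)[of k "c - un k", where 'b = real] un_split[OF k] by simp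
    thus ?thesis using un_add(1)[of "%j. 2 * u j" k "c - un k"] un_split[OF k] by simp
   qed
   hence "(\<Sum>k\<in>ky c. 2 * u k * ?f (c - un k)) = (fact i / afact c * real (sz c)) *\<^sub>R mpow (%j. 2 * u j) c"
    by (simp add: sz_def scaleR_sum_left[symmetric] sum_distrib_left)
   thus "(\<Sum>k\<in>ky c. 2 * u k * ?f (c - un k)) = (fact (Suc i) / afact c) *\<^sub>R mpow (%j. 2 * u j) c"
    using c by (simp add: mult_ac)
  qed
  finally show ?case .
 qed
 have le: "sz c <= wt c" for c unfolding sz_def wt_def by (intro sum_mono) simp
 have "schur_q u n = (\<Sum>i\<in>{0..n}. \<Sum>c | wt c = n & sz c = i. (1 / afact c) *\<^sub>R mpow (%j. 2 * u j) c)"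
  unfolding schur_q_def fps_compose_nth G_def[symmetric] pw by (simp add: scaleR_sum_right sum_distrib_left of_real_def)
 also have "... = (\<Sum>c\<in>(\<Union>i\<in>{0..n}. {c. wt c = n & sz c = i}). (1 / afact c) *\<^sub>R mpow (%j. 2 * u j) c)"
  by (rule sum.UNION_disjoint[symmetric]) (auto intro: finite_subset[OF _ finite_wt])
 also have "(\<Union>i\<in>{0..n}. {c. wt c = n & sz c = i}) = {c. wt c = n}" using le by auto
 finally show ?thesis .
qed

lemma schur_q_real: "schur_q u n = (\<Sum>c | wt c = n. tmon (%j. 2 * u j) c :: real)"
 by (simp add: schur_q_expansion tmon_def)

lemma tcoeff_tvar_mult: "tcoeff (tvar k * G) a = (if k : ky a then tcoeff G (a - un k) else 0)"
proof -
 have "tcoeff (tvar k * G) a = (\<Sum>(b, c)\<in>splits a. if b : range un then (if the_elem (ky b) = k then tcoeff G c else 0) else 0)"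
  unfolding tcoeff_simps tvar_def un_def[symmetric] tcoeff_Abs by (intro sum.cong) (auto simp: un split: if_splits)
 also have "... = (\<Sum>j\<in>ky a. if j = k then tcoeff G (a - un j) else 0)" by (rule sum_splits_un)
 finally show ?thesis by (simp add: sum.delta)
qed

lemma tcoeff_mpow_tvar: "tcoeff (mpow tvar c) a = (if a = c then 1 else (0::'a::comm_ring_1))"
proof (induction "sz c" arbitrary: c a)
 case 0
 thus ?case by (simp add: ky_zero tcoeff_simps)
next
 case (Suc i)
 then obtain k where k: "k : ky c" using ky_zero(1,6)[of c] by fastforce
 note s = un_split[OF k]
 have i: "i = sz (c - un k)" using un_add(2)[of k "c - un k"] s Suc(2) by simp
 have "(tcoeff (mpow tvar c) a :: 'a) = tcoeff (tvar k * mpow tvar (c - un k)) a"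
  by (simp only: un_add(1)[symmetric] s[symmetric])
 also have "... = (if k : ky a & a - un k = c - un k then 1 else 0)"
  unfolding tcoeff_tvar_mult Suc(1)[OF i] by simp
 also have "... = (if a = c then 1 else 0)" using s un_split[of k a] k by (metis (no_types))
 finally show ?case .
qed

lemma tcoeff_schur_q_tvar: "tcoeff (schur_q (%j. r j *\<^sub>R tvar j) n) a = (if wt a = n then tmon (%j. 2 * r j) a else (0::real))"
proof -
 have "mpow (%j. 2 * (r j *\<^sub>R tvar j)) c = mpow (%j. 2 * r j) c *\<^sub>R mpow (tvar :: nat => real tseries) c" for c
 proof -
  have "2 * (r j *\<^sub>R tvar j) = (2 * r j) *\<^sub>R (tvar j :: real tseries)" for j
   by (simp only: mult_2 scaleR_left_distrib)
  thus ?thesis by (simp only: mpow_scaleR)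
 qed
 hence "tcoeff (schur_q (%j. r j *\<^sub>R tvar j) n) a = (\<Sum>c | wt c = n. if c = a then tmon (%j. 2 * r j) a else 0)"
  unfolding schur_q_expansion tcoeff_sum tcoeff_simps by (intro sum.cong) (auto simp: tcoeff_mpow_tvar tmon_def tcoeff_simps(6))
 thus ?thesis by (simp add: finite_wt)
qed

section \<open>The Miwa shift of the partition function\<close>

text \<open>The binomial theorem in each variable. Truncated subtraction in the exponent is
  harmless, as the binomial coefficient is 0 there.\<close>

lemma tcoeff_shifted:
 fixes s :: "nat => 'a::comm_ring_1"
 assumes "finite K" "ky a \<subseteq> K" "ky b \<subseteq> K"
 shows "tcoeff (mpow (%j. tvar j - tconst (s j)) a) b = (\<Prod>j\<in>K. of_nat (lk a j choose lk b j) * (- s j) ^ (lk a j - lk b j))"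
 using assms
proof (induction "sz a" arbitrary: a b)
 case 0
 hence a: "a = 0" by (simp add: ky_zero)
 show ?case
 proof (cases "b = 0")
  case False
  then obtain k where "k : ky b" using ky_zero(6)[of b] by blast
  hence "(\<Prod>j\<in>K. of_nat (lk a j choose lk b j) * (- s j) ^ (lk a j - lk b j)) = 0"
   using 0 by (intro prod_zero bexI[of _ k]) (auto simp: a in_keys_iff binomial_eq_0)
  thus ?thesis using False by (simp add: a ky_zero tcoeff_simps)
 qed (simp add: a ky_zero tcoeff_simps)
next
 case (Suc i)
 note S = Suc
 from S obtain k where k: "k : ky a" using ky_zero(1,6)[of a] by fastforce
 define a' where "a' = a - un k"
 have a: "a = un k + a'" using un_split[OF k] by (simp add: a'_def)
 have i: "i = sz a'" using S(2) a un_add(2)[of k a'] by simp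
 have Ka: "ky a' \<subseteq> K" "ky (b - un k) \<subseteq> K" using S(4,5) by (auto simp: a'_def in_keys_iff lookup_minus)
 have kK: "k : K" using k S(4) by blast
 define x R where "x = - s k" and "R = (\<Prod>j\<in>K - {k}. of_nat (lk a j choose lk b j) * (- s j) ^ (lk a j - lk b j))"
 define \<alpha> \<beta> where "\<alpha> = lk a' k" and "\<beta> = lk b k"
 have l: "lk a j = (if j = k then Suc \<alpha> else lk a' j)" for j by (simp add: a lookup_add un \<alpha>_def)
 have IH: "tcoeff (mpow (%j. tvar j - tconst (s j)) a') b' = of_nat (\<alpha> choose lk b' k) * x ^ (\<alpha> - lk b' k) * R"
  if "ky b' \<subseteq> K" "!!j. j ~= k ==> lk b' j = lk b j" for b'
 proof -
  have "(\<Prod>j\<in>K - {k}. of_nat (lk a' j choose lk b' j) * (- s j) ^ (lk a' j - lk b' j)) = R"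
   unfolding R_def using that(2) by (intro prod.cong) (auto simp: l)
  thus ?thesis
   using S(1)[OF i S(3) Ka(1) that(1)] by (simp add: prod.remove[OF S(3) kK] \<alpha>_def x_def)
 qed
 have "tcoeff (mpow (%j. tvar j - tconst (s j)) a) b =
   (if k : ky b then tcoeff (mpow (%j. tvar j - tconst (s j)) a') (b - un k) else 0) + x * tcoeff (mpow (%j. tvar j - tconst (s j)) a') b"
  unfolding a un_add(1) left_diff_distrib tcoeff_simps(2) tcoeff_tvar_mult tcoeff_tconst_mult by (simp add: x_def)
 also have "... = of_nat (Suc \<alpha> choose \<beta>) * x ^ (Suc \<alpha> - \<beta>) * R"
 proof (cases \<beta>)
  case 0
  hence "k ~: ky b" by (simp add: \<beta>_def in_keys_iff)
  thus ?thesis using IH[OF S(5)] 0 by (simp add: \<beta>_def[symmetric] mult_ac)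
 next
  case (Suc \<beta>')
  hence kb: "k : ky b" by (simp add: \<beta>_def in_keys_iff)
  have "tcoeff (mpow (%j. tvar j - tconst (s j)) a') (b - un k) = of_nat (\<alpha> choose \<beta>') * x ^ (\<alpha> - \<beta>') * R"
   using IH[OF Ka(2)] Suc by (simp add: lookup_minus un \<beta>_def[symmetric])
  moreover have "x * (of_nat (\<alpha> choose Suc \<beta>') * x ^ (\<alpha> - Suc \<beta>') * R) = of_nat (\<alpha> choose Suc \<beta>') * x ^ (\<alpha> - \<beta>') * R"
  proof (cases "Suc \<beta>' <= \<alpha>")
   case True
   hence "x ^ (\<alpha> - \<beta>') = x * x ^ (\<alpha> - Suc \<beta>')" by (simp add: power_Suc[symmetric] Suc_diff_Suc del: power_Suc)
   thus ?thesis by (simp add: mult_ac)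
  qed (simp add: binomial_eq_0 not_le)
  ultimately show ?thesis using IH[OF S(5)] Suc kb
   by (simp add: \<beta>_def[symmetric] algebra_simps)
 qed
 also have "... = (\<Prod>j\<in>K. of_nat (lk a j choose lk b j) * (- s j) ^ (lk a j - lk b j))"
  unfolding prod.remove[OF S(3) kK] R_def[symmetric] by (simp add: l \<beta>_def x_def)
 finally show ?case .
qed

text \<open>The multi-index binomial coefficient of b + c over b. It turns the coefficient of an
  exponential at b + c into the product of its coefficients at b and at c.\<close>

definition bn :: "expo => expo => real" where "bn b c = (\<Prod>j\<in>ky b \<union> ky c. of_nat (lk b j + lk c j choose lk b j))"

lemma bn: "bn b c * tmon p (b + c) = tmon p b * tmon p c"
proof -
 have K: "finite (ky b \<union> ky c)" "ky (b + c) \<subseteq> ky b \<union> ky c" "ky b \<subseteq> ky b \<union> ky c" "ky c \<subseteq> ky b \<union> ky c"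
  using keys_add[of b c] by auto
 have "real (m + n choose m) * (p ^ (m + n) / fact (m + n)) = p ^ m / fact m * (p ^ n / fact n)" for m n and p :: real
  by (simp add: binomial_fact power_add)
 thus ?thesis
  unfolding bn_def tmon_def superset[OF K(1,2)] superset[OF K(1,3)] superset[OF K(1,4)] prod_dividef[symmetric] prod.distrib[symmetric]
  by (intro prod.cong refl) (simp only: lookup_add)
qed

lemma tmon_mult: "tmon (%j. p j * q j) a = mpow p a * tmon q a"
 by (simp add: tmon_def mpow_def power_mult_distrib prod.distrib)

lemma tmon_const_power: "tmon (%j. x ^ (2 * j + 1) * q j) c = x ^ wt c * tmon q c"
 unfolding tmon_mult by (simp only: mpow_def wt_def power_mult[symmetric] power_sum)

lemma fls_const_prod: "fls_const (\<Prod>i\<in>A. f i) = (\<Prod>i\<in>A. fls_const (f i :: 'a::comm_ring_1))"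
 by (induction A rule: infinite_finite_induct) (simp_all flip: fls_const_mult_const)

lemma shifted_monom_coeff:
 "fls_nth (tcoeff (shifted_monom (b + c)) b) (int m) = (if wt c = m then bn b c * mpow (%j. - 2 / real (2 * j + 1)) c else 0)"
proof -
 let ?K = "ky b \<union> ky c" and ?s = "%j. fls_const (2 / real (2 * j + 1)) * zvar_inv ^ (2 * j + 1)"
 have K: "finite ?K" "ky (b + c) \<subseteq> ?K" "ky b \<subseteq> ?K" "ky c \<subseteq> ?K" using keys_add[of b c] by auto
 have "tcoeff (shifted_monom (b + c)) b = (\<Prod>j\<in>?K. of_nat (lk b j + lk c j choose lk b j) * (- ?s j) ^ lk c j)"
  unfolding shifted_monom_def mpow_def[symmetric] tcoeff_shifted[OF K(1-3)] by (simp add: lookup_add)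
 also have "... = (\<Prod>j\<in>?K. fls_const (real (lk b j + lk c j choose lk b j) * (- 2 / real (2 * j + 1)) ^ lk c j) * zvar_inv ^ ((2 * j + 1) * lk c j))"
 proof (intro prod.cong refl)
  fix j
  have "- ?s j = fls_const (- (2 / real (2 * j + 1))) * zvar_inv ^ (2 * j + 1)"
   unfolding mult_minus_left[symmetric] by (intro arg_cong2[where f = "(*)"] fls_eqI refl) simp
  hence "- ?s j = fls_const (- 2 / real (2 * j + 1)) * zvar_inv ^ (2 * j + 1)" by (simp only: minus_divide_left)
  thus "of_nat (lk b j + lk c j choose lk b j) * (- ?s j) ^ lk c j =
    fls_const (real (lk b j + lk c j choose lk b j) * (- 2 / real (2 * j + 1)) ^ lk c j) * zvar_inv ^ ((2 * j + 1) * lk c j)"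
   by (simp only: power_mult_distrib power_mult fls_const_power fls_const_mult_const[symmetric] fls_of_nat mult.assoc)
 qed
 also have "... = fls_const (bn b c * mpow (%j. - 2 / real (2 * j + 1)) c) * zvar_inv ^ wt c"
  by (simp only: bn_def superset[OF K(1,4)] power_sum prod.distrib[symmetric] fls_const_prod)
 finally show ?thesis by (simp add: fls_X_power_nth)
qed

lemma shifted_monom_zero: "tcoeff (shifted_monom a) b ~= 0 ==> \<exists>c. a = b + c"
proof -
 assume nz: "tcoeff (shifted_monom a) b ~= 0"
 let ?K = "ky a \<union> ky b"
 have "lk b j <= lk a j" for j
 proof (rule ccontr)
  assume "~ lk b j <= lk a j"
  hence "j : ?K" "lk a j choose lk b j = 0" by (auto simp: in_keys_iff)
  hence "tcoeff (shifted_monom a) b = 0"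
   unfolding shifted_monom_def mpow_def[symmetric] by (subst tcoeff_shifted[of ?K]) (auto intro!: prod_zero bexI[of _ j])
  with nz show False ..
 qed
 hence "a = b + (a - b)" by (intro poly_mapping_eqI) (simp add: lookup_add lookup_minus)
 thus ?thesis ..
qed

text \<open>The shift inserts the generating function of the Q-functions at the argument -1/z. All
  subscripts being odd, each variable contributes one sign per unit of weight modulo 2.\<close>

lemma schur_q_power_sums: "(\<Sum>c | wt c = m. tmon (%j. - 2 / real (2 * j + 1) * tr_pow H (2 * j + 1)) c) = (-1) ^ m * schur_q (power_sums H) m"
proof -
 have "tmon (%j. - 2 / real (2 * j + 1) * tr_pow H (2 * j + 1)) c = (-1) ^ wt c * tmon (%j. 2 * power_sums H j) c" for c
  unfolding tmon_const_power[symmetric] by (intro arg_cong2[where f = tmon] ext refl) (simp add: power_sums_def)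
 thus ?thesis by (simp add: schur_q_real sum_distrib_left)
qed

lemma grow_tmon: "grow n (%H. tmon (%j. r j * tr_pow H (2 * j + 1)) a)"
 unfolding tmon_mult unfolding tmon_def mpow_def divide_inverse
 by (intro grow_intros(1,4) grow_prod grow_power grow_intros(2))

lemma grow_schur_q: "grow n (%H. schur_q (power_sums H) m)"
proof -
 have "(%H. schur_q (power_sums H) m) = (%H. (-1) ^ m * (\<Sum>c | wt c = m. tmon (%j. - 2 / real (2 * j + 1) * tr_pow H (2 * j + 1)) c))"
  unfolding schur_q_power_sums by (simp add: mult.assoc[symmetric] power_mult_distrib[symmetric])
 thus ?thesis by (simp only:) (intro grow_intros(1,4) grow_sum grow_tmon)
qed

abbreviation pw :: "complex mat => nat => real" where "pw H == %k. tr_pow H (2 * k + 1)"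

lemma grow_tmon_pw: "grow n (%H. tmon (pw H) a)"
 using grow_tmon[of n "%_. 1" a] by simp

lemma tcoeff_mu_integral: "tcoeff (mu_integral lam V0 (%H. tconst (f H))) a = (LINT H|mu0 lam V0. tmon (pw H) a * f H)"
 unfolding mu_integral_def tintegral_def tcoeff_Abs
 by (simp add: mult.commute[of _ "tconst _"] tcoeff_tconst_mult tcoeff_texp mult.commute)

lemma tcoeff_Z: "tcoeff (Z lam V0) a = (LINT H|mu0 lam V0. tmon (pw H) a)"
 unfolding Z_def mu_integral_def tintegral_def by (simp add: tcoeff_texp)

context matrix_model
begin

text \<open>Taylor expansion of the shift. Only exponent vectors b + c with \<open>c\<close> of
  weight \<open>m\<close> contribute, which are finitely many, so the sum may be moved under the
  integral.\<close>

lemma miwa_coeff: "fls_nth (tcoeff (miwa_shift (Z lam V0)) b) (int m) = (LINT H|mu0 lam V0. tmon (pw H) b * ((-1) ^ m * schur_q (power_sums H) m))"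
proof -
 let ?s = "%j. - 2 / real (2 * j + 1)" and ?g = "%a. tcoeff (Z lam V0) a * fls_nth (tcoeff (shifted_monom a) b) (int m)"
 let ?C = "{c. wt c = m}"
 have nz: "{a. ?g a ~= 0} \<subseteq> (%c. b + c) ` ?C"
 proof
  fix a assume a: "a : {a. ?g a ~= 0}"
  hence "tcoeff (shifted_monom a) b ~= 0" by auto
  then obtain c where c: "a = b + c" using shifted_monom_zero by blast
  with a have "wt c = m" by (auto simp: shifted_monom_coeff split: if_splits)
  with c show "a : (%c. b + c) ` ?C" by blast
 qed
 have "fls_nth (tcoeff (miwa_shift (Z lam V0)) b) (int m) = Sum_any ?g"
  unfolding miwa_shift_def by simp
 also have "... = sum ?g ((%c. b + c) ` ?C)"
  by (rule Sum_any.expand_superset[OF finite_imageI[OF finite_wt] nz])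
 also have "... = (\<Sum>c\<in>?C. ?g (b + c))" by (subst sum.reindex) (auto simp: inj_on_def)
 also have "... = (\<Sum>c\<in>?C. LINT H|mu0 lam V0. tmon (pw H) b * tmon (%j. ?s j * pw H j) c)"
 proof (intro sum.cong refl)
  fix c assume "c : ?C"
  hence "?g (b + c) = (LINT H|mu0 lam V0. tmon (pw H) (b + c)) * (bn b c * mpow ?s c)"
   by (simp add: shifted_monom_coeff tcoeff_Z)
  also have "... = (LINT H|mu0 lam V0. tmon (pw H) (b + c) * (bn b c * mpow ?s c))" by simp
  also have "... = (LINT H|mu0 lam V0. tmon (pw H) b * tmon (%j. ?s j * pw H j) c)"
  proof (rule Bochner_Integration.integral_cong[OF refl])
   fix H
   have "tmon (pw H) (b + c) * (bn b c * mpow ?s c) = (bn b c * tmon (pw H) (b + c)) * mpow ?s c" by (simp only: mult_ac)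
   thus "tmon (pw H) (b + c) * (bn b c * mpow ?s c) = tmon (pw H) b * tmon (%j. ?s j * pw H j) c"
    unfolding bn tmon_mult by (simp only: mult_ac)
  qed
  finally show "?g (b + c) = (LINT H|mu0 lam V0. tmon (pw H) b * tmon (%j. ?s j * pw H j) c)" .
 qed
 also have "... = (LINT H|mu0 lam V0. (\<Sum>c\<in>?C. tmon (pw H) b * tmon (%j. ?s j * pw H j) c))"
  by (intro Bochner_Integration.integral_sum[symmetric] grow_integrable grow_intros(4) grow_tmon_pw grow_tmon)
 also have "... = (LINT H|mu0 lam V0. tmon (pw H) b * ((-1) ^ m * schur_q (power_sums H) m))"
  by (simp only: sum_distrib_left[symmetric] schur_q_power_sums)
 finally show ?thesis .
qed

text \<open>Multiplication by z^(k - 1) moves the coefficient of z^(-k) to z^(-1), which is index 1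
  in powers of \<open>fls_X\<close>.\<close>

lemma residue_A:
 assumes "k > 0"
 shows "tcoeff (residue_z (miwa_shift (Z lam V0) * tconst (zvar ^ (k - 1)))) a = (-1) ^ k * (LINT H|mu0 lam V0. tmon (pw H) a * schur_q (power_sums H) k)"
proof -
 have "tcoeff (residue_z (miwa_shift (Z lam V0) * tconst (zvar ^ (k - 1)))) a = fls_nth (zvar ^ (k - 1) * tcoeff (miwa_shift (Z lam V0)) a) 1"
  unfolding residue_z_def tcoeff_Abs mult.commute[of _ "tconst _"] tcoeff_tconst_mult ..
 also have "... = fls_nth (tcoeff (miwa_shift (Z lam V0)) a) (int k)"
  using assms by (simp add: fls_X_inv_power_times_conv_shift of_nat_diff)
 finally show ?thesis unfolding miwa_coeff by (simp add: mult.left_commute)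
qed

lemma tmon_zvar: "tmon (%j. 2 * zvar ^ (2 * j + 1)) c = fls_const (tmon (%_. 2) c) * zvar ^ wt c"
proof -
 have "(fact m :: real fls) = fls_const (fact m)" for m by (metis of_nat_fact fls_of_nat)
 hence f: "(afact c :: real fls) = fls_const (afact c)" by (simp only: afact_def fls_const_prod)
 have "(2 * zvar ^ (2 * j + 1)) ^ m = fls_const (2 ^ m) * zvar ^ ((2 * j + 1) * m)" for j m
  by (simp only: power_mult_distrib power_mult fls_const_power fls_const_numeral)
 hence "mpow (%j. 2 * zvar ^ (2 * j + 1)) c = fls_const (mpow (%_. 2) c) * zvar ^ wt c"
  by (simp only: mpow_def wt_def power_sum prod.distrib fls_const_prod)
 moreover have "fls_const (mpow (%_. 2) c) * zvar ^ wt c / fls_const (afact c) = fls_const (mpow (%_. 2) c / afact c) * zvar ^ wt c"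
  unfolding fls_const_divide_const[symmetric] by (simp only: times_divide_eq_left)
 ultimately show ?thesis unfolding tmon_def f by simp
qed

text \<open>With the factor 1/z the residue picks the power z^0, so the weight of the exponential
  factor must match the order in 1/z of the shifted partition function. Subtracting 1 removes the
  terms with \<open>c = 0\<close>.\<close>

lemma residue_B:
 "tcoeff (residue_z (miwa_shift (Z lam V0) * (texp (tlin (%j. 2 * zvar ^ (2 * j + 1))) - 1) * tconst zvar_inv)) a =
  (\<Sum>(b, c)\<in>splits a. if c = 0 then 0 else tmon (%_. 2) c * (LINT H|mu0 lam V0. tmon (pw H) b * ((-1) ^ wt c * schur_q (power_sums H) (wt c))))"
proof -
 let ?M = "tcoeff (miwa_shift (Z lam V0))"
 have "tcoeff (residue_z (miwa_shift (Z lam V0) * (texp (tlin (%j. 2 * zvar ^ (2 * j + 1))) - 1) * tconst zvar_inv)) a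
   = (\<Sum>(b, c)\<in>splits a. fls_nth (zvar_inv * (?M b * (tmon (%j. 2 * zvar ^ (2 * j + 1)) c - (if c = 0 then 1 else 0)))) 1)"
  unfolding residue_z_def tcoeff_Abs mult.commute[of _ "tconst _"] tcoeff_tconst_mult
  unfolding tcoeff_simps(5) sum_distrib_left tcoeff_simps tcoeff_texp by (simp add: case_prod_beta fls_nth_sum)
 also have "... = (\<Sum>(b, c)\<in>splits a. if c = 0 then 0 else tmon (%_. 2) c * fls_nth (?M b) (int (wt c)))"
 proof (intro sum.cong refl, clarify)
  fix b c :: expo
  have "zvar_inv * (?M b * (fls_const (tmon (%_. 2) c) * zvar ^ wt c)) = fls_const (tmon (%_. 2) c) * (zvar_inv * (zvar ^ wt c * ?M b))"
   by (simp only: mult_ac)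
  hence "fls_nth (zvar_inv * (?M b * (fls_const (tmon (%_. 2) c) * zvar ^ wt c))) 1 = tmon (%_. 2) c * fls_nth (?M b) (int (wt c))"
   by (simp add: fls_X_inv_power_times_conv_shift fls_X_times_conv_shift)
  thus "fls_nth (zvar_inv * (?M b * (tmon (%j. 2 * zvar ^ (2 * j + 1)) c - (if c = 0 then 1 else 0)))) 1 =
    (if c = 0 then 0 else tmon (%_. 2) c * fls_nth (?M b) (int (wt c)))"
   unfolding tmon_zvar by (cases "c = 0") (simp_all add: tmon_def ky_zero)
 qed
 finally show ?thesis unfolding miwa_coeff .
qed

end

section \<open>Schur Q-functions of the eigenvalues\<close>

definition Rr :: "nat => (nat => real) => nat => real" where
 "Rr n x r = (\<Prod>i\<in>{..<n} - {r}. (x r + x i) / (x r - x i))"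

lemma Rr_Suc:
 "Rr (Suc n) x n = (\<Prod>i<n. (x n + x i) / (x n - x i))"
 "r < n ==> Rr (Suc n) x r = Rr n x r * ((x r + x n) / (x r - x n))"
proof -
 have "{..<Suc n} - {n} = {..<n}" by auto
 thus "Rr (Suc n) x n = (\<Prod>i<n. (x n + x i) / (x n - x i))" by (simp add: Rr_def)
 assume "r < n"
 hence "{..<Suc n} - {r} = insert n ({..<n} - {r})" by auto
 thus "Rr (Suc n) x r = Rr n x r * ((x r + x n) / (x r - x n))" by (simp add: Rr_def)
qed

text \<open>As a function of \<open>y\<close> the product has simple poles at the x_r, with residues
  2 x_r R_r, and tends to 1 at infinity. The induction splits off the last factor and separates
  products of two simple poles.\<close>

lemma partial_fractions:
 assumes "inj_on x {..<n}" "!!i. i < n ==> y ~= x i"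
 shows "(\<Prod>i<n. (y + x i) / (y - x i)) = 1 + (\<Sum>r<n. 2 * x r * Rr n x r / (y - x r))"
 using assms
proof (induction n arbitrary: y)
 case (Suc n)
 let ?z = "x n"
 have inj: "inj_on x {..<n}" by (rule inj_on_subset[OF Suc.prems(1)]) auto
 have z: "?z ~= x i" if "i < n" for i using inj_onD[OF Suc.prems(1), of n i] that by auto
 have y: "y ~= ?z" using Suc.prems(2) by simp
 have "(\<Prod>i<Suc n. (y + x i) / (y - x i)) = (1 + (\<Sum>r<n. 2 * x r * Rr n x r / (y - x r))) * ((y + ?z) / (y - ?z))"
  using Suc.IH[OF inj, of y] Suc.prems(2) by simp
 also have "... = 1 + 2 * ?z / (y - ?z) + (\<Sum>r<n. 2 * x r * Rr n x r / (y - x r) * ((y + ?z) / (y - ?z)))"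
  unfolding distrib_right sum_distrib_right using y by (simp add: field_simps)
 also have "(\<Sum>r<n. 2 * x r * Rr n x r / (y - x r) * ((y + ?z) / (y - ?z))) =
   (\<Sum>r<n. 2 * x r * Rr (Suc n) x r / (y - x r) + 2 * ?z / (y - ?z) * (2 * x r * Rr n x r / (?z - x r)))"
 proof (intro sum.cong refl)
  fix r assume "r : {..<n}"
  hence r: "r < n" "y ~= x r" "?z ~= x r" "x r ~= ?z" using Suc.prems(2) z[of r] by auto
  have "1 / (y - x r) * ((y + ?z) / (y - ?z)) = (x r + ?z) / (x r - ?z) / (y - x r) + 2 * ?z / (y - ?z) / (?z - x r)"
   using r y by (simp add: divide_simps) (simp add: algebra_simps)
  from arg_cong[where f = "%t. 2 * x r * Rr n x r * t", OF this]
  show "2 * x r * Rr n x r / (y - x r) * ((y + ?z) / (y - ?z)) =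
    2 * x r * Rr (Suc n) x r / (y - x r) + 2 * ?z / (y - ?z) * (2 * x r * Rr n x r / (?z - x r))"
   unfolding Rr_Suc(2)[OF r(1)] by (simp add: distrib_left mult_ac)
 qed
 also have "1 + 2 * ?z / (y - ?z) + ... = 1 + (\<Sum>r<n. 2 * x r * Rr (Suc n) x r / (y - x r)) +
   2 * ?z / (y - ?z) * (1 + (\<Sum>r<n. 2 * x r * Rr n x r / (?z - x r)))"
  by (simp only: sum.distrib sum_distrib_left distrib_left mult_1_right add_ac)
 also have "1 + (\<Sum>r<n. 2 * x r * Rr n x r / (?z - x r)) = Rr (Suc n) x n"
  unfolding Rr_Suc(1) using Suc.IH[OF inj, of ?z] z by simp
 finally show ?case by (simp add: add_ac)
qed simp

text \<open>The partial fractions at y = 0: every factor on the left is -1, and the right side is 1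
  - 2 times the sum.\<close>

lemma sum_Rr_odd:
 assumes "odd n" "inj_on x {..<n}" "!!i. i < n ==> x i ~= 0"
 shows "(\<Sum>r<n. Rr n x r) = 1"
proof -
 have "(\<Prod>i<n. (0 + x i) / (0 - x i)) = (\<Prod>i<n. - 1 :: real)" using assms(3) by (intro prod.cong) auto
 moreover have "(\<Sum>r<n. 2 * x r * Rr n x r / (0 - x r)) = - 2 * (\<Sum>r<n. Rr n x r)"
  unfolding sum_distrib_left using assms(3) by (intro sum.cong) auto
 ultimately show ?thesis using partial_fractions[OF assms(2), of 0] assms(1,3) by simp
qed

lemma fps_linear_ode_unique:
 fixes F H a :: "real fps"
 assumes "fps_deriv F = a * F" "fps_deriv H = a * H" "fps_nth F 0 = fps_nth H 0"
 shows "F = H"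
proof (rule fps_ext)
 fix n show "fps_nth F n = fps_nth H n"
 proof (induction n rule: less_induct)
  case (less n)
  show ?case
  proof (cases n)
   case (Suc m)
   have "real (Suc m) * fps_nth F (Suc m) = real (Suc m) * fps_nth H (Suc m)"
    using arg_cong[OF assms(1), of "%f. fps_nth f m"] arg_cong[OF assms(2), of "%f. fps_nth f m"] less Suc
    by (simp add: fps_mult_nth)
   thus ?thesis unfolding Suc by (simp only: mult_left_cancel of_nat_eq_0_iff nat.distinct not_False_eq_True)
  qed (use assms(3) in simp)
 qed
qed

lemma fps_deriv_prod_log:
 fixes F :: "nat => real fps"
 assumes "!!i. fps_deriv (F i) = a i * F i"
 shows "fps_deriv (\<Prod>i<n. F i) = (\<Sum>i<n. a i) * (\<Prod>i<n. F i)"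
 by (induction n) (simp_all add: assms algebra_simps)

text \<open>The generating function of the left side is the product of (1 + x_i X) / (1 - x_i X),
  and the right side lists the coefficients of its partial fraction expansion. Both are compared
  after multiplication by the denominator \<open>D n\<close>.\<close>

theorem schur_q_eigenvalues:
 assumes inj: "inj_on x {..<n}" and k: "k > 0"
 shows "schur_q (power_sums (rdiag n x)) k = 2 * (\<Sum>r<n. x r ^ k * Rr n x r)"
proof -
 define u where "u = power_sums (rdiag n x)"
 define P where "P n = (\<Prod>i<n. 1 + fps_const (x i) * fps_X)" for n
 define D where "D n = (\<Prod>i<n. 1 - fps_const (x i) * fps_X)" for n
 define A where "A i = Abs_fps (%m. x i * (- x i) ^ m)" for i
 define B where "B i = Abs_fps (%m. - x i * x i ^ m)" for i
 define G where "G = Abs_fps (%n. if odd n then 2 * u (n div 2) else 0)"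
 define E where "E = fps_exp 1 oo G"
 have E_nth: "fps_nth E m = schur_q u m" for m
  unfolding E_def schur_q_def G_def fps_exp_def by simp
 have nth: "fps_nth (F * (1 + fps_const c * fps_X)) (Suc j) = fps_nth F (Suc j) + c * fps_nth F j" for F :: "real fps" and c j
  by (simp add: distrib_left mult.left_commute[of F])
 have lin: "fps_deriv (1 + fps_const c * fps_X) = Abs_fps (%m. c * (- c) ^ m) * (1 + fps_const c * fps_X)" for c :: real
 proof (rule fps_ext)
  fix m show "fps_nth (fps_deriv (1 + fps_const c * fps_X)) m = fps_nth (Abs_fps (%m. c * (- c) ^ m) * (1 + fps_const c * fps_X)) m"
   by (cases m) (simp_all add: nth)
 qed
 have A: "fps_deriv (1 + fps_const (x i) * fps_X) = A i * (1 + fps_const (x i) * fps_X)" for i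
  unfolding A_def by (rule lin)
 have B: "fps_deriv (1 - fps_const (x i) * fps_X) = B i * (1 - fps_const (x i) * fps_X)" for i
 proof -
  have "1 - fps_const (x i) * fps_X = 1 + fps_const (- x i) * fps_X" by simp
  thus ?thesis using lin[of "- x i"] by (simp only: B_def minus_minus)
 qed
 have G': "fps_deriv G = (\<Sum>i<n. A i) - (\<Sum>i<n. B i)"
 proof (rule fps_ext)
  fix m
  have "fps_nth (fps_deriv G) m = (\<Sum>i<n. if even m then 2 * x i ^ Suc m else 0)"
  proof (cases "even m")
   case True
   then obtain j where "m = 2 * j" by blast
   thus ?thesis by (simp add: G_def u_def power_sums_def tr_pow_rdiag) (simp add: sum_distrib_left)
  qed (simp add: G_def)
  also have "... = fps_nth ((\<Sum>i<n. A i) - (\<Sum>i<n. B i)) m"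
   unfolding fps_sub_nth fps_sum_nth sum_subtractf[symmetric] by (intro sum.cong refl) (auto simp: A_def B_def)
  finally show "fps_nth (fps_deriv G) m = fps_nth ((\<Sum>i<n. A i) - (\<Sum>i<n. B i)) m" .
 qed
 have dE: "fps_deriv E = fps_deriv G * E"
  unfolding E_def by (subst fps_compose_deriv) (simp_all add: G_def mult.commute)
 \<comment> \<open>Both sides have constant term 1 and the same logarithmic derivative.\<close>
 have "E * D n = P n"
 proof (rule fps_linear_ode_unique)
  show "fps_deriv (E * D n) = (\<Sum>i<n. A i) * (E * D n)"
   unfolding fps_deriv_mult dE G' D_def fps_deriv_prod_log[of "%i. 1 - fps_const (x i) * fps_X", OF B] by (simp add: algebra_simps)
  show "fps_deriv (P n) = (\<Sum>i<n. A i) * P n" unfolding P_def by (rule fps_deriv_prod_log[OF A])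
  have "fps_nth (P m) 0 = 1" "fps_nth (D m) 0 = 1" for m by (induction m) (simp_all add: P_def D_def)
  thus "fps_nth (E * D n) 0 = fps_nth (P n) 0" by (simp add: E_def)
 qed
 moreover
 \<comment> \<open>The constant term is set to 1 separately: for an odd number of distinct nonzero
   eigenvalues the sum formula would give 2 there.\<close>
 define Q where "Q n = Abs_fps (%k. if k = 0 then 1 else 2 * (\<Sum>r<n. x r ^ k * Rr n x r))" for n
 have "Q m * D m = P m" if "m <= n" for m using that
 proof (induction m)
  case 0
  have "Q 0 = 1" by (rule fps_ext) (simp add: Q_def)
  thus ?case by (simp add: P_def D_def)
 next
  case (Suc m)
  let ?z = "x m"
  have z: "x r ~= ?z" if "r < m" for r using inj_onD[OF inj, of r m] that Suc.prems by auto
  have pf: "Rr (Suc m) x m = 1 + (\<Sum>r<m. 2 * x r * Rr m x r / (?z - x r))"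
   unfolding Rr_Suc by (rule partial_fractions) (use inj Suc.prems z in \<open>auto intro: inj_on_subset dest: sym\<close>)
  have "Q (Suc m) * (1 - fps_const ?z * fps_X) = Q m * (1 + fps_const ?z * fps_X)"
  proof (rule fps_ext)
   fix k
   have z1: "1 - fps_const ?z * fps_X = 1 + fps_const (- ?z) * fps_X" by simp
   have R: "Rr (Suc m) x r * (x r - ?z) = Rr m x r * (x r + ?z)" if "r < m" for r
    using z[OF that] by (simp add: Rr_Suc(2)[OF that])
   show "fps_nth (Q (Suc m) * (1 - fps_const ?z * fps_X)) k = fps_nth (Q m * (1 + fps_const ?z * fps_X)) k"
   proof (cases k)
    case (Suc j)
    show ?thesis
    proof (cases "j = 0")
     case True
     have "(\<Sum>r<m. x r * Rr (Suc m) x r) = (\<Sum>r<m. x r * Rr m x r - ?z * (2 * x r * Rr m x r / (?z - x r)))"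
     proof (intro sum.cong refl)
      fix r assume "r : {..<m}"
      hence r: "r < m" "x r ~= ?z" "?z ~= x r" using z[of r] by auto
      thus "x r * Rr (Suc m) x r = x r * Rr m x r - ?z * (2 * x r * Rr m x r / (?z - x r))"
       unfolding Rr_Suc(2)[OF r(1)] by (simp add: divide_simps) (simp add: algebra_simps)
     qed
     also have "... = (\<Sum>r<m. x r * Rr m x r) - ?z * (Rr (Suc m) x m - 1)"
      unfolding pf by (simp add: sum_subtractf sum_distrib_left)
     finally show ?thesis unfolding Suc True z1 nth by (simp add: Q_def algebra_simps)
    next
     case False
     have "(\<Sum>r<m. x r ^ Suc j * Rr (Suc m) x r) - ?z * (\<Sum>r<m. x r ^ j * Rr (Suc m) x r) = (\<Sum>r<m. x r ^ j * (Rr (Suc m) x r * (x r - ?z)))"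
      by (simp add: sum_distrib_left sum_subtractf[symmetric] algebra_simps)
     also have "... = (\<Sum>r<m. x r ^ j * (Rr m x r * (x r + ?z)))"
     proof (rule sum.cong[OF refl])
      fix r assume "r : {..<m}"
      hence "r < m" by simp
      from R[OF this] show "x r ^ j * (Rr (Suc m) x r * (x r - ?z)) = x r ^ j * (Rr m x r * (x r + ?z))" by (rule arg_cong)
     qed
     also have "... = (\<Sum>r<m. x r ^ Suc j * Rr m x r) + ?z * (\<Sum>r<m. x r ^ j * Rr m x r)"
      unfolding sum_distrib_left sum.distrib[symmetric] by (intro sum.cong refl) (simp add: algebra_simps)
     finally show ?thesis unfolding Suc z1 nth using False by (simp add: Q_def algebra_simps)
    qed
   qed (simp add: Q_def)
  qed
  moreover have "Q (Suc m) * D (Suc m) = (Q (Suc m) * (1 - fps_const ?z * fps_X)) * D m"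
   unfolding D_def prod.lessThan_Suc by (simp only: mult_ac)
  ultimately have "Q (Suc m) * D (Suc m) = (Q m * D m) * (1 + fps_const ?z * fps_X)" by (simp only: mult_ac)
  also have "Q m * D m = P m" using Suc by simp
  finally show ?case unfolding P_def by simp
 qed
 ultimately have "E * D n = Q n * D n" by simp
 moreover have "D n ~= 0"
 proof -
  have "fps_nth (D m) 0 = 1" for m by (induction m) (simp_all add: D_def)
  thus ?thesis by (metis fps_zero_nth zero_neq_one)
 qed
 ultimately have "E = Q n" by simp
 thus ?thesis using E_nth[of k] k by (simp add: Q_def u_def)
qed

section \<open>Reduction to the last eigenvalue\<close>

definition skip :: "nat => nat => nat" where "skip s i = (if i < s then i else Suc i)"
text \<open>\<open>kap\<close> without the division by \<open>vdm m l\<close>, so that the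
  determinant in it can be expanded along a column without carrying that denominator.\<close>

definition Dk :: "nat => (nat => real) => (nat => real) => real" where "Dk m l x = (vdm m x)^2 * hck m l x"
definition ev :: "(real => real) => nat => (nat => real) => real" where "ev V m x = (\<Prod>i<m. exp (V (x i)))"

lemma Dk_cong: "(!!i. i < m ==> x i = y i) ==> (!!i. i < m ==> l i = k i) ==> Dk m l x = Dk m k y"
 unfolding Dk_def hck_def XD_def
 by (intro arg_cong2[where f = "(*)"] arg_cong2[where f = "(/)"] arg_cong[where f = "%t. t^2"] AD_cong vdm_cong) auto

text \<open>Laplace expansion along column 0. Because the columns are reversed this is the column of
  \<open>\<xi> m\<close>, and the signs are (-1)^s.\<close>

lemma XD_Suc: "XD (Suc m) l \<xi> = (\<Sum>s<Suc m. (-1) ^ s * exp (- \<xi> m * l s) * XD m (l o skip s) \<xi>)"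
proof -
 define A where "A = Matrix.mat (Suc m) (Suc m) (%(i, j). exp (- \<xi> (Suc m - Suc j) * l i))"
 have A: "A : carrier_mat (Suc m) (Suc m)" by (simp add: A_def)
 have c: "A $$ (s, 0) * cofactor A s 0 = (-1) ^ s * exp (- \<xi> m * l s) * XD m (l o skip s) \<xi>" if s: "s < Suc m" for s
 proof -
  have "mat_delete A s 0 = Matrix.mat m m (%(i, j). exp (- \<xi> (m - Suc j) * (l o skip s) i))"
   by (rule eq_matI) (use s in \<open>auto simp: mat_delete_def A_def skip_def\<close>)
  thus ?thesis using s by (simp add: cofactor_def XD_def AD_def A_def)
 qed
 have "XD (Suc m) l \<xi> = det A" by (simp only: XD_def AD_def A_def)
 also have "... = (\<Sum>s<Suc m. A $$ (s, 0) * cofactor A s 0)" by (rule laplace_expansion_column[OF A]) simp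
 also have "... = (\<Sum>s<Suc m. (-1) ^ s * exp (- \<xi> m * l s) * XD m (l o skip s) \<xi>)" by (rule sum.cong[OF refl c]) simp
 finally show ?thesis .
qed

text \<open>With x = x_m, each i < m contributes (x + x_i) / (x - x_i) times (x - x_i)^2 / (x^2 -
  x_i^2), which is 1. Only the expanded determinant still contains x_m.\<close>

lemma Rr_Dk:
 assumes "inj_on (sq x) {..<Suc m}"
 shows "Rr (Suc m) x m * Dk (Suc m) l x = (\<Sum>s<Suc m. (-1) ^ s * exp (- (x m)\<^sup>2 * l s) * Dk m (l o skip s) x)"
proof -
 let ?A = "\<Prod>i<m. x m - x i" and ?B = "\<Prod>i<m. x m + x i"
 have "(x m)^2 ~= (x i)^2" if "i < m" for i using inj_onD[OF assms, of m i] that by auto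
 hence "x m - x i ~= 0 & x m + x i ~= 0" if "i < m" for i using that by (auto simp: power2_eq_iff eq_neg_iff_add_eq_0)
 hence ne: "?A ~= 0" "?B ~= 0" by auto
 have "(\<Prod>i<m. (x m)^2 - (x i)^2) = ?A * ?B"
  unfolding prod.distrib[symmetric] by (intro prod.cong refl) (simp add: power2_eq_square algebra_simps)
 hence "Rr (Suc m) x m * Dk (Suc m) l x = (vdm m x)^2 * (XD (Suc m) l (sq x) / vdm m (sq x))"
  unfolding Dk_def hck_def Rr_Suc prod_dividef vdm_Suc using ne by (simp add: power2_eq_square)
 thus ?thesis unfolding XD_Suc Dk_def hck_def sum_divide_distrib sum_distrib_left by (simp only: mult_ac times_divide_eq_right)
qed

text \<open>\<open>l\<close> is half the external field, given as a function so that deleting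
  entries is composition with \<open>skip\<close>.\<close>

definition adm :: "(real => real) => nat => (nat => real) => bool" where
 "adm V m l \<longleftrightarrow> matrix_model (map (%i. 2 * l i) [0..<m]) V m & inj_on l {..<m}"

lemma adm_skip: "adm V (Suc m) l ==> s < Suc m ==> adm V m (l o skip s)"
proof -
 assume a: "adm V (Suc m) l" "s < Suc m"
 have sk: "skip s i < Suc m" if "i < m" for i using that by (simp add: skip_def)
 have nth: "map (%i. 2 * l i) [0..<Suc m] ! j = 2 * l j" if "j < Suc m" for j using that by (simp del: upt_Suc)
 from a(1) interpret matrix_model "map (%i. 2 * l i) [0..<Suc m]" V "Suc m" by (simp add: adm_def)
 have "matrix_model (map (%i. 2 * (l o skip s) i) [0..<m]) V m"
 proof
  fix i k assume i: "i < m"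
  show "0 < map (%i. 2 * (l o skip s) i) [0..<m] ! i" using pos[OF sk[OF i]] nth[OF sk[OF i]] i by simp
  show "integrable lborel (%x. x ^ k * exp (- (1/2) * map (%i. 2 * (l o skip s) i) [0..<m] ! i * x^2 + V x))"
   using mom[OF sk[OF i], of k] nth[OF sk[OF i]] i by simp
 qed (use cont in auto)
 moreover have "inj_on (skip s) {..<m}" by (auto simp: inj_on_def skip_def split: if_splits)
 hence "inj_on (l o skip s) {..<m}" using a(1) sk by (intro comp_inj_on) (auto simp: adm_def intro: inj_on_subset)
 ultimately show ?thesis by (simp add: adm_def)
qed

lemma vdm_nonzero: "inj_on l {..<m} ==> vdm m l ~= (0 :: real)"
 unfolding vdm_def prod_zero_iff[OF finite_lessThan] by (auto dest!: inj_onD)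

lemma Dk_W: "matrix_model lam V m ==> distinct lam ==>
  matrix_model.W lam V m x = matrix_model.cN lam m * (pi ^ (\<Sum>i<m. i) / fact m) / vdm m (%i. lam ! i / 2) * (ev V m x * Dk m (%i. lam ! i / 2) x)"
 by (simp add: matrix_model.W_def kap_def Dk_def ev_def)

lemma adm_field: "matrix_model lam V m ==> distinct lam ==> adm V m (%i. lam ! i / 2)"
proof -
 assume a: "matrix_model lam V m" "distinct lam"
 then interpret matrix_model lam V m by simp
 have "map (%i. 2 * (lam ! i / 2)) [0..<m] = lam" by (simp add: len[symmetric] map_nth)
 thus ?thesis using a len by (simp add: adm_def inj_on_def nth_eq_iff_index_eq)
qed

lemma measurable_Dk: "Dk m l bm LR m"
 unfolding Dk_def[abs_def] by (intro mi)

lemma Dk_integrable: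
 assumes "adm V m l"
 shows "integrable (LR m) (%x. (\<Prod>i<m. 1 + \<bar>x i\<bar>) ^ M * (ev V m x * Dk m l x))"
proof -
 let ?lam = "map (%i. 2 * l i) [0..<m]"
 interpret matrix_model ?lam V m using assms by (simp add: adm_def)
 have d: "distinct ?lam" using assms by (auto simp: adm_def distinct_map inj_on_def)
 \<comment> \<open>The power of the product of the 1 + |x_i| is realised as an invariant function of
   the matrix, so that \<open>integral_spectral\<close> gives its integrability.\<close>
 define F where "F H = exp (real M * tr_fun (%t. ln (1 + \<bar>t\<bar>)) H)" for H
 have F: "F (rdiag m x) = (\<Prod>i<m. 1 + \<bar>x i\<bar>) ^ M" for x
 proof -
  have "1 + \<bar>x i\<bar> > 0" for i by (simp add: add_pos_nonneg)
  thus ?thesis by (simp add: F_def tr_fun_rdiag sum_distrib_left exp_sum exp_of_nat_mult prod_power_distrib)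
 qed
 have "continuous_on UNIV (%t::real. ln (1 + \<bar>t\<bar>))" by (intro continuous_intros ballI) (simp add: add_nonneg_eq_0_iff)
 from measurable_tr_fun[OF this, of m] have "F bm HL m" unfolding F_def[abs_def] by measurable
 hence "grow m F" unfolding grow_def bnd_def F by (auto simp: uinv_def F_def tr_fun_conj_by intro!: exI[of _ 1] exI[of _ M] prod_nonneg zero_le_power)
 from integral_spectral(1)[OF d this]
 have I: "integrable (LR m) (%x. (\<Prod>i<m. 1 + \<bar>x i\<bar>) ^ M * W x)" unfolding F .
 define c where "c = cN * (pi ^ (\<Sum>i<m. i) / fact m) / vdm m l"
 have v: "vdm m l ~= 0" using vdm_nonzero assms by (auto simp: adm_def)
 have "W x = c * (ev V m x * Dk m l x)" for x
 proof -
  have "vdm m (%i. ?lam ! i / 2) = vdm m l" by (rule vdm_cong) simp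
  moreover have "Dk m (%i. ?lam ! i / 2) x = Dk m l x" by (rule Dk_cong) simp_all
  ultimately show ?thesis using Dk_W[OF matrix_model_axioms d, of x] by (simp add: c_def)
 qed
 with I have "integrable (LR m) (%x. c * ((\<Prod>i<m. 1 + \<bar>x i\<bar>) ^ M * (ev V m x * Dk m l x)))" by (simp add: mult_ac)
 moreover have "c ~= 0" using cN_pos v by (simp add: c_def)
 ultimately show ?thesis by simp
qed

lemma measurable_LR_restrict: "g bm LR m ==> (!!x y. (!!i. i < m ==> x i = y i) ==> g x = g y) ==> g bm LR (Suc m)"
proof -
 assume g: "g bm LR m" "!!x y. (!!i. i < m ==> x i = y i) ==> g x = g y"
 have "(%x. restrict x {..<m}) : LR (Suc m) ->M LR m" by (rule measurable_restrict_subset) auto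
 from mcomp[OF this g(1)] have "(%x. g (restrict x {..<m})) bm LR (Suc m)" .
 moreover have "g (restrict x {..<m}) = g x" for x by (rule g(2)) simp
 ultimately show ?thesis by simp
qed

lemma integral_LR_Suc:
 fixes f :: "(nat => real) => real"
 assumes "integrable (LR (Suc m)) f"
 shows "(LINT x|LR (Suc m). f x) = (LINT x|LR m. LINT t|lborel. f (x(m := t)))"
proof -
 interpret product_sigma_finite "%_::nat. lborel :: real measure" by (rule product_sigma_finite_lborel)
 show ?thesis using product_integral_insert[of "{..<m}" m f] assms by (simp add: lessThan_Suc)
qed

lemma integral_last_product:
 fixes f :: "real => real" and g :: "(nat => real) => real"
 assumes f: "integrable lborel f" and g: "integrable (LR m) g" and gc: "!!x y. (!!i. i < m ==> x i = y i) ==> g x = g y"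
 shows "integrable (LR (Suc m)) (%x. f (x m) * g x)"
  "(LINT x|LR (Suc m). f (x m) * g x) = (LINT t|lborel. f t) * (LINT x|LR m. g x)"
proof -
 have u: "g (x(m := t)) = g x" for x t by (rule gc) simp
 have fm: "f bm borel" and gm: "g bm LR m" using f g by auto
 have m: "(%x. f (x m) * g x) bm LR (Suc m)"
  by (intro mi measurable_LR_restrict[OF gm gc] mcomp[OF measurable_component_LR fm]) simp_all
 have "NI (LR (Suc m)) (%x. norm (f (x m) * g x)) = NI (LR m) (%x. NI lborel (%t. ennreal (norm (g x)) * ennreal (norm (f t))))"
  unfolding nn_integral_LR_Suc(1)[OF mcomp[OF mcomp[OF m borel_measurable_norm] measurable_ennreal]]
  by (intro nn_integral_cong) (simp add: u abs_mult ennreal_mult' mult.commute)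
 also have "... = NI (LR m) (%x. ennreal (norm (g x)) * NI lborel (%t. norm (f t)))"
  using fm by (intro nn_integral_cong nn_integral_cmult) auto
 also have "... = NI (LR m) (%x. norm (g x)) * NI lborel (%t. norm (f t))" using gm by (intro nn_integral_multc) auto
 also have "... < \<infinity>" using f g unfolding integrable_iff_bounded by (simp add: ennreal_mult_less_top)
 finally show I: "integrable (LR (Suc m)) (%x. f (x m) * g x)" using m by (intro integrableI_bounded)
 show "(LINT x|LR (Suc m). f (x m) * g x) = (LINT t|lborel. f t) * (LINT x|LR m. g x)"
  unfolding integral_LR_Suc[OF I] by (simp add: u)
qed

lemma moment_integrable: "adm V (Suc m) l ==> s < Suc m ==> integrable lborel (%t. (1 + \<bar>t\<bar>) ^ M * exp (V t - l s * t^2))"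
proof -
 assume a: "adm V (Suc m) l" and s: "s < Suc m"
 interpret matrix_model "map (%i. 2 * l i) [0..<Suc m]" V "Suc m" using a by (simp add: adm_def)
 have n: "map (%i. 2 * l i) [0..<Suc m] ! s = 2 * l s" using s by (simp del: upt_Suc)
 have V: "V bm borel" by (rule borel_measurable_continuous_onI[OF cont])
 have "NI lborel (%t. ennreal (norm ((1 + \<bar>t\<bar>) ^ M * exp (V t - l s * t^2)))) < \<infinity>"
  using mom_abs[OF s, of M] unfolding n by (simp add: abs_mult)
 moreover have "(%t. (1 + \<bar>t\<bar>) ^ M * exp (V t - l s * t^2)) bm lborel" using V by measurable
 ultimately show ?thesis by (intro integrableI_bounded)
qed

lemma last_terms_integrable:
 assumes a: "adm V (Suc m) l" and s: "s < Suc m" and \<psi>: "pbd (Suc m) \<psi>"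
 shows "integrable (LR (Suc m)) (%x. \<psi> x * (exp (V (x m) - l s * (x m)^2) * (ev V m x * Dk m (l o skip s) x)))"
proof -
 obtain C M where C: "0 <= C" "!!x. \<bar>\<psi> x\<bar> <= C * (\<Prod>i<Suc m. 1 + \<bar>x i\<bar>) ^ M" and \<psi>m: "\<psi> bm LR (Suc m)"
  using \<psi> unfolding pbd_def bnd_def by blast
 let ?P = "%x::nat => real. \<Prod>i<m. 1 + \<bar>x i\<bar>" and ?g = "%x. ev V m x * Dk m (l o skip s) x" and ?f = "%t. exp (V t - l s * t^2)"
 have gc: "?g x = ?g y" if "!!i. i < m ==> x i = y i" for x y
 proof -
  have "Dk m (l o skip s) x = Dk m (l o skip s) y" by (rule Dk_cong) (use that in auto)
  thus ?thesis by (simp add: ev_def that)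
 qed
 have V: "V bm borel" using a by (auto simp: adm_def matrix_model_def intro: borel_measurable_continuous_onI)
 have evm: "ev V m bm LR m" unfolding ev_def[abs_def]
  by (intro mi mcomp[OF measurable_component_LR V]) simp
 have gm: "?g bm LR (Suc m)"
  by (rule measurable_LR_restrict[OF borel_measurable_times[OF evm measurable_Dk] gc])
 have fm: "(%x. ?f (x m)) bm LR (Suc m)"
  by (rule mcomp[OF measurable_component_LR, where g = ?f]) (use V in measurable)
 have I: "integrable (LR (Suc m)) (%x. ((1 + \<bar>x m\<bar>) ^ M * ?f (x m)) * (?P x ^ M * ?g x))"
 proof (rule integral_last_product(1)[OF moment_integrable[OF a s] Dk_integrable[OF adm_skip[OF a s]]])
  fix x y :: "nat => real" assume e: "!!i. i < m ==> x i = y i"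
  hence "?P x = ?P y" by (intro prod.cong) auto
  with gc[OF e] show "?P x ^ M * ?g x = ?P y ^ M * ?g y" by (simp only:)
 qed
 show ?thesis
 proof (rule Bochner_Integration.integrable_bound[OF Bochner_Integration.integrable_mult_right[OF I, of C]])
  show "(%x. \<psi> x * (?f (x m) * ?g x)) bm LR (Suc m)" by (intro mi \<psi>m fm gm)
  show "AE x in LR (Suc m). norm (\<psi> x * (?f (x m) * ?g x)) <= norm (C * (((1 + \<bar>x m\<bar>) ^ M * ?f (x m)) * (?P x ^ M * ?g x)))"
  proof (rule AE_I2)
   fix x
   have P: "0 <= ?P x" by (intro prod_nonneg) auto
   have "\<bar>\<psi> x\<bar> * (?f (x m) * \<bar>?g x\<bar>) <= C * ((1 + \<bar>x m\<bar>) * ?P x) ^ M * (?f (x m) * \<bar>?g x\<bar>)"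
    using C(2)[of x] by (intro mult_right_mono) (simp_all add: mult.commute)
   thus "norm (\<psi> x * (?f (x m) * ?g x)) <= norm (C * (((1 + \<bar>x m\<bar>) ^ M * ?f (x m)) * (?P x ^ M * ?g x)))"
    using C(1) P by (simp add: abs_mult power_mult_distrib mult_ac)
  qed
 qed
qed

text \<open>\<open>Rr\<close> is singular where eigenvalues coincide, yet almost everywhere the
  integrand equals a finite sum of decoupled terms, each of which is integrable.\<close>

lemma last_expansion:
 assumes a: "adm V (Suc m) l" and \<psi>: "pbd (Suc m) \<psi>"
 defines "h == %x. \<psi> x * (Rr (Suc m) x m * (ev V (Suc m) x * Dk (Suc m) l x))"
 shows "integrable (LR (Suc m)) h"
  and "(LINT x|LR (Suc m). h x) = (\<Sum>s<Suc m. (-1) ^ s * (LINT x|LR (Suc m). \<psi> x * (exp (V (x m) - l s * (x m)^2) * (ev V m x * Dk m (l o skip s) x))))"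
proof -
 let ?t = "%s x. \<psi> x * (exp (V (x m) - l s * (x m)^2) * (ev V m x * Dk m (l o skip s) x))"
 have \<psi>m: "\<psi> bm LR (Suc m)" using \<psi> by (simp add: pbd_def)
 have V: "V bm borel" using a by (auto simp: adm_def matrix_model_def intro: borel_measurable_continuous_onI)
 have hm: "h bm LR (Suc m)"
  unfolding h_def Rr_def ev_def
  by (intro mi \<psi>m measurable_Dk mcomp[OF measurable_component_LR V]) auto
 have ae: "AE x in LR (Suc m). h x = (\<Sum>s<Suc m. (-1) ^ s * ?t s x)"
  using AE_LR_sq_inj[of "Suc m"]
 proof eventually_elim
  case (elim x)
  have "h x = \<psi> x * ev V (Suc m) x * (Rr (Suc m) x m * Dk (Suc m) l x)" by (simp add: h_def)
  also have "... = (\<Sum>s<Suc m. (-1) ^ s * ?t s x)"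
   unfolding Rr_Dk[OF elim] sum_distrib_left
   by (intro sum.cong refl) (simp add: ev_def exp_diff exp_minus field_simps)
  finally show ?case .
 qed
 have I: "integrable (LR (Suc m)) (%x. (-1) ^ s * ?t s x)" if "s : {..<Suc m}" for s
  using last_terms_integrable[OF a _ \<psi>, of s] that by (intro Bochner_Integration.integrable_mult_right) simp
 have IS: "integrable (LR (Suc m)) (%x. \<Sum>s<Suc m. (-1) ^ s * ?t s x)" by (rule Bochner_Integration.integrable_sum[OF I])
 show "integrable (LR (Suc m)) h" using IS by (rule Bochner_Integration.integrable_cong_AE_imp[OF _ hm]) (use ae in auto)
 have "(LINT x|LR (Suc m). h x) = (LINT x|LR (Suc m). (\<Sum>s<Suc m. (-1) ^ s * ?t s x))"
  by (rule integral_cong_AE[OF hm _ ae]) (use IS in simp)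
 also have "... = (\<Sum>s<Suc m. (-1) ^ s * (LINT x|LR (Suc m). ?t s x))"
  by (subst Bochner_Integration.integral_sum[OF I]) (auto simp del: sum.lessThan_Suc)
 finally show "(LINT x|LR (Suc m). h x) = (\<Sum>s<Suc m. (-1) ^ s * (LINT x|LR (Suc m). ?t s x))" .
qed

lemma distr_LR_permute: "p permutes {0..<n} ==> distr (LR n) (LR n) (%x. x o p) = LR n"
proof (rule measure_eqI)
 fix A assume p: "p permutes {0..<n}" and "A : sets (distr (LR n) (LR n) (%x. x o p))"
 hence A: "A : sets (LR n)" by simp
 hence "(indicator A :: _ => ennreal) bm LR n" "(indicator A :: _ => ennreal) bm distr (LR n) (LR n) (%x. x o p)" by simp_all
 from nn_integral_LR_permute[OF p this(1)] nn_integral_distr[OF measurable_LR_permute[OF p] this(2)]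
 have "NI (distr (LR n) (LR n) (%x. x o p)) (%x. indicator A x) = NI (LR n) (%x. indicator A x)" by simp
 thus "emeasure (distr (LR n) (LR n) (%x. x o p)) A = emeasure (LR n) A" using A by simp
qed simp

text \<open>Exchanging the variables \<open>r\<close> and \<open>m\<close> preserves the measure and
  the symmetric weight and turns the r-th summand into the last one.\<close>

theorem symmetrized_integral:
 assumes a: "adm V (Suc m) l" and \<psi>: "pbd (Suc m) \<psi>"
 defines "h == %x. \<psi> x * (Rr (Suc m) x m * (ev V (Suc m) x * Dk (Suc m) l x))"
 shows "(LINT x|LR (Suc m). (\<Sum>r<Suc m. \<psi> (x o swp r m) * Rr (Suc m) x r) * (ev V (Suc m) x * Dk (Suc m) l x)) = real (Suc m) * (LINT x|LR (Suc m). h x)"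
proof -
 have hi: "integrable (LR (Suc m)) h" unfolding h_def by (rule last_expansion(1)[OF a \<psi>])
 hence hm: "h bm LR (Suc m)" by simp
 have per: "swp r m permutes {0..<Suc m}" if "r < Suc m" for r using that by (intro permutes_swap_id) auto
 have h: "h (x o swp r m) = \<psi> (x o swp r m) * Rr (Suc m) x r * (ev V (Suc m) x * Dk (Suc m) l x)" if r: "r < Suc m" for r x
 proof -
  let ?t = "swp r m"
  have "Rr (Suc m) (x o ?t) m = Rr (Suc m) x r"
   unfolding Rr_def o_def transpose_apply_second
   by (rule prod.reindex_bij_witness[where i = ?t and j = ?t]) (use r in \<open>auto simp: Transposition.transpose_def split: if_splits\<close>)
  moreover have "ev V (Suc m) (x o ?t) = ev V (Suc m) x"
   using prod.permute[OF per[OF r], of "%i. exp (V (x i))"] by (simp add: ev_def o_def atLeast0LessThan)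
  moreover have "Dk (Suc m) l (x o ?t) = Dk (Suc m) l x"
  proof -
   have v: "vdm (Suc m) l ~= 0" using a vdm_nonzero by (auto simp: adm_def)
   thus ?thesis using kap_permute[OF per[OF r], of l x] by (simp add: kap_def Dk_def)
  qed
  ultimately show ?thesis by (simp add: h_def)
 qed
 have "(LINT x|LR (Suc m). (\<Sum>r<Suc m. \<psi> (x o swp r m) * Rr (Suc m) x r) * (ev V (Suc m) x * Dk (Suc m) l x)) = (LINT x|LR (Suc m). (\<Sum>r<Suc m. h (x o swp r m)))"
  unfolding sum_distrib_right by (intro Bochner_Integration.integral_cong sum.cong refl) (simp add: h)
 also have "... = (\<Sum>r<Suc m. LINT x|LR (Suc m). h (x o swp r m))"
 proof (rule Bochner_Integration.integral_sum)
  fix r assume "r : {..<Suc m}"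
  thus "integrable (LR (Suc m)) (%x. h (x o swp r m))"
   using hi integrable_distr[OF measurable_LR_permute[OF per], of r h] by (simp add: distr_LR_permute[OF per])
 qed
 also have "... = (\<Sum>r<Suc m. LINT x|LR (Suc m). h x)"
 proof (rule sum.cong[OF refl])
  fix r assume "r : {..<Suc m}"
  hence r: "r < Suc m" by simp
  show "(LINT x|LR (Suc m). h (x o swp r m)) = (LINT x|LR (Suc m). h x)"
   using integral_distr[OF measurable_LR_permute[OF per[OF r]] hm] by (simp add: distr_LR_permute[OF per[OF r]])
 qed
 finally show ?thesis by simp
qed

text \<open>In each decoupled term the last variable occurs only in an even one-variable weight and
  in the odd \<open>\<psi>\<close>.\<close>

lemma odd_integral_zero:
 assumes a: "adm V (Suc m) l" and \<psi>: "pbd (Suc m) \<psi>" and V: "!!t. V (- t) = V t"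
  and odd: "!!x t. \<psi> (x(m := - t)) = - \<psi> (x(m := t))"
 shows "(LINT x|LR (Suc m). \<psi> x * (Rr (Suc m) x m * (ev V (Suc m) x * Dk (Suc m) l x))) = 0"
 unfolding last_expansion(2)[OF a \<psi>]
proof (intro sum.neutral ballI)
 fix s assume "s : {..<Suc m}"
 hence s: "s < Suc m" by simp
 let ?t = "%x. \<psi> x * (exp (V (x m) - l s * (x m)^2) * (ev V m x * Dk m (l o skip s) x))"
 have "(LINT t|lborel. ?t (x(m := t))) = 0" for x
 proof -
  have "Dk m (l o skip s) (x(m := t)) = Dk m (l o skip s) x" "ev V m (x(m := t)) = ev V m x" for t
   by (rule Dk_cong) (simp_all add: ev_def)
  hence "?t (x(m := - t)) = - ?t (x(m := t))" for t by (simp add: odd V)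
  moreover have "(LINT t|lborel. ?t (x(m := t))) = (LINT t|lborel. ?t (x(m := - t)))"
   using lborel_integral_real_affine[of "-1" "%t. ?t (x(m := t))" 0] by simp
  ultimately show ?thesis by simp
 qed
 thus "(-1) ^ s * (LINT x|LR (Suc m). ?t x) = 0"
  unfolding integral_LR_Suc[OF last_terms_integrable[OF a s \<psi>]] by simp
qed

lemma spectral_last:
 assumes mm: "matrix_model lam V (Suc m)" and d: "distinct lam" and F: "grow (Suc m) F" and \<psi>: "pbd (Suc m) \<psi>"
  and eq: "AE x in LR (Suc m). F (rdiag (Suc m) x) = (\<Sum>r<Suc m. \<psi> (x o swp r m) * Rr (Suc m) x r)"
 shows "(LINT H|mu0 lam V. F H) = matrix_model.cN lam (Suc m) * pi ^ (\<Sum>i<Suc m. i) / (fact m * vdm (Suc m) (%i. lam ! i / 2)) *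
   (LINT x|LR (Suc m). \<psi> x * (Rr (Suc m) x m * (ev V (Suc m) x * Dk (Suc m) (%i. lam ! i / 2) x)))"
proof -
 let ?l = "%i. lam ! i / 2" and ?L = "LR (Suc m)"
 interpret matrix_model lam V "Suc m" by fact
 note a = adm_field[OF mm d]
 define c where "c = cN * (pi ^ (\<Sum>i<Suc m. i) / fact (Suc m)) / vdm (Suc m) ?l"
 have W: "W x = c * (ev V (Suc m) x * Dk (Suc m) ?l x)" for x
  unfolding Dk_W[OF mm d] c_def ..
 define h where "h x = \<psi> x * (Rr (Suc m) x m * (ev V (Suc m) x * Dk (Suc m) ?l x))" for x
 have "(LINT H|mu0 lam V. F H) = (LINT x|?L. F (rdiag (Suc m) x) * W x)" by (rule integral_spectral(2)[OF d F])
 also have "... = (LINT x|?L. c * ((\<Sum>r<Suc m. \<psi> (x o swp r m) * Rr (Suc m) x r) * (ev V (Suc m) x * Dk (Suc m) ?l x)))"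
 proof (rule integral_cong_AE)
  show "(%x. F (rdiag (Suc m) x) * W x) bm ?L" using integral_spectral(1)[OF d F] by simp
  have "(%x. \<psi> (x o swp r m)) bm ?L" if "r < Suc m" for r
   by (rule mcomp[OF measurable_LR_permute]) (use that \<psi> in \<open>auto simp: pbd_def intro: permutes_swap_id\<close>)
  note A = this
  have B: "(%x. Rr (Suc m) x r) bm ?L" if "r < Suc m" for r
   unfolding Rr_def by (intro mi) (use that in auto)
  have E: "(%x. ev V (Suc m) x * Dk (Suc m) ?l x) bm ?L"
   using Dk_integrable[OF a, of 0] by simp
  show "(%x. c * ((\<Sum>r<Suc m. \<psi> (x o swp r m) * Rr (Suc m) x r) * (ev V (Suc m) x * Dk (Suc m) ?l x))) bm ?L"
   by (rule borel_measurable_times[OF borel_measurable_const borel_measurable_times[OF borel_measurable_sum[OF borel_measurable_times[OF A B]] E]]) auto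
  show "AE x in ?L. F (rdiag (Suc m) x) * W x = c * ((\<Sum>r<Suc m. \<psi> (x o swp r m) * Rr (Suc m) x r) * (ev V (Suc m) x * Dk (Suc m) ?l x))"
   using eq by eventually_elim (simp only: W mult_ac)
 qed
 also have "... = c * (real (Suc m) * (LINT x|?L. h x))"
  unfolding h_def symmetrized_integral[OF a \<psi>, symmetric] by simp
 also have "c * (real (Suc m) * (LINT x|?L. h x)) = cN * pi ^ (\<Sum>i<Suc m. i) / (fact m * vdm (Suc m) ?l) * (LINT x|?L. h x)"
  unfolding c_def by (simp add: field_simps del: of_nat_Suc sum.lessThan_Suc)
 finally show ?thesis unfolding h_def .
qed

section \<open>Even potentials\<close>

context matrix_model
begin

lemma integral_mu0:
 assumes F: "F bm HL n"
 shows "(LINT H|mu0 lam V0. F H) = cN * (LINT H|HL n. exp (- pr (rdiag n (%i. lam ! i / 2)) (H ^\<^sub>m 2)) * (eV H * F H))"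
proof -
 have "(LINT H|mu0 lam V0. F H) = (LINT H|HL n. gw H * F H)"
  unfolding mu0_density using gw F by (subst integral_density) auto
 also have "... = (LINT H|HL n. cN * (exp (- pr (rdiag n (%i. lam ! i / 2)) (H ^\<^sub>m 2)) * (eV H * F H)))"
  by (simp add: gw_def mult_ac)
 finally show ?thesis by simp
qed

text \<open>Coinciding \<open>\<lambda>\<^sub>i\<close> are reached from distinct ones by continuity.\<close>

lemma vanish_by_perturbation:
 assumes F: "grow n F"
  and zero: "!!lam'. matrix_model lam' V0 n ==> distinct lam' ==> (LINT H|mu0 lam' V0. F H) = 0"
 shows "(LINT H|mu0 lam V0. F H) = 0"
proof -
 have Fm: "F bm HL n" using F by (simp add: grow_def)
 \<comment> \<open>Upward shifts keep all integrands below the unperturbed one. The shifts differ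
   for different \<open>i\<close>, so ties are broken at every stage, while unequal entries stay
   unequal for large \<open>k\<close>.\<close>
 define l where "l k i = lam ! i + real i / real (Suc k)" for k i
 define L where "L k = map (l k) [0..<n]" for k
 have lL: "L k ! i = l k i" if "i < n" for k i using that by (simp add: L_def)
 have mm: "matrix_model (L k) V0 n" for k
 proof
  fix i j assume i: "i < n"
  show "0 < L k ! i" using pos[OF i] by (simp add: lL[OF i] l_def add_pos_nonneg)
  have V: "V0 bm borel" by (rule borel_measurable_continuous_onI[OF cont])
  show "integrable lborel (%x. x ^ j * exp (- (1/2) * L k ! i * x^2 + V0 x))"
  proof (rule Bochner_Integration.integrable_bound[OF mom[OF i, of j]])
   show "(%x. x ^ j * exp (- (1/2) * L k ! i * x^2 + V0 x)) bm lborel" using V by measurable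
   show "AE x in lborel. norm (x ^ j * exp (- (1/2) * L k ! i * x^2 + V0 x)) <= norm (x ^ j * exp (- (1/2) * lam ! i * x^2 + V0 x))"
    unfolding lL[OF i] l_def by (intro AE_I2) (auto simp: abs_mult mult_left_mono mult_right_mono)
  qed
 qed (simp_all add: L_def cont)
 define f where "f m H = exp (- pr (rdiag n m) (H ^\<^sub>m 2)) * (eV H * F H)" for m :: "nat => real" and H
 have fm: "f m bm HL n" for m
 proof -
  have "(%H. pr (rdiag n m) (H ^\<^sub>m 2)) bm HL n"
   by (rule measurable_pr[OF measurable_const measurable_ident_sets[OF refl]]) (simp add: space_HL)
  thus ?thesis unfolding f_def[abs_def]
   by (intro mi Fm eV)
 qed
 have pr_l: "pr (rdiag n m) (H ^\<^sub>m 2) = (\<Sum>i<n. m i * (\<Sum>j<n. (cmod (H $$ (i, j)))^2))" if "herm n H" for m H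
  unfolding pr_rdiag_left[OF hermD(1)[OF herm_pow[OF that]]] by (intro sum.cong) (simp_all add: pow2_diag[OF that])
 have "(%k. LINT H|HL n. f (%i. l k i / 2) H) \<longlonglongrightarrow> (LINT H|HL n. f (%i. lam ! i / 2) H)"
 proof (rule integral_dominated_convergence[where w = "%H. \<bar>f (%i. lam ! i / 2) H\<bar>"])
  have "integrable (HL n) (%H. gw H * F H)"
   using grow_integrable[OF F] gw Fm unfolding mu0_density by (subst (asm) integrable_density) auto
  hence "integrable (HL n) (%H. cN * f (%i. lam ! i / 2) H)" by (simp add: gw_def f_def mult_ac)
  thus "integrable (HL n) (%H. \<bar>f (%i. lam ! i / 2) H\<bar>)" using cN_pos by simp
  show "AE H in HL n. (%k. f (%i. l k i / 2) H) \<longlonglongrightarrow> f (%i. lam ! i / 2) H"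
  proof (rule AE_I2)
   fix H assume "H : space (HL n)"
   hence H: "herm n H" by (rule space_HL_D)
   have "(%k. l k i) \<longlonglongrightarrow> lam ! i + 0" for i
    unfolding l_def by (intro tendsto_add tendsto_const LIMSEQ_Suc[OF lim_const_over_n])
   thus "(%k. f (%i. l k i / 2) H) \<longlonglongrightarrow> f (%i. lam ! i / 2) H"
    unfolding f_def pr_l[OF H] by (intro tendsto_intros) auto
  qed
  show "AE H in HL n. norm (f (%i. l k i / 2) H) <= \<bar>f (%i. lam ! i / 2) H\<bar>" for k
  proof (rule AE_I2)
   fix H assume "H : space (HL n)"
   hence H: "herm n H" by (rule space_HL_D)
   have "pr (rdiag n (%i. lam ! i / 2)) (H ^\<^sub>m 2) <= pr (rdiag n (%i. l k i / 2)) (H ^\<^sub>m 2)"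
    unfolding pr_l[OF H] by (intro sum_mono mult_right_mono sum_nonneg) (auto simp: l_def)
   thus "norm (f (%i. l k i / 2) H) <= \<bar>f (%i. lam ! i / 2) H\<bar>"
    unfolding f_def by (simp add: abs_mult mult_right_mono)
  qed
 qed (rule fm)+
 moreover have "\<forall>\<^sub>F k in sequentially. (LINT H|HL n. f (%i. l k i / 2) H) = 0"
 proof -
  have "\<forall>\<^sub>F k in sequentially. i ~= j --> l k i ~= l k j" for i j
  proof (cases "lam ! i = lam ! j")
   case False
   have "(%k. l k i - l k j) \<longlonglongrightarrow> lam ! i + 0 - (lam ! j + 0)"
    unfolding l_def by (intro tendsto_add tendsto_diff tendsto_const LIMSEQ_Suc[OF lim_const_over_n])
   hence "\<forall>\<^sub>F k in sequentially. l k i - l k j ~= 0" using False by (intro tendsto_imp_eventually_ne) auto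
   thus ?thesis by eventually_elim auto
  qed (simp add: l_def)
  hence "\<forall>\<^sub>F k in sequentially. \<forall>i\<in>{..<n}. \<forall>j\<in>{..<n}. i ~= j --> l k i ~= l k j"
   by (intro eventually_ball_finite ballI) auto
  thus ?thesis
  proof eventually_elim
   case (elim k)
   hence "distinct (L k)" unfolding L_def distinct_map by (force simp: inj_on_def)
   hence "(LINT H|mu0 (L k) V0. F H) = 0" by (rule zero[OF mm])
   moreover have "rdiag n (%i. L k ! i / 2) = rdiag n (%i. l k i / 2)" by (rule rdiag_cong) (simp add: lL)
   moreover have "0 < matrix_model.cN (L k) n" by (rule matrix_model.cN_pos[OF mm])
   ultimately show ?case using matrix_model.integral_mu0[OF mm Fm, of k] matrix_model.eV_def[OF mm] by (simp add: f_def eV_def)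
  qed
 qed
 ultimately have "(LINT H|HL n. f (%i. lam ! i / 2) H) = 0"
  by (blast intro: LIMSEQ_unique tendsto_eventually)
 thus ?thesis unfolding integral_mu0[OF Fm] f_def by simp
qed

end

lemma even_vanish:
 assumes mm: "matrix_model lam V (Suc m)" and even: "!!t. V (- t) = V t" and F: "grow (Suc m) F" and \<psi>: "pbd (Suc m) \<psi>"
  and eq: "!!x. inj_on x {..<Suc m} ==> F (rdiag (Suc m) x) = (\<Sum>r<Suc m. \<psi> (x o swp r m) * Rr (Suc m) x r)"
  and odd: "!!x t. \<psi> (x(m := - t)) = - \<psi> (x(m := t))"
 shows "(LINT H|mu0 lam V. F H) = 0"
proof (rule matrix_model.vanish_by_perturbation[OF mm F])
 fix lam' assume m: "matrix_model lam' V (Suc m)" and d: "distinct lam'"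
 have "AE x in LR (Suc m). F (rdiag (Suc m) x) = (\<Sum>r<Suc m. \<psi> (x o swp r m) * Rr (Suc m) x r)"
  using AE_LR_sq_inj[of "Suc m"]
 proof eventually_elim
  case (elim x)
  hence "inj_on x {..<Suc m}" by (auto simp: inj_on_def)
  thus ?case by (rule eq)
 qed
 from spectral_last[OF m d F \<psi> this] show "(LINT H|mu0 lam' V. F H) = 0"
  using odd_integral_zero[OF adm_field[OF m d] \<psi> even odd] by simp
qed

lemma transposed:
 "r < Suc m ==> (\<Sum>i<Suc m. f ((x o swp r m) i)) = (\<Sum>i<Suc m. f (x i))" "(x o swp r m) m = x r"
proof -
 assume r: "r < Suc m"
 hence "swp r m permutes {..<Suc m}" by (intro permutes_swap_id) auto
 from sum.permute[OF this, of "%i. f (x i)"] show "(\<Sum>i<Suc m. f ((x o swp r m) i)) = (\<Sum>i<Suc m. f (x i))" by (simp add: o_def del: sum.lessThan_Suc)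
qed simp

theorem part_C:
 assumes mm: "matrix_model lam V (Suc m)" and even: "!!t. V (- t) = V t" and k: "odd k" and j: "odd j"
 shows "(LINT H|mu0 lam V. schur_q (power_sums H) (k + j)) = (LINT H|mu0 lam V. tr_pow H j * schur_q (power_sums H) k)"
proof -
 interpret matrix_model lam V "Suc m" by fact
 let ?q = "%k H. schur_q (power_sums H) k"
 note g = grow_schur_q[of "Suc m"] grow_intros(2)[of "Suc m" j]
 \<comment> \<open>Taking x_m^j out of the power sum removes x_m from it, so the remaining
   dependence on x_m is the odd power x_m^k. The part taken out accounts for the Q-function of index
   k + j.\<close>
 define \<psi> where "\<psi> x = 2 * (((\<Sum>i<Suc m. x i ^ j) + - 1 * x m ^ j) * x m ^ k)" for x :: "nat => real"
 have "(LINT H|mu0 lam V. tr_pow H j * ?q k H + - 1 * ?q (k + j) H) = 0"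
 proof (rule even_vanish[OF mm even])
  show "grow (Suc m) (%H. tr_pow H j * ?q k H + - 1 * ?q (k + j) H)" by (intro grow_intros g)
  show "pbd (Suc m) \<psi>" unfolding \<psi>_def[abs_def]
   by (intro pbd_intros(1,3,4) pbd_sum pbd_power pbd_intros(2)) auto
  show "\<psi> (x(m := - t)) = - \<psi> (x(m := t))" for x t using j k by (simp add: \<psi>_def algebra_simps)
  fix x :: "nat => real" assume x: "inj_on x {..<Suc m}"
  have q: "?q i (rdiag (Suc m) x) = (\<Sum>r<Suc m. 2 * x r ^ i * Rr (Suc m) x r)" if "i > 0" for i
   unfolding schur_q_eigenvalues[OF x that] sum_distrib_left by (simp only: mult.assoc)
  have "tr_pow (rdiag (Suc m) x) j * ?q k (rdiag (Suc m) x) + - 1 * ?q (k + j) (rdiag (Suc m) x) =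
    (\<Sum>r<Suc m. (\<Sum>i<Suc m. x i ^ j) * (2 * x r ^ k * Rr (Suc m) x r) + - 1 * (2 * x r ^ (k + j) * Rr (Suc m) x r))"
   using odd_pos[OF k] odd_pos[OF j] by (simp only: q tr_pow_rdiag sum_distrib_left sum.distrib add_pos_pos)
  also have "... = (\<Sum>r<Suc m. \<psi> (x o swp r m) * Rr (Suc m) x r)"
  proof (rule sum.cong[OF refl])
   fix r assume "r : {..<Suc m}"
   hence r: "r < Suc m" by simp
   show "(\<Sum>i<Suc m. x i ^ j) * (2 * x r ^ k * Rr (Suc m) x r) + - 1 * (2 * x r ^ (k + j) * Rr (Suc m) x r) = \<psi> (x o swp r m) * Rr (Suc m) x r"
    unfolding \<psi>_def transposed(1)[OF r, of "%t. t ^ j"] transposed(2) by (simp add: algebra_simps power_add del: sum.lessThan_Suc)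
  qed
  finally show "tr_pow (rdiag (Suc m) x) j * ?q k (rdiag (Suc m) x) + - 1 * ?q (k + j) (rdiag (Suc m) x) = (\<Sum>r<Suc m. \<psi> (x o swp r m) * Rr (Suc m) x r)" .
 qed
 thus ?thesis
  using grow_integrable[OF g(1)] grow_integrable[OF grow_intros(4)[OF g(2) g(1)]] by simp
qed

lemma part_B_coeff:
 assumes mm: "matrix_model lam V (Suc m)" and even: "!!t. V (- t) = V t"
 shows "(\<Sum>(b, c)\<in>splits a. if c = 0 then 0 else tmon (%_. 2) c * (LINT H|mu0 lam V. tmon (pw H) b * ((-1) ^ wt c * schur_q (power_sums H) (wt c)))) = 0"
proof -
 interpret matrix_model lam V "Suc m" by fact
 define T where "T z H = (case z of (b, c) => if c = 0 then 0 else tmon (%_. 2) c * (tmon (pw H) b * ((-1) ^ wt c * schur_q (power_sums H) (wt c))))" for z H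
 have g: "grow (Suc m) (T z)" for z
 proof (cases z)
  case (Pair b c)
  hence "T z = (%H. if c = 0 then 0 else tmon (%_. 2) c * (tmon (pw H) b * ((-1) ^ wt c * schur_q (power_sums H) (wt c))))" by (simp add: T_def fun_eq_iff)
  thus ?thesis by (cases "c = 0") (simp_all only: if_True if_False simp_thms grow_intros(1,4) grow_schur_q grow_tmon_pw)
 qed
 define p where "p x j = (\<Sum>i<Suc m. x i ^ (2 * j + 1))" for x :: "nat => real" and j
 \<comment> \<open>By \<open>tmon_add\<close>, summing over the splittings replaces each odd power
   sum p_j by p_j - 2 x_m^(2j+1), which is the power sum with the sign of x_m reversed. The
   difference with the original is odd in x_m.\<close>
 define \<psi> where "\<psi> x = 2 * (tmon (%j. p x j + (- x m) ^ (2 * j + 1) * 2) a + - 1 * tmon (p x) a)" for x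
 have ptm: "pbd (Suc m) (%x. tmon (f x) a)" if "!!j. pbd (Suc m) (%x. f x j)" for f
  unfolding tmon_def mpow_def divide_inverse by (intro pbd_intros(1,4) pbd_prod pbd_power that)
 have "(LINT H|mu0 lam V. (\<Sum>z\<in>splits a. T z H)) = 0"
 proof (rule even_vanish[OF mm even grow_sum[OF g]])
  have xm: "pbd (Suc m) (%x. - x m)" using pbd_intros(4)[OF pbd_intros(1)[of _ "- 1"] pbd_intros(2)[of m "Suc m"]] by simp
  show "pbd (Suc m) \<psi>" unfolding \<psi>_def[abs_def] p_def[abs_def]
   by (intro pbd_intros(1,3,4) ptm pbd_sum pbd_power xm pbd_intros(2)) auto
  have o: "(- t) ^ (2 * j + 1) = - (t ^ (2 * j + 1))" for t :: real and j by simp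
  show "\<psi> (x(m := - t)) = - \<psi> (x(m := t))" for x t
  proof -
   have "p (x(m := s)) j + (- s) ^ (2 * j + 1) * 2 = p (x(m := - s)) j" for s j by (simp add: p_def o)
   from this[of t] this[of "- t"] show ?thesis unfolding \<psi>_def by (simp add: fun_upd_same cong: if_cong)
  qed
  fix x :: "nat => real" assume x: "inj_on x {..<Suc m}"
  have pwx: "pw (rdiag (Suc m) x) = p x" by (simp only: tr_pow_rdiag p_def fun_eq_iff simp_thms)
  have T: "T z (rdiag (Suc m) x) = (\<Sum>r<Suc m. (case z of (b, c) => if c = 0 then 0 else 2 * (tmon (p x) b * tmon (%j. (- x r) ^ (2 * j + 1) * 2) c)) * Rr (Suc m) x r)" for z
  proof (cases z)
   case (Pair b c)
   show ?thesis
   proof (cases "c = 0")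
    case False
    hence "wt c > 0" using ky_zero(5)[of c] by simp
    from schur_q_eigenvalues[OF x this] show ?thesis
     unfolding T_def Pair pwx tmon_const_power using False
     by (simp add: sum_distrib_left power_minus[of "x _"] mult_ac del: sum.lessThan_Suc)
   qed (simp add: T_def Pair)
  qed
  have S: "(\<Sum>z\<in>splits a. case z of (b, c) => if c = 0 then 0 else 2 * (tmon (p x) b * tmon q c)) = 2 * (tmon (%j. p x j + q j) a + - 1 * tmon (p x) a)" for q
  proof -
   have "(\<Sum>z\<in>splits a. case z of (b, c) => if c = 0 then 0 else 2 * (tmon (p x) b * tmon q c)) =
     (\<Sum>z\<in>splits a. 2 * (case z of (b, c) => tmon (p x) b * tmon q c) - 2 * (if z = (a, 0) then tmon (p x) a else 0))"
   proof (rule sum.cong[OF refl])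
    fix z assume "z : splits a"
    thus "(case z of (b, c) => if c = 0 then 0 else 2 * (tmon (p x) b * tmon q c)) = 2 * (case z of (b, c) => tmon (p x) b * tmon q c) - 2 * (if z = (a, 0) then tmon (p x) a else 0)"
     by (cases "snd z = 0") (auto simp: tmon_def[where ?a = 0] ky_zero)
   qed
   also have "... = 2 * (tmon (%j. p x j + q j) a - tmon (p x) a)"
    unfolding sum_subtractf sum_distrib_left[symmetric] tmon_add by (simp add: finite_splits right_diff_distrib)
   finally show ?thesis by simp
  qed
  have "(\<Sum>z\<in>splits a. T z (rdiag (Suc m) x)) = (\<Sum>r<Suc m. (\<Sum>z\<in>splits a. case z of (b, c) => if c = 0 then 0 else 2 * (tmon (p x) b * tmon (%j. (- x r) ^ (2 * j + 1) * 2) c)) * Rr (Suc m) x r)"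
   unfolding T sum_distrib_right by (rule sum.swap)
  also have "... = (\<Sum>r<Suc m. \<psi> (x o swp r m) * Rr (Suc m) x r)"
  proof (rule sum.cong[OF refl])
   fix r assume "r : {..<Suc m}"
   hence "p (x o swp r m) = p x" unfolding p_def using transposed(1)[of r m "%t. t ^ (2 * _ + 1)" x] by (simp only: lessThan_iff)
   thus "(\<Sum>z\<in>splits a. case z of (b, c) => if c = 0 then 0 else 2 * (tmon (p x) b * tmon (%j. (- x r) ^ (2 * j + 1) * 2) c)) * Rr (Suc m) x r = \<psi> (x o swp r m) * Rr (Suc m) x r"
    unfolding \<psi>_def S transposed(2) by (simp only:)
  qed
  finally show "(\<Sum>z\<in>splits a. T z (rdiag (Suc m) x)) = (\<Sum>r<Suc m. \<psi> (x o swp r m) * Rr (Suc m) x r)" .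
 qed
 also have "(LINT H|mu0 lam V. (\<Sum>z\<in>splits a. T z H)) = (\<Sum>z\<in>splits a. LINT H|mu0 lam V. T z H)"
  by (rule Bochner_Integration.integral_sum[OF grow_integrable[OF g]])
 also have "... = (\<Sum>(b, c)\<in>splits a. if c = 0 then 0 else tmon (%_. 2) c * (LINT H|mu0 lam V. tmon (pw H) b * ((-1) ^ wt c * schur_q (power_sums H) (wt c))))"
  unfolding T_def case_prod_beta by (intro sum.cong refl) simp
 finally show ?thesis .
qed

section \<open>The expansion over pairs\<close>

abbreviation psum :: "nat => (nat => real) => nat => real" where "psum m x == %j. \<Sum>i<m. x i ^ (2 * j + 1)"

text \<open>\<open>tmon (%_. 1) c\<close> is the reciprocal of the multi-index factorial, so this is
  the one-variable integral of x^k against the Gaussian weight and the exponentiated potential with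
  parameters t.\<close>

definition ek :: "(real => real) => nat => real => real tseries" where
 "ek V k z = Abs_tseries (%c. LINT t|lborel. t ^ k * (t ^ wt c * tmon (%_. 1) c) * exp (V t - z * t^2))"

text \<open>The partition function stripped of its constants and of the division by
  \<open>vdm m l\<close>.\<close>

definition jj :: "(real => real) => nat => (nat => real) => real tseries" where
 "jj V m l = Abs_tseries (%b. LINT x|LR m. tmon (psum m x) b * (ev V m x * Dk m l x))"

lemma pbd_psum: "pbd m (%x. tmon (psum m x) a)"
 unfolding tmon_def mpow_def divide_inverse by (intro pbd_intros(1,4) pbd_prod pbd_power pbd_sum pbd_intros(2)) auto

lemma pbd_Dk_integrable:
 assumes a: "adm V m l" and f: "pbd m f"
 shows "integrable (LR m) (%x. f x * (ev V m x * Dk m l x))"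
proof -
 obtain C M where C: "0 <= C" "!!x. \<bar>f x\<bar> <= C * (\<Prod>i<m. 1 + \<bar>x i\<bar>) ^ M" and fm: "f bm LR m"
  using f unfolding pbd_def bnd_def by blast
 have gm: "(%x. ev V m x * Dk m l x) bm LR m" using Dk_integrable[OF a, of 0] by simp
 show ?thesis
 proof (rule Bochner_Integration.integrable_bound[OF Bochner_Integration.integrable_mult_right[OF Dk_integrable[OF a, of M], of C]])
  show "AE x in LR m. norm (f x * (ev V m x * Dk m l x)) <= norm (C * ((\<Prod>i<m. 1 + \<bar>x i\<bar>) ^ M * (ev V m x * Dk m l x)))"
  proof (rule AE_I2)
   fix x :: "nat => real"
   have "0 <= (\<Prod>i<m. 1 + \<bar>x i\<bar>)" by (intro prod_nonneg) auto
   with mult_right_mono[OF C(2)[of x], of "\<bar>ev V m x * Dk m l x\<bar>"] C(1)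
   show "norm (f x * (ev V m x * Dk m l x)) <= norm (C * ((\<Prod>i<m. 1 + \<bar>x i\<bar>) ^ M * (ev V m x * Dk m l x)))"
    by (simp add: abs_mult mult_ac)
  qed
 qed (intro mi fm gm)
qed

lemma moment_integrable': "adm V (Suc m) l ==> s < Suc m ==> integrable lborel (%t. t ^ k * (t ^ i * c) * exp (V t - l s * t^2))"
proof -
 assume a: "adm V (Suc m) l" and s: "s < Suc m"
 interpret matrix_model "map (%i. 2 * l i) [0..<Suc m]" V "Suc m" using a by (simp add: adm_def)
 have "map (%i. 2 * l i) [0..<Suc m] ! s = 2 * l s" using s by (simp del: upt_Suc)
 with mom[OF s, of "k + i"] have "integrable lborel (%t. c * (t ^ (k + i) * exp (V t - l s * t^2)))"
  by (intro Bochner_Integration.integrable_mult_right) simp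
 thus ?thesis by (simp add: power_add mult_ac)
qed

text \<open>In the decoupled terms the last variable enters the parameters t only through its own
  odd powers. By \<open>tmon_add\<close> the exponential splits, and the coefficient becomes that of
  a product of two series.\<close>

lemma peel:
 assumes a: "adm V (Suc m) l"
 shows "(LINT x|LR (Suc m). x m ^ k * tmon (psum (Suc m) x) a * (Rr (Suc m) x m * (ev V (Suc m) x * Dk (Suc m) l x))) =
  tcoeff (\<Sum>s<Suc m. (-1) ^ s *\<^sub>R (jj V m (l o skip s) * ek V k (l s))) a"
proof -
 have pb: "pbd (Suc m) (%x. x m ^ k * tmon (psum (Suc m) x) a)" by (intro pbd_intros(4) pbd_power pbd_intros(2) pbd_psum) simp
 show ?thesis unfolding last_expansion(2)[OF a pb] tcoeff_sum tcoeff_simps real_scaleR_def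
 proof (intro sum.cong refl arg_cong2[where f = "(*)"])
  fix s assume "s : {..<Suc m}"
  hence s: "s < Suc m" by simp
  let ?f = "%c t. t ^ k * (t ^ wt c * tmon (%_. 1) c) * exp (V t - l s * t^2)" and ?E = "%x. ev V m x * Dk m (l o skip s) x"
  let ?g = "%b x. tmon (psum m x) b * ?E x"
  have gc: "?g b x = ?g b y" if "!!i. i < m ==> x i = y i" for b x y
  proof -
   have "Dk m (l o skip s) x = Dk m (l o skip s) y" by (rule Dk_cong) (use that in auto)
   moreover have "psum m x = psum m y" "ev V m x = ev V m y" by (simp_all add: that ev_def)
   ultimately show ?thesis by (simp only:)
  qed
  have P: "integrable (LR (Suc m)) (%x. ?f c (x m) * ?g b x)" "(LINT x|LR (Suc m). ?f c (x m) * ?g b x) = (LINT t|lborel. ?f c t) * (LINT x|LR m. ?g b x)" for b c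
   using integral_last_product[OF moment_integrable'[OF a s] pbd_Dk_integrable[OF adm_skip[OF a s] pbd_psum] gc] by blast+
  have "(LINT x|LR (Suc m). x m ^ k * tmon (psum (Suc m) x) a * (exp (V (x m) - l s * (x m)^2) * ?E x)) =
    (LINT x|LR (Suc m). (\<Sum>z\<in>splits a. ?f (snd z) (x m) * ?g (fst z) x))"
  proof (rule Bochner_Integration.integral_cong[OF refl])
   fix x :: "nat => real"
   have "psum (Suc m) x = (%j. psum m x j + x m ^ (2 * j + 1) * 1)" by simp
   hence "tmon (psum (Suc m) x) a = (\<Sum>z\<in>splits a. tmon (psum m x) (fst z) * (x m ^ wt (snd z) * tmon (%_. 1) (snd z)))"
    unfolding tmon_const_power[symmetric] by (simp only: tmon_add case_prod_unfold)
   thus "x m ^ k * tmon (psum (Suc m) x) a * (exp (V (x m) - l s * (x m)^2) * ?E x) = (\<Sum>z\<in>splits a. ?f (snd z) (x m) * ?g (fst z) x)"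
    by (simp only: sum_distrib_left sum_distrib_right mult_ac)
  qed
  also have "... = (\<Sum>z\<in>splits a. (LINT t|lborel. ?f (snd z) t) * (LINT x|LR m. ?g (fst z) x))"
   by (subst Bochner_Integration.integral_sum[OF P(1)]) (simp only: P(2))
  finally show "(LINT x|LR (Suc m). x m ^ k * tmon (psum (Suc m) x) a * (exp (V (x m) - l s * (x m)^2) * ?E x)) =
    (\<Sum>(b, c)\<in>splits a. tcoeff (jj V m (l o skip s)) b * tcoeff (ek V k (l s)) c)"
   by (simp add: case_prod_beta ek_def jj_def mult.commute)
 qed
qed

text \<open>At odd size the identity of \<open>sum_Rr_odd\<close> allows the factor 1 to be written
  as the sum of the \<open>Rr\<close>, which makes an eigenvalue decouple although no Q-function is
  present.\<close>

lemma jj_odd: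
 assumes a: "adm V (Suc m) l" and odd: "odd (Suc m)"
 shows "jj V (Suc m) l = real (Suc m) *\<^sub>R (\<Sum>s<Suc m. (-1) ^ s *\<^sub>R (jj V m (l o skip s) * ek V 0 (l s)))"
proof (rule tseries_eqI)
 fix b
 let ?p = "%x. tmon (psum (Suc m) x) b" and ?E = "%x. ev V (Suc m) x * Dk (Suc m) l x"
 have t: "?p (x o swp r m) = ?p x" if "r < Suc m" for r x
  using transposed(1)[OF that, of "%t. t ^ (2 * _ + 1)" x] by (simp only:)
 have B: "(%x. Rr (Suc m) x r) bm LR (Suc m)" if "r < Suc m" for r
  unfolding Rr_def by (intro mi) (use that in auto)
 have I: "integrable (LR (Suc m)) (%x. ?p x * ?E x)" by (rule pbd_Dk_integrable[OF a pbd_psum])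
 have "(LINT x|LR (Suc m). ?p x * ?E x) = (LINT x|LR (Suc m). (\<Sum>r<Suc m. Rr (Suc m) x r) * (?p x * ?E x))"
 proof (rule integral_cong_AE)
  show "AE x in LR (Suc m). ?p x * ?E x = (\<Sum>r<Suc m. Rr (Suc m) x r) * (?p x * ?E x)"
   using AE_LR_nondegenerate[of "Suc m"] AE_LR_sq_inj[of "Suc m"]
  proof eventually_elim
   case (elim x)
   hence "inj_on x {..<Suc m}" by (auto simp: inj_on_def)
   hence "(\<Sum>r<Suc m. Rr (Suc m) x r) = 1" by (rule sum_Rr_odd[OF odd]) (use elim in auto)
   thus ?case by (simp only: mult_1)
  qed
  show "(%x. (\<Sum>r<Suc m. Rr (Suc m) x r) * (?p x * ?E x)) bm LR (Suc m)"
   by (rule borel_measurable_times[OF borel_measurable_sum[OF B] borel_measurable_integrable[OF I]]) simp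
 qed (rule borel_measurable_integrable[OF I])
 also have "... = (LINT x|LR (Suc m). (\<Sum>r<Suc m. ?p (x o swp r m) * Rr (Suc m) x r) * ?E x)"
  unfolding sum_distrib_right by (intro Bochner_Integration.integral_cong sum.cong refl) (simp only: t lessThan_iff, simp only: mult_ac)
 also have "... = real (Suc m) * tcoeff (\<Sum>s<Suc m. (-1) ^ s *\<^sub>R (jj V m (l o skip s) * ek V 0 (l s))) b"
  unfolding symmetrized_integral[OF a pbd_psum] peel[OF a, of 0, symmetric] power_0 mult_1 ..
 finally show "tcoeff (jj V (Suc m) l) b = tcoeff (real (Suc m) *\<^sub>R (\<Sum>s<Suc m. (-1) ^ s *\<^sub>R (jj V m (l o skip s) * ek V 0 (l s)))) b"
  by (simp only: jj_def tcoeff_Abs tcoeff_simps real_scaleR_def)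
qed

lemma jj_cong: "(!!i. i < m ==> l i = k i) ==> jj V m l = jj V m k"
 unfolding jj_def by (simp add: Dk_cong[of m _ _ l k])

lemma Z_jj:
 assumes mm: "matrix_model lam V m" and d: "distinct lam"
 shows "Z lam V = (matrix_model.cN lam m * (pi ^ (\<Sum>i<m. i) / fact m) / vdm m (%i. lam ! i / 2)) *\<^sub>R jj V m (%i. lam ! i / 2)"
proof (rule tseries_eqI)
 fix b
 interpret matrix_model lam V m by fact
 have "tcoeff (Z lam V) b = (LINT x|LR m. tmon (psum m x) b * W x)"
  unfolding tcoeff_Z integral_spectral(2)[OF d grow_tmon_pw] tr_pow_rdiag ..
 thus "tcoeff (Z lam V) b = tcoeff ((cN * (pi ^ (\<Sum>i<m. i) / fact m) / vdm m (%i. lam ! i / 2)) *\<^sub>R jj V m (%i. lam ! i / 2)) b"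
  unfolding Dk_W[OF mm d] tcoeff_simps jj_def by (simp add: mult.left_commute[of "tmon _ _"])
qed

text \<open>The first decoupling: the Q-function supplies the factor \<open>Rr\<close>, and the
  power x^k stays with the eigenvalue that is split off.\<close>

lemma q_peel:
 assumes mm: "matrix_model lam V (Suc m)" and d: "distinct lam" and k: "k > 0"
 defines "l == %i. lam ! i / 2"
 shows "mu_integral lam V (%H. tconst (schur_q (power_sums H) k)) =
  (2 * (matrix_model.cN lam (Suc m) * pi ^ (\<Sum>i<Suc m. i) / (fact m * vdm (Suc m) l))) *\<^sub>R (\<Sum>s<Suc m. (-1) ^ s *\<^sub>R (jj V m (l o skip s) * ek V k (l s)))"
proof (rule tseries_eqI)
 fix a
 interpret matrix_model lam V "Suc m" by fact
 define \<psi> where "\<psi> x = 2 * (x m ^ k * tmon (psum (Suc m) x) a)" for x :: "nat => real"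
 have \<psi>: "pbd (Suc m) \<psi>" unfolding \<psi>_def[abs_def] by (intro pbd_intros(1,4) pbd_power pbd_intros(2) pbd_psum) simp
 have "AE x in LR (Suc m). tmon (pw (rdiag (Suc m) x)) a * schur_q (power_sums (rdiag (Suc m) x)) k = (\<Sum>r<Suc m. \<psi> (x o swp r m) * Rr (Suc m) x r)"
  using AE_LR_sq_inj[of "Suc m"]
 proof eventually_elim
  case (elim x)
  hence x: "inj_on x {..<Suc m}" by (auto simp: inj_on_def)
  have "\<psi> (x o swp r m) = 2 * (x r ^ k * tmon (psum (Suc m) x) a)" if "r < Suc m" for r
   unfolding \<psi>_def using transposed(1)[OF that, of "%t. t ^ (2 * _ + 1)" x] transposed(2)[of x r m] by (simp only:)
  hence "(\<Sum>r<Suc m. \<psi> (x o swp r m) * Rr (Suc m) x r) = (\<Sum>r<Suc m. 2 * (x r ^ k * tmon (psum (Suc m) x) a) * Rr (Suc m) x r)"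
   by (intro sum.cong refl) simp
  thus ?case unfolding schur_q_eigenvalues[OF x k] tr_pow_rdiag sum_distrib_left by (simp only: mult_ac)
 qed
 note S = spectral_last[OF mm d grow_intros(4)[OF grow_tmon_pw grow_schur_q] \<psi> this, folded l_def]
 have a: "adm V (Suc m) l" unfolding l_def by (rule adm_field[OF mm d])
 have E: "\<psi> x * y = 2 * (x m ^ k * tmon (psum (Suc m) x) a * y)" for x y by (simp add: \<psi>_def)
 show "tcoeff (mu_integral lam V (%H. tconst (schur_q (power_sums H) k))) a = tcoeff ((2 * (cN * pi ^ (\<Sum>i<Suc m. i) / (fact m * vdm (Suc m) l))) *\<^sub>R (\<Sum>s<Suc m. (-1) ^ s *\<^sub>R (jj V m (l o skip s) * ek V k (l s)))) a"
  unfolding tcoeff_mu_integral S tcoeff_simps(6) peel[OF a, symmetric] E integral_mult_right_zero by (simp only: real_scaleR_def mult_ac)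
qed

section \<open>Deleting two indices; signs and constants\<close>

lemma bij_skip: "s < Suc m ==> bij_betw (skip s) {..<m} ({..<Suc m} - {s})"
 by (rule bij_betw_byWitness[where f' = "%i. if i < s then i else i - 1"]) (auto simp: skip_def)

lemma prod_skip:
 fixes f :: "nat => 'a::comm_monoid_mult"
 shows "s < Suc m ==> (\<Prod>i<Suc m. f i) = f s * (\<Prod>i<m. f (skip s i))"
 unfolding prod.reindex_bij_betw[OF bij_skip] by (subst prod.remove[of _ s]) auto

text \<open>Of the factors involving l_s, those with one of the m - s larger indices occur in the
  opposite order; these give the sign.\<close>

lemma vdm_skip: "s < Suc m ==> vdm (Suc m) l = (-1) ^ (m - s) * (\<Prod>i<m. l s - l (skip s i)) * vdm m (l o skip s)"
proof (induction m)
 case (Suc m)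
 show ?case
 proof (cases "s = Suc m")
  case True
  hence "(\<Prod>i<Suc m. l s - l (skip s i)) = (\<Prod>i<Suc m. l s - l i)" "vdm (Suc m) (l o skip s) = vdm (Suc m) l"
   by (intro prod.cong vdm_cong; simp add: skip_def)+
  thus ?thesis by (simp only: True vdm_Suc[of "Suc m"] diff_self_eq_0 power_0 mult_1 mult.commute)
 next
  case False
  hence s: "s < Suc m" using Suc by simp
  hence k: "skip s m = Suc m" "Suc m - s = Suc (m - s)" by (auto simp: skip_def)
  show ?thesis
   unfolding vdm_Suc[of "Suc m" l] vdm_Suc[of m "l o skip s"] prod_skip[OF s, of "%i. l (Suc m) - l i"] Suc.IH[OF s] k(2)
   by (simp add: k(1)) (simp add: algebra_simps)
 qed
qed (simp add: vdm_def)

lemma skip_skip: "u < v ==> skip u (skip (v - 1) i) = skip v (skip u i)"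
 by (auto simp: skip_def)

lemma bij_skip2: "u < v ==> v < Suc (Suc p) ==> bij_betw (%i. skip v (skip u i)) {..<p} ({..<Suc (Suc p)} - {u, v})"
proof -
 assume uv: "u < v" "v < Suc (Suc p)"
 hence "skip v ` ({..<Suc p} - {u}) = {..<Suc (Suc p)} - {u, v}"
  using bij_skip[of v "Suc p"] unfolding bij_betw_def
  by (subst image_set_diff) (auto simp: skip_def inj_def split: if_splits)
 moreover have "inj_on (skip v) ({..<Suc p} - {u})" by (auto simp: skip_def inj_on_def split: if_splits)
 ultimately have "bij_betw (skip v) ({..<Suc p} - {u}) ({..<Suc (Suc p)} - {u, v})" by (simp add: bij_betw_def)
 from bij_betw_trans[OF bij_skip this] uv show ?thesis by (simp add: o_def)
qed

lemma delete2_skip: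
 assumes uv: "u < v" "v < Suc (Suc p)" and l: "length xs = Suc (Suc p)"
 shows "delete2 xs u v = map (%i. xs ! skip v (skip u i)) [0..<p]"
proof -
 have z: "zip xs [0..<length xs] = map (%i. (xs ! i, i)) [0..<length xs]"
  by (rule nth_equalityI) auto
 have "filter (%i. i : - {u, v}) [0..<length xs] = map (%i. skip v (skip u i)) [0..<p]"
 proof (rule sorted_distinct_set_unique)
  have "i <= j ==> skip v (skip u i) <= skip v (skip u j)" for i j by (auto simp: skip_def)
  thus "sorted (map (%i. skip v (skip u i)) [0..<p])" by (simp add: sorted_iff_nth_mono)
  show "distinct (map (%i. skip v (skip u i)) [0..<p])" by (auto simp: distinct_map inj_on_def skip_def split: if_splits)
  show "set (filter (%i. i : - {u, v}) [0..<length xs]) = set (map (%i. skip v (skip u i)) [0..<p])"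
   unfolding set_filter set_map set_upt atLeast0LessThan l bij_betw_imp_surj_on[OF bij_skip2[OF uv]] by auto
 qed (auto intro: sorted_wrt_filter)
 thus ?thesis unfolding delete2_def nths_def z by (simp add: filter_map o_def)
qed

text \<open>Deleting \<open>s\<close> and then the r-th remaining index removes a pair u < v, in one
  of two orders: \<open>v\<close> and then \<open>u\<close>, or \<open>u\<close> and then
  \<open>v\<close>, which by then has moved to position v - 1.\<close>

lemma sum_pairs:
 fixes f :: "nat => nat => 'a::comm_monoid_add"
 shows "(\<Sum>s<Suc m. \<Sum>r<m. f s r) = (\<Sum>(u, v)\<in>{(u, v). u < v & v < Suc m}. f v u + f u (v - 1))"
proof -
 let ?P = "{(u, v). u < v & v < Suc m}"
 have "(\<Sum>s<Suc m. \<Sum>r<m. f s r) = (\<Sum>(s, r)\<in>{..<Suc m} \<times> {..<m}. f s r)" by (simp only: sum.cartesian_product)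
 also have "{..<Suc m} \<times> {..<m} = {(s, r). r < s & s < Suc m} \<union> {(s, r). s <= r & r < m}" by auto
 also have "(\<Sum>(s, r)\<in>.... f s r) = (\<Sum>(s, r)\<in>{(s, r). r < s & s < Suc m}. f s r) + (\<Sum>(s, r)\<in>{(s, r). s <= r & r < m}. f s r)"
 proof (rule sum.union_disjoint)
  show "finite {(s, r). r < s & s < Suc m}" by (rule finite_subset[of _ "{..<Suc m} \<times> {..<Suc m}"]) auto
  show "finite {(s, r). s <= r & r < m}" by (rule finite_subset[of _ "{..<m} \<times> {..<m}"]) auto
 qed auto
 also have "(\<Sum>(s, r)\<in>{(s, r). r < s & s < Suc m}. f s r) = (\<Sum>(u, v)\<in>?P. f v u)"
  by (rule sum.reindex_bij_witness[where i = prod.swap and j = prod.swap]) auto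
 also have "(\<Sum>(s, r)\<in>{(s, r). s <= r & r < m}. f s r) = (\<Sum>(u, v)\<in>?P. f u (v - 1))"
  by (rule sum.reindex_bij_witness[where i = "%(u, v). (u, v - 1)" and j = "%(u, v). (u, Suc v)"]) auto
 finally show ?thesis by (simp only: sum.distrib case_prod_unfold)
qed

text \<open>Each mixed factor with index \<open>s\<close> occurs twice in the symmetric double
  product and so leaves the root; the diagonal factor 2 a_s stays under it.\<close>

lemma sqrt_gram:
 fixes a :: "nat => real"
 assumes "s < Suc m" "!!i. i < Suc m ==> 0 < a i"
 shows "sqrt (\<Prod>i<Suc m. \<Prod>j<Suc m. a i + a j) = sqrt (2 * a s) * (\<Prod>i<m. a s + a (skip s i)) * sqrt (\<Prod>i<m. \<Prod>j<m. a (skip s i) + a (skip s j))"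
proof -
 have "0 <= (\<Prod>i<m. a s + a (skip s i))"
  using assms by (intro prod_nonneg) (auto simp: skip_def add_pos_pos less_imp_le)
 moreover have "(\<Prod>i<Suc m. \<Prod>j<Suc m. a i + a j) = 2 * a s * (\<Prod>i<m. a s + a (skip s i))^2 * (\<Prod>i<m. \<Prod>j<m. a (skip s i) + a (skip s j))"
  unfolding prod_skip[OF assms(1)] prod.distrib add.commute[of "a (skip s _)" "a s"] by (simp add: power2_eq_square)
 ultimately show ?thesis by (simp add: real_sqrt_mult del: prod.lessThan_Suc)
qed

definition pair_coeff :: "real list => nat => nat => real" where
 "pair_coeff lam r s = sqrt (lam ! r * lam ! s) / pi * ((lam ! s + lam ! r) / (lam ! r - lam ! s))
  * (\<Prod>i\<in>{..<length lam} - {r, s}. ((lam ! r + lam ! i) * (lam ! s + lam ! i)) / ((lam ! r - lam ! i) * (lam ! s - lam ! i)))"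

text \<open>The two diagonal factors of the double product give the root of \<lambda>_u \<lambda>_v,
  the mixed factors give the sums in the numerators, and the Vandermonde product gives the
  differences. Against the (2 pi)^(2p+2) of the Gaussian constants the spectral formula offers
  pi^(2p+1), which leaves 1 / pi. The powers of 2 cancel against the halves in
  \<open>l\<close>.\<close>

lemma pair_coefficient:
 assumes mm: "matrix_model lam V (Suc (Suc p))" and d: "distinct lam" and uv: "u < v" "v < Suc (Suc p)"
  and mm': "matrix_model (delete2 lam u v) V p"
 defines "l == %i. lam ! i / 2"
 shows "2 * (matrix_model.cN lam (Suc (Suc p)) * pi ^ (\<Sum>i<Suc (Suc p). i) / (fact (Suc p) * vdm (Suc (Suc p)) l)) * ((-1) ^ (u + v) * real (Suc p)) =
  pair_coeff lam u v *
   (matrix_model.cN (delete2 lam u v) p * (pi ^ (\<Sum>i<p. i) / fact p) / vdm p (%i. delete2 lam u v ! i / 2))"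
proof -
 interpret matrix_model lam V "Suc (Suc p)" by fact
 let ?s = "%i. skip v (skip u i)"
 define a where "a i = lam ! i" for i
 have u: "u < Suc p" "skip v u = u" using uv by (auto simp: skip_def)
 have a': "delete2 lam u v ! i = a (?s i)" if "i < p" for i using that by (simp add: delete2_skip[OF uv len] a_def)
 define X where "X = (\<Prod>i<p. a v + a (?s i))"
 define Y where "Y = (\<Prod>i<p. a u + a (?s i))"
 define X' where "X' = (\<Prod>i<p. a v - a (?s i))"
 define Y' where "Y' = (\<Prod>i<p. a u - a (?s i))"
 define w where "w = vdm p (%i. l (?s i))"
 define G where "G = sqrt (\<Prod>i<p. \<Prod>j<p. a (?s i) + a (?s j))"
 define c where "c = 2 powr (real p / 2) * (2 * pi) powr ((real p)^2 / 2)"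
 have c: "c > 0" by (simp add: c_def)
 have P: "(\<Prod>i\<in>{..<Suc (Suc p)} - {u, v}. f i) = (\<Prod>i<p. f (?s i))" for f :: "nat => real"
  by (rule prod.reindex_bij_betw[OF bij_skip2[OF uv], symmetric])
 have pw: "a i > 0" if "i < Suc (Suc p)" for i using pos[OF that] by (simp add: a_def)
 have sk: "skip v i < Suc (Suc p)" if "i < Suc p" for i using that by (simp add: skip_def)
 have "sqrt (\<Prod>i<Suc (Suc p). \<Prod>j<Suc (Suc p). a i + a j) = sqrt (2 * a v) * ((a v + a u) * X) * (sqrt (2 * a u) * Y * G)"
  using sqrt_gram[OF uv(2), of a] sqrt_gram[OF u(1), of "%i. a (skip v i)"] pw sk
   prod_skip[OF u(1), of "%i. a v + a (skip v i)"] unfolding X_def Y_def G_def u(2) by (simp only: simp_thms)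
 also have "... = 2 * sqrt (a u * a v) * (a v + a u) * X * Y * G" by (simp add: real_sqrt_mult)
 finally have g: "sqrt (\<Prod>i<Suc (Suc p). \<Prod>j<Suc (Suc p). lam ! i + lam ! j) = 2 * sqrt (a u * a v) * (a v + a u) * X * Y * G" by (simp only: a_def)
 have "2 powr (real (Suc (Suc p)) / 2) = 2 powr (real p / 2) * 2" by (simp add: powr_add add_divide_distrib)
 moreover have "(2 * pi) powr ((real (Suc (Suc p)))^2 / 2) = (2 * pi) powr ((real p)^2 / 2) * (2 * pi) powr (real (2 * p + 2))"
  unfolding powr_add[symmetric] by (rule arg_cong2[where f = "(powr)"]) (simp_all add: power2_eq_square field_simps)
 hence "(2 * pi) powr ((real (Suc (Suc p)))^2 / 2) = (2 * pi) powr ((real p)^2 / 2) * (2 * pi) ^ (2 * p + 2)"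
  by (subst (asm) powr_realpow) auto
 ultimately have C: "cN = 2 * sqrt (a u * a v) * (a v + a u) * X * Y * G / (c * 2 * (2 * pi) ^ (2 * p + 2))"
  unfolding cN_def g c_def by simp
 have C': "matrix_model.cN (delete2 lam u v) p = G / c"
  unfolding matrix_model.cN_def[OF mm'] G_def c_def by (intro arg_cong2[where f = "(/)"] arg_cong[where f = sqrt] prod.cong refl) (simp add: a')
 have w': "vdm p (%i. delete2 lam u v ! i / 2) = w" unfolding w_def l_def by (rule vdm_cong) (simp add: a' a_def)
 have hd: "(\<Prod>i<p. l t - l (?s i)) = (\<Prod>i<p. a t - a (?s i)) / 2 ^ p" for t
  unfolding l_def a_def diff_divide_distrib[symmetric] prod_dividef by simp
 have "vdm (Suc (Suc p)) l = (-1) ^ (Suc p - v) * (\<Prod>i<Suc p. l v - l (skip v i)) * ((-1) ^ (p - u) * (\<Prod>i<p. l u - l (?s i)) * w)"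
  unfolding vdm_skip[OF uv(2)] vdm_skip[OF u(1), of "l o skip v"] w_def by (simp add: u(2) o_def)
 also have "(\<Prod>i<Suc p. l v - l (skip v i)) = (a v - a u) / 2 * (X' / 2 ^ p)"
  unfolding prod_skip[OF u(1)] hd u(2) X'_def by (simp add: l_def a_def diff_divide_distrib)
 also have "(\<Prod>i<p. l u - l (?s i)) = Y' / 2 ^ p" unfolding hd Y'_def ..
 also have "(-1) ^ (Suc p - v) * ((a v - a u) / 2 * (X' / 2 ^ p)) * ((-1) ^ (p - u) * (Y' / 2 ^ p) * w) =
   ((-1) ^ (Suc p - v) * (-1) ^ (p - u) * -1) * ((a u - a v) * X' * Y' * w / (2 * (2 ^ p * 2 ^ p)))"
  by (simp only: times_divide_eq_left times_divide_eq_right divide_divide_eq_left) (simp add: algebra_simps)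
 \<comment> \<open>The extra -1 comes from writing the difference as a_u - a_v; the total exponent
   then has the parity of u + v and cancels the sign of the two column expansions.\<close>
 also have "(-1) ^ (Suc p - v) * (-1) ^ (p - u) * -1 = ((-1) ^ (u + v) :: real)"
 proof -
 have "(-1) ^ (a - b) = (-1) ^ a * ((-1) ^ b :: real)" if "b <= a" for a b :: nat
   using that by (auto simp: minus_one_power_iff)
  thus ?thesis using uv u by (simp add: minus_one_power_iff)
 qed
 finally have v: "vdm (Suc (Suc p)) l = (-1) ^ (u + v) * ((a u - a v) * X' * Y' * w / (2 * (2 ^ p * 2 ^ p)))" .
 have "inj_on l {..<Suc (Suc p)}" using d len by (simp add: l_def inj_on_def nth_eq_iff_index_eq)
 hence "vdm (Suc (Suc p)) l ~= 0" by (rule vdm_nonzero)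
 hence nz: "a u - a v ~= 0" "X' ~= 0" "Y' ~= 0" "w ~= 0" unfolding v by auto
 have "(\<Sum>i<Suc (Suc p). i) = (\<Sum>i<p. i) + (2 * p + 1)" by simp
 hence pi: "pi ^ (\<Sum>i<Suc (Suc p). i) = pi ^ (\<Sum>i<p. i) * pi ^ (2 * p + 1)" by (simp only: power_add)
 have Q: "(\<Prod>i\<in>{..<Suc (Suc p)} - {u, v}. ((a u + a i) * (a v + a i)) / ((a u - a i) * (a v - a i))) = Y * X / (Y' * X')"
  unfolding prod_dividef prod.distrib P X_def Y_def X'_def Y'_def ..
 have e: "(2 * pi) ^ (2 * p + 2) = 4 * (2 ^ p * 2 ^ p) * (pi ^ (2 * p + 1) * pi)" by (simp add: power_mult_distrib power_even_eq power2_eq_square)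
 define sn where "sn = ((-1) ^ (u + v) :: real)"
 have sn: "sn = 1 | sn = -1" by (simp add: sn_def minus_one_power_iff)
 define D where "D = a u - a v"
 define q where "q = pi ^ (2 * p + 1)"
 have "q ~= 0" "D ~= 0" using nz by (simp_all add: q_def D_def)
 thus ?thesis
  unfolding pair_coeff_def len C C' w' v pi a_def[symmetric] Q e sn_def[symmetric] fact_Suc D_def[symmetric] q_def[symmetric]
  using c nz sn by (elim disjE) (simp_all add: divide_simps del: of_nat_Suc)
qed

section \<open>Double integrals and the pair expansion\<close>

lemma integral_product_lborel:
 fixes f g :: "real => real"
 assumes f: "integrable lborel f" and g: "integrable lborel g"
 shows "integrable lborel (%(x, y). f x * g y)" "(LINT z|lborel. (case z of (x, y) => f x * g y)) = (LINT x|lborel. f x) * (LINT y|lborel. g y)"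
proof -
 have m: "f bm borel" "g bm borel" using f g by auto
 have "integrable (lborel XM lborel) (%(x, y). f x * g y)"
 proof (rule lborel_pair.Fubini_integrable)
  show "(%(x, y). f x * g y) bm lborel XM lborel" using m by measurable
  have "integrable lborel (%x. \<bar>f x\<bar> * (LINT y|lborel. \<bar>g y\<bar>))" using f by simp
  thus "integrable lborel (%x. LINT y|lborel. norm (case (x, y) of (x, y) => f x * g y))" by (simp add: abs_mult)
 qed (use g in simp)
 from this lborel_pair.integral_fst'[OF this]
 show "integrable lborel (%(x, y). f x * g y)" "(LINT z|lborel. (case z of (x, y) => f x * g y)) = (LINT x|lborel. f x) * (LINT y|lborel. g y)"
  by (simp_all add: lborel_prod)
qed

lemma tintegral_pair:
 assumes a: "adm V (Suc m) l" and uv: "u < Suc m" "v < Suc m"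
 shows "tintegral (lborel :: (real \<times> real) measure) (%(x, y).
   ((-1) ^ k * (x ^ k - y ^ k) * exp (- (1/2) * (2 * l v) * x^2 - (1/2) * (2 * l u) * y^2) * exp (V x + V y))
    *\<^sub>R texp (tlin (%j. x ^ (2 * j + 1) + y ^ (2 * j + 1)))) = (-1) ^ k *\<^sub>R (ek V k (l v) * ek V 0 (l u) - ek V 0 (l v) * ek V k (l u))"
  (is "tintegral _ ?F = _")
proof (rule tseries_eqI)
 fix a
 let ?f = "%k z c t. t ^ k * (t ^ wt c * tmon (%_. 1) c) * exp (V t - z * t^2)"
 let ?g = "%k k' z. %(x, y). ?f k (l v) (fst z) x * ?f k' (l u) (snd z) y"
 note P = integral_product_lborel[OF moment_integrable'[OF assms(1) uv(2)] moment_integrable'[OF assms(1) uv(1)]]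
 have I: "integrable lborel (?g k k' z)" for k k' z by (rule P(1))
 have V: "(LINT w|lborel. ?g k k' z w) = tcoeff (ek V k (l v)) (fst z) * tcoeff (ek V k' (l u)) (snd z)" for k k' z
  unfolding ek_def tcoeff_Abs by (rule P(2))
 have e: "tcoeff (?F w) a = (-1) ^ k * ((\<Sum>z\<in>splits a. ?g k 0 z w) - (\<Sum>z\<in>splits a. ?g 0 k z w))" for w
 proof (cases w)
  case (Pair x y)
  have "tmon (%j. x ^ (2 * j + 1) * 1 + y ^ (2 * j + 1) * 1) a = (\<Sum>z\<in>splits a. (x ^ wt (fst z) * tmon (%_. 1) (fst z)) * (y ^ wt (snd z) * tmon (%_. 1) (snd z)))"
   unfolding tmon_add tmon_const_power case_prod_unfold ..
  hence "tcoeff (?F w) a = (\<Sum>z\<in>splits a. (-1) ^ k * (x ^ k - y ^ k) * exp (- (1/2) * (2 * l v) * x^2 - (1/2) * (2 * l u) * y^2) * exp (V x + V y) * ((x ^ wt (fst z) * tmon (%_. 1) (fst z)) * (y ^ wt (snd z) * tmon (%_. 1) (snd z))))"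
   by (simp add: Pair tcoeff_simps tcoeff_texp sum_distrib_left)
  also have "... = (\<Sum>z\<in>splits a. (-1) ^ k * (?g k 0 z w - ?g 0 k z w))"
   by (intro sum.cong refl) (simp add: Pair exp_diff exp_add exp_minus field_simps)
  finally show ?thesis by (simp only: sum_subtractf sum_distrib_left[symmetric])
 qed
 have "tcoeff (tintegral lborel ?F) a = (-1) ^ k * ((\<Sum>z\<in>splits a. LINT w|lborel. ?g k 0 z w) - (\<Sum>z\<in>splits a. LINT w|lborel. ?g 0 k z w))"
  unfolding tintegral_def tcoeff_Abs e
  by (subst Bochner_Integration.integral_sum[symmetric], rule I)+
    (subst Bochner_Integration.integral_diff[symmetric], (intro Bochner_Integration.integrable_sum I)+, simp)
 thus "tcoeff (tintegral lborel ?F) a = tcoeff ((-1) ^ k *\<^sub>R (ek V k (l v) * ek V 0 (l u) - ek V 0 (l v) * ek V k (l u))) a"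
  by (simp only: V tcoeff_simps real_scaleR_def) (simp only: case_prod_beta')
qed

definition pair_integral :: "(real => real) => real list => nat => nat => nat => real tseries" where
 "pair_integral V lam k r s = tintegral (lborel :: (real \<times> real) measure) (%(x, y).
   ((-1) ^ k * (x ^ k - y ^ k) * exp (- (1/2) * lam ! s * x^2 - (1/2) * lam ! r * y^2) * exp (V x + V y))
    *\<^sub>R texp (tlin (%j. x ^ (2 * j + 1) + y ^ (2 * j + 1))))"

text \<open>\<open>q_peel\<close> removes one eigenvalue, and as an odd number is left,
  \<open>jj_odd\<close> removes a second. The two orders of deleting the same pair carry opposite
  signs, so they combine to the antisymmetric \<open>E u v\<close>, which is the double
  integral.\<close>

theorem part_A_pairs:
 assumes mm: "matrix_model lam V (Suc (Suc p))" and d: "distinct lam" and p: "even p" and k: "k > 0"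
 shows "(-1) ^ k *\<^sub>R mu_integral lam V (%H. tconst (schur_q (power_sums H) k)) =
   (\<Sum>(r, s)\<in>{(r, s). r < s & s < Suc (Suc p)}. pair_coeff lam r s *\<^sub>R (Z (delete2 lam r s) V * pair_integral V lam k r s))"
proof -
 interpret matrix_model lam V "Suc (Suc p)" by fact
 define l where "l i = lam ! i / 2" for i
 have l_fun: "l = (%i. lam ! i / 2)" by (simp add: l_def fun_eq_iff)
 have a: "adm V (Suc (Suc p)) l" unfolding l_fun by (rule adm_field[OF mm d])
 define K where "K = 2 * (cN * pi ^ (\<Sum>i<Suc (Suc p). i) / (fact (Suc p) * vdm (Suc (Suc p)) l))"
 define E where "E u v = ek V k (l v) * ek V 0 (l u) - ek V 0 (l v) * ek V k (l u)" for u v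
 let ?f = "%s r. ((-1) ^ s * ((-1) ^ r * real (Suc p))) *\<^sub>R (jj V p (l o skip s o skip r) * ek V 0 ((l o skip s) r) * ek V k (l s))"
 have "(-1) ^ k *\<^sub>R mu_integral lam V (%H. tconst (schur_q (power_sums H) k)) = (-1) ^ k *\<^sub>R (K *\<^sub>R (\<Sum>s<Suc (Suc p). (-1) ^ s *\<^sub>R (jj V (Suc p) (l o skip s) * ek V k (l s))))"
  using q_peel[OF mm d k, folded l_fun] by (simp only: K_def l_def[symmetric])
 also have "(\<Sum>s<Suc (Suc p). (-1) ^ s *\<^sub>R (jj V (Suc p) (l o skip s) * ek V k (l s))) = (\<Sum>s<Suc (Suc p). \<Sum>r<Suc p. ?f s r)"
 proof (rule sum.cong[OF refl])
  fix s assume "s : {..<Suc (Suc p)}"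
  hence "adm V (Suc p) (l o skip s)" using adm_skip[OF a] by simp
  note J = jj_odd[OF this]
  show "(-1) ^ s *\<^sub>R (jj V (Suc p) (l o skip s) * ek V k (l s)) = (\<Sum>r<Suc p. ?f s r)"
   using p by (subst J) (simp, simp only: scaleR_sum_right sum_distrib_right mult_scaleR_left scaleR_scaleR o_apply, simp only: mult_ac)
 qed
 also have "... = (\<Sum>(u, v)\<in>{(u, v). u < v & v < Suc (Suc p)}. ?f v u + ?f u (v - 1))" by (rule sum_pairs)
 also have "(-1) ^ k *\<^sub>R (K *\<^sub>R ...) = (\<Sum>(u, v)\<in>{(u, v). u < v & v < Suc (Suc p)}. (-1) ^ k *\<^sub>R (K *\<^sub>R (?f v u + ?f u (v - 1))))"
  unfolding scaleR_sum_right by (intro sum.cong refl) (simp only: split_paired_all prod.case)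
 also have "... = (\<Sum>(r, s)\<in>{(r, s). r < s & s < Suc (Suc p)}.
    pair_coeff lam r s *\<^sub>R (Z (delete2 lam r s) V * ((-1) ^ k *\<^sub>R E r s)))"
 proof (rule sum.cong[OF refl], clarify)
  fix u v assume uv: "u < v" "v < Suc (Suc p)"
  hence u: "u < Suc p" by simp
  define l' where "l' = (%i. delete2 lam u v ! i / 2)"
  have l': "l' i = (l o skip v o skip u) i" if "i < p" for i using that by (simp add: l'_def l_def delete2_skip[OF uv len])
  have ml: "map (%i. 2 * (l o skip v o skip u) i) [0..<p] = delete2 lam u v" by (simp add: delete2_skip[OF uv len] l_def)
  from adm_skip[OF adm_skip[OF a uv(2)] u] have mm': "matrix_model (delete2 lam u v) V p" and i: "inj_on (l o skip v o skip u) {..<p}"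
   by (simp_all only: adm_def ml)
  hence d': "distinct (delete2 lam u v)" unfolding ml[symmetric] by (simp add: distinct_map inj_on_def)
  define D where "D = matrix_model.cN (delete2 lam u v) p * (pi ^ (\<Sum>i<p. i) / fact p) / vdm p l'"
  have Z': "Z (delete2 lam u v) V = D *\<^sub>R jj V p (l o skip v o skip u)"
   using Z_jj[OF mm' d', folded l'_def] jj_cong[OF l'] by (simp only: D_def)
  have "skip v u = u" "skip u (v - 1) = v" using uv by (auto simp: skip_def)
  moreover have "l o skip u o skip (v - 1) = l o skip v o skip u" using skip_skip[OF uv(1)] by (simp add: fun_eq_iff)
  moreover have "(-1) ^ u * (-1) ^ (v - 1) = - ((-1) ^ (u + v) :: real)" using uv by (cases v) (simp_all add: power_add)
  ultimately have "?f v u + ?f u (v - 1) = ((-1) ^ (u + v) * real (Suc p)) *\<^sub>R (jj V p (l o skip v o skip u) * E u v)"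
   unfolding E_def mult.assoc[symmetric, where 'a = real] o_apply[of l]
   by (simp add: power_add mult_ac right_diff_distrib scaleR_right_diff_distrib del: of_nat_Suc)
  thus "(-1) ^ k *\<^sub>R (K *\<^sub>R (?f v u + ?f u (v - 1))) =
    pair_coeff lam u v *\<^sub>R (Z (delete2 lam u v) V * ((-1) ^ k *\<^sub>R E u v))"
   using pair_coefficient[OF mm d uv mm', folded l_fun l'_def] unfolding K_def[symmetric] D_def[symmetric] Z'
   by (simp only: scaleR_scaleR mult_scaleR_left mult_scaleR_right mult.assoc[symmetric]) (simp only: mult_ac)
 qed
 also have "... = (\<Sum>(r, s)\<in>{(r, s). r < s & s < Suc (Suc p)}.
    pair_coeff lam r s *\<^sub>R (Z (delete2 lam r s) V * pair_integral V lam k r s))"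
 proof (rule sum.cong[OF refl], clarify)
  fix u v assume uv: "u < v" "v < Suc (Suc p)"
  have l2: "2 * l i = lam ! i" for i by (simp add: l_def)
  note tintegral_pair[OF a less_trans[OF uv] uv(2), of k, unfolded l2, folded pair_integral_def]
  thus "pair_coeff lam u v *\<^sub>R (Z (delete2 lam u v) V * ((-1) ^ k *\<^sub>R E u v)) =
    pair_coeff lam u v *\<^sub>R (Z (delete2 lam u v) V * pair_integral V lam k u v)"
   unfolding E_def by (simp only:)
 qed
 finally show ?thesis .
qed

section \<open>Formal sums over pairs of weights\<close>

text \<open>For each monomial, a finite sum over \<open>S a\<close> is regrouped along the fibres of
  \<open>\<phi>\<close>. Fibres over indices outside \<open>I\<close> may be dropped because
  \<open>h\<close> vanishes on them.\<close>

lemma tsums_fibres: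
 fixes h :: "'b => real" and \<phi> :: "'b => 'i"
 assumes S: "!!a. finite (S a)" and F: "!!i a. i : I ==> tcoeff (F i) a = (\<Sum>z\<in>S a. if \<phi> z = i then h z else 0)"
  and h: "!!z. \<phi> z ~: I ==> h z = 0" and R: "!!a. tcoeff R a = (\<Sum>z\<in>S a. h z)"
 shows "tsums F I R"
 unfolding tsums_def
proof (intro allI conjI)
 fix a
 let ?N = "{i : I. tcoeff (F i) a ~= 0}"
 have sub: "?N \<subseteq> \<phi> ` S a"
 proof
  fix i assume "i : ?N"
  hence "(\<Sum>z\<in>S a. if \<phi> z = i then h z else 0) ~= 0" using F by auto
  thus "i : \<phi> ` S a" by (rule contrapos_np) (auto intro!: sum.neutral)
 qed
 thus "finite ?N" using S finite_subset by blast
 have "(\<Sum>i\<in>?N. tcoeff (F i) a) = (\<Sum>i\<in>\<phi> ` S a. \<Sum>z\<in>S a. if \<phi> z = i then h z else 0)"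
 proof (rule sum.mono_neutral_cong_left)
  show "\<forall>i\<in>\<phi> ` S a - ?N. (\<Sum>z\<in>S a. if \<phi> z = i then h z else 0) = 0"
  proof
   fix i assume "i : \<phi> ` S a - ?N"
   thus "(\<Sum>z\<in>S a. if \<phi> z = i then h z else 0) = 0"
    using F[of i a] h by (cases "i : I") (auto intro!: sum.neutral)
  qed
 qed (use S sub F in auto)
 also have "... = (\<Sum>z\<in>S a. h z)" by (subst sum.swap) (simp add: S)
 finally show "(\<Sum>i\<in>?N. tcoeff (F i) a) = tcoeff R a" by (simp only: R)
qed

lemma tcoeff_term_B: "tcoeff ((-1) ^ k * schur_q tvar k * tintegral (mu0 lam V0) (%H. tconst (schur_q (power_sums H) k)
   * schur_q (%j. ((1/2) * tr_pow H (2 * j + 1)) *\<^sub>R tvar j) m)) a =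
  (\<Sum>(b, c)\<in>splits a. if (wt b, wt c) = (k, m) then tmon (%_. 2) b * (LINT H|mu0 lam V0. tmon (pw H) c * ((-1) ^ wt b * schur_q (power_sums H) (wt b))) else 0)"
proof -
 have q: "tcoeff (schur_q tvar k) b = (if wt b = k then tmon (%_. 2) b else (0 :: real))" for b
  using tcoeff_schur_q_tvar[of "%_. 1" k b] by simp
 have t: "tcoeff (tintegral (mu0 lam V0) (%H. tconst (schur_q (power_sums H) k) * schur_q (%j. ((1/2) * tr_pow H (2 * j + 1)) *\<^sub>R tvar j) m)) c =
   (if wt c = m then LINT H|mu0 lam V0. tmon (pw H) c * schur_q (power_sums H) k else 0)" for c
  unfolding tintegral_def tcoeff_Abs tcoeff_tconst_mult tcoeff_schur_q_tvar by (simp add: mult.commute)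
 have s: "(-1) ^ k * F = (-1) ^ k *\<^sub>R F" for F :: "real tseries" by (cases "even k") simp_all
 show ?thesis
  unfolding mult.assoc s tcoeff_simps q t real_scaleR_def sum_distrib_left
  by (intro sum.cong refl) (auto simp: mult.left_commute[of "tmon _ _" "(-1) ^ _"])
qed

theorem theorem2:
  fixes N :: nat and lam :: "real list" and V0 :: "real \<Rightarrow> real"
  assumes "N \<ge> 2" and "even N"
    and "length lam = N"
    and "\<And>i. i < N \<Longrightarrow> lam ! i > 0"
    and "continuous_on UNIV V0"
    and "\<And>i n. i < N \<Longrightarrow>
           integrable lborel (\<lambda>x::real. x ^ n * exp (- (1/2) * lam ! i * x\<^sup>2 + V0 x))"
  shows
    "(distinct lam \<longrightarrow> (\<forall>k::nat. k > 0 \<longrightarrow>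
        (-1) ^ k *\<^sub>R mu_integral lam V0 (\<lambda>H. tconst (schur_q (power_sums H) k))
          = residue_z (miwa_shift (Z lam V0) * tconst (zvar ^ (k - 1)))
      \<and> residue_z (miwa_shift (Z lam V0) * tconst (zvar ^ (k - 1)))
          = (\<Sum>(r, s)\<in>{(r, s). r < s \<and> s < N}.
               (sqrt (lam ! r * lam ! s) / pi
                 * ((lam ! s + lam ! r) / (lam ! r - lam ! s))
                 * (\<Prod>i\<in>{..<N} - {r, s}.
                     ((lam ! r + lam ! i) * (lam ! s + lam ! i))
                       / ((lam ! r - lam ! i) * (lam ! s - lam ! i))))
               *\<^sub>R (Z (delete2 lam r s) V0
                    * tintegral (lborel :: (real \<times> real) measure) (\<lambda>(x, y).
                        ((-1) ^ k * (x ^ k - y ^ k)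
                          * exp (- (1/2) * lam ! s * x\<^sup>2 - (1/2) * lam ! r * y\<^sup>2)
                          * exp (V0 x + V0 y))
                        *\<^sub>R texp (tlin (\<lambda>j. x ^ (2 * j + 1) + y ^ (2 * j + 1))))))))
   \<and> ((\<forall>x. V0 x = V0 (- x)) \<longrightarrow>
        0 = residue_z (miwa_shift (Z lam V0)
              * (texp (tlin (\<lambda>j. 2 * zvar ^ (2 * j + 1))) - 1) * tconst zvar_inv)
      \<and> tsums (\<lambda>(k, m).
            (-1) ^ k * schur_q tvar k
            * tintegral (mu0 lam V0) (\<lambda>H. tconst (schur_q (power_sums H) k)
                * schur_q (\<lambda>j. ((1/2) * tr_pow H (2 * j + 1)) *\<^sub>R tvar j) m))
          ({1..} \<times> UNIV)
          (residue_z (miwa_shift (Z lam V0)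
              * (texp (tlin (\<lambda>j. 2 * zvar ^ (2 * j + 1))) - 1) * tconst zvar_inv)))
   \<and> ((\<forall>x. V0 x = V0 (- x)) \<longrightarrow>
        (\<forall>k m. odd k \<and> odd m \<longrightarrow>
          (\<integral>H. schur_q (power_sums H) (k + m) \<partial>(mu0 lam V0))
            = (\<integral>H. tr_pow H m * schur_q (power_sums H) k \<partial>(mu0 lam V0))))"
proof -
 have mm: "matrix_model lam V0 N" using assms by unfold_locales
 then interpret matrix_model lam V0 N .
 obtain m where m: "N = Suc m" using assms(1) by (cases N) auto
 obtain p where p: "N = Suc (Suc p)" using assms(1) m by (cases m) auto
 have A1: "(-1) ^ k *\<^sub>R mu_integral lam V0 (%H. tconst (schur_q (power_sums H) k)) = residue_z (miwa_shift (Z lam V0) * tconst (zvar ^ (k - 1)))" if "k > 0" for k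
  by (rule tseries_eqI) (simp only: residue_A[OF that] tcoeff_simps tcoeff_mu_integral real_scaleR_def)
 show ?thesis
 proof (intro conjI impI allI, goal_cases)
  case (1 k)
  thus ?case by (intro A1)
 next
  case (2 k)
  thus ?case
   using part_A_pairs[OF mm[unfolded p], of k] A1[of k] assms(2) len unfolding pair_coeff_def pair_integral_def p by simp
 next
  case 3
  show ?case
   by (rule tseries_eqI) (use 3 in \<open>simp only: residue_B tcoeff_simps part_B_coeff[OF mm[unfolded m]]\<close>)
 next
  case 4
  show ?case
  \<comment> \<open>The pair (k, m) consists of the weights of the two parts of a splitting. The
    excluded value k = 0 means \<open>b = 0\<close>, the term that the subtraction of 1 removes in
    the residue.\<close>
  proof (rule tsums_fibres[where S = splits and \<phi> = "%(b, c). (wt b, wt c)" and h = "%(b, c). if b = 0 then 0 else tmon (%_. 2) b * (LINT H|mu0 lam V0. tmon (pw H) c * ((-1) ^ wt b * schur_q (power_sums H) (wt b)))"])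
   fix i :: "nat \<times> nat" and a :: expo assume "i : {1..} \<times> UNIV"
   then obtain k m where i: "i = (k, m)" and k: "k ~= 0" by (cases i) auto
   hence b: "wt b = k ==> b ~= 0" for b by (auto simp: ky_zero)
   show "tcoeff (case i of (k, m) => (-1) ^ k * schur_q tvar k * tintegral (mu0 lam V0) (%H. tconst (schur_q (power_sums H) k)
         * schur_q (%j. ((1/2) * tr_pow H (2 * j + 1)) *\<^sub>R tvar j) m)) a =
    (\<Sum>z\<in>splits a. if (case z of (b, c) => (wt b, wt c)) = i then case z of (b, c) => if b = 0 then 0 else tmon (%_. 2) b * (LINT H|mu0 lam V0. tmon (pw H) c * ((-1) ^ wt b * schur_q (power_sums H) (wt b))) else 0)"
    unfolding i prod.case tcoeff_term_B
   proof (rule sum.cong[OF refl], goal_cases)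
    case (1 z)
    show ?case by (cases z; cases "wt (fst z) = k") (use b in auto)
   qed
  next
   fix a :: expo
   show "tcoeff (residue_z (miwa_shift (Z lam V0) * (texp (tlin (%j. 2 * zvar ^ (2 * j + 1))) - 1) * tconst zvar_inv)) a =
    (\<Sum>z\<in>splits a. case z of (b, c) => if b = 0 then 0 else tmon (%_. 2) b * (LINT H|mu0 lam V0. tmon (pw H) c * ((-1) ^ wt b * schur_q (power_sums H) (wt b))))"
    unfolding residue_B by (rule sum.reindex_bij_witness[where i = prod.swap and j = prod.swap]) (auto simp: add.commute)
  qed (auto simp: finite_splits ky_zero Suc_le_eq zero_less_iff_neq_zero)
 next
  case (5 k j)
  thus ?case by (intro part_C[OF mm[unfolded m]]) auto
 qed
qed

end
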